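(* For $0<r<1$ consider the IFS on $\mathbb R^3$ $$\widetilde\Phi_r=\{f_{O,0}(x)=rOx,\ f_{O,1}(x)=rOx+e_1\}_{O\in\mathcal R_5},$$ where $\mathcal R_5\subset\mathrm{SO}(3)$ is the Ramanujan set associated to $p=5$. For every $0<\delta<1$ and every $0\le t<\delta/2$ there exist $0<r<1$ and a self-similar measure $\nu\in\mathcal P(\mathbb R^3)$ with respect to $\widetilde\Phi_r$ such that: (1) $\dim_2\nu<1+\delta$; in particular, $\nu\notin L^2(\mathbb R^3)$. (2) For every $V\in G_{3,1}$, $\pi_V\nu\ll\mathrm{Leb}_V$ and $\pi_V\nu\in H^t(V)$.
   Context: For a prime $p\equiv 1\pmod 4$, let $$\Omega_p:=\Big\{\tfrac{1}{\sqrt p}(a,b,c,d)\in S^3: a,b,c,d\in\mathbb Z,\ a^2+b^2+c^2+d^2=p,\ a>0\text{ odd},\ b,c,d\text{ even}\Big\},$$ regarded as a set of unit quaternions. The Ramanujan set is $\mathcal R_p:=\{\mathrm{Ad}_\omega:\omega\in\Omega_p\}\subset\mathrm{SO}(3)$, where $\mathrm{Ad}_\omega(x)=\omega x\omega^{-1}$ acts on purely imaginary quaternions, identified with $\mathbb R^3$ via the basis $(i,j,k)$. It has $p+1$ elements (so $|\mathcal R_5|=6$). A self-similar measure with respect to an IFS $\{f_i\}$ is the unique Borel probability measure with $\nu=\sum_ip_if_i\nu$ (push-forwards) for some strictly positive probability vector $(p_i)$. $e_1=(1,0,0)$. $\dim_2\nu:=\sup\{\alpha:\iint|x-y|^{-\alpha}d\nu(x)d\nu(y)<\infty\}$.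 $\nu\notin L^2(\mathbb R^3)$ means that $\nu$ has no $L^2$ density. $G_{3,1}$ is the space of lines through $0$ in $\mathbb R^3$, $\pi_V$ the orthogonal projection onto $V$, $\pi_V\nu$ the push-forward, $H^t(V)$ the $L^2$-Sobolev space of order $t$ on $V$. *)

theory Defs
  imports "HOL-Probability.Probability"
begin

section \<open>Quaternions and Ramanujan sets\<close>

text \<open>The quaternion \<open>a + b i + c j + d k\<close> is the pair of its real part \<open>a\<close> and its imaginary
  part \<open>(b, c, d)\<close>. The norm of the product type is the Euclidean norm of \<open>(a, b, c, d)\<close>.\<close>

type_synonym quaternion = "real \<times> (real^3)"

definition qmult :: "quaternion \<Rightarrow> quaternion \<Rightarrow> quaternion" where
  "qmult q w = (fst q * fst w - snd q \<bullet> snd w,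
                fst q *\<^sub>R snd w + fst w *\<^sub>R snd q + cross3 (snd q) (snd w))"

definition qinv :: "quaternion \<Rightarrow> quaternion" where
  "qinv q = (1 / (norm q)\<^sup>2) *\<^sub>R (fst q, - snd q)"

lemma qmult_qinv:
  assumes "q \<noteq> 0"
  shows "qmult q (qinv q) = (1, 0)" and "qmult (qinv q) q = (1, 0)"
proof -
  have "fst q * fst q + snd q \<bullet> snd q = (norm q)\<^sup>2"
    by (simp add: norm_Pair norm_prod_def power2_eq_square dot_square_norm)
  moreover have "(norm q)\<^sup>2 \<noteq> 0"
    using assms by simp
  ultimately show "qmult q (qinv q) = (1, 0)" and "qmult (qinv q) q = (1, 0)"
    by (simp_all add: qmult_def qinv_def cross_mult_left cross_mult_right cross_minus_right
        cross_minus_left add_divide_distrib [symmetric])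
qed

definition Ad :: "quaternion \<Rightarrow> real^3 \<Rightarrow> real^3" where
  "Ad w x = snd (qmult (qmult w (0, x)) (qinv w))"

lemma Ad_imaginary: "qmult (qmult w (0, x)) (qinv w) = (0, Ad w x)"
proof -
  have "fst (qmult (qmult w (0, x)) (qinv w)) = 0"
    by (simp add: qmult_def qinv_def inner_add_left inner_commute [of "snd w"] dot_cross_self)
  then show ?thesis
    by (simp add: Ad_def prod_eq_iff)
qed

definition Omega :: "nat \<Rightarrow> quaternion set" where
  "Omega p = {(1 / sqrt (real p)) *\<^sub>R (of_int a, vector [of_int b, of_int c, of_int d]) | a b c d :: int.
     a\<^sup>2 + b\<^sup>2 + c\<^sup>2 + d\<^sup>2 = int p \<and> a > 0 \<and> odd a \<and> even b \<and> even c \<and> even d}"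

definition ramanujan_set :: "nat \<Rightarrow> (real^3 \<Rightarrow> real^3) set" where
  "ramanujan_set p = Ad ` Omega p"

section \<open>Self-similar measures\<close>

text \<open>For a contractive iterated function system there is exactly one such measure for every
  strictly positive probability vector \<open>p\<close>.\<close>

definition self_similar_measure ::
    "'i set \<Rightarrow> ('i \<Rightarrow> 'a \<Rightarrow> 'a) \<Rightarrow> 'a::euclidean_space measure \<Rightarrow> bool" where
  "self_similar_measure I f \<nu> \<longleftrightarrow>
     prob_space \<nu> \<and> sets \<nu> = sets borel \<and>
     (\<exists>p :: 'i \<Rightarrow> real. (\<forall>i\<in>I. 0 < p i) \<and> (\<Sum>i\<in>I. p i) = 1 \<and>
        (\<forall>A\<in>sets borel. emeasure \<nu> A =
           (\<Sum>i\<in>I. ennreal (p i) * emeasure (distr \<nu> borel (f i)) A)))"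

definition ramanujan_ifs :: "real \<Rightarrow> (real^3 \<Rightarrow> real^3) \<times> nat \<Rightarrow> real^3 \<Rightarrow> real^3" where
  "ramanujan_ifs r = (\<lambda>(O', i) x. r *\<^sub>R O' x + real i *\<^sub>R axis 1 1)"

definition ramanujan_ifs_index :: "nat \<Rightarrow> ((real^3 \<Rightarrow> real^3) \<times> nat) set" where
  "ramanujan_ifs_index p = ramanujan_set p \<times> {0, 1}"

section \<open>Correlation dimension and square-integrable densities\<close>

text \<open>\<open>riesz_kernel \<alpha> z\<close> is $|z|^{-\alpha}$ with the value \<open>\<infinity>\<close> at \<open>z = 0\<close> for \<open>\<alpha> > 0\<close> (so atoms have
  infinite energy) and \<open>1\<close> for \<open>\<alpha> = 0\<close>; \<^const>\<open>powr\<close> alone would give \<open>0\<close> in both cases.\<close>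

definition riesz_kernel :: "real \<Rightarrow> 'a::real_normed_vector \<Rightarrow> ennreal" where
  "riesz_kernel \<alpha> z =
     (if \<alpha> = 0 then 1 else if \<alpha> > 0 \<and> z = 0 then \<infinity> else ennreal (norm z powr (- \<alpha>)))"

definition riesz_energy :: "real \<Rightarrow> 'a::real_normed_vector measure \<Rightarrow> ennreal" where
  "riesz_energy \<alpha> \<nu> = (\<integral>\<^sup>+ x. (\<integral>\<^sup>+ y. riesz_kernel \<alpha> (x - y) \<partial>\<nu>) \<partial>\<nu>)"

definition dim2 :: "'a::real_normed_vector measure \<Rightarrow> ereal" where
  "dim2 \<nu> = Sup (ereal ` {\<alpha>. riesz_energy \<alpha> \<nu> < \<infinity>})"

definition has_L2_density :: "'a::euclidean_space measure \<Rightarrow> bool" where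
  "has_L2_density \<nu> \<longleftrightarrow>
     (\<exists>g :: 'a \<Rightarrow> real. g \<in> borel_measurable borel \<and> (\<forall>x. 0 \<le> g x) \<and>
        integrable lborel (\<lambda>x. (g x)\<^sup>2) \<and> \<nu> = density lborel (\<lambda>x. ennreal (g x)))"

section \<open>Projections to lines\<close>

definition grassmannian :: "nat \<Rightarrow> 'a::euclidean_space set set" where
  "grassmannian m = {V. subspace V \<and> dim V = m}"

definition orth_proj :: "'a::euclidean_space set \<Rightarrow> 'a \<Rightarrow> 'a" where
  "orth_proj V x = (THE y. y \<in> V \<and> (\<forall>v\<in>V. (x - y) \<bullet> v = 0))"

lemma orth_proj_ex1:
  fixes V :: "'a::euclidean_space set"
  assumes "subspace V"
  shows "\<exists>!y. y \<in> V \<and> (\<forall>v\<in>V. (x - y) \<bullet> v = 0)"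
proof (rule ex_ex1I)
  obtain y z where "y \<in> span V" "\<And>w. w \<in> span V \<Longrightarrow> orthogonal z w" "x = y + z"
    using orthogonal_subspace_decomp_exists [of V x] by metis
  then show "\<exists>y. y \<in> V \<and> (\<forall>v\<in>V. (x - y) \<bullet> v = 0)"
    using assms unfolding orthogonal_def span_eq_iff [THEN iffD2, OF assms]
    by (auto intro!: exI [of _ y])
next
  fix y y'
  assume y: "y \<in> V \<and> (\<forall>v\<in>V. (x - y) \<bullet> v = 0)" and y': "y' \<in> V \<and> (\<forall>v\<in>V. (x - y') \<bullet> v = 0)"
  then have "y - y' \<in> V"
    using assms subspace_diff by blast
  with y y' have "(x - y') \<bullet> (y - y') - (x - y) \<bullet> (y - y') = 0"
    by simp
  then show "y = y'"
    by (simp add: inner_diff_left [symmetric])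
qed

definition proj_measure :: "'a::euclidean_space set \<Rightarrow> 'a measure \<Rightarrow> 'a measure" where
  "proj_measure V \<nu> = distr \<nu> (restrict_space borel V) (orth_proj V)"

text \<open>Lebesgue measure on a line \<open>V\<close> through the origin, via an isometric parametrisation; by the
  lemma below the choice of the unit vector does not matter.\<close>

definition line_lebesgue :: "'a::euclidean_space set \<Rightarrow> 'a measure" where
  "line_lebesgue V =
     distr lborel (restrict_space borel V) (\<lambda>s. s *\<^sub>R (SOME u. u \<in> V \<and> norm u = 1))"

lemma line_lebesgue_eq:
  fixes V :: "'a::euclidean_space set"
  assumes V: "V \<in> grassmannian 1" and u: "u \<in> V" "norm u = 1"
  shows "line_lebesgue V = distr lborel (restrict_space borel V) (\<lambda>s. s *\<^sub>R u)"
proof -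
  define e where "e = (SOME u. u \<in> V \<and> norm u = 1)"
  have e: "e \<in> V" "norm e = 1"
    unfolding e_def using someI [of "\<lambda>u. u \<in> V \<and> norm u = 1" u] u by auto
  have sub: "subspace V" and dim: "dim V = 1"
    using V by (auto simp: grassmannian_def)
  have meas: "(\<lambda>s. s *\<^sub>R u) \<in> lborel \<rightarrow>\<^sub>M restrict_space borel V"
    using sub u by (intro measurable_restrict_space2) (auto intro: subspace_scale)
  have "u \<noteq> 0"
    using u by auto
  then have "independent {u}"
    by simp
  then have "V \<subseteq> span {u}"
    using u dim by (intro card_ge_dim_independent) auto
  then obtain c where c: "e = c *\<^sub>R u"
    using e by (auto simp: span_singleton)
  then have "\<bar>c\<bar> = 1"
    using e u by simp
  then consider "e = u" | "e = - u"
    using c by (cases "c \<ge> 0") auto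
  then show ?thesis
  proof cases
    case 1
    then show ?thesis
      unfolding line_lebesgue_def e_def [symmetric] by simp
  next
    case 2
    have "distr (distr lborel borel uminus) (restrict_space borel V) (\<lambda>s. s *\<^sub>R u)
        = distr lborel (restrict_space borel V) ((\<lambda>s. s *\<^sub>R u) \<circ> uminus)"
      using meas by (intro distr_distr) simp_all
    then have "distr lborel (restrict_space borel V) (\<lambda>s. s *\<^sub>R u)
        = distr lborel (restrict_space borel V) (\<lambda>s. s *\<^sub>R e)"
      using 2 by (simp add: lborel_distr_uminus o_def)
    then show ?thesis
      unfolding line_lebesgue_def e_def [symmetric] by simp
  qed
qed

section \<open>Sobolev regularity of measures on a line\<close>

definition fourier_measure :: "'a::euclidean_space measure \<Rightarrow> 'a \<Rightarrow> complex" where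
  "fourier_measure \<mu> \<xi> = (\<integral> x. cis (- (\<xi> \<bullet> x)) \<partial>\<mu>)"

text \<open>Membership of a finite Borel measure \<open>\<mu>\<close> on \<open>V\<close> (as a tempered distribution) in \<open>H\<^sup>t(V)\<close>, that is
  $\int_V (1 + |\xi|^2)^t |\hat\mu(\xi)|^2 d\xi < \infty$. The dual of \<open>V\<close> is identified with \<open>V\<close> through the
  inner product, and $\hat\mu$ is the distributional Fourier transform of \<open>\<mu>\<close>, a bounded continuous
  function.\<close>

definition in_sobolev :: "real \<Rightarrow> 'a::euclidean_space set \<Rightarrow> 'a measure \<Rightarrow> bool" where
  "in_sobolev t V \<mu> \<longleftrightarrow>
     (\<integral>\<^sup>+ \<xi>. ennreal ((1 + (norm \<xi>)\<^sup>2) powr t * (cmod (fourier_measure \<mu> \<xi>))\<^sup>2) \<partial>line_lebesgue V) < \<infinity>"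

end

theory Submission
  imports Defs "HOL-Computational_Algebra.Polynomial"
begin

text \<open>
  The measure \<open>\<nu>\<close> is the law of the random point whose next map is chosen with a uniformly random
  rotation \<open>O\<close> and, independently, with the translation by \<open>e1\<close> only with a small probability
  \<open>\<epsilon>\<close> (locale \<open>lazy_walk\<close>). Two properties of \<open>\<nu>\<close> pull in opposite directions, and the proof
  consists in showing that both hold up to an arbitrarily small loss in the exponents.

  \<^bold>\<open>Concentration.\<close> With probability \<open>(1 - \<epsilon>)^n\<close> none of the first \<open>n\<close> maps translates, and then
  the point is at distance \<open>O(r^n)\<close> of the origin (\<open>ball_mass\<close>). If \<open>r powr a = (1 - \<epsilon>)\<^sup>2\<close>, the
  energies of \<open>\<nu>\<close> of order above \<open>a\<close> are therefore infinite, and for \<open>a < 3\<close> there is no square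
  integrable density (\<open>dim2_le\<close>, \<open>no_L2_density\<close>).

  \<^bold>\<open>Fourier decay.\<close> Let \<open>F\<close> be the squared modulus of the Fourier transform of \<open>\<nu>\<close>. Self-similarity
  bounds \<open>F \<xi>\<close> by \<open>\<phi> (\<xi>$1)\<close> times the average of \<open>F\<close> over the six points \<open>r O \<xi>\<close>, where
  \<open>\<phi> s\<close> is the squared modulus of \<open>1 - \<epsilon> + \<epsilon> cis (- s)\<close> (\<open>F_rec\<close>). The average over the
  six rotations has a spectral gap on the sphere (\<open>spectral_gap\<close>), so that for small \<open>\<epsilon>\<close> only the
  constant part of \<open>F\<close> on a sphere of radius \<open>R\<close> matters, and the oscillating part of \<open>\<phi>\<close> has mean
  \<open>O(1 / R)\<close>. One step thus multiplies the mean of \<open>F\<^sup>2\<close> over a large sphere by a factor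
  \<open>1 - 4 \<epsilon> + O(\<eta> \<epsilon>)\<close>, whose first order is that of \<open>(1 - \<epsilon>)^4 = r powr (2 * a)\<close>: in mean
  square, \<open>F\<close> decays with an exponent close to \<open>a\<close> (\<open>L2_step\<close>, \<open>HR_decay\<close>). Averaging another
  \<open>O(ln R)\<close> times, \<open>F\<close> being Lipschitz, turns this into pointwise decay; the price is a factor
  \<open>1 - O(ln (1 / r))\<close> in the exponent, which tends to \<open>1\<close> with \<open>\<epsilon>\<close> (\<open>F_decay\<close>). For
  \<open>1 + 2 * t < a < 1 + \<delta>\<close> and \<open>\<epsilon>\<close> small, \<open>F\<close> still decays with an exponent above
  \<open>1 + 2 * t\<close>. Since the Fourier transform of a projection of \<open>\<nu>\<close> to a line is the restriction of that
  of \<open>\<nu>\<close>, this is the Sobolev bound, and absolute continuity follows because a measure on the line with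
  square integrable Fourier transform is absolutely continuous (\<open>abs_cont\<close>, \<open>projections_regular\<close>).

  \<^bold>\<open>The spectral gap.\<close> It is proved separately on the spherical harmonics of each degree \<open>d\<close>. For
  large \<open>d\<close>, consider the sum of the rotations over all reduced words of length \<open>m\<close> in the six
  generators, with \<open>5 ^ m\<close> about \<open>d powr (9/4)\<close>. Its norm is controlled by the decay \<open>1 / (2 * d + 1)\<close>
  of matrix coefficients and by the number of pairs of words whose rotations are at distance at most
  \<open>1 / (4 * d)\<close> (\<open>operator_bound\<close>). Such pairs produce integral quaternions of norm \<open>25 ^ l\<close> close
  to the real axis and not divisible by \<open>5\<close>; these are lattice points on spheres, and even a weak
  count of them suffices (\<open>near_int_bound\<close>). As word sums satisfy the recurrence of the walk on the tree
  of degree six, a bound for one word length bounds the generators themselves (\<open>high_degree_gap\<close>). For each of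
  the finitely many small degrees a gap without uniformity is enough, and it comes from the irrationality of
  the rotation angle of the generators (\<open>low_degree_gap\<close>).
\<close>

section \<open>Integration against compactly supported probability measures\<close>

text \<open>With compact support, continuity of an integrand is all that integrability, Fubini and
  continuity in parameters require, which keeps the many exchanges of integrals below short.\<close>

definition cpt_prob :: "'a::euclidean_space measure \<Rightarrow> bool" where
  "cpt_prob M \<longleftrightarrow> prob_space M \<and> sets M = sets borel \<and> (\<exists>K. compact K \<and> (AE x in M. x \<in> K))"

lemma cpt_prob_integrable:
  fixes f :: "'a::euclidean_space \<Rightarrow> 'b::{banach,second_countable_topology}"
  assumes M: "cpt_prob M" and f: "continuous_on UNIV f"
  shows "integrable M f"
proof -
  interpret prob_space M using M by (simp add: cpt_prob_def)
  obtain K where K: "compact K" "AE x in M. x \<in> K" using M by (auto simp: cpt_prob_def)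
  have "compact (f ` K)"
    using K(1) f by (metis compact_continuous_image continuous_on_subset subset_UNIV)
  then obtain B where B: "\<And>x. x \<in> K \<Longrightarrow> norm (f x) \<le> B"
    by (meson bounded_iff compact_imp_bounded imageI)
  have sets: "sets M = sets borel" using M by (simp add: cpt_prob_def)
  have "f \<in> borel_measurable M"
    using borel_measurable_continuous_onI[OF f] by (simp add: measurable_cong_sets[OF sets refl])
  moreover have "AE x in M. norm (f x) \<le> B" using K(2) by eventually_elim (rule B)
  ultimately show ?thesis by (intro integrable_const_bound)
qed

lemma cpt_prob_fubini:
  fixes f :: "'a::euclidean_space \<Rightarrow> 'b::euclidean_space \<Rightarrow> real"
  assumes M: "cpt_prob M" and N: "cpt_prob N" and f: "continuous_on UNIV (\<lambda>(x,y). f x y)"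
  shows "(\<integral>x. (\<integral>y. f x y \<partial>N) \<partial>M) = (\<integral>y. (\<integral>x. f x y \<partial>M) \<partial>N)"
proof -
  interpret M: prob_space M using M by (simp add: cpt_prob_def)
  interpret N: prob_space N using N by (simp add: cpt_prob_def)
  interpret pair_prob_space M N ..
  obtain K where K: "compact K" "AE x in M. x \<in> K" using M by (auto simp: cpt_prob_def)
  obtain L where L: "compact L" "AE x in N. x \<in> L" using N by (auto simp: cpt_prob_def)
  have sets: "sets M = sets borel" "sets N = sets borel" using M N by (simp_all add: cpt_prob_def)
  have "compact ((\<lambda>(x,y). f x y) ` (K \<times> L))"
    using compact_Times[OF K(1) L(1)] f by (metis compact_continuous_image continuous_on_subset subset_UNIV)
  then obtain B where "\<forall>z\<in>(\<lambda>(x,y). f x y) ` (K \<times> L). norm z \<le> B"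
    by (meson bounded_iff compact_imp_bounded)
  then have B: "\<bar>f x y\<bar> \<le> B" if "x \<in> K" "y \<in> L" for x y using that by force
  define g where "g = (\<lambda>x y. max (-B) (min B (f x y)))"
  have eq: "g x y = f x y" if "x \<in> K" "y \<in> L" for x y using B[OF that] by (auto simp: g_def)
  have gc: "continuous_on UNIV (\<lambda>(x,y). g x y)"
    using f unfolding g_def case_prod_beta by (intro continuous_intros)
  have sp: "sets (M \<Otimes>\<^sub>M N) = sets borel"
    using sets_pair_measure_cong[OF sets] by (metis borel_prod)
  have "case_prod g \<in> borel_measurable (M \<Otimes>\<^sub>M N)"
    using borel_measurable_continuous_onI[OF gc] by (simp add: measurable_cong_sets[OF sp refl] case_prod_beta')
  then have "integrable (M \<Otimes>\<^sub>M N) (case_prod g)"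
    by (intro integrable_const_bound[where B = "\<bar>B\<bar>"]) (auto simp: g_def)
  from Fubini_integral[OF this]
  have F: "(\<integral>y. (\<integral>x. g x y \<partial>M) \<partial>N) = (\<integral>x. (\<integral>y. g x y \<partial>N) \<partial>M)" .
  have mg1: "(\<lambda>x. g x y) \<in> borel_measurable M" for y
    using continuous_on_compose2[OF gc, of UNIV "\<lambda>x. (x,y)"]
    by (simp add: measurable_cong_sets[OF sets(1) refl] borel_measurable_continuous_onI continuous_intros)
  have mg2: "(\<lambda>y. g x y) \<in> borel_measurable N" for x
    using continuous_on_compose2[OF gc, of UNIV "\<lambda>y. (x,y)"]
    by (simp add: measurable_cong_sets[OF sets(2) refl] borel_measurable_continuous_onI continuous_intros)
  have mf1: "(\<lambda>x. f x y) \<in> borel_measurable M" for y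
    using continuous_on_compose2[OF f, of UNIV "\<lambda>x. (x,y)"]
    by (simp add: measurable_cong_sets[OF sets(1) refl] borel_measurable_continuous_onI continuous_intros)
  have mf2: "(\<lambda>y. f x y) \<in> borel_measurable N" for x
    using continuous_on_compose2[OF f, of UNIV "\<lambda>y. (x,y)"]
    by (simp add: measurable_cong_sets[OF sets(2) refl] borel_measurable_continuous_onI continuous_intros)
  have 1: "(\<integral>y. f x y \<partial>N) = (\<integral>y. g x y \<partial>N)" if "x \<in> K" for x
    using L(2) that by (intro integral_cong_AE mf2 mg2) (auto elim!: eventually_mono simp: eq)
  have 2: "(\<integral>x. f x y \<partial>M) = (\<integral>x. g x y \<partial>M)" if "y \<in> L" for y
    using K(2) that by (intro integral_cong_AE mf1 mg1) (auto elim!: eventually_mono simp: eq)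
  have spf: "(\<lambda>(x,y). f x y) \<in> borel_measurable (M \<Otimes>\<^sub>M N)"
    using borel_measurable_continuous_onI[OF f] by (simp add: measurable_cong_sets[OF sp refl] case_prod_beta')
  have spf': "(\<lambda>(y,x). f x y) \<in> borel_measurable (N \<Otimes>\<^sub>M M)"
    using measurable_pair_swap[OF spf] by simp
  have spg: "(\<lambda>(x,y). g x y) \<in> borel_measurable (M \<Otimes>\<^sub>M N)"
    using borel_measurable_continuous_onI[OF gc] by (simp add: measurable_cong_sets[OF sp refl] case_prod_beta')
  have spg': "(\<lambda>(y,x). g x y) \<in> borel_measurable (N \<Otimes>\<^sub>M M)"
    using measurable_pair_swap[OF spg] by simp
  have "(\<integral>x. (\<integral>y. f x y \<partial>N) \<partial>M) = (\<integral>x. (\<integral>y. g x y \<partial>N) \<partial>M)"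
    using K(2) by (intro integral_cong_AE N.borel_measurable_lebesgue_integral spf spg)
      (auto elim!: eventually_mono simp: 1)
  also have "\<dots> = (\<integral>y. (\<integral>x. g x y \<partial>M) \<partial>N)" by (simp add: F)
  also have "\<dots> = (\<integral>y. (\<integral>x. f x y \<partial>M) \<partial>N)"
    using L(2) by (intro integral_cong_AE M.borel_measurable_lebesgue_integral spf' spg')
      (auto elim!: eventually_mono simp: 2)
  finally show ?thesis .
qed

lemma cpt_prob_continuous_integral:
  fixes f :: "'a::euclidean_space \<Rightarrow> 'b::euclidean_space \<Rightarrow> real"
  assumes M: "cpt_prob M" and f: "continuous_on UNIV (\<lambda>(x,y). f x y)"
  shows "continuous_on UNIV (\<lambda>x. \<integral>y. f x y \<partial>M)"
proof (rule continuous_on_sequentiallyI)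
  fix u :: "nat \<Rightarrow> 'a" and a assume u: "u \<longlonglongrightarrow> a"
  interpret M: prob_space M using M by (simp add: cpt_prob_def)
  obtain K where K: "compact K" "AE x in M. x \<in> K" using M by (auto simp: cpt_prob_def)
  have sets: "sets M = sets borel" using M by (simp add: cpt_prob_def)
  define S where "S = insert a (range u)"
  have "compact S" unfolding S_def by (rule compact_sequence_with_limit[OF u])
  then have "compact ((\<lambda>(x,y). f x y) ` (S \<times> K))"
    using compact_Times K(1) f by (metis compact_continuous_image continuous_on_subset subset_UNIV)
  then obtain B where "\<forall>z\<in>(\<lambda>(x,y). f x y) ` (S \<times> K). norm z \<le> B"
    by (meson bounded_iff compact_imp_bounded)
  then have B: "\<bar>f x y\<bar> \<le> B" if "x \<in> S" "y \<in> K" for x y using that by force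
  have mf: "(\<lambda>y. f x y) \<in> borel_measurable M" for x
    using continuous_on_compose2[OF f, of UNIV "\<lambda>y. (x,y)"]
    by (simp add: measurable_cong_sets[OF sets refl] borel_measurable_continuous_onI continuous_intros)
  show "(\<lambda>n. \<integral>y. f (u n) y \<partial>M) \<longlonglongrightarrow> (\<integral>y. f a y \<partial>M)"
  proof (rule integral_dominated_convergence[where w = "\<lambda>_. B"])
    show "AE y in M. (\<lambda>n. f (u n) y) \<longlonglongrightarrow> f a y"
    proof (intro AE_I2)
      fix y
      have "continuous_on UNIV (\<lambda>x. f x y)"
        using continuous_on_compose2[OF f, of UNIV "\<lambda>x. (x,y)"] by (simp add: continuous_intros)
      then have "isCont (\<lambda>x. f x y) a" by (simp add: continuous_on_eq_continuous_at)
      then show "(\<lambda>n. f (u n) y) \<longlonglongrightarrow> f a y" using u by (rule isCont_tendsto_compose)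
    qed
    show "AE y in M. norm (f (u n) y) \<le> B" for n
      using K(2) by eventually_elim (auto simp: S_def intro!: B)
  qed (use mf in auto)
qed

lemma integral_Cauchy_Schwarz:
  fixes f g :: "'a \<Rightarrow> real"
  assumes "integrable M (\<lambda>x. (f x)\<^sup>2)" "integrable M (\<lambda>x. (g x)\<^sup>2)" "integrable M (\<lambda>x. f x * g x)"
  shows "(\<integral>x. f x * g x \<partial>M)\<^sup>2 \<le> (\<integral>x. (f x)\<^sup>2 \<partial>M) * (\<integral>x. (g x)\<^sup>2 \<partial>M)"
proof -
  define A where "A = (\<integral>x. (f x)\<^sup>2 \<partial>M)"
  define B where "B = (\<integral>x. f x * g x \<partial>M)"
  define C where "C = (\<integral>x. (g x)\<^sup>2 \<partial>M)"
  have q: "0 \<le> A - 2 * t * B + t\<^sup>2 * C" for t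
  proof -
    have "0 \<le> (\<integral>x. (f x - t * g x)\<^sup>2 \<partial>M)" by simp
    also have "(\<lambda>x. (f x - t * g x)\<^sup>2) = (\<lambda>x. (f x)\<^sup>2 - 2 * t * (f x * g x) + t\<^sup>2 * (g x)\<^sup>2)"
      by (auto simp: power2_eq_square algebra_simps)
    also have "(\<integral>x. (f x)\<^sup>2 - 2 * t * (f x * g x) + t\<^sup>2 * (g x)\<^sup>2 \<partial>M) = A - 2 * t * B + t\<^sup>2 * C"
      using assms by (simp add: A_def B_def C_def)
    finally show ?thesis .
  qed
  have C0: "0 \<le> C" by (simp add: C_def)
  show ?thesis
  proof (cases "C = 0")
    case True
    have "B = 0"
    proof (rule ccontr)
      assume "B \<noteq> 0"
      with q[of "(A + 1) / (2 * B)"] True show False by (simp add: field_simps)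
    qed
    then show ?thesis using True by (simp add: A_def B_def C_def)
  next
    case False
    with q[of "B / C"] C0 have "B\<^sup>2 \<le> A * C"
      by (simp add: field_simps power2_eq_square split: if_splits)
    then show ?thesis by (simp add: A_def B_def C_def)
  qed
qed

section \<open>Quaternions and rotations\<close>

definition qcnj :: "quaternion \<Rightarrow> quaternion" where "qcnj q = (fst q, - snd q)"

text \<open>This is the imaginary part of \<open>q x q\<^sup>*\<close>, written out so that it is visibly linear in \<open>x\<close>; for unit \<open>q\<close>
  it is \<open>Ad q\<close>.\<close>

definition rot :: "quaternion \<Rightarrow> real^3 \<Rightarrow> real^3" where
  "rot q x = ((fst q)\<^sup>2 - snd q \<bullet> snd q) *\<^sub>R x + (2 * (snd q \<bullet> x)) *\<^sub>R snd q + (2 * fst q) *\<^sub>R cross3 (snd q) x"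

lemmas comp3 = prod_eq_iff vec_eq_iff forall_3 inner_vec_def sum_3 cross3_def

lemma qmult_assoc: "qmult (qmult p q) w = qmult p (qmult q w)"
  by (simp add: qmult_def comp3 algebra_simps)

lemma qcnj_qmult: "qcnj (qmult p q) = qmult (qcnj q) (qcnj p)"
  by (simp add: qmult_def qcnj_def comp3 algebra_simps)

lemma qmult_rot: "qmult (qmult q (0, x)) (qcnj q) = (0, rot q x)"
  by (simp add: qmult_def qcnj_def rot_def comp3 algebra_simps power2_eq_square)

lemma qcnj_qcnj [simp]: "qcnj (qcnj q) = q" by (simp add: qcnj_def)

lemma rot_qmult: "rot (qmult p q) x = rot p (rot q x)"
proof -
  have "(0, rot (qmult p q) x) = qmult (qmult p (qmult (qmult q (0, x)) (qcnj q))) (qcnj p)"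
    by (simp add: qmult_rot [symmetric] qcnj_qmult qmult_assoc)
  then show ?thesis by (simp add: qmult_rot)
qed

lemma norm_q: "(norm (q::quaternion))\<^sup>2 = (fst q)\<^sup>2 + snd q \<bullet> snd q"
  by (simp add: norm_prod_def dot_square_norm)

lemma qmult_qcnj: "qmult q (qcnj q) = ((norm q)\<^sup>2, 0)" "qmult (qcnj q) q = ((norm q)\<^sup>2, 0)"
  unfolding norm_q by (simp_all add: qmult_def qcnj_def comp3 algebra_simps power2_eq_square)

lemma norm_qmult: "norm (qmult p q) = norm p * norm q"
proof -
  have "(norm (qmult p q))\<^sup>2 = (norm p * norm q)\<^sup>2"
    unfolding power_mult_distrib norm_q
    by (simp add: qmult_def comp3 algebra_simps power2_eq_square)
  then show ?thesis by simp
qed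

lemma norm_qcnj [simp]: "norm (qcnj q) = norm q"
  by (simp add: qcnj_def norm_prod_def)

lemma rot_real [simp]: "rot (c, 0) x = c\<^sup>2 *\<^sub>R x"
  by (simp add: rot_def)

lemma rot_inner: "rot q x \<bullet> y = x \<bullet> rot (qcnj q) y"
  by (simp add: rot_def qcnj_def comp3 algebra_simps power2_eq_square)

lemma rot_cancel [simp]:
  assumes "norm q = 1" shows "rot (qcnj q) (rot q x) = x" "rot q (rot (qcnj q) x) = x"
  using assms by (simp_all add: rot_qmult [symmetric] qmult_qcnj)

lemma norm_rot [simp]: assumes "norm q = 1" shows "norm (rot q x) = norm x"
  using assms by (simp add: norm_eq_sqrt_inner rot_inner)

lemma linear_rot: "linear (rot q)"
  by (intro linearI) (simp_all add: rot_def comp3 algebra_simps)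

lemma Ad_eq_rot: "norm q \<noteq> 0 \<Longrightarrow> Ad q x = (1 / (norm q)\<^sup>2) *\<^sub>R rot q x"
proof -
  have "qmult (qmult q (0,x)) (qinv q) = (1 / (norm q)\<^sup>2) *\<^sub>R qmult (qmult q (0,x)) (qcnj q)"
    by (simp add: qinv_def qcnj_def qmult_def algebra_simps cross_mult_right cross_minus_right)
  then show ?thesis by (simp add: Ad_def qmult_rot)
qed

lemma continuous_rot [continuous_intros]:
  fixes S :: "'a::t2_space set"
  shows "continuous_on S f \<Longrightarrow> continuous_on S g \<Longrightarrow> continuous_on S (\<lambda>x. rot (f x) (g x))"
  unfolding rot_def by (intro continuous_intros continuous_on_cross)

lemma continuous_qmult [continuous_intros]:
  fixes S :: "'a::t2_space set"
  shows "continuous_on S f \<Longrightarrow> continuous_on S g \<Longrightarrow> continuous_on S (\<lambda>x. qmult (f x) (g x))"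
  unfolding qmult_def by (intro continuous_intros continuous_on_cross)

lemma continuous_qcnj [continuous_intros]:
  fixes S :: "'a::t2_space set"
  shows "continuous_on S f \<Longrightarrow> continuous_on S (\<lambda>x. qcnj (f x))"
  unfolding qcnj_def by (intro continuous_intros)

section \<open>The uniform measure on the unit quaternions\<close>

lemma vector_4 [simp]:
  "(vector [w,x,y,z] :: ('a::zero)^4) $ 1 = w"
  "(vector [w,x,y,z] :: ('a::zero)^4) $ 2 = x"
  "(vector [w,x,y,z] :: ('a::zero)^4) $ 3 = y"
  "(vector [w,x,y,z] :: ('a::zero)^4) $ 4 = z"
  unfolding vector_def by simp_all

definition quat4 :: "real^4 \<Rightarrow> quaternion" where
  "quat4 v = (v$1, vector [v$2, v$3, v$4])"

definition vec4 :: "quaternion \<Rightarrow> real^4" where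
  "vec4 q = vector [fst q, snd q $ 1, snd q $ 2, snd q $ 3]"

lemma quat4_vec4 [simp]: "quat4 (vec4 q) = q" 
  by (simp add: quat4_def vec4_def prod_eq_iff vec_eq_iff forall_3 vector_4)
lemma vec4_quat4 [simp]: "vec4 (quat4 q) = q" 
  by (simp add: quat4_def vec4_def vec_eq_iff forall_4 vector_4)
lemma linear_quat4: "linear quat4"
  by (intro linearI) (simp_all add: quat4_def prod_eq_iff vec_eq_iff forall_3)
lemma linear_vec4: "linear vec4"
  by (intro linearI) (simp_all add: vec4_def vec_eq_iff forall_4 vector_4)
lemma norm_quat4 [simp]: "norm (quat4 v) = norm v"
  by (simp add: quat4_def norm_prod_def norm_eq_sqrt_inner inner_vec_def sum_3 sum_4 power2_eq_square)
lemma norm_vec4 [simp]: "norm (vec4 q) = norm q"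
  using norm_quat4[of "vec4 q"] by simp

text \<open>The radial projection of the normalized Lebesgue measure on the unit ball; it inherits the
  invariance under all linear isometries, in particular under multiplication by unit quaternions on either side.\<close>

definition haar :: "quaternion measure" where
  "haar = distr (uniform_measure lborel (ball 0 1)) borel (\<lambda>v. sgn (quat4 v))"

lemma meas_sgn_quat4 [measurable]: "(\<lambda>v. sgn (quat4 v)) \<in> borel \<rightarrow>\<^sub>M borel"
proof -
  have "quat4 \<in> borel \<rightarrow>\<^sub>M borel"
    by (intro borel_measurable_continuous_onI linear_continuous_on linear_quat4 linear_conv_bounded_linear[THEN iffD1])
  moreover have "(sgn :: quaternion \<Rightarrow> _) \<in> borel \<rightarrow>\<^sub>M borel" by measurable
  ultimately show ?thesis by measurable
qed

lemma emeasure_ball4: "emeasure lborel (ball (0::real^4) 1) \<noteq> 0" "emeasure lborel (ball (0::real^4) 1) \<noteq> \<infinity>"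
proof -
  have "measure lborel (ball (0::real^4) 1) > 0" by (rule content_ball_pos) simp
  then show "emeasure lborel (ball (0::real^4) 1) \<noteq> 0" unfolding measure_def by fastforce
  show "emeasure lborel (ball (0::real^4) 1) \<noteq> \<infinity>"
    using emeasure_lborel_ball_finite[of "0::real^4" 1] by (metis less_irrefl infinity_ennreal_def)
qed

lemma prob_haar: "prob_space haar"
  unfolding haar_def
  by (intro prob_space.prob_space_distr prob_space_uniform_measure emeasure_ball4) auto

lemma sets_haar [simp, measurable_cong]: "sets haar = sets borel" by (simp add: haar_def)
lemma space_haar [simp]: "space haar = UNIV" by (simp add: haar_def)

lemma AE_haar_norm: "AE q in haar. norm q = 1"
proof -
  have "AE v in lborel. v \<noteq> (0::real^4)" by (rule AE_lborel_singleton)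
  then have "AE v in uniform_measure lborel (ball (0::real^4) 1). norm (sgn (quat4 v)) = 1"
  proof (intro AE_uniform_measureI)
    have *: "norm (sgn (quat4 v)) = 1" if "v \<noteq> 0" for v
      using that norm_quat4[of v] by (metis norm_eq_zero norm_sgn)
    show "AE v in lborel. v \<in> ball (0::real^4) 1 \<longrightarrow> norm (sgn (quat4 v)) = 1"
      by (rule eventually_mono[OF \<open>AE v in lborel. v \<noteq> (0::real^4)\<close>]) (rule impI, rule *)
  qed simp
  then show ?thesis unfolding haar_def by (subst AE_distr_iff) auto
qed

lemma cpt_prob_haar: "cpt_prob haar"
  unfolding cpt_prob_def
  by (intro conjI prob_haar sets_haar exI[of _ "sphere 0 1"]) (use AE_haar_norm in auto)

lemma emeasure_haar:
  assumes "A \<in> sets borel"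
  shows "emeasure haar A = emeasure lborel (ball 0 1 \<inter> {v. sgn (quat4 v) \<in> A}) / emeasure lborel (ball (0::real^4) 1)"
proof -
  have s: "{v. sgn (quat4 v) \<in> A} \<in> sets borel"
    using measurable_sets[OF meas_sgn_quat4 assms] by (simp add: vimage_def)
  show ?thesis unfolding haar_def using assms s
    by (subst emeasure_distr) (auto simp: vimage_def)
qed

text \<open>A linear isometry of the quaternions preserves both the Lebesgue measure of the unit ball and the radial
  projection.\<close>

lemma distr_haar_orthogonal:
  assumes L: "linear L" "\<And>q. norm (L q) = norm q"
  shows "distr haar borel L = haar"
proof (rule measure_eqI)
  fix A assume "A \<in> sets (distr haar borel L)"
  then have A: "A \<in> sets borel" by simp
  have mL: "L \<in> borel \<rightarrow>\<^sub>M borel"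
    by (intro borel_measurable_continuous_onI linear_continuous_on linear_conv_bounded_linear[THEN iffD1] L)
  have LA: "L -` A \<in> sets borel" using measurable_sets[OF mL A] by simp
  define L' where "L' = vec4 \<circ> L \<circ> quat4"
  have L': "orthogonal_transformation L'"
    unfolding orthogonal_transformation L'_def
    by (intro conjI linear_compose linear_quat4 linear_vec4 L) (auto simp: L)
  have "surj L'" "inj L'" using L' orthogonal_transformation_surj orthogonal_transformation_inj by auto
  define S where "S = ball 0 1 \<inter> {v. sgn (quat4 v) \<in> A}"
  define S' where "S' = ball 0 1 \<inter> {v. sgn (quat4 v) \<in> L -` A}"
  have *: "{v. sgn (quat4 v) \<in> B} \<in> sets borel" if "B \<in> sets borel" for B
    using measurable_sets[OF meas_sgn_quat4 that] by (simp add: vimage_def)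
  have Sb: "S \<in> sets borel" "S' \<in> sets borel"
    using *[OF A] *[OF LA] unfolding S_def S'_def by (metis borel_open open_ball sets.Int)+
  have "L' v \<in> S \<longleftrightarrow> v \<in> S'" for v
    by (simp add: S_def S'_def L'_def L sgn_div_norm linear_scale[OF L(1)] )
  then have "L' ` S' = S" using \<open>surj L'\<close> by (auto simp: image_iff) (metis surjD)
  moreover have "emeasure lborel B = ennreal (measure lebesgue B)" "B \<in> lmeasurable" if "B \<in> sets borel" "B \<subseteq> ball 0 1" for B :: "(real^4) set"
  proof -
    have "B \<in> sets lebesgue" using that(1) by (intro sets_completionI_sets) simp
    then show "B \<in> lmeasurable" using that(2) by (intro fmeasurableI2[OF lmeasurable_ball])
    then have "emeasure lebesgue B = ennreal (measure lebesgue B)" by (rule emeasure_eq_measure2)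
    moreover have "emeasure lebesgue B = emeasure lborel B"
      using that(1) by simp
    ultimately show "emeasure lborel B = ennreal (measure lebesgue B)" by simp
  qed
  ultimately have "emeasure lborel S = emeasure lborel S'"
    using measure_orthogonal_image[OF L', of S'] Sb by (metis S_def S'_def inf_le1)
  then show "emeasure (distr haar borel L) A = emeasure haar A"
    using A LA mL by (simp add: emeasure_distr measurable_cong_sets[OF sets_haar refl] emeasure_haar S_def S'_def)
qed simp

lemma haar_integral_orthogonal:
  fixes f :: "quaternion \<Rightarrow> real"
  assumes L: "linear L" "\<And>q. norm (L q) = norm q" and f: "f \<in> borel_measurable borel"
  shows "(\<integral>q. f (L q) \<partial>haar) = (\<integral>q. f q \<partial>haar)"
proof -
  have mL: "L \<in> haar \<rightarrow>\<^sub>M borel"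
    by (subst measurable_cong_sets[OF sets_haar refl]) (intro borel_measurable_continuous_onI linear_continuous_on linear_conv_bounded_linear[THEN iffD1] L)
  have "(\<integral>q. f q \<partial>haar) = (\<integral>q. f q \<partial>distr haar borel L)" by (simp add: distr_haar_orthogonal[OF L])
  also have "\<dots> = (\<integral>q. f (L q) \<partial>haar)" by (rule integral_distr[OF mL f])
  finally show ?thesis by simp
qed

lemma linear_qmult_left: "linear (qmult p)" and linear_qmult_right: "linear (\<lambda>q. qmult q p)"
  by (intro linearI; simp add: qmult_def comp3 algebra_simps)+

lemma haar_left: "norm p = 1 \<Longrightarrow> (f :: quaternion \<Rightarrow> real) \<in> borel_measurable borel \<Longrightarrow> (\<integral>q. f (qmult p q) \<partial>haar) = (\<integral>q. f q \<partial>haar)"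
  by (intro haar_integral_orthogonal linear_qmult_left) (auto simp: norm_qmult)

lemma haar_right: "norm p = 1 \<Longrightarrow> (f :: quaternion \<Rightarrow> real) \<in> borel_measurable borel \<Longrightarrow> (\<integral>q. f (qmult q p) \<partial>haar) = (\<integral>q. f q \<partial>haar)"
  by (intro haar_integral_orthogonal[where L = "\<lambda>q. qmult q p"] linear_qmult_right) (auto simp: norm_qmult)

text \<open>The cone over a cap of radius \<open>\<delta>\<close> contains a box with one side of constant length and three sides
  of length proportional to \<open>\<delta>\<close>.\<close>

lemma haar_cap:
  "\<exists>c>0. \<forall>\<delta>. 0 < \<delta> \<longrightarrow> \<delta> \<le> 1 \<longrightarrow> c * \<delta> ^ 3 \<le> measure haar {q. norm (q - (1,0)) \<le> \<delta>}"
proof -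
  define V where "V = measure lborel (ball (0::real^4) 1)"
  have V: "V > 0" unfolding V_def using content_ball_pos[of 1 "0::real^4"] by simp
  have VE: "emeasure lborel (ball (0::real^4) 1) = ennreal V"
    unfolding V_def by (rule emeasure_eq_ennreal_measure) (use emeasure_ball4(2) in simp)
  show ?thesis
  proof (intro exI[of _ "1 / (2048 * V)"] conjI allI impI)
    fix \<delta> :: real assume d: "0 < \<delta>" "\<delta> \<le> 1"
    define A where "A = {q::quaternion. norm (q - (1,0)) \<le> \<delta>}"
    have A: "A \<in> sets borel" unfolding A_def by measurable
    define lo where "lo = (vector [1/2, -\<delta>/16, -\<delta>/16, -\<delta>/16] :: real^4)"
    define hi where "hi = (vector [3/4, \<delta>/16, \<delta>/16, \<delta>/16] :: real^4)"
    have sub: "cbox lo hi \<subseteq> ball 0 1 \<inter> {v. sgn (quat4 v) \<in> A}"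
    proof
      fix v assume "v \<in> cbox lo hi"
      then have v: "1/2 \<le> v$1" "v$1 \<le> 3/4" "\<bar>v$2\<bar> \<le> \<delta>/16" "\<bar>v$3\<bar> \<le> \<delta>/16" "\<bar>v$4\<bar> \<le> \<delta>/16"
        by (auto simp: mem_box_cart forall_4 lo_def hi_def vector_4)
      define w where "w = (vector [v$2, v$3, v$4] :: real^3)"
      have w: "norm w \<le> 3 * \<delta> / 16"
        using norm_le_l1_cart[of w] v by (simp add: w_def sum_3)
      have q: "quat4 v = (v$1, w)" by (simp add: quat4_def w_def)
      have n1: "norm v \<le> v$1 + norm w" "v$1 \<le> norm v"
        using v norm_Pair_le[of "v$1" w] norm_fst_le[of "v$1" w] by (auto simp: norm_quat4[symmetric, of v] q simp del: norm_quat4)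
      then have "norm v < 1" using v w d by auto
      have np: "norm v \<ge> 1/2" using n1 v by simp
      have "norm v *\<^sub>R sgn (quat4 v) = quat4 v"
      proof -
        have "norm v \<noteq> 0" using np by linarith
        then show ?thesis by (simp add: sgn_div_norm)
      qed
      then have "norm v *\<^sub>R (sgn (quat4 v) - (1,0)) = (v$1 - norm v, w)"
        by (simp add: scaleR_diff_right q)
      then have "norm v * norm (sgn (quat4 v) - (1,0)) = norm (v$1 - norm v, w)"
        by (metis norm_scaleR abs_norm_cancel)
      also have "\<dots> \<le> \<bar>v$1 - norm v\<bar> + norm w" using norm_Pair_le by (metis real_norm_def)
      also have "\<dots> \<le> 2 * norm w" using n1 by auto
      also have "\<dots> \<le> 3 * \<delta> / 8" using w by simp
      also have "\<dots> \<le> norm v * \<delta>" using mult_right_mono[OF np, of \<delta>] d by linarith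
      finally have "norm (sgn (quat4 v) - (1,0)) \<le> \<delta>"
        using np by (subst (asm) mult_le_cancel_left) (use np in linarith)
      then show "v \<in> ball 0 1 \<inter> {v. sgn (quat4 v) \<in> A}" using \<open>norm v < 1\<close> by (simp add: A_def)
    qed
    have ne: "cbox lo hi \<noteq> {}"
      using d by (simp add: interval_ne_empty_cart forall_4 lo_def hi_def)
    have "measure lborel (cbox lo hi) = (\<Prod>i\<in>UNIV. hi $ i - lo $ i)" by (rule content_cbox_cart[OF ne])
    also have "\<dots> = (hi$1 - lo$1) * (hi$2 - lo$2) * (hi$3 - lo$3) * (hi$4 - lo$4)"
      unfolding UNIV_4 by (simp add: ac_simps)
    also have "\<dots> = \<delta>^3 / 2048" by (simp add: lo_def hi_def power3_eq_cube)
    finally have ct: "measure lborel (cbox lo hi) = \<delta>^3 / 2048" .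
    have S: "ball 0 1 \<inter> {v. sgn (quat4 v) \<in> A} \<in> sets lborel"
      using measurable_sets[OF meas_sgn_quat4 A] by (simp add: vimage_def)
    have "ennreal (\<delta>^3 / 2048) = emeasure lborel (cbox lo hi)"
      unfolding ct[symmetric] by (rule emeasure_eq_ennreal_measure [symmetric]) (metis emeasure_lborel_cbox_finite less_irrefl infinity_ennreal_def top.not_eq_extremum)
    also have "\<dots> \<le> emeasure lborel (ball 0 1 \<inter> {v. sgn (quat4 v) \<in> A})"
      by (rule emeasure_mono[OF sub S])
    finally have "ennreal (\<delta>^3 / 2048) / ennreal V \<le> emeasure haar A"
      unfolding emeasure_haar[OF A] VE by (rule divide_right_mono_ennreal)
    then have "ennreal (1 / (2048 * V) * \<delta>^3) \<le> emeasure haar A"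
      using V d by (simp add: divide_ennreal)
    then show "1 / (2048 * V) * \<delta>^3 \<le> measure haar {q. norm (q - (1,0)) \<le> \<delta>}"
      unfolding A_def[symmetric]
      by (simp add: finite_measure.emeasure_eq_measure[OF prob_space.finite_measure[OF prob_haar]])
  qed (use V in auto)
qed

section \<open>The uniform measure on the sphere\<close>

abbreviation e1 :: "real^3" where "e1 \<equiv> axis 1 1"

definition sph :: "(real^3) measure" where
  "sph = distr haar borel (\<lambda>q. rot q e1)"

abbreviation cont :: "('a::topological_space \<Rightarrow> 'b::topological_space) \<Rightarrow> bool" where
  "cont f \<equiv> continuous_on UNIV f"

lemma cont_comp: "cont f \<Longrightarrow> continuous_on S g \<Longrightarrow> continuous_on S (\<lambda>x. f (g x))"
  by (rule continuous_on_compose2) auto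

lemma cont_borel: "cont (f :: 'a::topological_space \<Rightarrow> real) \<Longrightarrow> f \<in> borel_measurable borel"
  by (rule borel_measurable_continuous_onI)

lemma meas_rot_e1 [measurable]: "(\<lambda>q. rot q x) \<in> borel \<rightarrow>\<^sub>M borel"
  by (intro borel_measurable_continuous_onI continuous_intros)

lemma sets_sph [simp, measurable_cong]: "sets sph = sets borel" by (simp add: sph_def)
lemma space_sph [simp]: "space sph = UNIV" by (simp add: sph_def)

lemma AE_sph_norm: "AE x in sph. norm x = 1"
  unfolding sph_def by (subst AE_distr_iff) (use AE_haar_norm in \<open>auto elim!: eventually_mono\<close>)

lemma prob_sph: "prob_space sph"
  unfolding sph_def by (intro prob_space.prob_space_distr prob_haar) simp

lemma cpt_prob_sph: "cpt_prob sph"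
  unfolding cpt_prob_def
  by (intro conjI prob_sph sets_sph exI[of _ "sphere 0 1"]) (use AE_sph_norm in auto)

lemma sph_eq: "cont f \<Longrightarrow> (\<integral>x. f x \<partial>sph) = (\<integral>q. f (rot q e1) \<partial>haar)" for f :: "real^3 \<Rightarrow> real"
  unfolding sph_def by (rule integral_distr) (auto simp: cont_borel)

lemma sph_rot:
  fixes f :: "real^3 \<Rightarrow> real"
  assumes "norm p = 1" "cont f"
  shows "(\<integral>x. f (rot p x) \<partial>sph) = (\<integral>x. f x \<partial>sph)"
proof -
  have c: "cont (\<lambda>x. f (rot p x))" by (intro cont_comp[OF assms(2)] continuous_intros)
  have "(\<integral>x. f (rot p x) \<partial>sph) = (\<integral>q. f (rot (qmult p q) e1) \<partial>haar)"
    using sph_eq[OF c] by (simp add: rot_qmult)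
  also have "\<dots> = (\<integral>q. f (rot q e1) \<partial>haar)"
    by (rule haar_left[OF assms(1), of "\<lambda>q. f (rot q e1)"]) (intro cont_borel cont_comp[OF assms(2)] continuous_intros)
  finally show ?thesis using sph_eq[OF assms(2)] by simp
qed

lemma norm_e1 [simp]: "norm e1 = 1" by (simp add: norm_axis_1)

text \<open>The half-turn about the bisector of \<open>e1\<close> and \<open>x\<close> maps \<open>e1\<close> to \<open>x\<close>; only \<open>x = - e1\<close> needs
  another choice.\<close>

lemma rot_transitive:
  assumes "norm x = 1" shows "\<exists>q. norm q = 1 \<and> rot q e1 = x"
proof (cases "x = - e1")
  case True
  have "norm ((0, axis 2 1) :: quaternion) = 1" by (simp add: norm_prod_def norm_axis_1)
  moreover have "rot (0, axis 2 1) e1 = x"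
    by (simp add: True rot_def comp3 axis_def)
  ultimately show ?thesis by blast
next
  case False
  define n where "n = norm (e1 + x)"
  have n0: "n \<noteq> 0" using False by (auto simp: n_def add_eq_0_iff)
  have xx: "x \<bullet> x = 1" using assms by (simp add: norm_eq_1)
  have ee: "e1 \<bullet> e1 = (1::real)" using norm_e1 by (simp only: norm_eq_1)
  have nn: "n\<^sup>2 = 2 + 2 * (e1 \<bullet> x)"
    unfolding n_def power2_norm_eq_inner by (simp add: algebra_simps xx ee inner_commute)
  define u where "u = (1/n) *\<^sub>R (e1 + x)"
  have uu: "norm u = 1" using n0 by (simp add: u_def n_def)
  have ue: "2 * (u \<bullet> e1) = n"
    using nn n0 by (simp add: u_def algebra_simps ee inner_commute power2_eq_square field_simps)
  have "rot (0, u) e1 = - e1 + n *\<^sub>R u"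
    using uu by (simp add: rot_def norm_eq_1 ue)
  also have "\<dots> = x" using n0 by (simp add: u_def)
  finally show ?thesis using uu by (intro exI[of _ "(0,u)"]) (simp add: norm_prod_def)
qed

text \<open>The point \<open>x\<close> is the image of \<open>e1\<close> under some rotation, which right invariance absorbs.\<close>

lemma haar_point:
  fixes f :: "real^3 \<Rightarrow> real"
  assumes "norm x = 1" "cont f"
  shows "(\<integral>q. f (rot q x) \<partial>haar) = (\<integral>x. f x \<partial>sph)"
proof -
  obtain h where h: "norm h = 1" "rot h e1 = x" using rot_transitive[OF assms(1)] by blast
  have "(\<integral>q. f (rot q x) \<partial>haar) = (\<integral>q. f (rot (qmult q h) e1) \<partial>haar)" by (simp add: rot_qmult h)
  also have "\<dots> = (\<integral>q. f (rot q e1) \<partial>haar)"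
    by (rule haar_right[OF h(1), of "\<lambda>q. f (rot q e1)"]) (intro cont_borel cont_comp[OF assms(2)] continuous_intros)
  finally show ?thesis using sph_eq[OF assms(2)] by simp
qed

definition ip :: "(real^3 \<Rightarrow> real) \<Rightarrow> (real^3 \<Rightarrow> real) \<Rightarrow> real" where
  "ip f g = (\<integral>x. f x * g x \<partial>sph)"

lemma int_sph: "cont (f :: real^3 \<Rightarrow> real) \<Longrightarrow> integrable sph f" by (rule cpt_prob_integrable[OF cpt_prob_sph])
lemma int_haar: "cont (f :: quaternion \<Rightarrow> real) \<Longrightarrow> integrable haar f" by (rule cpt_prob_integrable[OF cpt_prob_haar])

lemma ip_commute: "ip f g = ip g f" by (simp add: ip_def mult.commute)

lemma ip_add: "cont f \<Longrightarrow> cont g \<Longrightarrow> cont h \<Longrightarrow> ip (\<lambda>x. f x + g x) h = ip f h + ip g h"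
  unfolding ip_def distrib_right by (intro Bochner_Integration.integral_add int_sph continuous_intros)

lemma ip_diff: "cont f \<Longrightarrow> cont g \<Longrightarrow> cont h \<Longrightarrow> ip (\<lambda>x. f x - g x) h = ip f h - ip g h"
  unfolding ip_def left_diff_distrib by (intro Bochner_Integration.integral_diff int_sph continuous_intros)

lemma ip_scale: "ip (\<lambda>x. c * f x) h = c * ip f h"
  unfolding ip_def by (simp add: mult.assoc)

lemma ip_sum: "finite I \<Longrightarrow> (\<And>i. i \<in> I \<Longrightarrow> cont (f i)) \<Longrightarrow> cont h \<Longrightarrow> ip (\<lambda>x. \<Sum>i\<in>I. f i x) h = (\<Sum>i\<in>I. ip (f i) h)"
  unfolding ip_def sum_distrib_right by (intro Bochner_Integration.integral_sum int_sph continuous_intros) auto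

lemma ip_nonneg [simp]: "0 \<le> ip f f" unfolding ip_def by (intro integral_nonneg_AE) auto

lemma ip_CS: "cont f \<Longrightarrow> cont g \<Longrightarrow> (ip f g)\<^sup>2 \<le> ip f f * ip g g"
  using integral_Cauchy_Schwarz[of sph f g] unfolding ip_def
  by (simp add: power2_eq_square int_sph continuous_intros)

lemma ip_CS': "cont f \<Longrightarrow> cont g \<Longrightarrow> \<bar>ip f g\<bar> \<le> sqrt (ip f f) * sqrt (ip g g)"
  by (metis ip_CS real_sqrt_abs real_sqrt_le_mono real_sqrt_mult)

lemma ip_rot: "norm q = 1 \<Longrightarrow> cont f \<Longrightarrow> cont g \<Longrightarrow> ip (\<lambda>x. f (rot q x)) (\<lambda>x. g (rot q x)) = ip f g"
  unfolding ip_def by (rule sph_rot[of q "\<lambda>x. f x * g x"]) (auto intro: continuous_intros)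

lemma ip_rot_adj: "norm q = 1 \<Longrightarrow> cont f \<Longrightarrow> cont g \<Longrightarrow> ip f (\<lambda>x. g (rot q x)) = ip (\<lambda>x. f (rot (qcnj q) x)) g"
  using ip_rot[of q "\<lambda>x. f (rot (qcnj q) x)" g] by (simp add: cont_comp continuous_intros)

section \<open>Polynomial functions and spherical harmonics\<close>

text \<open>The functions given by a polynomial of degree at most \<open>d\<close> in the three coordinates, generated by
  multiplication with linear forms so that rotation invariance is immediate.\<close>

inductive polyd :: "nat \<Rightarrow> (real^3 \<Rightarrow> real) \<Rightarrow> bool" where
  polyd_const: "polyd d (\<lambda>_. c)"
| polyd_add: "polyd d f \<Longrightarrow> polyd d g \<Longrightarrow> polyd d (\<lambda>x. f x + g x)"
| polyd_mult: "polyd d f \<Longrightarrow> polyd (Suc d) (\<lambda>x. (v \<bullet> x) * f x)"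

lemma polyd_cont: "polyd d f \<Longrightarrow> cont f"
  by (induction rule: polyd.induct) (auto intro!: continuous_intros)

lemma polyd_Suc: "polyd d f \<Longrightarrow> polyd (Suc d) f"
  by (induction rule: polyd.induct) (auto intro: polyd.intros)

lemma polyd_mono: "polyd d f \<Longrightarrow> d \<le> e \<Longrightarrow> polyd e f"
  by (induction e) (auto simp: le_Suc_eq intro: polyd_Suc)

lemma polyd_scale: "polyd d f \<Longrightarrow> polyd d (\<lambda>x. c * f x)"
proof (induction rule: polyd.induct)
  case (polyd_mult d f v)
  then show ?case using polyd.polyd_mult[of d "\<lambda>x. c * f x" v] by (simp add: algebra_simps)
qed (auto simp: algebra_simps intro: polyd.intros)

lemma polyd_diff: "polyd d f \<Longrightarrow> polyd d g \<Longrightarrow> polyd d (\<lambda>x. f x - g x)"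
  using polyd_add[of d f "\<lambda>x. (-1) * g x"] polyd_scale[of d g "-1"] by simp

lemma polyd_sum: "finite I \<Longrightarrow> (\<And>i. i \<in> I \<Longrightarrow> polyd d (f i)) \<Longrightarrow> polyd d (\<lambda>x. \<Sum>i\<in>I. f i x)"
  by (induction rule: finite_induct) (auto intro: polyd.intros)

lemma polyd_rot: "polyd d f \<Longrightarrow> polyd d (\<lambda>x. f (rot q x))"
proof (induction rule: polyd.induct)
  case (polyd_mult d f v)
  have "v \<bullet> rot q x = rot (qcnj q) v \<bullet> x" for x by (metis inner_commute rot_inner)
  then show ?case using polyd.polyd_mult[OF polyd_mult.IH, of "rot (qcnj q) v"] by simp
qed (auto intro: polyd.intros)

lemma polyd_times: "polyd d f \<Longrightarrow> polyd e g \<Longrightarrow> polyd (d + e) (\<lambda>x. f x * g x)"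
proof (induction rule: polyd.induct)
  case (polyd_const d c)
  then show ?case by (auto intro: polyd_mono[of e] polyd_scale)
next
  case (polyd_mult d f v)
  then show ?case using polyd.polyd_mult[of "d + e" "\<lambda>x. f x * g x" v] by (simp add: mult.assoc)
qed (auto simp: algebra_simps intro: polyd.intros)

lemma polyd_poly: "degree p \<le> d \<Longrightarrow> polyd d (\<lambda>x. poly p (x$1))"
proof (induction p arbitrary: d)
  case 0 then show ?case by (simp add: polyd_const)
next
  case (pCons a p)
  show ?case
  proof (cases "p = 0")
    case True then show ?thesis by (simp add: polyd_const)
  next
    case False
    then obtain d' where d: "d = Suc d'" "degree p \<le> d'" using pCons.prems by (cases d) auto
    have "e1 \<bullet> x = x $ 1" for x by (simp add: inner_axis')
    then show ?thesis
      using polyd_add[OF polyd_const[of d a] polyd_mult[OF pCons.IH[OF d(2)], of e1, folded d(1)]] by simp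
  qed
qed

lemma polyd_haar:
  "polyd d f \<Longrightarrow> cont w \<Longrightarrow> polyd d (\<lambda>x. \<integral>q. f (rot q x) * w q \<partial>haar)"
proof (induction arbitrary: w rule: polyd.induct)
  case (polyd_const d c)
  then show ?case by (simp add: polyd.polyd_const)
next
  case (polyd_add d f g)
  have "integrable haar (\<lambda>q. f (rot q x) * w q)" "integrable haar (\<lambda>q. g (rot q x) * w q)" for x
    using polyd_add by (auto intro!: int_haar continuous_intros cont_comp[OF polyd_cont[of d f]] cont_comp[OF polyd_cont[of d g]])
  then show ?case using polyd.polyd_add[OF polyd_add.IH(1)[OF polyd_add.prems] polyd_add.IH(2)[OF polyd_add.prems]]
    by (simp add: distrib_right)
next
  case (polyd_mult d f v)
  define w' where "w' i q = (rot (qcnj q) v $ i) * w q" for i q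
  have w': "cont (w' i)" for i unfolding w'_def using polyd_mult.prems by (intro continuous_intros)
  have fc: "cont f" using polyd_mult.hyps by (rule polyd_cont)
  have "polyd (Suc d) (\<lambda>x. \<Sum>i\<in>UNIV. (axis i 1 \<bullet> x) * (\<integral>q. f (rot q x) * w' i q \<partial>haar))"
    by (intro polyd_sum polyd.polyd_mult polyd_mult.IH w') auto
  also have "(\<lambda>x. \<Sum>i\<in>UNIV. (axis i 1 \<bullet> x) * (\<integral>q. f (rot q x) * w' i q \<partial>haar))
     = (\<lambda>x. \<integral>q. (v \<bullet> rot q x) * f (rot q x) * w q \<partial>haar)"
  proof
    fix x :: "real^3"
    have "(\<Sum>i\<in>UNIV. (axis i 1 \<bullet> x) * (\<integral>q. f (rot q x) * w' i q \<partial>haar))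
       = (\<Sum>i\<in>UNIV. (\<integral>q. x $ i * (f (rot q x) * w' i q) \<partial>haar))"
      by (simp add: inner_axis')
    also have "\<dots> = (\<integral>q. (\<Sum>i\<in>UNIV. x $ i * (f (rot q x) * w' i q)) \<partial>haar)"
      by (intro Bochner_Integration.integral_sum[symmetric] int_haar continuous_intros w' cont_comp[OF fc])
    also have "\<dots> = (\<integral>q. (v \<bullet> rot q x) * f (rot q x) * w q \<partial>haar)"
    proof (intro Bochner_Integration.integral_cong refl)
      fix q
      have "v \<bullet> rot q x = (\<Sum>i\<in>UNIV. x $ i * (rot (qcnj q) v $ i))"
        by (subst inner_commute, subst rot_inner) (simp add: inner_vec_def)
      then show "(\<Sum>i\<in>UNIV. x $ i * (f (rot q x) * w' i q)) = (v \<bullet> rot q x) * f (rot q x) * w q"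
        by (simp add: w'_def sum_distrib_left sum_distrib_right algebra_simps)
    qed
    finally show "(\<Sum>i\<in>UNIV. (axis i 1 \<bullet> x) * (\<integral>q. f (rot q x) * w' i q \<partial>haar)) = (\<integral>q. (v \<bullet> rot q x) * f (rot q x) * w q \<partial>haar)" .
  qed
  finally show ?case .
qed

text \<open>On the sphere these are the spherical harmonics of degree \<open>d\<close>. Describing them by orthogonality to all
  polynomial functions of lower degree avoids the Laplacian, and makes invariance under rotations and
  averaging evident.\<close>

definition harm :: "nat \<Rightarrow> (real^3 \<Rightarrow> real) \<Rightarrow> bool" where
  "harm d f \<longleftrightarrow> polyd d f \<and> (\<forall>e<d. \<forall>p. polyd e p \<longrightarrow> ip f p = 0)"

lemma harm_cont: "harm d f \<Longrightarrow> cont f" by (auto simp: harm_def intro: polyd_cont)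

lemma harm_rot: assumes "norm q = 1" "harm d f" shows "harm d (\<lambda>x. f (rot q x))"
  unfolding harm_def
proof (intro conjI allI impI)
  show "polyd d (\<lambda>x. f (rot q x))" using assms by (auto simp: harm_def polyd_rot)
  fix e p assume "e < d" "polyd e p"
  then have "ip f (\<lambda>x. p (rot (qcnj q) x)) = 0" using assms(2) polyd_rot by (auto simp: harm_def)
  then show "ip (\<lambda>x. f (rot q x)) p = 0"
    using ip_rot_adj[of "qcnj q" f p] assms harm_cont polyd_cont[OF \<open>polyd e p\<close>] by auto
qed

lemma harm_diff: "harm d f \<Longrightarrow> harm d g \<Longrightarrow> harm d (\<lambda>x. f x - g x)"
  by (auto simp: harm_def polyd_diff ip_diff polyd_cont)
lemma harm_add: "harm d f \<Longrightarrow> harm d g \<Longrightarrow> harm d (\<lambda>x. f x + g x)"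
  by (auto simp: harm_def polyd_add ip_add polyd_cont)
lemma harm_0: "harm d (\<lambda>_. 0)" by (auto simp: harm_def polyd_const ip_def)
lemma harm_sum: "finite I \<Longrightarrow> (\<And>i. i \<in> I \<Longrightarrow> harm d (f i)) \<Longrightarrow> harm d (\<lambda>x. \<Sum>i\<in>I. f i x)"
  by (induction rule: finite_induct) (auto intro: harm_0 harm_add)

lemma fubini_haar_sph:
  fixes f :: "quaternion \<Rightarrow> real^3 \<Rightarrow> real"
  shows "cont (\<lambda>(q,x). f q x) \<Longrightarrow> (\<integral>q. (\<integral>x. f q x \<partial>sph) \<partial>haar) = (\<integral>x. (\<integral>q. f q x \<partial>haar) \<partial>sph)"
  by (rule cpt_prob_fubini[OF cpt_prob_haar cpt_prob_sph])

lemma harm_haar: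
  assumes f: "harm d f" and w: "cont w"
  shows "harm d (\<lambda>x. \<integral>q. f (rot q x) * w q \<partial>haar)"
  unfolding harm_def
proof (intro conjI allI impI)
  show "polyd d (\<lambda>x. \<integral>q. f (rot q x) * w q \<partial>haar)" using f w by (auto simp: harm_def intro: polyd_haar)
  fix e p assume e: "e < d" and p: "polyd e p"
  note fc = harm_cont[OF f] and pc = polyd_cont[OF p]
  have "ip (\<lambda>x. \<integral>q. f (rot q x) * w q \<partial>haar) p = (\<integral>x. (\<integral>q. f (rot q x) * w q * p x \<partial>haar) \<partial>sph)"
    by (simp add: ip_def)
  also have "\<dots> = (\<integral>q. (\<integral>x. f (rot q x) * w q * p x \<partial>sph) \<partial>haar)"
    by (intro fubini_haar_sph[symmetric]) (auto simp: case_prod_beta intro!: continuous_intros cont_comp[OF fc] cont_comp[OF pc] cont_comp[OF w])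
  also have "\<dots> = (\<integral>q. w q * ip (\<lambda>x. f (rot q x)) p \<partial>haar)"
    unfolding ip_def by (intro Bochner_Integration.integral_cong refl) (simp add: ac_simps flip: integral_mult_right_zero)
  also have "\<dots> = (\<integral>q. 0 \<partial>haar)"
  proof (intro integral_cong_AE)
    have "cont (\<lambda>q. w q * ip (\<lambda>x. f (rot q x)) p)" unfolding ip_def
      by (intro continuous_intros w cpt_prob_continuous_integral[OF cpt_prob_sph])
         (auto simp: case_prod_beta intro!: continuous_intros cont_comp[OF fc] cont_comp[OF pc])
    then show "(\<lambda>q. w q * ip (\<lambda>x. f (rot q x)) p) \<in> borel_measurable haar"
      using cont_borel by (simp add: measurable_cong_sets[OF sets_haar refl])
    show "AE q in haar. w q * ip (\<lambda>x. f (rot q x)) p = 0"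
      using AE_haar_norm by eventually_elim (use harm_rot[OF _ f] e p in \<open>auto simp: harm_def\<close>)
  qed auto
  finally show "ip (\<lambda>x. \<integral>q. f (rot q x) * w q \<partial>haar) p = 0" by simp
qed

section \<open>Rotations about an axis and zonal polynomials\<close>

definition erot :: "real^3 \<Rightarrow> real \<Rightarrow> quaternion" where
  "erot u \<phi> = (cos (\<phi>/2), sin (\<phi>/2) *\<^sub>R u)"

lemma norm_erot [simp]: "norm u = 1 \<Longrightarrow> norm (erot u \<phi>) = 1"
  by (simp add: erot_def norm_prod_def)

lemma rot_erot:
  assumes "norm u = 1"
  shows "rot (erot u \<phi>) x = cos \<phi> *\<^sub>R x + sin \<phi> *\<^sub>R cross3 u x + ((1 - cos \<phi>) * (u \<bullet> x)) *\<^sub>R u"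
proof -
  have uu: "u \<bullet> u = 1" using assms by (simp add: norm_eq_1)
  have c: "cos \<phi> = (cos (\<phi>/2))\<^sup>2 - (sin (\<phi>/2))\<^sup>2" using cos_double[of "\<phi>/2"] by simp
  have s: "sin \<phi> = 2 * sin (\<phi>/2) * cos (\<phi>/2)" using sin_double[of "\<phi>/2"] by simp
  have c2: "1 - cos \<phi> = 2 * (sin (\<phi>/2))\<^sup>2" using cos_double_sin[of "\<phi>/2"] by simp
  show ?thesis
    unfolding rot_def erot_def
    by (simp add: uu c2 power2_eq_square cross_mult_left) (simp add: c s power2_eq_square algebra_simps)
qed

text \<open>On a great circle, even powers of the second coordinate \<open>s\<close> can be eliminated by \<open>s\<^sup>2 = 1 - z\<^sup>2\<close>.\<close>

lemma polyd_plane: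
  assumes "polyd d f"
  shows "\<exists>a b :: real poly. degree a \<le> d \<and> (b = 0 \<or> degree b < d) \<and>
    (\<forall>z s. s\<^sup>2 = 1 - z\<^sup>2 \<longrightarrow> f (vector [z, s, 0]) = poly a z + s * poly b z)"
  using assms
proof (induction rule: polyd.induct)
  case (polyd_const d c)
  then show ?case by (intro exI[of _ "[:c:]"] exI[of _ 0]) auto
next
  case (polyd_add d f g)
  then obtain a b a' b' where ab: "degree a \<le> d" "b = 0 \<or> degree b < d" "\<And>z s. s\<^sup>2 = 1 - z\<^sup>2 \<Longrightarrow> f (vector [z, s, 0]) = poly a z + s * poly b z"
     "degree a' \<le> d" "b' = 0 \<or> degree b' < d" "\<And>z s. s\<^sup>2 = 1 - z\<^sup>2 \<Longrightarrow> g (vector [z, s, 0]) = poly a' z + s * poly b' z"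
    by blast
  show ?case
  proof (rule exI[of _ "a + a'"], rule exI[of _ "b + b'"], intro conjI allI impI)
    show "degree (a + a') \<le> d" using ab by (simp add: degree_add_le)
    show "b + b' = 0 \<or> degree (b + b') < d" using ab by (auto simp: degree_add_less)
  qed (use ab in \<open>auto simp: algebra_simps\<close>)
next
  case (polyd_mult d f v)
  then obtain a b where ab: "degree a \<le> d" "b = 0 \<or> degree b < d" "\<And>z s. s\<^sup>2 = 1 - z\<^sup>2 \<Longrightarrow> f (vector [z, s, 0]) = poly a z + s * poly b z"
    by blast
  define a' where "a' = smult (v$1) (pCons 0 a) + smult (v$2) ([:1,0,-1:] * b)"
  define b' where "b' = smult (v$1) (pCons 0 b) + smult (v$2) a"
  have d1: "degree (pCons 0 b) \<le> d" using ab(2) by auto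
  have d2: "degree ([:1,0,-1:] * b) \<le> Suc d"
    using ab(2) degree_mult_le[of "[:1,0,-1:]" b] by auto
  show ?case
  proof (rule exI[of _ a'], rule exI[of _ b'], intro conjI allI impI)
    show "degree a' \<le> Suc d" unfolding a'_def using ab d2
      by (intro degree_add_le) (auto intro: order_trans[OF degree_smult_le] order_trans[OF degree_pCons_le])
    have "degree b' \<le> d" unfolding b'_def using ab d1
      by (intro degree_add_le) (auto intro: order_trans[OF degree_smult_le])
    then show "b' = 0 \<or> degree b' < Suc d" by simp
    fix z s :: real assume s: "s\<^sup>2 = 1 - z\<^sup>2"
    have "v \<bullet> vector [z, s, 0] = v$1 * z + v$2 * s" by (simp add: inner_vec_def sum_3)
    then have "(v \<bullet> vector [z, s, 0]) * f (vector [z, s, 0]) = (v$1 * z + v$2 * s) * (poly a z + s * poly b z)"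
      using ab(3)[OF s] by simp
    also have "\<dots> = poly a' z + s * poly b' z + v$2 * poly b z * (s\<^sup>2 - (1 - z\<^sup>2))"
      by (simp add: a'_def b'_def algebra_simps power2_eq_square)
    finally show "(v \<bullet> vector [z, s, 0]) * f (vector [z, s, 0]) = poly a' z + s * poly b' z" using s by simp
  qed
qed

lemma rot_e1_axis: "rot (erot e1 \<phi>) x = vector [x$1, cos \<phi> * x$2 - sin \<phi> * x$3, sin \<phi> * x$2 + cos \<phi> * x$3]"
  unfolding rot_erot[OF norm_e1] by (simp add: comp3 axis_def algebra_simps)

lemma rot_e1_fix: "rot (erot e1 \<phi>) e1 = e1"
  unfolding rot_e1_axis by (simp add: vec_eq_iff forall_3 axis_def)

text \<open>Every point of the sphere can be rotated about \<open>e1\<close> into the half circle \<open>(z, s, 0)\<close>; the part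
  that is odd in \<open>s\<close> vanishes because of the half-turn about \<open>e1\<close>.\<close>

lemma polyd_zonal:
  assumes f: "polyd d f" and inv: "\<And>h x. norm h = 1 \<Longrightarrow> rot h e1 = e1 \<Longrightarrow> f (rot h x) = f x"
  shows "\<exists>c. degree c \<le> d \<and> (\<forall>x. norm x = 1 \<longrightarrow> f x = poly c (x$1))"
proof -
  obtain a b where ab: "degree a \<le> d" "\<And>z s. s\<^sup>2 = 1 - z\<^sup>2 \<Longrightarrow> f (vector [z, s, 0]) = poly a z + s * poly b z"
    using polyd_plane[OF f] by blast
  have inv': "f (rot (erot e1 \<phi>) x) = f x" for \<phi> x
    by (rule inv) (auto simp: rot_e1_fix)
  have 1: "f (vector [z, s, 0]) = poly a z" if "s\<^sup>2 = 1 - z\<^sup>2" for z s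
  proof -
    have "f (vector [z, s, 0]) = f (vector [z, -s, 0])"
      using inv'[of pi "vector [z,s,0]"] by (simp add: rot_e1_axis)
    then show ?thesis using ab(2)[OF that] ab(2)[of "-s" z] that by simp
  qed
  show ?thesis
  proof (intro exI[of _ a] conjI ab allI impI)
    fix x :: "real^3" assume "norm x = 1"
    then have x: "(x$1)\<^sup>2 + (x$2)\<^sup>2 + (x$3)\<^sup>2 = 1"
      by (simp add: norm_eq_1 inner_vec_def sum_3 power2_eq_square)
    define s where "s = sqrt ((x$2)\<^sup>2 + (x$3)\<^sup>2)"
    have s2: "s\<^sup>2 = 1 - (x$1)\<^sup>2" using x by (simp add: s_def)
    obtain \<alpha> where al: "x$2 = s * cos \<alpha>" "x$3 = s * sin \<alpha>"
      unfolding s_def by (metis Re_complex_of_real complex.sel cmod_def rcis_cmod_Arg Re_rcis Im_rcis)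
    have sc: "cos \<alpha> * (s * cos \<alpha>) + sin \<alpha> * (s * sin \<alpha>) = s"
      using sin_cos_squared_add2[of \<alpha>] by algebra
    have "rot (erot e1 (-\<alpha>)) x = vector [x$1, s, 0]"
      by (simp only: rot_e1_axis al) (simp add: vec_eq_iff forall_3 sc)
    then have "f x = f (vector [x$1, s, 0])" using inv'[of "-\<alpha>" x] by simp
    then show "f x = poly a (x$1)" using 1[OF s2] by simp
  qed
qed

text \<open>By Archimedes this is the mean of \<open>p\<close> over \<open>[-1, 1]\<close>; \<open>zmean_pderiv\<close> derives this from rotation
  invariance alone.\<close>

definition zmean :: "real poly \<Rightarrow> real" where "zmean p = (\<integral>x. poly p (x$1) \<partial>sph)"

lemma cont_poly1 [continuous_intros]: "continuous_on S (\<lambda>x::real^3. poly p (x$1))"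
  by (intro continuous_intros)

lemma zmean_add: "zmean (p + q) = zmean p + zmean q"
  unfolding zmean_def poly_add by (intro Bochner_Integration.integral_add int_sph continuous_intros)
lemma zmean_smult: "zmean (smult c p) = c * zmean p" by (simp add: zmean_def)
lemma zmean_const: "zmean [:c:] = c" using prob_space.prob_space[OF prob_sph] by (simp add: zmean_def)

definition unif01 :: "real measure" where "unif01 = uniform_measure lborel {0..1}"

lemma cpt_prob_unif01: "cpt_prob unif01"
  unfolding cpt_prob_def
proof (intro conjI exI[of _ "{0..1}"])
  show "prob_space unif01" unfolding unif01_def by (intro prob_space_uniform_measure) auto
  show "AE x in unif01. x \<in> {0..1}" unfolding unif01_def by (intro AE_uniform_measureI) auto
qed (auto simp: unif01_def)

lemma unif01_FTC:
  fixes F f :: "real \<Rightarrow> real"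
  assumes "\<And>x. (F has_real_derivative f x) (at x)" "cont f"
  shows "(\<integral>x. f x \<partial>unif01) = F 1 - F 0"
proof -
  have "(\<integral>x. f x \<partial>unif01) = (\<integral>x. indicator {0..1} x * f x \<partial>lborel)"
  proof -
    have "unif01 = density lborel (\<lambda>x. ennreal (indicator {0..1} x))"
      unfolding unif01_def uniform_measure_def
      by (intro arg_cong[where f = "density lborel"]) (auto simp: fun_eq_iff indicator_def)
    then show ?thesis
      using integral_density[of f lborel "indicator {0..1}"] cont_borel[OF assms(2)] by simp
  qed
  also have "\<dots> = (\<integral>x. f x * indicator {0..1} x \<partial>lborel)" by (simp add: mult.commute)
  also have "\<dots> = F 1 - F 0"
    by (rule integral_FTC_Icc_real) (use assms in \<open>auto simp: continuous_on_eq_continuous_at\<close>)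
  finally show ?thesis .
qed

text \<open>The integral over the sphere of a derivative along a rotation flow vanishes. Apply this to the rotation
  about the third axis and the function \<open>x$2 * poly p (x$1)\<close>, and use that \<open>(x$2)\<^sup>2\<close> and \<open>(x$3)\<^sup>2\<close> have the
  same mean against functions of \<open>x$1\<close>.\<close>

lemma zmean_by_parts: "zmean (pderiv ([:1,0,-1:] * p)) = 0"
proof -
  define G where "G x = x$1 * poly p (x$1) - (x$2)\<^sup>2 * poly (pderiv p) (x$1)" for x :: "real^3"
  define g where "g x = x$2 * poly p (x$1)" for x :: "real^3"
  define R where "R s = rot (erot (axis 3 1) s)" for s
  have n3: "norm (axis 3 1 :: real^3) = 1" by (simp add: norm_axis_1)
  have R: "R s x = vector [cos s * x$1 - sin s * x$2, sin s * x$1 + cos s * x$2, x$3]" for s x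
    unfolding R_def rot_erot[OF n3] by (simp add: comp3 axis_def algebra_simps)
  have contG: "cont G" "cont g" unfolding G_def g_def by (intro continuous_intros)+
  have contR: "cont (\<lambda>(s, x). R s x)"
    unfolding R_def erot_def case_prod_beta by (intro continuous_intros) auto
  have contGR: "cont (\<lambda>(s, x). G (R s x))"
    using cont_comp[OF contG(1) contR] by (simp add: case_prod_beta)
  have inv: "(\<integral>x. h (R s x) \<partial>sph) = (\<integral>x. h x \<partial>sph)" if "cont h" for h :: "real^3 \<Rightarrow> real" and s
    unfolding R_def by (rule sph_rot) (use that n3 in auto)
  have FTC: "(\<integral>s. G (R s x) \<partial>unif01) = g (R 1 x) - g x" for x
  proof -
    have "((\<lambda>s. g (R s x)) has_real_derivative G (R s x)) (at s)" for s
    proof -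
      have "((\<lambda>s. (sin s * x$1 + cos s * x$2) * poly p (cos s * x$1 - sin s * x$2)) has_real_derivative
          (cos s * x$1 - sin s * x$2) * poly p (cos s * x$1 - sin s * x$2) +
          (sin s * x$1 + cos s * x$2) * (poly (pderiv p) (cos s * x$1 - sin s * x$2) * (- sin s * x$1 - cos s * x$2))) (at s)"
        by (rule derivative_eq_intros DERIV_chain2[where f = "poly p"] poly_DERIV refl | simp)+
      then show ?thesis by (simp add: g_def G_def R algebra_simps power2_eq_square)
    qed
    moreover have "cont (\<lambda>s. G (R s x))"
      using continuous_on_compose2[OF contGR, of UNIV "\<lambda>s. (s,x)"] by (simp add: continuous_intros)
    ultimately have "(\<integral>s. G (R s x) \<partial>unif01) = g (R 1 x) - g (R 0 x)" by (rule unif01_FTC)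
    also have "R 0 x = x" by (simp add: R vec_eq_iff forall_3)
    finally show ?thesis .
  qed
  have "(\<integral>s. (\<integral>x. G (R s x) \<partial>sph) \<partial>unif01) = (\<integral>x. (\<integral>s. G (R s x) \<partial>unif01) \<partial>sph)"
    by (rule cpt_prob_fubini[OF cpt_prob_unif01 cpt_prob_sph contGR])
  also have "\<dots> = (\<integral>x. g (R 1 x) \<partial>sph) - (\<integral>x. g x \<partial>sph)"
    unfolding FTC by (intro Bochner_Integration.integral_diff int_sph contG)
      (unfold R_def, intro cont_comp[OF contG(2)] continuous_intros)
  also have "\<dots> = 0" using inv[OF contG(2)] by simp
  finally have "(\<integral>s. (\<integral>x. G x \<partial>sph) \<partial>unif01) = 0" using inv[OF contG(1)] by simp
  then have G0: "(\<integral>x. G x \<partial>sph) = 0"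
    using prob_space.prob_space[of unif01] cpt_prob_unif01 by (simp add: cpt_prob_def)
  define A where "A i = (\<integral>x. (x$i)\<^sup>2 * poly (pderiv p) (x$1) \<partial>sph)" for i
  have iA: "integrable sph (\<lambda>x. (x$i)\<^sup>2 * poly (pderiv p) (x$1))" for i
    by (intro int_sph continuous_intros)
  have A2: "zmean ([:0,1:] * p) = A 2"
  proof -
    have "0 = (\<integral>x. x$1 * poly p (x$1) \<partial>sph) - A 2"
      unfolding A_def using G0 unfolding G_def
      by (subst (asm) Bochner_Integration.integral_diff) (auto intro!: int_sph continuous_intros)
    then show ?thesis by (simp add: zmean_def)
  qed
  have A23: "A 2 = A 3"
  proof -
    have "(\<integral>x. ((rot (erot e1 (pi/2)) x)$3)\<^sup>2 * poly (pderiv p) ((rot (erot e1 (pi/2)) x)$1) \<partial>sph) = A 3"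
      unfolding A_def by (rule sph_rot[of _ "\<lambda>x. (x$3)\<^sup>2 * poly (pderiv p) (x$1)"]) (auto intro!: continuous_intros)
    then show ?thesis by (simp add: rot_e1_axis A_def)
  qed
  have "A 2 + A 3 = (\<integral>x. (x$2)\<^sup>2 * poly (pderiv p) (x$1) + (x$3)\<^sup>2 * poly (pderiv p) (x$1) \<partial>sph)"
    unfolding A_def by (intro Bochner_Integration.integral_add[symmetric] iA)
  also have "\<dots> = zmean ([:1,0,-1:] * pderiv p)"
    unfolding zmean_def
  proof (intro integral_cong_AE)
    show "AE x in sph. (x$2)\<^sup>2 * poly (pderiv p) (x$1) + (x$3)\<^sup>2 * poly (pderiv p) (x$1) = poly ([:1,0,-1:] * pderiv p) (x$1)"
      using AE_sph_norm
    proof eventually_elim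
      case (elim x)
      then have "(x$2)\<^sup>2 + (x$3)\<^sup>2 = 1 - (x$1)\<^sup>2"
        by (simp add: norm_eq_1 inner_vec_def sum_3 power2_eq_square)
      then have "((x$2)\<^sup>2 + (x$3)\<^sup>2) * poly (pderiv p) (x$1) = (1 - (x$1)\<^sup>2) * poly (pderiv p) (x$1)" by simp
      then show ?case by (simp add: algebra_simps power2_eq_square)
    qed
  qed (simp_all only: measurable_cong_sets[OF sets_sph refl], (intro cont_borel continuous_intros)+)
  finally have "2 * zmean ([:0,1:] * p) = zmean ([:1,0,-1:] * pderiv p)" using A2 A23 by simp
  moreover have "pderiv ([:1,0,-1:] * p) = [:1,0,-1:] * pderiv p + smult (-2) ([:0,1:] * p)"
  proof -
    have "pderiv [:1,0,-1::real:] = [:0,-2:]" by (simp add: pderiv_pCons)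
    moreover have "p * [:0,-2:] = smult (-2) ([:0,1:] * p)" by simp
    ultimately show ?thesis unfolding pderiv_mult by simp
  qed
  ultimately show ?thesis by (simp only: zmean_add zmean_smult)
qed

lemma zmean_pderiv: "zmean (pderiv q) = (poly q 1 - poly q (-1)) / 2"
proof -
  define m where "m = ([:1,0,-1:] :: real poly)"
  have m: "m \<noteq> 0" "degree m = 2" by (simp_all add: m_def)
  have "degree (q mod m) < 2 \<or> q mod m = 0" using degree_mod_less[OF m(1), of q] m(2) by auto
  then have "degree (q mod m) \<le> 1" by auto
  then have "q mod m = [:coeff (q mod m) 0, coeff (q mod m) 1:]"
    by (intro poly_eqI) (auto simp: coeff_pCons coeff_eq_0 split: nat.split)
  then obtain a b where ab: "q mod m = [:a, b:]" by blast
  have q: "q = m * (q div m) + [:a,b:]" using ab by (metis mult_div_mod_eq)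
  have "zmean (pderiv q) = zmean (pderiv (m * (q div m))) + zmean [:b:]"
    by (subst q) (simp add: pderiv_add zmean_add pderiv_pCons)
  also have "\<dots> = b" unfolding m_def by (simp only: zmean_by_parts zmean_const)
  also have "b = (poly q 1 - poly q (-1)) / 2" by (subst q, subst q) (simp add: m_def)
  finally show ?thesis .
qed

lemma ex_antiderivative: "\<exists>Q. pderiv Q = (p :: real poly)"
proof
  show "pderiv (\<Sum>i\<le>degree p. monom (coeff p i / (real i + 1)) (Suc i)) = p"
    by (subst (2) poly_as_sum_of_monoms[of p, symmetric])
      (simp add: higher_pderiv_sum[of 1, simplified] pderiv_monom add.commute)
qed

text \<open>An antiderivative of the nonnegative polynomial \<open>(1 - z) p(z)\<^sup>2\<close> is monotone on \<open>[-1, 1]\<close> and has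
  equal values at the end points, hence is constant.\<close>

lemma zmean_square_eq_0:
  assumes "zmean ([:1,-1:] * (p * p)) = 0" shows "p = 0"
proof -
  obtain Q where Q: "pderiv Q = [:1,-1:] * (p * p)" using ex_antiderivative by blast
  have Q1: "poly Q 1 = poly Q (-1)" using zmean_pderiv[of Q] assms Q by simp
  have mono: "poly Q x \<le> poly Q y" if "-1 \<le> x" "x \<le> y" "y \<le> 1" for x y
  proof (rule DERIV_nonneg_imp_nondecreasing[OF that(2)])
    fix u assume u: "x \<le> u" "u \<le> y"
    have "poly (pderiv Q) u = (1 - u) * (poly p u)\<^sup>2" by (simp add: Q algebra_simps power2_eq_square)
    then have "0 \<le> poly (pderiv Q) u" using u that by simp
    then show "\<exists>z. (poly Q has_real_derivative z) (at u) \<and> 0 \<le> z" using poly_DERIV by blast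
  qed
  have root: "poly (Q - [:poly Q 1:]) x = 0" if "-1 \<le> x" "x \<le> 1" for x
    using mono[of "-1" x] mono[of x 1] that Q1 by simp
  have sub: "{-1..1} \<subseteq> {x. poly (Q - [:poly Q 1:]) x = 0}"
  proof
    fix x :: real assume "x \<in> {-1..1}"
    then show "x \<in> {x. poly (Q - [:poly Q 1:]) x = 0}"
      unfolding mem_Collect_eq atLeastAtMost_iff by (intro root) simp_all
  qed
  have "infinite {-1..1::real}" by (rule infinite_Icc) simp
  then have "infinite {x. poly (Q - [:poly Q 1:]) x = 0}" using finite_subset[OF sub] by blast
  then have "Q - [:poly Q 1:] = 0" using poly_roots_finite by blast
  then have "pderiv Q = 0" by (metis eq_iff_diff_eq_0 pderiv_singleton)
  then have "[:1,-1:] * (p * p) = 0" unfolding Q .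
  then show ?thesis by (simp only: mult_eq_0_iff) simp
qed

text \<open>Up to scaling, the Legendre polynomial of degree \<open>d\<close>.\<close>

definition zonal :: "nat \<Rightarrow> real poly \<Rightarrow> bool" where
  "zonal d c \<longleftrightarrow> degree c \<le> d \<and> (\<forall>p. degree p < d \<longrightarrow> zmean (c * p) = 0)"

lemma poly_eqI_poly: "(\<And>x. poly p x = poly q x) \<Longrightarrow> p = (q :: real poly)"
  by (metis poly_eq_poly_eq_iff ext)

text \<open>This is the norm of the Legendre polynomial, in the form needed. The polynomial \<open>z c'(z) - d c(z)\<close> has
  degree less than \<open>d\<close> and is therefore orthogonal to \<open>c\<close>, so that integrating the derivative of \<open>z c(z)\<^sup>2\<close>
  gives \<open>(2 d + 1)\<close> times the mean of \<open>c\<^sup>2\<close>.\<close>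

lemma zonal_norm:
  assumes c: "zonal d c" and b: "\<bar>poly c (-1)\<bar> \<le> poly c 1"
  shows "(2 * real d + 1) * zmean (c * c) \<le> (poly c 1)\<^sup>2"
proof -
  \<comment> \<open>The leading terms cancel.\<close>
  define r where "r = [:0,1:] * pderiv c - smult (real d) c"
  have "zmean (c * r) = 0"
  proof (cases "r = 0")
    case True then show ?thesis by (simp add: zmean_def)
  next
    case False
    have co: "coeff r n = (real n - real d) * coeff c n" for n
      by (cases n) (simp_all add: r_def coeff_pderiv algebra_simps)
    have "coeff r (degree r) \<noteq> 0" using False by simp
    then have "coeff c (degree r) \<noteq> 0" "degree r \<noteq> d" unfolding co by auto
    then have "degree r < d" using c le_degree[of c "degree r"] by (auto simp: zonal_def)
    then show ?thesis using c by (auto simp: zonal_def)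
  qed
  have "pderiv ([:0,1:] * (c * c)) = c * c + smult 2 (c * ([:0,1:] * pderiv c))"
    by (rule poly_eqI_poly) (simp add: pderiv_mult pderiv_pCons algebra_simps)
  also have "c * ([:0,1:] * pderiv c) = c * r + smult (real d) (c * c)"
    by (simp add: r_def algebra_simps)
  finally have "zmean (pderiv ([:0,1:] * (c * c))) = (2 * real d + 1) * zmean (c * c)"
    using \<open>zmean (c * r) = 0\<close> by (simp add: zmean_add zmean_smult algebra_simps)
  also have "zmean (pderiv ([:0,1:] * (c * c))) = ((poly c 1)\<^sup>2 + (poly c (-1))\<^sup>2) / 2"
    by (simp add: zmean_pderiv power2_eq_square)
  finally have "(2 * real d + 1) * zmean (c * c) = ((poly c 1)\<^sup>2 + (poly c (-1))\<^sup>2) / 2" by simp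
  moreover have "(poly c (-1))\<^sup>2 \<le> (poly c 1)\<^sup>2" using b by (metis abs_le_square_iff abs_ge_self order_trans)
  ultimately show ?thesis by simp
qed

text \<open>A combination \<open>e\<close> of the two that vanishes at \<open>1\<close> is \<open>(z - 1) g(z)\<close> with \<open>g\<close> of degree less than
  \<open>d\<close>; orthogonality of \<open>e\<close> to \<open>g\<close> forces \<open>g = 0\<close>.\<close>

lemma zonal_unique:
  assumes c: "zonal d c" and c': "zonal d c'"
  shows "smult (poly c 1) c' = smult (poly c' 1) c"
proof -
  define e where "e = smult (poly c 1) c' - smult (poly c' 1) c"
  have "poly e 1 = 0" by (simp add: e_def)
  then obtain g where g: "e = [:-1,1:] * g" by (metis poly_eq_0_iff_dvd dvd_def)
  have e: "degree e \<le> d" unfolding e_def using c c'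
    by (intro degree_diff_le) (auto simp: zonal_def intro: order_trans[OF degree_smult_le])
  have orth: "zmean (e * p) = 0" if "degree p < d" for p
  proof -
    have "e * p = smult (poly c 1) (c' * p) + smult (- poly c' 1) (c * p)"
      by (simp add: e_def algebra_simps)
    then have "zmean (e * p) = poly c 1 * zmean (c' * p) + (- poly c' 1) * zmean (c * p)"
      by (simp only: zmean_add zmean_smult)
    then show ?thesis using c c' that by (simp add: zonal_def)
  qed
  have "g = 0"
  proof (rule ccontr)
    assume g0: "g \<noteq> 0"
    then have "degree e = Suc (degree g)" unfolding g by (subst degree_mult_eq) auto
    then have "zmean (e * g) = 0" using e by (intro orth) simp
    moreover have "[:1,-1:] * (g * g) = smult (-1) (e * g)" by (simp add: g algebra_simps)
    ultimately have "zmean ([:1,-1:] * (g * g)) = 0" by (simp only: zmean_smult)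
    then show False using g0 zmean_square_eq_0 by blast
  qed
  then show ?thesis using g by (simp add: e_def)
qed

section \<open>Matrix coefficients of spherical harmonics\<close>

text \<open>A rotation invariant kernel; for a spherical harmonic it is a multiple of the reproducing kernel of its
  degree, which is what \<open>kern_conv\<close> expresses.\<close>

definition kern :: "(real^3 \<Rightarrow> real) \<Rightarrow> real^3 \<Rightarrow> real^3 \<Rightarrow> real" where
  "kern f x y = (\<integral>q. f (rot q x) * f (rot q y) \<partial>haar)"

lemma kern_cont: assumes f: "cont f" shows "cont (\<lambda>(x,y). kern f x y)"
  unfolding kern_def case_prod_beta
  by (intro cpt_prob_continuous_integral[OF cpt_prob_haar])
    (auto simp: case_prod_beta intro!: continuous_intros cont_comp[OF f])

lemma kern_cont' [continuous_intros]:
  fixes S :: "'a::topological_space set"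
  assumes "cont f" "continuous_on S g" "continuous_on S h" shows "continuous_on S (\<lambda>x. kern f (g x) (h x))"
  using cont_comp[OF kern_cont[OF assms(1)], of S "\<lambda>x. (g x, h x)"] assms(2,3) by (auto intro!: continuous_intros)

lemma kern_inv: assumes "norm h = 1" "cont f" shows "kern f (rot h x) (rot h y) = kern f x y"
  unfolding kern_def rot_qmult[symmetric]
  by (rule haar_right[OF assms(1), of "\<lambda>q. f (rot q x) * f (rot q y)"])
    (intro cont_borel continuous_intros cont_comp[OF assms(2)])

lemma kern_diag: assumes "norm x = 1" "cont f" shows "kern f x x = ip f f"
  unfolding kern_def ip_def
  by (rule haar_point[OF assms(1), of "\<lambda>x. f x * f x"]) (intro continuous_intros assms)

lemma kern_bound: assumes "norm x = 1" "norm y = 1" "cont f" shows "\<bar>kern f x y\<bar> \<le> ip f f"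
proof -
  have "(kern f x y)\<^sup>2 \<le> kern f x x * kern f y y"
    unfolding kern_def power2_eq_square[of "f _", symmetric]
    by (intro integral_Cauchy_Schwarz int_haar continuous_intros cont_comp[OF assms(3)])
  then have "(kern f x y)\<^sup>2 \<le> (ip f f)\<^sup>2" using assms by (simp add: kern_diag power2_eq_square)
  then show ?thesis by (metis abs_le_square_iff abs_of_nonneg ip_nonneg)
qed

text \<open>The averaged function is a spherical harmonic invariant under the rotations fixing \<open>e1\<close>, and such
  functions are zonal polynomials.\<close>

lemma zonal_harm:
  assumes f: "harm d f" and w: "cont w"
    and inv: "\<And>h q. norm h = 1 \<Longrightarrow> rot h e1 = e1 \<Longrightarrow> w (qmult q h) = w q"
  shows "\<exists>c. zonal d c \<and> (\<forall>x. norm x = 1 \<longrightarrow> (\<integral>q. f (rot q x) * w q \<partial>haar) = poly c (x$1))"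
proof -
  define k where "k x = (\<integral>q. f (rot q x) * w q \<partial>haar)" for x
  note fc = harm_cont[OF f]
  have k: "harm d k" unfolding k_def using f w by (rule harm_haar)
  have kc: "cont k" using k by (rule harm_cont)
  have "k (rot h x) = k x" if h: "norm h = 1" "rot h e1 = e1" for h x
  proof -
    have h': "norm (qcnj h) = 1" "rot (qcnj h) e1 = e1" using h rot_cancel(1)[OF h(1), of e1] by auto
    have ch: "qmult (qmult q h) (qcnj h) = q" for q
      by (simp add: qmult_assoc qmult_qcnj h) (simp add: qmult_def)
    have "k (rot h x) = (\<integral>q. f (rot (qmult q h) x) * w (qmult (qmult q h) (qcnj h)) \<partial>haar)"
      by (simp add: k_def rot_qmult ch)
    also have "\<dots> = (\<integral>q. f (rot q x) * w (qmult q (qcnj h)) \<partial>haar)"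
      by (rule haar_right[OF h(1), of "\<lambda>q. f (rot q x) * w (qmult q (qcnj h))"])
        (intro cont_borel continuous_intros cont_comp[OF fc] cont_comp[OF w])
    also have "\<dots> = k x" by (simp add: k_def inv[OF h'])
    finally show ?thesis .
  qed
  then obtain c where c: "degree c \<le> d" "\<And>x. norm x = 1 \<Longrightarrow> k x = poly c (x$1)"
    using polyd_zonal[of d k] k by (auto simp: harm_def)
  have "zmean (c * p) = 0" if "degree p < d" for p
  proof -
    have "zmean (c * p) = ip k (\<lambda>x. poly p (x$1))"
      unfolding zmean_def ip_def
      by (intro integral_cong_AE)
        (simp_all only: measurable_cong_sets[OF sets_sph refl] poly_mult,
          auto intro!: cont_borel continuous_intros kc eventually_mono[OF AE_sph_norm] simp: c)
    also have "\<dots> = 0" using k that polyd_poly[of p "degree p"] by (auto simp: harm_def)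
    finally show ?thesis .
  qed
  then show ?thesis using c unfolding k_def zonal_def by blast
qed

lemma sph_fubini:
  fixes f :: "real^3 \<Rightarrow> real^3 \<Rightarrow> real"
  shows "cont (\<lambda>(x,y). f x y) \<Longrightarrow> (\<integral>x. (\<integral>y. f x y \<partial>sph) \<partial>sph) = (\<integral>y. (\<integral>x. f x y \<partial>sph) \<partial>sph)"
  by (rule cpt_prob_fubini[OF cpt_prob_sph cpt_prob_sph])

text \<open>Both the kernel and its square under convolution are zonal of the same degree in each variable, and zonal
  polynomials are unique up to a factor. The factor is estimated by \<open>zonal_norm\<close>; this is where the dimension
  \<open>2 * d + 1\<close> of the space of spherical harmonics enters.\<close>

lemma kern_conv:
  assumes f: "harm d f"
  shows "\<exists>K\<ge>0. (2 * real d + 1) * K \<le> (ip f f)\<^sup>2 \<and>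
    (\<forall>y w. norm y = 1 \<longrightarrow> norm w = 1 \<longrightarrow> ip f f * (\<integral>x. kern f x y * kern f x w \<partial>sph) = K * kern f y w)"
proof -
  note fc = harm_cont[OF f]
  define C where "C x = kern f x e1" for x
  have Cc: "cont C" unfolding C_def by (intro continuous_intros fc)
  have "\<exists>c. zonal d c \<and> (\<forall>x. norm x = 1 \<longrightarrow> (\<integral>q. f (rot q x) * f (rot q e1) \<partial>haar) = poly c (x$1))"
    by (rule zonal_harm[OF f]) (auto simp: rot_qmult intro!: cont_comp[OF fc] continuous_intros)
  then obtain c where c: "zonal d c" "\<And>x. norm x = 1 \<Longrightarrow> C x = poly c (x$1)"
    unfolding C_def kern_def by blast
  have "\<exists>c. zonal d c \<and> (\<forall>x. norm x = 1 \<longrightarrow> (\<integral>q. f (rot q x) * (\<integral>y. f (rot q y) * C y \<partial>sph) \<partial>haar) = poly c (x$1))"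
  proof (rule zonal_harm[OF f])
    show "cont (\<lambda>q. \<integral>y. f (rot q y) * C y \<partial>sph)"
      by (intro cpt_prob_continuous_integral[OF cpt_prob_sph])
        (auto simp: case_prod_beta intro!: continuous_intros cont_comp[OF fc] cont_comp[OF Cc])
    fix h q assume h: "norm h = 1" "rot h e1 = e1"
    have Ch: "C (rot h y) = C y" for y
      unfolding C_def using kern_inv[OF h(1) fc, of y e1] h by simp
    have "(\<integral>y. f (rot (qmult q h) y) * C y \<partial>sph) = (\<integral>y. f (rot q (rot h y)) * C (rot h y) \<partial>sph)"
      by (simp add: rot_qmult Ch)
    also have "\<dots> = (\<integral>y. f (rot q y) * C y \<partial>sph)"
      by (rule sph_rot[OF h(1), of "\<lambda>y. f (rot q y) * C y"]) (intro continuous_intros cont_comp[OF fc] Cc)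
    finally show "(\<integral>y. f (rot (qmult q h) y) * C y \<partial>sph) = (\<integral>y. f (rot q y) * C y \<partial>sph)" .
  qed
  then obtain c2 where c2: "zonal d c2" "\<And>x. norm x = 1 \<Longrightarrow> (\<integral>q. f (rot q x) * (\<integral>y. f (rot q y) * C y \<partial>sph) \<partial>haar) = poly c2 (x$1)"
    by blast
  have D2: "(\<integral>y. kern f y x * C y \<partial>sph) = poly c2 (x$1)" if "norm x = 1" for x
  proof -
    have "(\<integral>y. kern f y x * C y \<partial>sph) = (\<integral>y. (\<integral>q. f (rot q x) * (f (rot q y) * C y) \<partial>haar) \<partial>sph)"
      by (simp add: kern_def ac_simps flip: integral_mult_right_zero integral_mult_left_zero)
    also have "\<dots> = (\<integral>q. (\<integral>y. f (rot q x) * (f (rot q y) * C y) \<partial>sph) \<partial>haar)"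
      by (intro fubini_haar_sph[symmetric])
        (auto simp: case_prod_beta intro!: continuous_intros cont_comp[OF fc] cont_comp[OF Cc])
    also have "\<dots> = poly c2 (x$1)" using c2(2)[OF that] by simp
    finally show ?thesis .
  qed
  have e11: "e1 $ 1 = (1::real)" by (simp add: axis_def)
  have ce1: "poly c 1 = ip f f" using c(2)[of e1] kern_diag[OF norm_e1 fc] by (simp add: C_def e11)
  have cm1: "\<bar>poly c (-1)\<bar> \<le> ip f f"
    using c(2)[of "- e1"] kern_bound[of "- e1" e1 f] fc by (simp add: C_def e11)
  define K where "K = zmean (c * c)"
  have K: "K = (\<integral>y. C y * C y \<partial>sph)"
    unfolding K_def zmean_def
    by (intro integral_cong_AE)
      (simp_all only: measurable_cong_sets[OF sets_sph refl] poly_mult,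
        auto intro!: cont_borel continuous_intros Cc eventually_mono[OF AE_sph_norm] simp: c)
  have K0: "0 \<le> K" unfolding K by (intro integral_nonneg_AE) auto
  have c2e: "poly c2 1 = K" using D2[of e1] by (simp add: K e11 C_def)
  have base: "ip f f * (\<integral>x. kern f x y * kern f x e1 \<partial>sph) = K * kern f y e1" if "norm y = 1" for y
  proof -
    have "ip f f * poly c2 (y$1) = K * poly c (y$1)"
      using arg_cong[OF zonal_unique[OF c(1) c2(1)], of "\<lambda>p. poly p (y$1)"] by (simp add: ce1 c2e)
    then show ?thesis using D2[OF that] c(2)[OF that] by (simp add: C_def)
  qed
  show ?thesis
  proof (intro exI[of _ K] conjI K0 allI impI)
    show "(2 * real d + 1) * K \<le> (ip f f)\<^sup>2"
      unfolding K_def ce1[symmetric] by (rule zonal_norm[OF c(1)]) (use cm1 ce1 in simp)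
    fix y w :: "real^3" assume y: "norm y = 1" and w: "norm w = 1"
    obtain h where h: "norm h = 1" "rot h e1 = w" using rot_transitive[OF w] by blast
    define y' where "y' = rot (qcnj h) y"
    have yy: "y = rot h y'" "norm y' = 1" using h y by (simp_all add: y'_def)
    have "(\<integral>x. kern f x y * kern f x w \<partial>sph) = (\<integral>x. kern f (rot h x) y * kern f (rot h x) w \<partial>sph)"
      by (rule sph_rot[OF h(1), of "\<lambda>x. kern f x y * kern f x w", symmetric]) (intro continuous_intros fc)
    also have "\<dots> = (\<integral>x. kern f x y' * kern f x e1 \<partial>sph)"
      unfolding yy(1) h(2)[symmetric] by (simp add: kern_inv[OF h(1) fc])
    finally have "ip f f * (\<integral>x. kern f x y * kern f x w \<partial>sph) = K * kern f y' e1" using base[OF yy(2)] by simp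
    also have "kern f y' e1 = kern f y w" unfolding yy(1) h(2)[symmetric] by (simp add: kern_inv[OF h(1) fc])
    finally show "ip f f * (\<integral>x. kern f x y * kern f x w \<partial>sph) = K * kern f y w" .
  qed
qed

text \<open>The Schur orthogonality relations, as an upper bound. The left hand side \<open>z\<close> is the inner product of \<open>g\<close> with
  \<open>Z\<close>, the image of \<open>g\<close> under the kernel of \<open>f\<close>. As the kernel is proportional to its square, the norm of
  \<open>Z\<close> is again a multiple of \<open>z\<close>, and the Cauchy-Schwarz inequality for \<open>g\<close> and \<open>Z\<close> bounds \<open>z\<close>.\<close>

lemma matrix_coefficient_norm:
  assumes f: "harm d f" and g: "cont g"
  shows "(\<integral>q. (ip g (\<lambda>x. f (rot q x)))\<^sup>2 \<partial>haar) \<le> ip f f * ip g g / (2 * real d + 1)"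
proof -
  note fc = harm_cont[OF f]
  define F where "F q = ip g (\<lambda>x. f (rot q x))" for q
  have Fc: "cont F" unfolding F_def ip_def
    by (intro cpt_prob_continuous_integral[OF cpt_prob_sph])
      (auto simp: case_prod_beta intro!: continuous_intros cont_comp[OF fc] cont_comp[OF g])
  define Z where "Z x = (\<integral>y. kern f x y * g y \<partial>sph)" for x
  have Zc: "cont Z" unfolding Z_def
    by (intro cpt_prob_continuous_integral[OF cpt_prob_sph])
      (auto simp: case_prod_beta intro!: continuous_intros fc cont_comp[OF g])
  have FZ: "(\<integral>q. f (rot q x) * F q \<partial>haar) = Z x" for x
  proof -
    have "(\<integral>q. f (rot q x) * F q \<partial>haar) = (\<integral>q. (\<integral>y. f (rot q x) * (g y * f (rot q y)) \<partial>sph) \<partial>haar)"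
      by (simp add: F_def ip_def)
    also have "\<dots> = (\<integral>y. (\<integral>q. f (rot q x) * (g y * f (rot q y)) \<partial>haar) \<partial>sph)"
      by (intro fubini_haar_sph) (auto simp: case_prod_beta intro!: continuous_intros cont_comp[OF fc] cont_comp[OF g])
    also have "\<dots> = Z x"
      by (simp add: Z_def kern_def ac_simps flip: integral_mult_right_zero integral_mult_left_zero)
    finally show ?thesis .
  qed
  define z where "z = (\<integral>q. (F q)\<^sup>2 \<partial>haar)"
  have z0: "0 \<le> z" unfolding z_def by (intro integral_nonneg_AE) auto
  have zi: "z = ip g Z"
  proof -
    have "z = (\<integral>q. (\<integral>x. g x * f (rot q x) * F q \<partial>sph) \<partial>haar)"
      by (simp add: z_def F_def ip_def power2_eq_square)
    also have "\<dots> = (\<integral>x. (\<integral>q. g x * f (rot q x) * F q \<partial>haar) \<partial>sph)"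
      by (intro fubini_haar_sph) (auto simp: case_prod_beta intro!: continuous_intros cont_comp[OF fc] cont_comp[OF g] cont_comp[OF Fc])
    also have "\<dots> = ip g Z" by (simp add: ip_def mult.assoc FZ)
    finally show ?thesis .
  qed
  define s where "s = ip f f"
  show ?thesis
  proof (cases "s = 0")
    case True
    have "F q = 0" if "norm q = 1" for q
      using ip_CS[of g "\<lambda>x. f (rot q x)"] ip_rot[OF that fc fc] True g
      by (simp add: F_def s_def cont_comp[OF fc] continuous_intros)
    then have "AE q in haar. (F q)\<^sup>2 = 0" using AE_haar_norm by (auto elim!: eventually_mono)
    then have "z = 0" unfolding z_def
      by (subst integral_cong_AE[where g = "\<lambda>_. 0"])
        (auto simp only: measurable_cong_sets[OF sets_haar refl] intro!: cont_borel continuous_intros Fc, simp_all)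
    then show ?thesis using True by (simp add: z_def F_def s_def)
  next
    case False
    then have s: "s > 0" by (simp add: s_def order_less_le)
    obtain K where K: "0 \<le> K" "(2 * real d + 1) * K \<le> s\<^sup>2"
      "\<And>y w. norm y = 1 \<Longrightarrow> norm w = 1 \<Longrightarrow> (\<integral>x. kern f x y * kern f x w \<partial>sph) = K / s * kern f y w"
      using kern_conv[OF f] s unfolding s_def[symmetric] by (auto simp: field_simps)
    have kZ: "(\<integral>x. kern f x y * Z x \<partial>sph) = K / s * Z y" if y: "norm y = 1" for y
    proof -
      have "(\<integral>x. kern f x y * Z x \<partial>sph) = (\<integral>x. (\<integral>w. kern f x y * (kern f x w * g w) \<partial>sph) \<partial>sph)"
        by (simp add: Z_def)
      also have "\<dots> = (\<integral>w. (\<integral>x. kern f x y * (kern f x w * g w) \<partial>sph) \<partial>sph)"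
        by (intro sph_fubini) (auto simp: case_prod_beta intro!: continuous_intros fc cont_comp[OF g])
      also have "\<dots> = (\<integral>w. g w * (\<integral>x. kern f x y * kern f x w \<partial>sph) \<partial>sph)"
        by (simp add: ac_simps flip: integral_mult_right_zero)
      also have "\<dots> = (\<integral>w. g w * (K / s * kern f y w) \<partial>sph)"
      proof (intro integral_cong_AE)
        show "AE w in sph. g w * (\<integral>x. kern f x y * kern f x w \<partial>sph) = g w * (K / s * kern f y w)"
          using AE_sph_norm by eventually_elim (simp add: K(3)[OF y])
        have "cont (\<lambda>w. \<integral>x. kern f x y * kern f x w \<partial>sph)"
          by (intro cpt_prob_continuous_integral[OF cpt_prob_sph])
            (auto simp: case_prod_beta intro!: continuous_intros fc)
        then show "(\<lambda>w. g w * (\<integral>x. kern f x y * kern f x w \<partial>sph)) \<in> borel_measurable sph"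
          by (simp only: measurable_cong_sets[OF sets_sph refl]) (intro cont_borel continuous_intros g)
        show "(\<lambda>w. g w * (K / s * kern f y w)) \<in> borel_measurable sph"
          by (simp only: measurable_cong_sets[OF sets_sph refl]) (intro cont_borel continuous_intros g fc)
      qed
      also have "\<dots> = K / s * Z y"
        by (simp add: Z_def ac_simps flip: integral_mult_right_zero)
      finally show ?thesis .
    qed
    have "ip Z Z = (\<integral>x. (\<integral>y. Z x * (kern f x y * g y) \<partial>sph) \<partial>sph)"
      by (simp add: ip_def Z_def)
    also have "\<dots> = (\<integral>y. (\<integral>x. Z x * (kern f x y * g y) \<partial>sph) \<partial>sph)"
      by (intro sph_fubini) (auto simp: case_prod_beta intro!: continuous_intros fc cont_comp[OF g] cont_comp[OF Zc])
    also have "\<dots> = (\<integral>y. g y * (\<integral>x. kern f x y * Z x \<partial>sph) \<partial>sph)"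
      by (simp add: ac_simps flip: integral_mult_right_zero)
    also have "\<dots> = (\<integral>y. g y * (K / s * Z y) \<partial>sph)"
    proof (intro integral_cong_AE)
      show "AE y in sph. g y * (\<integral>x. kern f x y * Z x \<partial>sph) = g y * (K / s * Z y)"
        using AE_sph_norm by eventually_elim (simp add: kZ)
      have "cont (\<lambda>y. \<integral>x. kern f x y * Z x \<partial>sph)"
        by (intro cpt_prob_continuous_integral[OF cpt_prob_sph])
          (auto simp: case_prod_beta intro!: continuous_intros fc cont_comp[OF Zc])
      then show "(\<lambda>y. g y * (\<integral>x. kern f x y * Z x \<partial>sph)) \<in> borel_measurable sph"
        by (simp only: measurable_cong_sets[OF sets_sph refl]) (intro cont_borel continuous_intros g)
      show "(\<lambda>y. g y * (K / s * Z y)) \<in> borel_measurable sph"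
        by (simp only: measurable_cong_sets[OF sets_sph refl]) (intro cont_borel continuous_intros g Zc)
    qed
    also have "\<dots> = K / s * z" unfolding zi ip_def
      by (simp add: ac_simps flip: integral_mult_right_zero)
    finally have ZZ: "ip Z Z = K / s * z" .
    have "z\<^sup>2 \<le> ip g g * (K / s * z)" using ip_CS[OF g Zc] ZZ zi by simp
    then have "z * z \<le> (ip g g * (K / s)) * z" by (simp only: power2_eq_square mult.assoc)
    moreover have "0 \<le> ip g g * (K / s)" using s K(1) by simp
    ultimately have "z \<le> ip g g * (K / s)"
      using z0 mult_right_le_imp_le[of z z "ip g g * (K / s)"] by linarith
    moreover have "ip g g * (K / s) \<le> ip g g * (s / (2 * real d + 1))"
    proof (rule mult_left_mono)
      have "K \<le> s * s / (2 * real d + 1)" using K(2) by (simp add: pos_le_divide_eq power2_eq_square mult.commute)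
      then show "K / s \<le> s / (2 * real d + 1)" using s by (simp add: pos_divide_le_eq mult.commute)
    qed simp
    ultimately have "z \<le> s * ip g g / (2 * real d + 1)" by (simp add: mult.commute)
    then show ?thesis unfolding z_def F_def s_def .
  qed
qed

section \<open>Differences of polynomial functions under rotations\<close>

text \<open>Along a circle of rotations a polynomial function of degree \<open>d\<close> is a trigonometric polynomial of degree
  \<open>d\<close>.\<close>

lemma polyd_circle:
  assumes "polyd d f" "norm u = 1"
  shows "\<exists>p :: complex poly. degree p \<le> 2 * d \<and>
    (\<forall>\<phi>. complex_of_real (f (rot (erot u \<phi>) x)) = cis (- (real d * \<phi>)) * poly p (cis \<phi>))"
  using assms(1)
proof (induction rule: polyd.induct)
  case (polyd_const d c)
  have "cis (- (real d * \<phi>)) * cis \<phi> ^ d = 1" for \<phi> by (simp add: Complex.DeMoivre cis_mult)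
  then show ?case
    by (intro exI[of _ "monom (complex_of_real c) d"]) (auto simp: degree_monom_eq poly_monom ac_simps degree_monom_le order_trans[OF degree_monom_le])
next
  case (polyd_add d f g)
  then obtain p p' where p: "degree p \<le> 2 * d" "\<And>\<phi>. complex_of_real (f (rot (erot u \<phi>) x)) = cis (- (real d * \<phi>)) * poly p (cis \<phi>)"
    "degree p' \<le> 2 * d" "\<And>\<phi>. complex_of_real (g (rot (erot u \<phi>) x)) = cis (- (real d * \<phi>)) * poly p' (cis \<phi>)" by blast
  then show ?case
    by (intro exI[of _ "p + p'"]) (auto simp: degree_add_le algebra_simps)
next
  case (polyd_mult d f v)
  then obtain p where p: "degree p \<le> 2 * d" "\<And>\<phi>. complex_of_real (f (rot (erot u \<phi>) x)) = cis (- (real d * \<phi>)) * poly p (cis \<phi>)" by blast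
  define \<gamma> where "\<gamma> = (u \<bullet> x) * (v \<bullet> u)"
  define \<alpha> where "\<alpha> = v \<bullet> x - \<gamma>"
  define \<beta> where "\<beta> = v \<bullet> cross3 u x"
  define s where "s = [:(of_real \<alpha> + \<i> * of_real \<beta>) / 2, of_real \<gamma>, (of_real \<alpha> - \<i> * of_real \<beta>) / 2:]"
  have v: "complex_of_real (v \<bullet> rot (erot u \<phi>) x) = cis (- \<phi>) * poly s (cis \<phi>)" for \<phi>
  proof -
    have "v \<bullet> rot (erot u \<phi>) x = cos \<phi> * \<alpha> + sin \<phi> * \<beta> + \<gamma>"
      unfolding rot_erot[OF assms(2)] by (simp add: \<alpha>_def \<beta>_def \<gamma>_def algebra_simps)
    moreover have "cis (- \<phi>) * poly s (cis \<phi>) = of_real \<gamma> + (of_real \<alpha> + \<i> * of_real \<beta>) / 2 * cis (- \<phi>) + (of_real \<alpha> - \<i> * of_real \<beta>) / 2 * cis \<phi>"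
    proof -
      have c: "cis (- \<phi>) * cis \<phi> = 1" by (simp add: cis_mult)
      have "cis (- \<phi>) * poly s (cis \<phi>) = (of_real \<alpha> + \<i> * of_real \<beta>) / 2 * cis (- \<phi>) + (cis (- \<phi>) * cis \<phi>) * (of_real \<gamma> + (of_real \<alpha> - \<i> * of_real \<beta>) / 2 * cis \<phi>)"
        by (simp add: s_def algebra_simps)
      then show ?thesis unfolding c by simp
    qed
    ultimately show ?thesis by (simp add: complex_eq_iff field_simps)
  qed
  show ?case
  proof (intro exI[of _ "s * p"] conjI allI)
    have "degree s \<le> 2" by (simp add: s_def)
    then show "degree (s * p) \<le> 2 * Suc d" using p(1) degree_mult_le[of s p] by simp
    fix \<phi>
    have "cis (- (real (Suc d) * \<phi>)) = cis (- \<phi>) * cis (- (real d * \<phi>))" by (simp add: cis_mult algebra_simps)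
    then show "complex_of_real ((v \<bullet> rot (erot u \<phi>) x) * f (rot (erot u \<phi>) x)) = cis (- (real (Suc d) * \<phi>)) * poly (s * p) (cis \<phi>)"
      using v[of \<phi>] p(2)[of \<phi>] by simp
  qed
qed

lemma sum_unity_roots:
  assumes "k < N" "l < N"
  shows "(\<Sum>j<N. cis (2 * pi * real j / real N) ^ k * cnj (cis (2 * pi * real j / real N) ^ l)) = (if k = l then of_nat N else 0)"
proof -
  define \<zeta> where "\<zeta> = cis (2 * pi * (real k - real l) / real N)"
  have N: "N > 0" using assms by simp
  have eq: "cis (2 * pi * real j / real N) ^ k * cnj (cis (2 * pi * real j / real N) ^ l) = \<zeta> ^ j" for j
    unfolding \<zeta>_def Complex.DeMoivre cis_cnj cis_mult
    by (rule arg_cong[where f = cis]) (use N in \<open>simp add: field_simps\<close>)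
  show ?thesis
  proof (cases "k = l")
    case True then show ?thesis unfolding eq by (simp add: \<zeta>_def)
  next
    case False
    have "\<zeta> \<noteq> 1"
    proof
      assume "\<zeta> = 1"
      then have "cos (2 * pi * (real k - real l) / real N) = 1" by (simp add: \<zeta>_def complex_eq_iff)
      then obtain n :: int where "2 * pi * (real k - real l) / real N = real_of_int n * 2 * pi"
        using cos_one_2pi_int by blast
      then have "(2 * pi) * (real k - real l) = (2 * pi) * (real_of_int n * real N)" using N by (simp add: field_simps)
      then have "real k - real l = real_of_int n * real N" by (simp only: mult_cancel_left) simp
      then have "int k - int l = n * int N"
        by (metis (mono_tags, opaque_lifting) of_int_diff of_int_eq_iff of_int_mult of_int_of_nat_eq)
      then have "int N dvd int k - int l" by simp
      then show False using assms False zdvd_not_zless[of "\<bar>int k - int l\<bar>" "int N"] by fastforce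
    qed
    moreover have "\<zeta> ^ N = 1"
    proof -
      have "\<zeta> ^ N = cis (2 * pi * (real k - real l))" unfolding \<zeta>_def Complex.DeMoivre
        by (rule arg_cong[where f = cis]) (use N in simp)
      also have "\<dots> = cis (2 * pi * real k) / cis (2 * pi * real l)" by (simp add: cis_divide algebra_simps)
      also have "\<dots> = 1" by (simp add: cis_multiple_2pi)
      finally show ?thesis .
    qed
    ultimately show ?thesis unfolding eq using False by (simp add: geometric_sum)
  qed
qed

lemma discrete_Parseval:
  fixes c :: "nat \<Rightarrow> complex"
  shows "(\<Sum>j<N. (cmod (\<Sum>k<N. c k * cis (2 * pi * real j / real N) ^ k))\<^sup>2) = real N * (\<Sum>k<N. (cmod (c k))\<^sup>2)"
proof -
  define w where "w j = cis (2 * pi * real j / real N)" for j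
  have "complex_of_real (\<Sum>j<N. (cmod (\<Sum>k<N. c k * w j ^ k))\<^sup>2)
      = (\<Sum>j<N. (\<Sum>k<N. c k * w j ^ k) * cnj (\<Sum>l<N. c l * w j ^ l))"
    unfolding of_real_sum by (intro sum.cong refl) (simp only: complex_norm_square)
  also have "\<dots> = (\<Sum>j<N. \<Sum>k<N. \<Sum>l<N. c k * cnj (c l) * (w j ^ k * cnj (w j ^ l)))"
    unfolding cnj_sum complex_cnj_mult sum_product by (intro sum.cong refl) (simp add: ac_simps)
  also have "\<dots> = (\<Sum>k<N. \<Sum>l<N. \<Sum>j<N. c k * cnj (c l) * (w j ^ k * cnj (w j ^ l)))"
  proof -
    have "(\<Sum>j<N. \<Sum>k<N. \<Sum>l<N. c k * cnj (c l) * (w j ^ k * cnj (w j ^ l)))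
       = (\<Sum>k<N. \<Sum>j<N. \<Sum>l<N. c k * cnj (c l) * (w j ^ k * cnj (w j ^ l)))" by (rule sum.swap)
    then show ?thesis by (simp only:) (intro sum.cong refl sum.swap)
  qed
  also have "\<dots> = (\<Sum>k<N. \<Sum>l<N. c k * cnj (c l) * (if k = l then of_nat N else 0))"
    unfolding w_def sum_distrib_left[symmetric] by (intro sum.cong refl) (simp only: sum_unity_roots lessThan_iff)
  also have "\<dots> = (\<Sum>k<N. c k * cnj (c k) * of_nat N)"
    by (intro sum.cong refl) (simp add: if_distrib sum.delta' cong: if_cong)
  also have "\<dots> = complex_of_real (real N * (\<Sum>k<N. (cmod (c k))\<^sup>2))"
    unfolding of_real_mult of_real_sum sum_distrib_left
    by (intro sum.cong refl) (simp only: complex_norm_square of_real_of_nat_eq mult.commute)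
  finally show ?thesis unfolding w_def of_real_eq_iff .
qed

lemma erot_add: "norm u = 1 \<Longrightarrow> erot u (a + b) = qmult (erot u a) (erot u b)"
  by (simp add: erot_def qmult_def add_divide_distrib cos_add sin_add cross_mult_left cross_mult_right dot_square_norm algebra_simps)

text \<open>Along the circles about \<open>u\<close> the function \<open>f\<close> is a trigonometric polynomial, so a comparison of the
  multipliers at each frequency \<open>k\<close> gives a comparison of the norms by Parseval. The circle is
  sampled at \<open>2 * d + 1\<close> equidistant angles, for which the discrete Parseval identity is exact, and
  rotation invariance makes the choice of the base point on the circle irrelevant after integration.\<close>

lemma rotation_difference_bound:
  assumes f: "polyd d f" and u: "norm u = 1" and B: "0 \<le> B" "0 \<le> B'"
    and le: "\<And>k::int. \<bar>k\<bar> \<le> int d \<Longrightarrow>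
      (cmod (cis (of_int k * \<phi>) - 1))\<^sup>2 \<le> B * (cmod (cis (of_int k * \<theta>) - 1))\<^sup>2 + B'"
  shows "(\<integral>x. (f (rot (erot u \<phi>) x) - f x)\<^sup>2 \<partial>sph) \<le>
    B * (\<integral>x. (f (rot (erot u \<theta>) x) - f x)\<^sup>2 \<partial>sph) + B' * (\<integral>x. (f x)\<^sup>2 \<partial>sph)"
proof -
  define N where "N = 2 * d + 1"
  have N: "N > 0" by (simp add: N_def)
  define a where "a j = 2 * pi * real j / real N" for j
  note fc = polyd_cont[OF f]
  define R where "R t = rot (erot u t)" for t
  have Rc: "cont (R t)" for t unfolding R_def by (intro continuous_intros)
  have Radd: "R (s + t) x = R s (R t x)" for s t x by (simp add: R_def erot_add[OF u] rot_qmult)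
  define S where "S t x = (\<Sum>j<N. (f (R t (R (a j) x)) - f (R (a j) x))\<^sup>2)" for t x
  define S0 where "S0 x = (\<Sum>j<N. (f (R (a j) x))\<^sup>2)" for x
  have pw: "S \<phi> x \<le> B * S \<theta> x + B' * S0 x" for x
  proof -
    obtain p where p: "degree p \<le> 2 * d" "\<And>\<phi>. complex_of_real (f (R \<phi> x)) = cis (- (real d * \<phi>)) * poly p (cis \<phi>)"
      using polyd_circle[OF f u, of x] unfolding R_def by blast
    have pp: "poly p z = (\<Sum>k<N. coeff p k * z ^ k)" for z
      unfolding poly_altdef using p(1) 
      by (intro sum.mono_neutral_left) (auto simp: N_def coeff_eq_0)
    have S: "S t x = real N * (\<Sum>k<N. (cmod (coeff p k))\<^sup>2 * (cmod (cis (of_int (int k - int d) * t) - 1))\<^sup>2)" for t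
    proof -
      have eq: "(f (R t (R (a j) x)) - f (R (a j) x))\<^sup>2 = (cmod (\<Sum>k<N. (coeff p k * (cis (of_int (int k - int d) * t) - 1)) * cis (a j) ^ k))\<^sup>2" for j
      proof -
        have "complex_of_real (f (R t (R (a j) x)) - f (R (a j) x)) =
          cis (- (real d * (t + a j))) * poly p (cis (t + a j)) - cis (- (real d * a j)) * poly p (cis (a j))"
          by (simp only: Radd[symmetric] of_real_diff p(2))
        also have "\<dots> = cis (- (real d * a j)) * (\<Sum>k<N. (coeff p k * (cis (of_int (int k - int d) * t) - 1)) * cis (a j) ^ k)"
        proof -
          have e: "cis (- (real d * (t + a j))) * cis (t + a j) ^ k = cis (- (real d * a j)) * (cis (of_int (int k - int d) * t) * cis (a j) ^ k)" for k
            by (simp add: Complex.DeMoivre cis_mult algebra_simps)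
          have "cis (- (real d * (t + a j))) * poly p (cis (t + a j)) = (\<Sum>k<N. coeff p k * (cis (- (real d * (t + a j))) * cis (t + a j) ^ k))"
            unfolding pp sum_distrib_left by (simp add: ac_simps)
          also have "\<dots> = cis (- (real d * a j)) * (\<Sum>k<N. coeff p k * cis (of_int (int k - int d) * t) * cis (a j) ^ k)"
            unfolding e sum_distrib_left by (simp only: ac_simps)
          finally show ?thesis
            unfolding pp right_diff_distrib[symmetric] by (simp add: right_diff_distrib left_diff_distrib sum_subtractf)
        qed
        finally have "cmod (complex_of_real (f (R t (R (a j) x)) - f (R (a j) x))) = cmod (\<Sum>k<N. (coeff p k * (cis (of_int (int k - int d) * t) - 1)) * cis (a j) ^ k)"
          by (simp only: norm_mult norm_cis mult_1)
        then show ?thesis by (metis norm_of_real power2_abs)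
      qed
      have "S t x = (\<Sum>j<N. (cmod (\<Sum>k<N. (coeff p k * (cis (of_int (int k - int d) * t) - 1)) * cis (2 * pi * real j / real N) ^ k))\<^sup>2)"
        by (simp only: S_def eq) (simp only: a_def)
      then show ?thesis unfolding discrete_Parseval norm_mult power_mult_distrib .
    qed
    have S0: "S0 x = real N * (\<Sum>k<N. (cmod (coeff p k))\<^sup>2)"
    proof -
      have eq: "(f (R (a j) x))\<^sup>2 = (cmod (\<Sum>k<N. coeff p k * cis (a j) ^ k))\<^sup>2" for j
      proof -
        have "cmod (complex_of_real (f (R (a j) x))) = cmod (\<Sum>k<N. coeff p k * cis (a j) ^ k)"
          by (simp only: p(2) norm_mult norm_cis mult_1 pp)
        then show ?thesis by (metis norm_of_real power2_abs)
      qed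
      have "S0 x = (\<Sum>j<N. (cmod (\<Sum>k<N. coeff p k * cis (2 * pi * real j / real N) ^ k))\<^sup>2)"
        by (simp only: S0_def eq) (simp only: a_def)
      then show ?thesis unfolding discrete_Parseval .
    qed
    have "(\<Sum>k<N. (cmod (coeff p k))\<^sup>2 * (cmod (cis (of_int (int k - int d) * \<phi>) - 1))\<^sup>2)
      \<le> (\<Sum>k<N. (cmod (coeff p k))\<^sup>2 * (B * (cmod (cis (of_int (int k - int d) * \<theta>) - 1))\<^sup>2 + B'))"
      by (intro sum_mono mult_left_mono le) (auto simp: N_def)
    also have "\<dots> = B * (\<Sum>k<N. (cmod (coeff p k))\<^sup>2 * (cmod (cis (of_int (int k - int d) * \<theta>) - 1))\<^sup>2) + B' * (\<Sum>k<N. (cmod (coeff p k))\<^sup>2)"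
      by (simp add: sum_distrib_left sum.distrib algebra_simps)
    finally have "real N * (\<Sum>k<N. (cmod (coeff p k))\<^sup>2 * (cmod (cis (of_int (int k - int d) * \<phi>) - 1))\<^sup>2) \<le> 
      real N * (B * (\<Sum>k<N. (cmod (coeff p k))\<^sup>2 * (cmod (cis (of_int (int k - int d) * \<theta>) - 1))\<^sup>2) + B' * (\<Sum>k<N. (cmod (coeff p k))\<^sup>2))"
      by (rule mult_left_mono) simp
    then show ?thesis unfolding S S0 by (simp only: distrib_left mult.left_commute[of "real N"])
  qed
  have inv: "(\<integral>x. h (R s x) \<partial>sph) = (\<integral>x. h x \<partial>sph)" if "cont h" for h :: "real^3 \<Rightarrow> real" and s
    unfolding R_def by (rule sph_rot) (use that u in auto)
  have Sc: "cont (S t)" "cont S0" for t unfolding S_def S0_def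
    by (intro continuous_intros cont_comp[OF fc] cont_comp[OF Rc])+
  have IS: "(\<integral>x. S t x \<partial>sph) = real N * (\<integral>x. (f (R t x) - f x)\<^sup>2 \<partial>sph)" for t
  proof -
    have "(\<integral>x. S t x \<partial>sph) = (\<Sum>j<N. (\<integral>x. (f (R t (R (a j) x)) - f (R (a j) x))\<^sup>2 \<partial>sph))"
      unfolding S_def by (intro Bochner_Integration.integral_sum int_sph continuous_intros cont_comp[OF fc] cont_comp[OF Rc])
    also have "\<dots> = (\<Sum>j<N. (\<integral>x. (f (R t x) - f x)\<^sup>2 \<partial>sph))"
      by (intro sum.cong refl inv[of "\<lambda>x. (f (R t x) - f x)\<^sup>2"] continuous_intros cont_comp[OF fc] cont_comp[OF Rc] fc Rc)
    finally show ?thesis by simp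
  qed
  have IS0: "(\<integral>x. S0 x \<partial>sph) = real N * (\<integral>x. (f x)\<^sup>2 \<partial>sph)"
  proof -
    have "(\<integral>x. S0 x \<partial>sph) = (\<Sum>j<N. (\<integral>x. (f (R (a j) x))\<^sup>2 \<partial>sph))"
      unfolding S0_def by (intro Bochner_Integration.integral_sum int_sph continuous_intros cont_comp[OF fc] Rc)
    also have "\<dots> = (\<Sum>j<N. (\<integral>x. (f x)\<^sup>2 \<partial>sph))"
      by (intro sum.cong refl inv[of "\<lambda>x. (f x)\<^sup>2"] continuous_intros fc)
    finally show ?thesis by simp
  qed
  have "(\<integral>x. S \<phi> x \<partial>sph) \<le> (\<integral>x. B * S \<theta> x + B' * S0 x \<partial>sph)"
    by (intro integral_mono int_sph continuous_intros Sc pw)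
  also have "\<dots> = B * (\<integral>x. S \<theta> x \<partial>sph) + B' * (\<integral>x. S0 x \<partial>sph)"
    by (subst Bochner_Integration.integral_add) (auto intro!: int_sph continuous_intros Sc)
  finally have "real N * (\<integral>x. (f (R \<phi> x) - f x)\<^sup>2 \<partial>sph) \<le> real N * (B * (\<integral>x. (f (R \<theta> x) - f x)\<^sup>2 \<partial>sph) + B' * (\<integral>x. (f x)\<^sup>2 \<partial>sph))"
    unfolding IS IS0 by (simp only: distrib_left mult.left_commute[of "real N"])
  then show ?thesis using N by (simp add: R_def)
qed

lemma cmod_cis_diff: "cmod (cis t - 1) \<le> \<bar>t\<bar>"
proof -
  have "(cmod (cis t - 1))\<^sup>2 = 2 - 2 * cos t"
    using sin_cos_squared_add[of t] by (simp add: cmod_power2 power2_diff)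
  also have "\<dots> = (2 * sin (t/2))\<^sup>2" using cos_double_sin[of "t/2"] by (simp add: power_mult_distrib)
  finally have "cmod (cis t - 1) = \<bar>2 * sin (t/2)\<bar>" by (metis abs_norm_cancel real_sqrt_abs)
  also have "\<dots> \<le> \<bar>t\<bar>" using abs_sin_x_le_abs_x[of "t/2"] by (simp add: abs_mult)
  finally show ?thesis .
qed

lemma near_one_erot:
  assumes q: "norm q = 1" and d: "norm (q - (1,0)) \<le> \<delta>" "\<delta> \<le> 1/2"
  shows "\<exists>u \<phi>. norm u = 1 \<and> q = erot u \<phi> \<and> \<bar>\<phi>\<bar> \<le> 4 * \<delta>"
proof -
  define a where "a = fst q"
  define v where "v = snd q"
  have qq: "q = (a, v)" by (simp add: a_def v_def)
  have av: "a\<^sup>2 + (norm v)\<^sup>2 = 1" using q norm_q[of q] by (simp add: qq dot_square_norm)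
  have v: "norm v \<le> \<delta>" using d norm_snd_le[of v "a - 1"] by (simp add: qq)
  have "\<bar>a - 1\<bar> \<le> \<delta>" using d norm_fst_le[of "a - 1" v] by (simp add: qq)
  then have a: "a \<ge> 1/2" using d by linarith
  show ?thesis
  proof (cases "v = 0")
    case True
    then have "a = 1" using av a by (simp add: power2_eq_1_iff)
    then show ?thesis using True v
      using order_trans[OF norm_ge_zero v] by (intro exI[of _ e1] exI[of _ 0]) (auto simp: erot_def qq)
  next
    case False
    define t where "t = norm v / a"
    have "1 + t\<^sup>2 = (1/a)\<^sup>2" using av a by (simp add: t_def field_simps power2_eq_square)
    then have r: "sqrt (1 + t\<^sup>2) = 1 / a" using a by (simp add: real_sqrt_abs)
    have "cos (arctan t) = a" "sin (arctan t) = norm v" using a by (simp_all add: cos_arctan sin_arctan r) (simp add: t_def)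
    then have "q = erot ((1 / norm v) *\<^sub>R v) (2 * arctan t)" using False by (simp add: erot_def qq)
    moreover have "\<bar>2 * arctan t\<bar> \<le> 4 * \<delta>"
    proof -
      have t0: "0 \<le> t" using a by (simp add: t_def)
      have "norm v / a \<le> \<delta> / (1/2)" using v a order_trans[OF norm_ge_zero v] by (intro frac_le) auto
      then have "t \<le> 2 * \<delta>" by (simp add: t_def)
      moreover have "arctan t \<le> t" using t0 by (rule arctan_le_self)
      moreover have "0 \<le> arctan t" using t0 by (simp add: zero_le_arctan_iff)
      ultimately show ?thesis by simp
    qed
    ultimately show ?thesis using False by (intro exI[of _ "(1 / norm v) *\<^sub>R v"] exI[of _ "2 * arctan t"]) simp
  qed
qed

text \<open>Bernstein's inequality on the circle: at frequency \<open>k\<close> a rotation by \<open>\<phi>\<close> changes \<open>f\<close> by a factor of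
  at most \<open>\<bar>k * \<phi>\<bar> \<le> d * \<bar>\<phi>\<bar>\<close>.\<close>

lemma Bernstein_rotation:
  assumes f: "polyd d f" and q: "norm q = 1" "norm (q - (1,0)) \<le> \<delta>" "\<delta> \<le> 1/2"
  shows "(\<integral>x. (f x - f (rot q x))\<^sup>2 \<partial>sph) \<le> (4 * real d * \<delta>)\<^sup>2 * (\<integral>x. (f x)\<^sup>2 \<partial>sph)"
proof -
  obtain u \<phi> where u: "norm u = 1" "q = erot u \<phi>" "\<bar>\<phi>\<bar> \<le> 4 * \<delta>" using near_one_erot[OF q] by blast
  have "(\<integral>x. (f (rot (erot u \<phi>) x) - f x)\<^sup>2 \<partial>sph) \<le>
    0 * (\<integral>x. (f (rot (erot u 0) x) - f x)\<^sup>2 \<partial>sph) + (4 * real d * \<delta>)\<^sup>2 * (\<integral>x. (f x)\<^sup>2 \<partial>sph)"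
  proof (rule rotation_difference_bound[OF f u(1)])
    fix k :: int assume "\<bar>k\<bar> \<le> int d"
    then have k: "\<bar>real_of_int k\<bar> \<le> real d" by linarith
    have "cmod (cis (of_int k * \<phi>) - 1) \<le> \<bar>real_of_int k\<bar> * \<bar>\<phi>\<bar>"
      using cmod_cis_diff[of "of_int k * \<phi>"] by (simp add: abs_mult)
    also have "\<dots> \<le> real d * (4 * \<delta>)" using k u(3) by (intro mult_mono) auto
    finally have "(cmod (cis (of_int k * \<phi>) - 1))\<^sup>2 \<le> (real d * (4 * \<delta>))\<^sup>2" by (intro power_mono) auto
    then show "(cmod (cis (of_int k * \<phi>) - 1))\<^sup>2 \<le> 0 * (cmod (cis (of_int k * 0) - 1))\<^sup>2 + (4 * real d * \<delta>)\<^sup>2"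
      by (simp add: ac_simps)
  qed auto
  then show ?thesis using u by (simp add: power2_commute)
qed

section \<open>Sums of rotations with few close pairs\<close>

lemma ip_sum_right: "finite I \<Longrightarrow> (\<And>i. i \<in> I \<Longrightarrow> cont (f i)) \<Longrightarrow> cont h \<Longrightarrow> ip h (\<lambda>x. \<Sum>i\<in>I. f i x) = (\<Sum>i\<in>I. ip h (f i))"
  using ip_sum[of I f h] by (simp add: ip_commute)

definition cap :: "quaternion \<Rightarrow> real \<Rightarrow> quaternion set" where
  "cap g \<delta> = {q. norm (q - g) \<le> \<delta>}"

lemma cap_borel [measurable]: "cap g \<delta> \<in> sets borel" unfolding cap_def by measurable

lemma cap_right:
  assumes "norm g = 1"
  shows "qmult q g \<in> cap g \<delta> \<longleftrightarrow> q \<in> cap (1,0) \<delta>"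
proof -
  have "qmult q g - g = qmult (q - (1,0)) g" by (simp add: qmult_def comp3 algebra_simps)
  then show ?thesis using assms by (simp add: cap_def norm_qmult)
qed

lemma measure_cap:
  assumes "norm g = 1" shows "measure haar (cap g \<delta>) = measure haar (cap (1,0) \<delta>)"
proof -
  have "(\<integral>q. indicat_real (cap g \<delta>) (qmult q g) \<partial>haar) = (\<integral>q. indicat_real (cap g \<delta>) q \<partial>haar)"
    by (rule haar_right[OF assms]) simp
  moreover have "indicat_real (cap g \<delta>) (qmult q g) = indicat_real (cap (1,0) \<delta>) q" for q
    by (simp add: indicator_def cap_right[OF assms])
  ultimately have "(\<integral>q. indicat_real (cap (1,0) \<delta>) q \<partial>haar) = (\<integral>q. indicat_real (cap g \<delta>) q \<partial>haar)" by (simp only:)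
  then show ?thesis by simp
qed

text \<open>The radius \<open>\<delta>\<close> is so small compared with \<open>1 / d\<close> that by Bernstein's inequality a rotation in the cap of
  radius \<open>\<delta>\<close> moves a harmonic of degree \<open>d\<close> by at most half of its norm.\<close>

locale rotation_sum =
  fixes I :: "'i set" and g :: "'i \<Rightarrow> quaternion" and d :: nat and \<delta> :: real
  assumes fin: "finite I" and g1: "i \<in> I \<Longrightarrow> norm (g i) = 1" and d: "d \<ge> 1" and del: "\<delta> = 1 / (8 * real d)"
begin

definition T :: "(real^3 \<Rightarrow> real) \<Rightarrow> real^3 \<Rightarrow> real" where
  "T f x = (\<Sum>i\<in>I. f (rot (g i) x))"

definition close_pairs :: nat where "close_pairs = card {(i,j) \<in> I \<times> I. norm (g i - g j) \<le> 2 * \<delta>}"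

definition v :: real where "v = measure haar (cap (1,0) \<delta>)"

lemma T_cont: assumes "cont f" shows "cont (T f)"
  unfolding T_def by (intro continuous_intros cont_comp[OF assms])

lemma v_pos: "v > 0"
proof -
  obtain c where c: "c > 0" "\<And>\<delta>. 0 < \<delta> \<Longrightarrow> \<delta> \<le> 1 \<Longrightarrow> c * \<delta> ^ 3 \<le> measure haar {q. norm (q - (1,0)) \<le> \<delta>}"
    using haar_cap by blast
  have "0 < \<delta>" "\<delta> \<le> 1" using d by (simp_all add: del)
  then have "0 < c * \<delta>^3" "c * \<delta>^3 \<le> v" using c by (auto simp: v_def cap_def)
  then show ?thesis by linarith
qed

definition S :: real where "S = sqrt (close_pairs / (v * (2 * real d + 1)))"

text \<open>Smear out: replace \<open>f\<close> by its translates under rotations \<open>q\<close> in a small cap at the identity. The smeared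
  sum is the integral of a matrix coefficient against the sum \<open>W\<close> of the caps about the \<open>g i\<close>; by
  Cauchy-Schwarz, \<open>matrix_coefficient_norm\<close> and the count of overlapping caps it contributes at most \<open>S\<close>. The error is
  the operator applied to a harmonic of at most half the norm, which is bounded by \<open>N / 2\<close>.\<close>

lemma operator_bound_step:
  assumes N: "\<And>f f'. harm d f \<Longrightarrow> harm d f' \<Longrightarrow> \<bar>ip f' (T f)\<bar> \<le> N * sqrt (ip f f) * sqrt (ip f' f')"
    and N0: "N \<ge> 0" and f: "harm d f" and f': "harm d f'"
  shows "\<bar>ip f' (T f)\<bar> \<le> (S + N / 2) * sqrt (ip f f) * sqrt (ip f' f')"
proof -
  note fc = harm_cont[OF f] and fc' = harm_cont[OF f']
  define F where "F q = ip f' (\<lambda>x. f (rot q x))" for q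
  have Fc: "cont F" unfolding F_def ip_def
    by (intro cpt_prob_continuous_integral[OF cpt_prob_sph])
      (auto simp: case_prod_beta intro!: continuous_intros cont_comp[OF fc] cont_comp[OF fc'])
  define W where "W q = (\<Sum>i\<in>I. indicat_real (cap (g i) \<delta>) q)" for q
  have iF: "integrable haar (\<lambda>q. h q * indicat_real (cap a \<delta>) q)" if "cont h" for h a
    using integrable_real_mult_indicator[of "cap a \<delta>" haar h] int_haar[OF that] by simp
  have iP: "integrable haar (\<lambda>q. indicat_real (cap a \<delta>) q * indicat_real (cap b \<delta>) q)" for a b
    using integrable_real_mult_indicator[of "cap b \<delta>" haar "indicat_real (cap a \<delta>)"] iF[of "\<lambda>_. 1" a] by simp
  have TF: "ip f' (T (\<lambda>x. f (rot q x))) = (\<Sum>i\<in>I. F (qmult q (g i)))" for q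
    unfolding T_def F_def rot_qmult by (intro ip_sum_right fin fc' cont_comp[OF fc] continuous_intros)
  have main: "(\<integral>q. (\<Sum>i\<in>I. F (qmult q (g i))) * indicat_real (cap (1,0) \<delta>) q \<partial>haar) = (\<integral>q. F q * W q \<partial>haar)"
  proof -
    have "(\<integral>q. (\<Sum>i\<in>I. F (qmult q (g i))) * indicat_real (cap (1,0) \<delta>) q \<partial>haar)
       = (\<Sum>i\<in>I. (\<integral>q. F (qmult q (g i)) * indicat_real (cap (1,0) \<delta>) q \<partial>haar))"
      unfolding sum_distrib_right by (intro Bochner_Integration.integral_sum iF cont_comp[OF Fc] continuous_intros)
    also have "\<dots> = (\<Sum>i\<in>I. (\<integral>q. F q * indicat_real (cap (g i) \<delta>) q \<partial>haar))"
    proof (intro sum.cong refl)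
      fix i assume i: "i \<in> I"
      have "(\<integral>q. F (qmult q (g i)) * indicat_real (cap (g i) \<delta>) (qmult q (g i)) \<partial>haar) = (\<integral>q. F q * indicat_real (cap (g i) \<delta>) q \<partial>haar)"
        by (rule haar_right[OF g1[OF i], of "\<lambda>q. F q * indicat_real (cap (g i) \<delta>) q"])
          (intro borel_measurable_times cont_borel Fc borel_measurable_indicator cap_borel)
      then show "(\<integral>q. F (qmult q (g i)) * indicat_real (cap (1,0) \<delta>) q \<partial>haar) = (\<integral>q. F q * indicat_real (cap (g i) \<delta>) q \<partial>haar)"
        by (simp add: indicator_def cap_right[OF g1[OF i]])
    qed
    also have "\<dots> = (\<integral>q. F q * W q \<partial>haar)"
      unfolding W_def sum_distrib_left by (intro Bochner_Integration.integral_sum[symmetric] iF Fc)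
    finally show ?thesis .
  qed
  have W2: "(\<integral>q. (W q)\<^sup>2 \<partial>haar) \<le> close_pairs * v"
  proof -
    have "(\<integral>q. (W q)\<^sup>2 \<partial>haar) = (\<Sum>i\<in>I. \<Sum>j\<in>I. (\<integral>q. indicat_real (cap (g i) \<delta>) q * indicat_real (cap (g j) \<delta>) q \<partial>haar))"
      unfolding W_def power2_eq_square sum_product
      by (subst Bochner_Integration.integral_sum) (auto intro!: Bochner_Integration.integrable_sum sum.cong Bochner_Integration.integral_sum iP)
    also have "\<dots> \<le> (\<Sum>i\<in>I. \<Sum>j\<in>I. if norm (g i - g j) \<le> 2 * \<delta> then v else 0)"
    proof (intro sum_mono)
      fix i j assume i: "i \<in> I" and j: "j \<in> I"
      show "(\<integral>q. indicat_real (cap (g i) \<delta>) q * indicat_real (cap (g j) \<delta>) q \<partial>haar) \<le> (if norm (g i - g j) \<le> 2 * \<delta> then v else 0)"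
      proof (cases "norm (g i - g j) \<le> 2 * \<delta>")
        case True
        have "(\<integral>q. indicat_real (cap (g i) \<delta>) q * indicat_real (cap (g j) \<delta>) q \<partial>haar) \<le> (\<integral>q. indicat_real (cap (g i) \<delta>) q \<partial>haar)"
          using iF[of "\<lambda>_. 1" "g i"] by (intro integral_mono iP) (auto simp: indicator_def)
        also have "\<dots> = v" by (simp add: v_def measure_cap[OF g1[OF i]])
        finally show ?thesis using True by simp
      next
        case False
        have z: "indicat_real (cap (g i) \<delta>) q * indicat_real (cap (g j) \<delta>) q = 0" for q
        proof (rule ccontr)
          assume "indicat_real (cap (g i) \<delta>) q * indicat_real (cap (g j) \<delta>) q \<noteq> 0"
          then have "norm (q - g i) \<le> \<delta>" "norm (q - g j) \<le> \<delta>" by (auto simp: cap_def indicator_def split: if_splits)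
          then have "norm (g i - g j) \<le> 2 * \<delta>"
            using norm_triangle_ineq4[of "q - g j" "q - g i"] by simp
          then show False using False by simp
        qed
        show ?thesis unfolding z using False by simp
      qed
    qed
    also have "\<dots> = close_pairs * v"
    proof -
      have "(\<Sum>i\<in>I. \<Sum>j\<in>I. if norm (g i - g j) \<le> 2 * \<delta> then v else 0) = (\<Sum>z\<in>I \<times> I. if norm (g (fst z) - g (snd z)) \<le> 2 * \<delta> then v else 0)"
        by (simp add: sum.cartesian_product case_prod_beta)
      also have "\<dots> = (\<Sum>z\<in>{(i,j) \<in> I \<times> I. norm (g i - g j) \<le> 2 * \<delta>}. v)"
        using fin by (intro sum.mono_neutral_cong_right) auto
      finally show ?thesis by (simp add: close_pairs_def)
    qed
    finally show ?thesis .
  qed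
  have F2: "(\<integral>q. (F q)\<^sup>2 \<partial>haar) \<le> ip f f * ip f' f' / (2 * real d + 1)"
    unfolding F_def by (rule matrix_coefficient_norm[OF f fc'])
  have iFW: "integrable haar (\<lambda>q. F q * W q)" unfolding W_def sum_distrib_left by (intro Bochner_Integration.integrable_sum iF Fc)
  have "(\<integral>q. F q * W q \<partial>haar)\<^sup>2 \<le> (\<integral>q. (F q)\<^sup>2 \<partial>haar) * (\<integral>q. (W q)\<^sup>2 \<partial>haar)"
  proof (rule integral_Cauchy_Schwarz[OF _ _ iFW])
    show "integrable haar (\<lambda>q. (F q)\<^sup>2)" by (intro int_haar continuous_intros Fc)
    show "integrable haar (\<lambda>q. (W q)\<^sup>2)"
      unfolding W_def power2_eq_square sum_product by (intro Bochner_Integration.integrable_sum iP)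
  qed
  also have "\<dots> \<le> (ip f f * ip f' f' / (2 * real d + 1)) * (close_pairs * v)"
    by (intro mult_mono F2 W2) auto
  also have "\<dots> = (v * S * sqrt (ip f f) * sqrt (ip f' f'))\<^sup>2"
  proof -
    have "S\<^sup>2 = close_pairs / (v * (2 * real d + 1))" unfolding S_def using v_pos by simp
    then have "(v * S * sqrt (ip f f) * sqrt (ip f' f'))\<^sup>2 = v\<^sup>2 * (close_pairs / (v * (2 * real d + 1))) * ip f f * ip f' f'"
      by (simp only: power_mult_distrib real_sqrt_pow2[OF ip_nonneg])
    then show ?thesis using v_pos by (simp add: power2_eq_square)
  qed
  finally have sq: "\<bar>\<integral>q. F q * W q \<partial>haar\<bar> \<le> \<bar>v * S * sqrt (ip f f) * sqrt (ip f' f')\<bar>"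
    by (rule abs_le_square_iff[THEN iffD2])
  have "0 \<le> v * S * sqrt (ip f f) * sqrt (ip f' f')"
    using v_pos unfolding S_def by (intro mult_nonneg_nonneg) simp_all
  with sq have mb: "\<bar>\<integral>q. F q * W q \<partial>haar\<bar> \<le> v * S * sqrt (ip f f) * sqrt (ip f' f')" by linarith
  define E where "E q = ip f' (T (\<lambda>x. f x - f (rot q x)))" for q
  have Ec: "cont E" unfolding E_def T_def ip_def
    by (intro cpt_prob_continuous_integral[OF cpt_prob_sph])
      (auto simp: case_prod_beta intro!: continuous_intros cont_comp[OF fc] cont_comp[OF fc'])
  have Eq: "ip f' (T f) = (\<Sum>i\<in>I. F (qmult q (g i))) + E q" for q
  proof -
    have "T f = (\<lambda>x. T (\<lambda>x. f (rot q x)) x + T (\<lambda>x. f x - f (rot q x)) x)"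
      by (rule ext) (simp add: T_def sum_subtractf)
    then have "ip f' (T f) = ip f' (T (\<lambda>x. f (rot q x))) + E q" unfolding E_def
      using ip_add[of "T (\<lambda>x. f (rot q x))" "T (\<lambda>x. f x - f (rot q x))" f']
      by (simp add: ip_commute[of f'] T_cont fc' continuous_intros cont_comp[OF fc] fc)
    then show ?thesis by (simp add: TF)
  qed
  have d0: "0 < \<delta>" "\<delta> \<le> 1/2" using d by (simp_all add: del)
  have Eb: "\<bar>E q\<bar> \<le> N / 2 * sqrt (ip f f) * sqrt (ip f' f')" if q: "norm q = 1" "q \<in> cap (1,0) \<delta>" for q
  proof -
    define h where "h x = f x - f (rot q x)" for x
    have h: "harm d h" unfolding h_def by (intro harm_diff f harm_rot q)
    have "ip h h \<le> (4 * real d * \<delta>)\<^sup>2 * ip f f"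
      using Bernstein_rotation[of d f q \<delta>] f q d0 unfolding ip_def h_def harm_def cap_def
      by (auto simp: power2_eq_square)
    also have "(4 * real d * \<delta>)\<^sup>2 = (1/2)\<^sup>2" using d by (simp add: del power2_eq_square)
    finally have "sqrt (ip h h) \<le> 1/2 * sqrt (ip f f)"
      by (metis real_sqrt_le_mono real_sqrt_mult real_sqrt_abs abs_of_nonneg zero_le_divide_1_iff zero_le_numeral)
    then have "N * sqrt (ip h h) * sqrt (ip f' f') \<le> N * (1/2 * sqrt (ip f f)) * sqrt (ip f' f')"
      by (intro mult_right_mono mult_left_mono N0) auto
    then show ?thesis using N[OF h f'] unfolding E_def h_def by simp
  qed
  have "(\<integral>q. ip f' (T f) * indicat_real (cap (1,0) \<delta>) q \<partial>haar) = v * ip f' (T f)"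
    by (simp add: v_def)
  also have "(\<integral>q. ip f' (T f) * indicat_real (cap (1,0) \<delta>) q \<partial>haar) =
     (\<integral>q. (\<Sum>i\<in>I. F (qmult q (g i))) * indicat_real (cap (1,0) \<delta>) q + E q * indicat_real (cap (1,0) \<delta>) q \<partial>haar)"
    by (rule Bochner_Integration.integral_cong[OF refl]) (subst Eq, rule distrib_right)
  also have "\<dots> = (\<integral>q. F q * W q \<partial>haar) + (\<integral>q. E q * indicat_real (cap (1,0) \<delta>) q \<partial>haar)"
    unfolding main[symmetric]
    by (intro Bochner_Integration.integral_add iF continuous_intros cont_comp[OF Fc] Ec)
  finally have eq: "v * ip f' (T f) = (\<integral>q. F q * W q \<partial>haar) + (\<integral>q. E q * indicat_real (cap (1,0) \<delta>) q \<partial>haar)" by simp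
  have "\<bar>\<integral>q. E q * indicat_real (cap (1,0) \<delta>) q \<partial>haar\<bar> \<le> (\<integral>q. \<bar>E q * indicat_real (cap (1,0) \<delta>) q\<bar> \<partial>haar)"
    by (rule integral_abs_bound)
  also have "\<dots> \<le> (\<integral>q. (N / 2 * sqrt (ip f f) * sqrt (ip f' f')) * indicat_real (cap (1,0) \<delta>) q \<partial>haar)"
  proof (intro integral_mono_AE)
    show "AE q in haar. \<bar>E q * indicat_real (cap (1,0) \<delta>) q\<bar> \<le> (N / 2 * sqrt (ip f f) * sqrt (ip f' f')) * indicat_real (cap (1,0) \<delta>) q"
      using AE_haar_norm by eventually_elim (use Eb in \<open>auto simp: indicator_def\<close>)
  qed (auto intro!: integrable_abs iF Ec)
  also have "\<dots> = v * (N / 2 * sqrt (ip f f) * sqrt (ip f' f'))" by (simp add: v_def)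
  finally have "\<bar>\<integral>q. E q * indicat_real (cap (1,0) \<delta>) q \<partial>haar\<bar> \<le> v * (N / 2 * sqrt (ip f f) * sqrt (ip f' f'))" .
  then have "v * \<bar>ip f' (T f)\<bar> \<le> v * S * sqrt (ip f f) * sqrt (ip f' f') + v * (N / 2 * sqrt (ip f f) * sqrt (ip f' f'))"
  proof -
    assume "\<bar>\<integral>q. E q * indicat_real (cap (1,0) \<delta>) q \<partial>haar\<bar> \<le> v * (N / 2 * sqrt (ip f f) * sqrt (ip f' f'))"
    moreover have "v * \<bar>ip f' (T f)\<bar> = \<bar>v * ip f' (T f)\<bar>" using v_pos by (simp add: abs_mult)
    ultimately show ?thesis using mb unfolding eq by linarith
  qed
  then have "v * \<bar>ip f' (T f)\<bar> \<le> v * ((S + N / 2) * sqrt (ip f f) * sqrt (ip f' f'))" by (simp add: algebra_simps)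
  then show ?thesis using v_pos by simp
qed

lemma trivial_bound:
  assumes f: "harm d f" and f': "harm d f'"
  shows "\<bar>ip f' (T f)\<bar> \<le> card I * sqrt (ip f f) * sqrt (ip f' f')"
proof -
  note fc = harm_cont[OF f] and fc' = harm_cont[OF f']
  have fr: "cont (\<lambda>x. f (rot q x))" for q by (intro cont_comp[OF fc] continuous_intros)
  have "\<bar>ip f' (T f)\<bar> = \<bar>\<Sum>i\<in>I. ip f' (\<lambda>x. f (rot (g i) x))\<bar>"
    unfolding T_def by (subst ip_sum_right[OF fin fr fc']) simp
  also have "\<dots> \<le> (\<Sum>i\<in>I. \<bar>ip f' (\<lambda>x. f (rot (g i) x))\<bar>)" by (rule sum_abs)
  also have "\<dots> \<le> (\<Sum>i\<in>I. sqrt (ip f f) * sqrt (ip f' f'))"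
  proof (intro sum_mono)
    fix i assume "i \<in> I"
    then show "\<bar>ip f' (\<lambda>x. f (rot (g i) x))\<bar> \<le> sqrt (ip f f) * sqrt (ip f' f')"
      using ip_CS'[OF fc' fr, of "g i"] ip_rot[OF g1 fc fc] by (simp add: mult.commute)
  qed
  finally show ?thesis by simp
qed

text \<open>Iterating \<open>N \<mapsto> S + N / 2\<close> from the trivial bound converges to the fixed point \<open>2 * S\<close>.\<close>

theorem operator_bound:
  assumes f: "harm d f" and f': "harm d f'"
  shows "\<bar>ip f' (T f)\<bar> \<le> 2 * S * sqrt (ip f f) * sqrt (ip f' f')"
proof -
  have S0: "S \<ge> 0" using v_pos by (simp add: S_def)
  have *: "\<bar>ip f' (T f)\<bar> \<le> (2 * S + real (card I) / 2 ^ k) * sqrt (ip f f) * sqrt (ip f' f')"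
    if "harm d f" "harm d f'" for k f f'
    using that
  proof (induction k arbitrary: f f')
    case 0
    have "card I * sqrt (ip f f) * sqrt (ip f' f') \<le> (2 * S + real (card I) / 2 ^ 0) * sqrt (ip f f) * sqrt (ip f' f')"
      using S0 by (intro mult_right_mono) auto
    then show ?case using trivial_bound[OF 0] by linarith
  next
    case (Suc k)
    have "\<bar>ip f' (T f)\<bar> \<le> (S + (2 * S + real (card I) / 2 ^ k) / 2) * sqrt (ip f f) * sqrt (ip f' f')"
      using S0 by (intro operator_bound_step Suc) auto
    also have "S + (2 * S + real (card I) / 2 ^ k) / 2 = 2 * S + real (card I) / 2 ^ Suc k" by (simp add: field_simps)
    finally show ?case .
  qed
  have "(\<lambda>k. (2 * S + real (card I) / 2 ^ k) * sqrt (ip f f) * sqrt (ip f' f')) \<longlonglongrightarrow> (2 * S + 0) * sqrt (ip f f) * sqrt (ip f' f')"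
    by (intro tendsto_intros LIMSEQ_divide_realpow_zero) auto
  then show ?thesis using *[OF f f'] by (intro LIMSEQ_le_const) auto
qed

end

section \<open>Lattice points on circles and spheres\<close>

text \<open>Heron's formula: the product of the squared side lengths of a triangle inscribed in a circle is four
  times the squared radius times the square of twice the area.\<close>

lemma circumradius_identity:
  fixes p1 p2 q1 q2 s1 s2 n :: int
  assumes "p1\<^sup>2 + p2\<^sup>2 = n" "q1\<^sup>2 + q2\<^sup>2 = n" "s1\<^sup>2 + s2\<^sup>2 = n"
  shows "((p1-q1)\<^sup>2 + (p2-q2)\<^sup>2) * ((q1-s1)\<^sup>2 + (q2-s2)\<^sup>2) * ((s1-p1)\<^sup>2 + (s2-p2)\<^sup>2)
    = 4 * n * ((q1-p1) * (s2-p2) - (q2-p2)*(s1-p1))\<^sup>2"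
proof -
  define x where "x = p1*q1 + p2*q2"
  define y where "y = q1 * s1 + q2 * s2"
  define z where "z = s1*p1 + s2*p2"
  have g: "n^3 + 2*x*y*z - n*(x\<^sup>2+y\<^sup>2+z\<^sup>2) = 0"
  proof -
    have "n^3 + 2*x*y*z - n*(x\<^sup>2+y\<^sup>2+z\<^sup>2) = (n*n*n + 2*x*y*z) - (n*x*x + n*y*y + n*z*z)"
      by (simp add: algebra_simps power2_eq_square power3_eq_cube)
    also have "\<dots> = ((p1\<^sup>2 + p2\<^sup>2)*(q1\<^sup>2 + q2\<^sup>2)*(s1\<^sup>2 + s2\<^sup>2) + 2*x*y*z) - ((s1\<^sup>2 + s2\<^sup>2)*x*x + (p1\<^sup>2 + p2\<^sup>2)*y*y + (q1\<^sup>2 + q2\<^sup>2)*z*z)"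
      by (simp only: assms)
    also have "\<dots> = 0" by (simp add: x_def y_def z_def algebra_simps power2_eq_square)
    finally show ?thesis .
  qed
  have a: "(p1-q1)\<^sup>2 + (p2-q2)\<^sup>2 = 2*n - 2*x" "(q1-s1)\<^sup>2 + (q2-s2)\<^sup>2 = 2*n - 2*y" "(s1-p1)\<^sup>2 + (s2-p2)\<^sup>2 = 2*n - 2*z"
    using assms by (simp_all add: x_def y_def z_def power2_eq_square algebra_simps)
  have d: "((q1-p1) * (s2-p2) - (q2-p2)*(s1-p1))\<^sup>2 = 3*n\<^sup>2 - (x\<^sup>2+y\<^sup>2+z\<^sup>2) + 2*(x*y+y*z+z*x) - 2*n*(x+y+z)"
  proof -
    have "((q1-p1) * (s2-p2) - (q2-p2)*(s1-p1))\<^sup>2 + ((q1-p1) * (s1-p1) + (q2-p2)*(s2-p2))\<^sup>2 = ((p1-q1)\<^sup>2 + (p2-q2)\<^sup>2) * ((s1-p1)\<^sup>2 + (s2-p2)\<^sup>2)"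
      by (simp add: power2_eq_square algebra_simps)
    moreover have "(q1-p1) * (s1-p1) + (q2-p2)*(s2-p2) = y - x - z + n"
      using assms by (simp add: x_def y_def z_def power2_eq_square algebra_simps)
    ultimately have "((q1-p1) * (s2-p2) - (q2-p2)*(s1-p1))\<^sup>2 = (2*n - 2*x) * (2*n - 2*z) - (y - x - z + n)\<^sup>2"
      unfolding a by (metis eq_diff_eq)
    also have "\<dots> = 3*n\<^sup>2 - (x\<^sup>2+y\<^sup>2+z\<^sup>2) + 2*(x*y+y*z+z*x) - 2*n*(x+y+z)"
      by (simp add: power2_eq_square algebra_simps)
    finally show ?thesis .
  qed
  have "(2*n - 2*x) * (2*n - 2*y) * (2*n - 2*z) - 4 * n * (3*n\<^sup>2 - (x\<^sup>2+y\<^sup>2+z\<^sup>2) + 2*(x*y+y*z+z*x) - 2*n*(x+y+z))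
     = - 4 * (n^3 + 2*x*y*z - n*(x\<^sup>2+y\<^sup>2+z\<^sup>2))"
    by (simp add: power2_eq_square power3_eq_cube algebra_simps)
  then show ?thesis unfolding a d using g by simp
qed

definition circ :: "int \<Rightarrow> (int \<times> int) set" where "circ n = {(c,d). c\<^sup>2 + d\<^sup>2 = n}"
text \<open>A quarter of the circle, on which two points are separated by their first coordinates.\<close>

definition arc :: "int \<Rightarrow> (int \<times> int) set" where "arc n = {(c,d). c\<^sup>2 + d\<^sup>2 = n \<and> \<bar>c\<bar> \<le> d}"

lemma finite_circ: "finite (circ n)"
proof (rule finite_subset)
  have sq: "\<bar>c\<bar> \<le> c\<^sup>2" for c :: int
    using self_le_power[of "\<bar>c\<bar>" 2] by (cases "c = 0") auto
  show "circ n \<subseteq> {-n..n} \<times> {-n..n}"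
  proof
    fix p assume "p \<in> circ n"
    then obtain c d where p: "p = (c,d)" "c\<^sup>2 + d\<^sup>2 = n" by (auto simp: circ_def)
    have "\<bar>c\<bar> \<le> n" "\<bar>d\<bar> \<le> n" using p(2) sq[of c] sq[of d] abs_ge_zero[of c] abs_ge_zero[of d] by linarith+
    then show "p \<in> {-n..n} \<times> {-n..n}" using p(1) by auto
  qed
qed simp

lemma arc_sub: "arc n \<subseteq> circ n" by (auto simp: arc_def circ_def)

lemma circ_arc: "card (circ n) \<le> 4 * card (arc n)"
proof -
  have fin: "finite (arc n)" using finite_subset[OF arc_sub finite_circ] .
  have "circ n \<subseteq> arc n \<union> (\<lambda>(c,d). (c,-d)) ` arc n \<union> (\<lambda>(c,d). (d,c)) ` arc n \<union> (\<lambda>(c,d). (-d,c)) ` arc n"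
  proof
    fix p assume "p \<in> circ n"
    then obtain c d where p: "p = (c,d)" "c\<^sup>2 + d\<^sup>2 = n" by (auto simp: circ_def)
    consider "\<bar>c\<bar> \<le> d" | "\<bar>c\<bar> \<le> -d" | "\<bar>d\<bar> \<le> c" | "\<bar>d\<bar> \<le> -c" by linarith
    then show "p \<in> arc n \<union> (\<lambda>(c,d). (c,-d)) ` arc n \<union> (\<lambda>(c,d). (d,c)) ` arc n \<union> (\<lambda>(c,d). (-d,c)) ` arc n"
    proof cases
      case 1 then show ?thesis using p by (simp add: arc_def)
    next
      case 2
      then have "(c,-d) \<in> arc n" using p by (simp add: arc_def)
      then have "(c, - (-d)) \<in> (\<lambda>(c,d). (c,-d)) ` arc n" by (intro image_eqI[where x = "(c,-d)"]) auto
      then show ?thesis using p by simp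
    next
      case 3
      then have "(d,c) \<in> arc n" using p by (simp add: arc_def)
      then have "(c,d) \<in> (\<lambda>(c,d). (d,c)) ` arc n" by (intro image_eqI[where x = "(d,c)"]) auto
      then show ?thesis using p by simp
    next
      case 4
      then have "(d,-c) \<in> arc n" using p by (simp add: arc_def)
      then have "(c,d) \<in> (\<lambda>(c,d). (-d,c)) ` arc n" by (intro image_eqI[where x = "(d,-c)"]) auto
      then show ?thesis using p by simp
    qed
  qed
  then have "card (circ n) \<le> card (arc n \<union> (\<lambda>(c,d). (c,-d)) ` arc n \<union> (\<lambda>(c,d). (d,c)) ` arc n \<union> (\<lambda>(c,d). (-d,c)) ` arc n)"
    using fin by (intro card_mono) auto
  also have "\<dots> \<le> card (arc n) + card (arc n) + card (arc n) + card (arc n)"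
    using fin by (intro order_trans[OF card_Un_le] add_mono card_image_le) auto
  finally show ?thesis by simp
qed

lemma arc_distinct:
  assumes "(c,d) \<in> arc n" "(c',d') \<in> arc n" "(c,d) \<noteq> (c',d')"
  shows "(c-c')\<^sup>2 + (d-d')\<^sup>2 \<le> 2 * (c-c')\<^sup>2"
proof -
  have h: "c\<^sup>2 + d\<^sup>2 = n" "\<bar>c\<bar> \<le> d" "c'\<^sup>2 + d'\<^sup>2 = n" "\<bar>c'\<bar> \<le> d'" using assms by (auto simp: arc_def)
  have pos: "d + d' > 0"
  proof (rule ccontr)
    assume "\<not> d + d' > 0"
    then have "d = 0" "d' = 0" "c = 0" "c' = 0" using h(2,4) by linarith+
    then show False using assms(3) by simp
  qed
  have e: "(d-d') * (d+d') = (c'-c) * (c'+c)" using h by (simp add: power2_eq_square algebra_simps)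
  have "\<bar>d-d'\<bar> * (d+d') = \<bar>c'-c\<bar> * \<bar>c'+c\<bar>" using arg_cong[OF e, of abs] pos by (simp add: abs_mult)
  also have "\<dots> \<le> \<bar>c'-c\<bar> * (d+d')" using h(2,4) by (intro mult_left_mono) linarith+
  finally have "\<bar>d-d'\<bar> \<le> \<bar>c-c'\<bar>" using pos by (simp add: abs_minus_commute)
  then have "(d-d')\<^sup>2 \<le> (c-c')\<^sup>2" by (simp only: abs_le_square_iff)
  then show ?thesis by simp
qed

text \<open>Three lattice points span a triangle with twice the area a nonzero integer, so by \<open>circumradius_identity\<close> three points of
  the circle cannot all lie within distance of order \<open>n powr (1/6)\<close>.\<close>

lemma arc_short:
  assumes A: "A \<subseteq> arc n" and w: "0 \<le> w" "2 * w ^ 6 < real_of_int n"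
    and close: "\<And>c d c' d'. (c,d) \<in> A \<Longrightarrow> (c',d') \<in> A \<Longrightarrow> \<bar>real_of_int c - real_of_int c'\<bar> \<le> w"
  shows "card A \<le> 2"
proof (rule ccontr)
  assume "\<not> card A \<le> 2"
  then have "Suc (Suc (Suc 0)) \<le> card A" by simp
  then obtain P A1 where 1: "A = insert P A1" "P \<notin> A1" "Suc (Suc 0) \<le> card A1"
    unfolding card_le_Suc_iff[of "Suc (Suc 0)"] by blast
  then obtain Q A2 where 2: "A1 = insert Q A2" "Q \<notin> A2" "Suc 0 \<le> card A2"
    unfolding card_le_Suc_iff[of "Suc 0"] by blast
  then obtain S A3 where 3: "A2 = insert S A3" "S \<notin> A3" unfolding card_le_Suc_iff[of 0] by blast
  have PQS: "P \<in> A" "Q \<in> A" "S \<in> A" "P \<noteq> Q" "Q \<noteq> S" "S \<noteq> P" using 1 2 3 by auto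
  obtain p1 p2 q1 q2 s1 s2 where e: "P = (p1,p2)" "Q = (q1,q2)" "S = (s1,s2)" by (metis surj_pair)
  have b: "(real_of_int ((c-c')\<^sup>2 + (d-d')\<^sup>2)) \<le> 2 * w\<^sup>2" "(c-c')\<^sup>2 + (d-d')\<^sup>2 > 0"
    if "(c,d) \<in> A" "(c',d') \<in> A" "(c,d) \<noteq> (c',d')" for c d c' d'
  proof -
    have "(real_of_int ((c-c')\<^sup>2 + (d-d')\<^sup>2)) \<le> real_of_int (2 * (c-c')\<^sup>2)"
      using arc_distinct[of c d n c' d'] that A by (subst of_int_le_iff) auto
    also have "\<dots> = 2 * (real_of_int c - real_of_int c')\<^sup>2" by simp
    also have "\<dots> \<le> 2 * w\<^sup>2" using close[OF that(1,2)] w(1) power_mono[of "\<bar>real_of_int c - real_of_int c'\<bar>" w 2] by simp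
    finally show "(real_of_int ((c-c')\<^sup>2 + (d-d')\<^sup>2)) \<le> 2 * w\<^sup>2" .
    show "(c-c')\<^sup>2 + (d-d')\<^sup>2 > 0" using that(3) by (auto simp: sum_power2_gt_zero_iff)
  qed
  define D where "D = (q1-p1) * (s2-p2) - (q2-p2)*(s1-p1)"
  define X where "X = (p1-q1)\<^sup>2 + (p2-q2)\<^sup>2"
  define Y where "Y = (q1-s1)\<^sup>2 + (q2-s2)\<^sup>2"
  define Z where "Z = (s1-p1)\<^sup>2 + (s2-p2)\<^sup>2"
  have XYZ: "X * Y * Z = 4 * n * D\<^sup>2"
    unfolding X_def Y_def Z_def D_def using PQS A e by (intro circumradius_identity) (auto simp: arc_def)
  have bX: "real_of_int X \<le> 2 * w\<^sup>2" "X > 0" and bY: "real_of_int Y \<le> 2 * w\<^sup>2" "Y > 0" and bZ: "real_of_int Z \<le> 2 * w\<^sup>2" "Z > 0"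
    unfolding X_def Y_def Z_def using b PQS e by auto
  have "X * Y * Z > 0" using bX bY bZ by simp
  then have "D\<^sup>2 \<ge> 1" "n > 0" unfolding XYZ using w zero_le_power[of w 6] by (auto simp: zero_less_mult_iff int_one_le_iff_zero_less)
  then have "4 * n \<le> X * Y * Z" unfolding XYZ by simp
  then have "real_of_int (4 * n) \<le> real_of_int X * real_of_int Y * real_of_int Z" by (metis of_int_le_iff of_int_mult)
  also have "\<dots> \<le> (2 * w\<^sup>2) * (2 * w\<^sup>2) * (2 * w\<^sup>2)" using bX bY bZ by (intro mult_mono) auto
  also have "\<dots> = 4 * (2 * w ^ 6)" by (simp add: power2_eq_square eval_nat_numeral)
  also have "\<dots> < 4 * real_of_int n" using w by simp
  finally show False by simp
qed

lemma card_le_fibres: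
  assumes "finite B" "f ` B \<subseteq> K" "finite K" "\<And>k. card {x \<in> B. f x = k} \<le> m"
  shows "card B \<le> m * card K"
proof -
  have "card B = (\<Sum>k\<in>f ` B. card {x \<in> B. f x = k})"
    using sum.image_gen[OF assms(1), of "\<lambda>_. 1::nat" f] by simp
  also have "\<dots> \<le> (\<Sum>k\<in>f ` B. m)" by (intro sum_mono assms(4))
  also have "\<dots> = m * card (f ` B)" by simp
  also have "\<dots> \<le> m * card K" using assms by (intro mult_le_mono2 card_mono)
  finally show ?thesis .
qed

text \<open>Each piece of the arc of width \<open>w = (n/3) powr (1/6)\<close> contains at most two lattice points. The divisor bound would give any
  positive exponent, but \<open>1/3\<close> suffices and is elementary.\<close>

lemma card_circ:
  assumes "n \<ge> 0" shows "real (card (circ n)) \<le> 40 * (real_of_int n + 1) powr (1/3)"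
proof (cases "n = 0")
  case True
  have "circ 0 = {(0,0)}" by (auto simp: circ_def sum_power2_eq_zero_iff)
  then show ?thesis using True by simp
next
  case False
  then have n: "n \<ge> 1" using assms by simp
  define x where "x = real_of_int n"
  have x: "x \<ge> 1" using n by (simp add: x_def)
  define w where "w = (x/3) powr (1/6)"
  have w0: "w > 0" using x by (simp add: w_def)
  have w6: "w ^ 6 = x / 3"
    using x by (simp add: w_def powr_powr flip: powr_realpow)
  define f where "f = (\<lambda>(c::int,d::int). \<lfloor>real_of_int c / w\<rfloor>)"
  define R where "R = sqrt x"
  have fin: "finite (arc n)" using finite_subset[OF arc_sub finite_circ] .
  have fib: "card {p \<in> arc n. f p = k} \<le> 2" for k
  proof (rule arc_short[of _ n w])
    fix c d c' d' assume "(c, d) \<in> {p \<in> arc n. f p = k}" "(c', d') \<in> {p \<in> arc n. f p = k}"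
    then have "\<lfloor>real_of_int c / w\<rfloor> = k" "\<lfloor>real_of_int c' / w\<rfloor> = k" by (auto simp: f_def)
    then have "\<bar>real_of_int c / w - real_of_int c' / w\<bar> \<le> 1" by linarith
    then show "\<bar>real_of_int c - real_of_int c'\<bar> \<le> w" using w0 by (simp add: diff_divide_distrib[symmetric] pos_divide_le_eq)
  next
    show "2 * w ^ 6 < real_of_int n" using w6 x unfolding x_def[symmetric] by simp
  qed (use w0 in auto)
  have im: "f ` arc n \<subseteq> {\<lfloor>- R / w\<rfloor>..\<lfloor>R / w\<rfloor>}"
  proof
    fix k assume "k \<in> f ` arc n"
    then obtain c d where cd: "c\<^sup>2 + d\<^sup>2 = n" "k = \<lfloor>real_of_int c / w\<rfloor>" by (auto simp: arc_def f_def)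
    have "c\<^sup>2 \<le> n" using cd(1) zero_le_power2[of d] by linarith
    then have "(real_of_int c)\<^sup>2 \<le> x" unfolding x_def by (metis of_int_le_iff of_int_power)
    then have "\<bar>real_of_int c\<bar> \<le> R" unfolding R_def by (rule real_le_rsqrt[of "\<bar>real_of_int c\<bar>", simplified])
    then have "- R \<le> real_of_int c" "real_of_int c \<le> R" by linarith+
    then have "- R / w \<le> real_of_int c / w" "real_of_int c / w \<le> R / w"
      using w0 divide_right_mono less_imp_le by blast+
    then show "k \<in> {\<lfloor>- R / w\<rfloor>..\<lfloor>R / w\<rfloor>}" unfolding cd(2) by (auto intro!: floor_mono)
  qed
  have "card (arc n) \<le> 2 * card {\<lfloor>- R / w\<rfloor>..\<lfloor>R / w\<rfloor>}"
    by (rule card_le_fibres[OF fin im _ fib]) simp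
  moreover have "real (card {\<lfloor>- R / w\<rfloor>..\<lfloor>R / w\<rfloor>}) \<le> 2 * (R / w) + 2"
  proof -
    have "0 \<le> R / w" using x w0 by (simp add: R_def)
    then have "\<lfloor>- R / w\<rfloor> \<le> \<lfloor>R / w\<rfloor> + 1" by (metis add.commute floor_mono le_add_same_cancel2 minus_divide_left neg_le_0_iff_le order_trans zle_add1_eq_le zless_add1_eq zero_le_one)
    then have "real (card {\<lfloor>- R / w\<rfloor>..\<lfloor>R / w\<rfloor>}) = real_of_int (\<lfloor>R / w\<rfloor> + 1 - \<lfloor>- R / w\<rfloor>)" by simp
    also have "\<dots> \<le> 2 * (R / w) + 2" by linarith
    finally show ?thesis .
  qed
  ultimately have c1: "real (card (circ n)) \<le> 16 * (R / w) + 16" using circ_arc[of n] by linarith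
  have "R / w = x powr (1/2) / (x/3) powr (1/6)" using x by (simp add: R_def w_def powr_half_sqrt)
  also have "\<dots> = 3 powr (1/6) * x powr (1/3)" 
  proof -
    have "x powr (1/2) = x powr (1/3) * x powr (1/6)" by (simp add: powr_add[symmetric])
    moreover have "(x/3) powr (1/6) = x powr (1/6) / 3 powr (1/6)" using x by (simp add: powr_divide)
    moreover have "x powr (1/6) > 0" using x by simp
    ultimately show ?thesis by simp
  qed
  also have "(3::real) powr (1/6) \<le> 3 powr (1/4)" by (intro powr_mono) auto
  also have "(3::real) powr (1/4) \<le> 14/10"
  proof -
    have "((3::real) powr (1/4)) ^ 4 = 3" by (simp add: powr_power)
    then have "((3::real) powr (1/4)) ^ 4 \<le> (14/10)^4" by (simp add: power_divide)
    then show ?thesis by (subst (asm) power_mono_iff) auto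
  qed
  finally have "R / w \<le> 14/10 * x powr (1/3)" using x by simp
  moreover have "1 \<le> x powr (1/3)" using x by (intro ge_one_powr_ge_zero) auto
  moreover have "x powr (1/3) \<le> (x + 1) powr (1/3)" using x by (intro powr_mono2) auto
  ultimately show ?thesis using c1 unfolding x_def by linarith
qed

definition sphere3 :: "int \<Rightarrow> (int \<times> int \<times> int) set" where
  "sphere3 n = {(b,c,d). b\<^sup>2 + c\<^sup>2 + d\<^sup>2 = n}"

lemma card_sphere3:
  assumes "n \<ge> 0"
  shows "finite (sphere3 n) \<and> real (card (sphere3 n)) \<le> 120 * (real_of_int n + 1) powr (5/6)"
proof -
  define x where "x = real_of_int n"
  have x: "x \<ge> 0" using assms by (simp add: x_def)
  have B: "b \<in> {b. b\<^sup>2 \<le> n} \<Longrightarrow> - sqrt x \<le> real_of_int b \<and> real_of_int b \<le> sqrt x" for b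
  proof -
    assume "b \<in> {b. b\<^sup>2 \<le> n}"
    then have "(real_of_int b)\<^sup>2 \<le> x" unfolding x_def mem_Collect_eq by (metis of_int_le_iff of_int_power)
    then have "\<bar>real_of_int b\<bar> \<le> sqrt x" by (rule real_le_rsqrt[of "\<bar>real_of_int b\<bar>", simplified])
    then show ?thesis by linarith
  qed
  have Bsub: "{b. b\<^sup>2 \<le> n} \<subseteq> {\<lceil>- sqrt x\<rceil>..\<lfloor>sqrt x\<rfloor>}"
    using B by (auto simp: le_floor_iff ceiling_le_iff)
  then have Bfin: "finite {b. b\<^sup>2 \<le> n}" by (rule finite_subset) simp
  have "\<lceil>- sqrt x\<rceil> \<le> \<lfloor>sqrt x\<rfloor> + 1"
  proof -
    have "0 \<le> sqrt x" using x by simp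
    then show ?thesis by linarith
  qed
  then have "real (card {\<lceil>- sqrt x\<rceil>..\<lfloor>sqrt x\<rfloor>}) = real_of_int (\<lfloor>sqrt x\<rfloor> + 1 - \<lceil>- sqrt x\<rceil>)" by simp
  also have "\<dots> \<le> 2 * sqrt x + 1" by linarith
  finally have Bcard: "real (card {b. b\<^sup>2 \<le> n}) \<le> 2 * sqrt x + 1"
    using card_mono[OF _ Bsub] by simp
  have eq: "sphere3 n = Sigma {b. b\<^sup>2 \<le> n} (\<lambda>b. circ (n - b\<^sup>2))"
  proof -
    have "b\<^sup>2 \<le> n" if "b\<^sup>2 + c\<^sup>2 + d\<^sup>2 = n" for b c d :: int
      using that zero_le_power2[of c] zero_le_power2[of d] by linarith
    then show ?thesis unfolding sphere3_def circ_def by (auto simp: algebra_simps)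
  qed
  have "real (card (sphere3 n)) = (\<Sum>b\<in>{b. b\<^sup>2 \<le> n}. real (card (circ (n - b\<^sup>2))))"
    unfolding eq using Bfin finite_circ by (subst card_SigmaI) auto
  also have "\<dots> \<le> (\<Sum>b\<in>{b. b\<^sup>2 \<le> n}. 40 * (x + 1) powr (1/3))"
  proof (intro sum_mono)
    fix b assume b: "b \<in> {b. b\<^sup>2 \<le> n}"
    then have nn: "0 \<le> n - b\<^sup>2" by simp
    have "real (card (circ (n - b\<^sup>2))) \<le> 40 * (real_of_int (n - b\<^sup>2) + 1) powr (1/3)" by (rule card_circ[OF nn])
    also have "\<dots> \<le> 40 * (x + 1) powr (1/3)"
    proof -
      have "0 \<le> real_of_int (n - b\<^sup>2)" using nn by (simp only: of_int_0_le_iff)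
      moreover have "real_of_int (n - b\<^sup>2) \<le> x" by (simp add: x_def)
      ultimately show ?thesis by (intro mult_left_mono powr_mono2) auto
    qed
    finally show "real (card (circ (n - b\<^sup>2))) \<le> 40 * (x + 1) powr (1/3)" .
  qed
  also have "\<dots> \<le> (2 * sqrt x + 1) * (40 * (x + 1) powr (1/3))"
    using Bcard by (simp add: mult_right_mono)
  also have "\<dots> \<le> (3 * sqrt (x + 1)) * (40 * (x + 1) powr (1/3))"
  proof (intro mult_right_mono)
    have "sqrt x \<le> sqrt (x + 1)" "1 \<le> sqrt (x + 1)" using x by auto
    then show "2 * sqrt x + 1 \<le> 3 * sqrt (x + 1)" by linarith
  qed auto
  also have "\<dots> = 120 * (x + 1) powr (5/6)"
    using x by (simp add: powr_half_sqrt[symmetric] powr_add[symmetric])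
  finally have "real (card (sphere3 n)) \<le> 120 * (x + 1) powr (5/6)" .
  then show ?thesis unfolding x_def eq using Bfin finite_circ by auto
qed

section \<open>Words in the integral quaternions of norm five\<close>

type_synonym iquat = "int \<times> int \<times> int \<times> int"

fun imul :: "iquat \<Rightarrow> iquat \<Rightarrow> iquat" where
  "imul (a,b,c,d) (a',b',c',d') =
    (a*a' - b*b' - c*c' - d*d', a*b' + b*a' + c*d' - d*c', a*c' - b*d' + c*a' + d*b', a*d' + b*c' - c*b' + d*a')"

fun icnj :: "iquat \<Rightarrow> iquat" where "icnj (a,b,c,d) = (a,-b,-c,-d)"
fun inorm :: "iquat \<Rightarrow> int" where "inorm (a,b,c,d) = a\<^sup>2 + b\<^sup>2 + c\<^sup>2 + d\<^sup>2"
fun emb :: "iquat \<Rightarrow> quaternion" where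
  "emb (a,b,c,d) = (of_int a, vector [of_int b, of_int c, of_int d])"
fun div5 :: "iquat \<Rightarrow> bool" where "div5 (a,b,c,d) \<longleftrightarrow> 5 dvd a \<and> 5 dvd b \<and> 5 dvd c \<and> 5 dvd d"

lemma emb_imul: "emb (imul p q) = qmult (emb p) (emb q)"
  by (cases p rule: prod_cases4, cases q rule: prod_cases4, hypsubst) (simp add: qmult_def comp3 algebra_simps)

lemma emb_icnj: "emb (icnj p) = qcnj (emb p)"
  by (cases p rule: prod_cases4, hypsubst) (simp add: qcnj_def comp3)

lemma norm_emb: "(norm (emb p))\<^sup>2 = of_int (inorm p)"
  by (cases p rule: prod_cases4, hypsubst, unfold norm_q) (simp add: inner_vec_def sum_3 power2_eq_square)

lemma imul_assoc: "imul (imul p q) r = imul p (imul q r)"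
  by (cases p; cases q; cases r) (simp add: algebra_simps)

lemma icnj_imul: "icnj (imul p q) = imul (icnj q) (icnj p)"
  by (cases p; cases q) (simp add: algebra_simps)

lemma icnj_icnj [simp]: "icnj (icnj p) = p" by (cases p) simp

lemma imul_one [simp]: "imul (1,0,0,0) p = p" "imul p (1,0,0,0) = p" by (cases p; simp)+

lemma imul_icnj: "imul (icnj p) p = (inorm p, 0, 0, 0)"
  by (cases p) (simp add: power2_eq_square algebra_simps)

lemma inorm_imul: "inorm (imul p q) = inorm p * inorm q"
  by (cases p; cases q) (simp add: power2_eq_square algebra_simps)

definition gens :: "iquat set" where
  "gens = {(1,2,0,0), (1,-2,0,0), (1,0,2,0), (1,0,-2,0), (1,0,0,2), (1,0,0,-2)}"

lemma icnj_gens: "x \<in> gens \<Longrightarrow> icnj x \<in> gens" by (auto simp: gens_def)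
lemma finite_gens [simp]: "finite gens" by (simp add: gens_def)
lemma card_gens: "card gens = 6" by (simp add: gens_def)
lemma inorm_gens: "x \<in> gens \<Longrightarrow> inorm x = 5" by (auto simp: gens_def)

definition reduced :: "iquat list \<Rightarrow> bool" where
  "reduced w \<longleftrightarrow> set w \<subseteq> gens \<and> successively (\<lambda>x y. y \<noteq> icnj x) w"

definition words :: "nat \<Rightarrow> iquat list set" where "words m = {w. reduced w \<and> length w = m}"

definition wval :: "iquat list \<Rightarrow> iquat" where "wval w = foldr imul w (1,0,0,0)"

lemma wval_Nil [simp]: "wval [] = (1,0,0,0)" by (simp add: wval_def)
lemma wval_Cons [simp]: "wval (x # w) = imul x (wval w)" by (simp add: wval_def)
lemma wval_append: "wval (u @ w) = imul (wval u) (wval w)"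
  by (induction u) (simp_all add: imul_assoc)
lemma wval_rev: "wval (rev (map icnj w)) = icnj (wval w)"
  by (induction w) (simp_all add: wval_append icnj_imul)

lemma inorm_wval: "set w \<subseteq> gens \<Longrightarrow> inorm (wval w) = 5 ^ length w"
  by (induction w) (auto simp: inorm_imul inorm_gens)

text \<open>One has \<open>y x y = 2 t y - 5 x\<^sup>*\<close> with \<open>t\<close> the real part of \<open>y x\<close>, and for generators \<open>5\<close> divides
  \<open>2 t\<close> only if \<open>y\<close> is the conjugate of \<open>x\<close>.\<close>

lemma sandwich_div5:
  assumes xy: "x \<in> gens" "y \<in> gens" "y \<noteq> icnj x" and dv: "div5 (imul x (imul y z))"
  shows "div5 (imul y z)"
proof -
  obtain a b c d where z: "imul y z = (a,b,c,d)" by (metis prod_cases4)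
  obtain a' b' c' d' where z': "z = (a',b',c',d')" by (metis prod_cases4)
  obtain p q r s where w: "imul x (imul y z) = (p,q,r,s)" by (metis prod_cases4)
  define t where "t = fst (imul y x)"
  have t: "\<not> 5 dvd 2 * t"
    using xy unfolding gens_def t_def by auto
  have "imul y (imul x (imul y z)) = imul (imul (imul y x) y) z" by (simp add: imul_assoc)
  moreover have "imul (imul y x) y = imul (2 * t, 0, 0, 0) y - imul (5,0,0,0) (icnj x)"
    using xy unfolding gens_def t_def by (auto simp: zero_prod_def)
  ultimately have eq: "imul y (p,q,r,s) = imul (imul (2 * t, 0, 0, 0) y - imul (5,0,0,0) (icnj x)) z"
    by (simp add: w)
  have "imul (imul (2 * t, 0, 0, 0) y - imul (5,0,0,0) (icnj x)) z = imul (2*t,0,0,0) (imul y z) - imul (5,0,0,0) (imul (icnj x) z)"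
    by (cases y; cases x) (simp add: z' algebra_simps)
  with eq have eq2: "imul y (p,q,r,s) + imul (5,0,0,0) (imul (icnj x) z) = imul (2*t,0,0,0) (a,b,c,d)" by (simp add: z)
  have d1: "div5 (imul y (p,q,r,s))" using dv unfolding w by (cases y) auto
  have d2: "div5 (imul (5,0,0,0) u)" for u by (cases u) auto
  have dadd: "div5 u \<Longrightarrow> div5 v \<Longrightarrow> div5 (u + v)" for u v by (cases u; cases v) auto
  have "div5 (imul (2*t,0,0,0) (a,b,c,d))" unfolding eq2[symmetric] by (intro dadd d1 d2)
  then have h: "5 dvd 2*t*a" "5 dvd 2*t*b" "5 dvd 2*t*c" "5 dvd 2*t*d" by auto
  have "prime (5::int)" by simp
  then have "5 dvd a" "5 dvd b" "5 dvd c" "5 dvd d"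
    using h t by (simp_all only: prime_dvd_mult_iff) auto
  then show ?thesis by (simp add: z)
qed

text \<open>This is the freeness of the group generated by the Ramanujan set: cancelling letters from the left by
  \<open>sandwich_div5\<close> would make a single generator divisible by \<open>5\<close>.\<close>

lemma reduced_not_div5: "reduced w \<Longrightarrow> w \<noteq> [] \<Longrightarrow> \<not> div5 (wval w)"
proof (induction w)
  case (Cons x w)
  show ?case
  proof (cases w)
    case Nil then show ?thesis using Cons.prems by (auto simp: reduced_def gens_def)
  next
    case (Cons y w')
    have r: "reduced w" "x \<in> gens" "y \<in> gens" "y \<noteq> icnj x"
      using Cons.prems Cons by (auto simp: reduced_def)
    then have "\<not> div5 (wval w)" using Cons.IH Cons by simp
    then show ?thesis using sandwich_div5[OF r(2-4), of "wval w'"] Cons by auto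
  qed
qed simp

lemma finite_words [simp]: "finite (words m)"
proof (rule finite_subset)
  show "words m \<subseteq> {w. set w \<subseteq> gens \<and> length w = m}" by (auto simp: words_def reduced_def)
qed (rule finite_lists_length_eq, simp)

lemma words_0: "words 0 = {[]}" by (auto simp: words_def reduced_def)

lemma words_1: "words (Suc 0) = (\<lambda>x. [x]) ` gens"
  by (auto simp: words_def reduced_def length_Suc_conv)

lemma words_Suc_Suc: "words (Suc (Suc m)) = (\<lambda>(w,x). x # w) ` (SIGMA w:words (Suc m). gens - {icnj (hd w)})"
proof (rule set_eqI)
  fix w
  show "w \<in> words (Suc (Suc m)) \<longleftrightarrow> w \<in> (\<lambda>(w,x). x # w) ` (SIGMA w:words (Suc m). gens - {icnj (hd w)})"
  proof
    assume "w \<in> words (Suc (Suc m))"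
    then obtain x y v where w: "w = x # y # v" "length v = m" by (auto simp: words_def length_Suc_conv)
    then have "y # v \<in> words (Suc m)" "x \<in> gens" "y \<noteq> icnj x"
      using \<open>w \<in> words (Suc (Suc m))\<close> by (auto simp: words_def reduced_def)
    moreover have "x \<noteq> icnj y" using \<open>y \<noteq> icnj x\<close> by auto
    ultimately show "w \<in> (\<lambda>(w,x). x # w) ` (SIGMA w:words (Suc m). gens - {icnj (hd w)})"
      by (intro image_eqI[where x = "(y # v, x)"]) (auto simp: w)
  next
    assume "w \<in> (\<lambda>(w,x). x # w) ` (SIGMA w:words (Suc m). gens - {icnj (hd w)})"
    then obtain z where z: "z \<in> (SIGMA w:words (Suc m). gens - {icnj (hd w)})" "w = (\<lambda>(w,x). x # w) z" by blast
    obtain v x where zz: "z = (v, x)" by (metis surj_pair)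
    have v: "w = x # v" "v \<in> words (Suc m)" "x \<in> gens" "x \<noteq> icnj (hd v)" using z unfolding zz by simp_all
    then obtain y u where "v = y # u" by (cases v) (auto simp: words_def)
    then show "w \<in> words (Suc (Suc m))" using v by (auto simp: words_def reduced_def)
  qed
qed

lemma card_words: "m \<ge> 1 \<Longrightarrow> card (words m) = 6 * 5 ^ (m - 1)"
proof (induction m rule: nat_induct_at_least)
  case base
  have "card ((\<lambda>x. [x]) ` gens) = card gens" by (intro card_image inj_onI) simp
  then show ?case by (simp add: words_1 card_gens)
next
  case (Suc m)
  then obtain k where m: "m = Suc k" by (cases m) auto
  have "inj_on (\<lambda>(w,x). x # w) (SIGMA w:words (Suc k). gens - {icnj (hd w)})" by (auto simp: inj_on_def)
  then have "card (words (Suc m)) = card (SIGMA w:words (Suc k). gens - {icnj (hd w)})"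
    unfolding m words_Suc_Suc by (rule card_image)
  also have "\<dots> = (\<Sum>w\<in>words (Suc k). card (gens - {icnj (hd w)}))" by (intro card_SigmaI) auto
  also have "\<dots> = (\<Sum>w\<in>words (Suc k). 5)"
  proof (intro sum.cong refl)
    fix w assume "w \<in> words (Suc k)"
    then have "hd w \<in> gens" by (cases w) (auto simp: words_def reduced_def)
    then show "card (gens - {icnj (hd w)}) = 5" by (simp add: icnj_gens card_gens)
  qed
  also have "\<dots> = 6 * 5 ^ (Suc m - 1)" using Suc.IH by (simp add: m)
  finally show ?case .
qed

lemma reduced_append: "reduced (u @ w) \<Longrightarrow> reduced u \<and> reduced w"
  by (auto simp: reduced_def successively_append_iff)

lemma reduced_quotient:
  assumes "reduced v" "reduced w" "v \<noteq> []" "w \<noteq> []" "hd v \<noteq> hd w"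
  shows "reduced (rev (map icnj v) @ w)"
proof -
  have "successively (\<lambda>x y. y \<noteq> icnj x) (rev (map icnj v))"
    unfolding successively_rev successively_map
    by (rule successively_mono[of "\<lambda>x y. y \<noteq> icnj x" v]) (use assms(1) in \<open>auto simp: reduced_def\<close>)
  moreover have "last (rev (map icnj v)) = icnj (hd v)" using assms by (simp add: last_rev hd_map)
  ultimately show ?thesis using assms icnj_gens
    by (auto simp: reduced_def successively_append_iff)
qed

lemma imul_cancel: assumes "inorm u \<noteq> 0" "imul u p = imul u q" shows "p = q"
proof -
  have "imul (inorm u, 0, 0, 0) p = imul (inorm u, 0, 0, 0) q"
    using arg_cong[OF assms(2), of "imul (icnj u)"] by (simp only: imul_assoc[symmetric] imul_icnj)
  then show ?thesis using assms(1) by (cases p; cases q) simp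
qed

lemma words_branch_apart:
  assumes "length w = length w'" "w \<noteq> w'"
  shows "\<exists>u v v'. w = u @ v \<and> w' = u @ v' \<and> v \<noteq> [] \<and> v' \<noteq> [] \<and> hd v \<noteq> hd v' \<and> length v = length v'"
  using assms
proof (induction w w' rule: list_induct2)
  case (Cons x xs y ys)
  show ?case
  proof (cases "x = y")
    case True
    then obtain u v v' where "xs = u @ v \<and> ys = u @ v' \<and> v \<noteq> [] \<and> v' \<noteq> [] \<and> hd v \<noteq> hd v' \<and> length v = length v'"
      using Cons by auto
    then have "x # xs = (x # u) @ v \<and> y # ys = (x # u) @ v' \<and> v \<noteq> [] \<and> v' \<noteq> [] \<and> hd v \<noteq> hd v' \<and> length v = length v'"
      using True by simp
    then show ?thesis by blast
  next
    case False
    then have "x # xs = [] @ (x # xs) \<and> y # ys = [] @ (y # ys) \<and> x # xs \<noteq> [] \<and> y # ys \<noteq> [] \<and>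
        hd (x # xs) \<noteq> hd (y # ys) \<and> length (x # xs) = length (y # ys)" using Cons.hyps by simp
    then show ?thesis by blast
  qed
qed simp

lemma wval_inj:
  assumes "reduced w" "reduced w'" "length w = length w'" "wval w = wval w'"
  shows "w = w'"
proof (rule ccontr)
  assume "w \<noteq> w'"
  then obtain u v v' where b: "w = u @ v" "w' = u @ v'" "v \<noteq> []" "v' \<noteq> []" "hd v \<noteq> hd v'" "length v = length v'"
    using words_branch_apart[OF assms(3)] by blast
  have r: "reduced v" "reduced v'" "reduced u" using assms b reduced_append by blast+
  have "inorm (wval u) \<noteq> 0" using r(3) by (simp add: inorm_wval reduced_def)
  then have "wval v = wval v'" using assms(4) unfolding b wval_append by (rule imul_cancel)
  then have "wval (rev (map icnj v) @ v') = imul (icnj (wval v)) (wval v)" by (simp add: wval_append wval_rev)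
  also have "\<dots> = (5 ^ length v, 0, 0, 0)" using r(1) by (simp add: imul_icnj inorm_wval reduced_def)
  finally have "div5 (wval (rev (map icnj v) @ v'))" using b(3) by (cases v) auto
  then show False using reduced_not_div5[OF reduced_quotient[OF r(1,2) b(3-5)]] b(3) by auto
qed

definition close :: "real \<Rightarrow> iquat list \<Rightarrow> iquat list \<Rightarrow> bool" where
  "close D w w' \<longleftrightarrow> norm (emb (wval w) - emb (wval w')) \<le> D * sqrt 5 ^ length w"

text \<open>Pairs of words that differ in the first letter; every pair of distinct words of equal length is a common
  prefix followed by such a pair.\<close>

definition branching :: "real \<Rightarrow> nat \<Rightarrow> (iquat list \<times> iquat list) set" where
  "branching D l = {(v,v') \<in> words l \<times> words l. hd v \<noteq> hd v' \<and> close D v v'}"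

lemma norm_emb_wval: "set w \<subseteq> gens \<Longrightarrow> norm (emb (wval w)) = sqrt 5 ^ length w"
proof -
  assume w: "set w \<subseteq> gens"
  have "(norm (emb (wval w)))\<^sup>2 = (sqrt 5 ^ length w)\<^sup>2"
    unfolding norm_emb inorm_wval[OF w] by (simp add: power_mult[symmetric] mult.commute[of _ 2] power_mult)
  then show ?thesis by simp
qed

lemma qmult_diff_right: "qmult p (q - r) = qmult p q - qmult p r"
  by (simp add: qmult_def comp3 algebra_simps)

text \<open>The products of a conjugate word with a nearby word: their norm is \<open>(5 ^ l)\<^sup>2\<close> and they are close to the real
  quaternion \<open>5 ^ l\<close>.\<close>

definition near_int :: "real \<Rightarrow> nat \<Rightarrow> iquat set" where
  "near_int D l = {\<beta>. inorm \<beta> = 25 ^ l \<and> \<not> div5 \<beta> \<and> norm (emb \<beta> - (5 ^ l, 0)) \<le> D * 5 ^ l}"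

text \<open>The quotient of two words with different first letters is a reduced word of twice the length, and reduced
  words of equal length have different values.\<close>

lemma card_branching:
  assumes l: "l \<ge> 1" and fin: "finite (near_int D l)"
  shows "card (branching D l) \<le> card (near_int D l)"
proof (rule card_inj_on_le[of "\<lambda>(v,v'). wval (rev (map icnj v) @ v')"])
  show "inj_on (\<lambda>(v,v'). wval (rev (map icnj v) @ v')) (branching D l)"
  proof (rule inj_onI, clarify)
    fix v v' w w' assume a: "(v,v') \<in> branching D l" "(w,w') \<in> branching D l"
      and e: "wval (rev (map icnj v) @ v') = wval (rev (map icnj w) @ w')"
    have len: "length v = l" "length v' = l" "length w = l" "length w' = l" using a by (auto simp: branching_def words_def)
    have "rev (map icnj v) @ v' = rev (map icnj w) @ w'"
    proof (rule wval_inj[OF _ _ _ e])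
      show "reduced (rev (map icnj v) @ v')" "reduced (rev (map icnj w) @ w')"
        using a len l by (auto simp: branching_def words_def intro!: reduced_quotient)
    qed (use len in simp)
    then have "map icnj v = map icnj w" "v' = w'" using len by auto
    moreover have "inj icnj" by (metis icnj_icnj injI)
    ultimately show "v = w \<and> v' = w'" by (simp add: inj_map_eq_map)
  qed
  show "(\<lambda>(v,v'). wval (rev (map icnj v) @ v')) ` branching D l \<subseteq> near_int D l"
  proof (rule image_subsetI, clarify)
    fix v v' assume a: "(v,v') \<in> branching D l"
    then have h: "reduced v" "reduced v'" "length v = l" "length v' = l" "hd v \<noteq> hd v'" "v \<noteq> []" "v' \<noteq> []" "close D v v'"
      using l by (auto simp: branching_def words_def)
    define \<beta> where "\<beta> = wval (rev (map icnj v) @ v')"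
    have r: "reduced (rev (map icnj v) @ v')" using h by (intro reduced_quotient)
    have "\<not> div5 \<beta>" unfolding \<beta>_def by (rule reduced_not_div5[OF r]) (use h in simp)
    moreover have "inorm \<beta> = 25 ^ l"
      unfolding \<beta>_def using r h by (subst inorm_wval) (auto simp: reduced_def power_add power_mult_distrib[symmetric])
    moreover have "norm (emb \<beta> - (5 ^ l, 0)) \<le> D * 5 ^ l"
    proof -
      have sv: "set v \<subseteq> gens" using h by (simp add: reduced_def)
      have "emb \<beta> = qmult (qcnj (emb (wval v))) (emb (wval v'))"
        by (simp add: \<beta>_def wval_append wval_rev emb_imul emb_icnj)
      moreover have "(5 ^ l, 0) = qmult (qcnj (emb (wval v))) (emb (wval v))"
        using sv h(3) by (simp add: qmult_qcnj norm_emb inorm_wval)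
      ultimately have "emb \<beta> - (5 ^ l, 0) = qmult (qcnj (emb (wval v))) (emb (wval v') - emb (wval v))"
        by (simp add: qmult_diff_right)
      then have "norm (emb \<beta> - (5 ^ l, 0)) = sqrt 5 ^ l * norm (emb (wval v) - emb (wval v'))"
        using sv h(3) by (simp add: norm_qmult norm_emb_wval norm_minus_commute)
      also have "\<dots> \<le> sqrt 5 ^ l * (D * sqrt 5 ^ l)" using h by (intro mult_left_mono) (auto simp: close_def)
      also have "\<dots> = D * 5 ^ l" by (simp add: power_mult_distrib[symmetric])
      finally show ?thesis .
    qed
    ultimately show "wval (rev (map icnj v) @ v') \<in> near_int D l" by (simp add: near_int_def \<beta>_def)
  qed
qed (rule fin)

lemma card_close_pairs:
  "card {(w,w') \<in> words m \<times> words m. close D w w'} \<le> card (words m) + (\<Sum>l\<in>{1..m}. card (words (m - l)) * card (branching D l))"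
proof -
  define P where "P = {(w,w') \<in> words m \<times> words m. close D w w'}"
  define ext where "ext = (\<lambda>(u::iquat list, v::iquat list, v'::iquat list). (u @ v, u @ v'))"
  have sub: "P \<subseteq> (\<lambda>w. (w,w)) ` words m \<union> (\<Union>l\<in>{1..m}. ext ` (words (m - l) \<times> branching D l))"
  proof
    fix z assume "z \<in> P"
    then obtain w w' where z: "z = (w,w')" and 1: "w \<in> words m" "w' \<in> words m" "close D w w'"
      by (auto simp: P_def)
    show "z \<in> (\<lambda>w. (w,w)) ` words m \<union> (\<Union>l\<in>{1..m}. ext ` (words (m - l) \<times> branching D l))"
    proof (cases "w = w'")
      case False
      then obtain u v v' where b: "w = u @ v" "w' = u @ v'" "v \<noteq> []" "v' \<noteq> []" "hd v \<noteq> hd v'" "length v = length v'"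
        using words_branch_apart[of w w'] 1 by (auto simp: words_def)
      have "reduced (u @ v)" "reduced (u @ v')" using 1 unfolding b words_def by simp_all
      then have r: "reduced v" "reduced v'" "reduced u" using reduced_append by blast+
      have m: "length u + length v = m" using 1 b by (simp add: words_def)
      have "close D v v'"
      proof -
        have su: "set u \<subseteq> gens" using r by (simp add: reduced_def)
        have "sqrt 5 ^ length u * norm (emb (wval v) - emb (wval v')) = norm (emb (wval w) - emb (wval w'))"
          unfolding b wval_append emb_imul by (simp add: qmult_diff_right[symmetric] norm_qmult norm_emb_wval[OF su])
        also have "\<dots> \<le> D * sqrt 5 ^ length w" using 1 by (simp add: close_def)
        also have "\<dots> = sqrt 5 ^ length u * (D * sqrt 5 ^ length v)" by (simp add: b power_add)
        finally show ?thesis by (simp add: close_def)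
      qed
      then have "(v,v') \<in> branching D (length v)" using r b by (auto simp: branching_def words_def)
      moreover have "u \<in> words (m - length v)" using r m by (auto simp: words_def)
      ultimately have "(w,w') \<in> ext ` (words (m - length v) \<times> branching D (length v))"
        by (intro image_eqI[where x = "(u,v,v')"]) (auto simp: ext_def b)
      moreover have "length v \<in> {1..m}" using b m by (cases v) auto
      ultimately show ?thesis unfolding z by (intro UnI2 UN_I[of "length v"])
    qed (use 1 z in auto)
  qed
  have fb: "finite (branching D l)" for l unfolding branching_def
    by (rule finite_subset[of _ "words l \<times> words l"]) auto
  have "card P \<le> card ((\<lambda>w. (w,w)) ` words m \<union> (\<Union>l\<in>{1..m}. ext ` (words (m - l) \<times> branching D l)))"
    by (intro card_mono sub) (auto simp: fb)
  also have "\<dots> \<le> card ((\<lambda>w. (w,w)) ` words m) + card (\<Union>l\<in>{1..m}. ext ` (words (m - l) \<times> branching D l))" by (rule card_Un_le)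
  also have "\<dots> \<le> card (words m) + (\<Sum>l\<in>{1..m}. card (ext ` (words (m - l) \<times> branching D l)))"
    by (intro add_mono card_image_le card_UN_le) auto
  also have "\<dots> \<le> card (words m) + (\<Sum>l\<in>{1..m}. card (words (m - l)) * card (branching D l))"
    unfolding card_cartesian_product[symmetric] by (intro add_mono sum_mono card_image_le) (auto simp: fb)
  finally show ?thesis by (simp add: P_def)
qed

text \<open>If \<open>(a, b, c, d)\<close> has norm \<open>Q\<^sup>2\<close> and lies at distance at most \<open>D * Q\<close> from \<open>Q\<close>, then
  \<open>Q - a\<close> lies between \<open>0\<close> and \<open>D\<^sup>2 * Q / 2\<close>, and \<open>(b, c, d)\<close> is on a sphere of squared radius at most
  \<open>D\<^sup>2 * Q\<^sup>2\<close>. The value \<open>a = Q\<close> is excluded by indivisibility; without this the count would never be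
  small.\<close>

lemma near_int_bound:
  assumes l: "l \<ge> 1" and D: "0 < D" "D \<le> 1"
  shows "finite (near_int D l) \<and> real (card (near_int D l)) \<le> 120 * D powr (11/3) * (5 ^ l) powr (8/3)"
proof -
  define Q where "Q = (5::int) ^ l"
  have Q: "Q \<ge> 5" unfolding Q_def using l self_le_power[of "5::int" l] by simp
  define x where "x = real_of_int Q"
  have x: "x \<ge> 5" using Q by (simp add: x_def)
  define y where "y = D\<^sup>2 * x / 2"
  define J where "J = \<lfloor>y\<rfloor>"
  have y0: "0 \<le> y" using D x by (simp add: y_def)
  have yx: "y \<le> x / 2" using D x power_le_one[of D 2] by (simp add: y_def mult_left_le_one_le)
  have QJ: "2 * Q - j \<ge> 0" if "j \<le> J" for j
  proof -
    have "real_of_int j \<le> y" using that unfolding J_def by linarith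
    then have "real_of_int j \<le> real_of_int (2 * Q)" using yx x unfolding x_def by simp
    then show ?thesis by linarith
  qed
  define A where "A = (SIGMA j:{1..J}. sphere3 (j * (2 * Q - j)))"
  define h where "h = (\<lambda>(j, b, c, d). (Q - j, b, c, d) :: iquat)"
  have sub: "near_int D l \<subseteq> h ` A"
  proof
    fix \<beta> assume b: "\<beta> \<in> near_int D l"
    obtain a b c d where be: "\<beta> = (a,b,c,d)" by (metis prod_cases4)
    have n: "a\<^sup>2 + b\<^sup>2 + c\<^sup>2 + d\<^sup>2 = Q\<^sup>2" and nd: "\<not> div5 \<beta>" and nr: "norm (emb \<beta> - (5 ^ l, 0)) \<le> D * 5 ^ l"
      using b by (auto simp: near_int_def be Q_def power_mult_distrib[symmetric] power2_eq_square)
    have x5: "5 ^ l = x" by (simp add: x_def Q_def)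
    have "(norm (emb \<beta> - (x, 0)))\<^sup>2 \<le> (D * x)\<^sup>2" using nr unfolding x5 by (intro power_mono) auto
    moreover have "(norm (emb \<beta> - (x, 0)))\<^sup>2 = real_of_int ((a - Q)\<^sup>2 + b\<^sup>2 + c\<^sup>2 + d\<^sup>2)"
    proof -
      have "emb \<beta> - (x, 0) = (real_of_int (a - Q), vector [real_of_int b, real_of_int c, real_of_int d])"
        by (simp add: be x_def)
      then show ?thesis unfolding norm_q by (simp add: inner_vec_def sum_3 power2_eq_square)
    qed
    moreover have "(a - Q)\<^sup>2 + b\<^sup>2 + c\<^sup>2 + d\<^sup>2 = 2 * Q * (Q - a)" using n by (simp add: power2_eq_square algebra_simps)
    ultimately have "2 * x * real_of_int (Q - a) \<le> (D * x)\<^sup>2" by (simp add: x_def)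
    then have "2 * x * real_of_int (Q - a) \<le> 2 * x * y" by (simp add: y_def power2_eq_square algebra_simps)
    then have "real_of_int (Q - a) \<le> y" using x by simp
    then have J: "Q - a \<le> J" unfolding J_def by (simp add: le_floor_iff)
    have aQ: "a \<le> Q"
    proof -
      have "a\<^sup>2 \<le> Q\<^sup>2" using n zero_le_power2[of b] zero_le_power2[of c] zero_le_power2[of d] by linarith
      then show ?thesis using Q by (metis abs_le_square_iff abs_ge_self abs_of_nonneg order_trans zero_le_numeral)
    qed
    have "a \<noteq> Q"
    proof
      assume "a = Q"
      then have "b\<^sup>2 + c\<^sup>2 + d\<^sup>2 = 0" using n by simp
      then have "b = 0 \<and> c = 0 \<and> d = 0"
        using zero_le_power2[of b] zero_le_power2[of c] zero_le_power2[of d] by (simp add: add_nonneg_eq_0_iff)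
      moreover have "5 dvd Q" unfolding Q_def using l by (simp add: dvd_power)
      ultimately show False using nd \<open>a = Q\<close> by (simp add: be)
    qed
    then have "Q - a \<in> {1..J}" using J aQ by auto
    moreover have "(b,c,d) \<in> sphere3 ((Q - a) * (2 * Q - (Q - a)))"
      using n by (simp add: sphere3_def power2_eq_square algebra_simps)
    ultimately show "\<beta> \<in> h ` A" unfolding be A_def h_def by (intro image_eqI[where x = "(Q - a, b, c, d)"]) auto
  qed
  have nn: "0 \<le> j * (2 * Q - j)" if "j \<in> {1..J}" for j using that QJ[of j] by simp
  have finA: "finite A" unfolding A_def using card_sphere3 nn by (intro finite_SigmaI) auto
  have s: "real (card (sphere3 (j * (2 * Q - j)))) \<le> 120 * (2 * D\<^sup>2 * x\<^sup>2) powr (5/6)" if j: "j \<in> {1..J}" for j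
  proof -
    have "real (card (sphere3 (j * (2 * Q - j)))) \<le> 120 * (real_of_int (j * (2 * Q - j)) + 1) powr (5/6)"
      using card_sphere3 nn[OF j] by blast
    also have "\<dots> \<le> 120 * (2 * D\<^sup>2 * x\<^sup>2) powr (5/6)"
    proof (intro mult_left_mono powr_mono2)
      have j1: "real_of_int j \<le> y" "1 \<le> y" using j unfolding J_def by (auto simp: le_floor_iff)
      have "0 \<le> real_of_int (j * (2 * Q - j))" using nn[OF j] by (simp only: of_int_0_le_iff)
      then show "0 \<le> real_of_int (j * (2 * Q - j)) + 1" by linarith
      have "real_of_int (j * (2 * Q - j)) = real_of_int j * (2 * x - real_of_int j)" by (simp add: x_def)
      also have "\<dots> \<le> real_of_int j * (2 * x)" using j by (intro mult_left_mono) auto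
      also have "\<dots> \<le> y * (2 * x)" using j1 x by (intro mult_right_mono) auto
      finally have "real_of_int (j * (2 * Q - j)) \<le> D\<^sup>2 * x\<^sup>2" by (simp add: y_def power2_eq_square)
      moreover have "1 \<le> D\<^sup>2 * x\<^sup>2"
      proof -
        have "1 * 1 \<le> y * (2 * x)" using j1 x by (intro mult_mono) auto
        then show ?thesis by (simp add: y_def power2_eq_square)
      qed
      ultimately show "real_of_int (j * (2 * Q - j)) + 1 \<le> 2 * D\<^sup>2 * x\<^sup>2" by simp
    qed auto
    finally show ?thesis .
  qed
  have "card (near_int D l) \<le> card A"
    using card_mono[OF finite_imageI[OF finA] sub] card_image_le[OF finA, of h] by linarith
  then have "real (card (near_int D l)) \<le> real (card A)" by simp
  also have "\<dots> = (\<Sum>j\<in>{1..J}. real (card (sphere3 (j * (2 * Q - j)))))"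
    unfolding A_def using card_sphere3 nn by (subst card_SigmaI) auto
  also have "\<dots> \<le> (\<Sum>j\<in>{1..J}. 120 * (2 * D\<^sup>2 * x\<^sup>2) powr (5/6))" by (intro sum_mono s)
  also have "\<dots> = real (nat J) * (120 * (2 * D\<^sup>2 * x\<^sup>2) powr (5/6))" by simp
  also have "\<dots> \<le> y * (120 * (2 * D\<^sup>2 * x\<^sup>2) powr (5/6))"
  proof (intro mult_right_mono)
    have "J \<ge> 0" using y0 by (simp add: J_def)
    then show "real (nat J) \<le> y" unfolding J_def by linarith
  qed auto
  also have "\<dots> \<le> 120 * D powr (11/3) * x powr (8/3)"
  proof -
    have "(2 * D\<^sup>2 * x\<^sup>2) powr (5/6) = 2 powr (5/6) * (D powr (5/3) * x powr (5/3))"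
    proof -
      have sq: "(u\<^sup>2) powr (5/6) = u powr (5/3)" if "u > 0" for u :: real
      proof -
        have "u\<^sup>2 = u powr 2" using that by simp
        then have "(u\<^sup>2) powr (5/6) = (u powr 2) powr (5/6)" by (rule arg_cong)
        then show ?thesis unfolding powr_powr by simp
      qed
      have "(2 * D\<^sup>2 * x\<^sup>2) powr (5/6) = 2 powr (5/6) * (D\<^sup>2) powr (5/6) * (x\<^sup>2) powr (5/6)"
      proof -
        have "(2 * D\<^sup>2 * x\<^sup>2) powr (5/6) = (2 * D\<^sup>2) powr (5/6) * (x\<^sup>2) powr (5/6)" by (rule powr_mult)
        moreover have "(2 * D\<^sup>2) powr (5/6) = 2 powr (5/6) * (D\<^sup>2) powr (5/6)" by (rule powr_mult)
        ultimately show ?thesis by (simp only:)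
      qed
      moreover have "x > 0" using x by simp
      ultimately show ?thesis using sq[OF D(1)] sq[of x] by (simp only: mult.assoc)
    qed
    also have "\<dots> \<le> 2 powr 1 * (D powr (5/3) * x powr (5/3))" by (intro mult_right_mono powr_mono) auto
    finally have h: "(2 * D\<^sup>2 * x\<^sup>2) powr (5/6) \<le> 2 * (D powr (5/3) * x powr (5/3))" by simp
    have "y * (120 * (2 * D\<^sup>2 * x\<^sup>2) powr (5/6)) \<le> y * (120 * (2 * (D powr (5/3) * x powr (5/3))))"
      by (intro mult_left_mono h y0) simp
    also have "\<dots> = 120 * (D powr 2 * D powr (5/3)) * (x powr 1 * x powr (5/3))"
    proof -
      have "D powr 2 = D\<^sup>2" "x powr 1 = x" using D x by simp_all
      then show ?thesis unfolding y_def by (simp only:) (simp add: ac_simps)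
    qed
    also have "\<dots> = 120 * D powr (11/3) * x powr (8/3)" by (simp only: powr_add[symmetric]) simp
    finally show ?thesis .
  qed
  finally have "real (card (near_int D l)) \<le> 120 * D powr (11/3) * x powr (8/3)" .
  moreover have "x = 5 ^ l" by (simp add: x_def Q_def)
  ultimately show ?thesis using finite_subset[OF sub finite_imageI[OF finA]] by simp
qed

section \<open>Word operators and the tree recurrence\<close>

definition unitq :: "iquat list \<Rightarrow> quaternion" where
  "unitq w = (1 / sqrt 5 ^ length w) *\<^sub>R emb (wval w)"

text \<open>The operators of the walk without backtracking on the tree of degree six.\<close>

definition wop :: "nat \<Rightarrow> (real^3 \<Rightarrow> real) \<Rightarrow> real^3 \<Rightarrow> real" where
  "wop m f x = (\<Sum>w\<in>words m. f (rot (unitq w) x))"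

definition hecke :: "(real^3 \<Rightarrow> real) \<Rightarrow> real^3 \<Rightarrow> real" where
  "hecke f x = (\<Sum>a\<in>gens. f (rot (unitq [a]) x))"

lemma norm_unitq: "w \<in> words m \<Longrightarrow> norm (unitq w) = 1"
  by (auto simp: unitq_def words_def reduced_def norm_emb_wval)

lemma norm_unitq1: "a \<in> gens \<Longrightarrow> norm (unitq [a]) = 1"
  using norm_emb_wval[of "[a]"] by (simp add: unitq_def)

lemma unitq_Cons: "rot (unitq (a # w)) x = rot (unitq [a]) (rot (unitq w) x)"
proof -
  have s: "rot (qmult (c *\<^sub>R p) (d *\<^sub>R q)) x = rot ((c * d) *\<^sub>R qmult p q) x" for c d p q
    by (simp add: qmult_def comp3 algebra_simps rot_def power2_eq_square)
  show ?thesis unfolding rot_qmult[symmetric] unitq_def s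
    by (simp add: emb_imul)
qed

lemma unitq_Nil [simp]: "rot (unitq []) x = x"
  by (simp add: unitq_def rot_def comp3)

lemma unitq_icnj: assumes "a \<in> gens" shows "rot (unitq [icnj a]) (rot (unitq [a]) x) = x"
proof -
  have "unitq [icnj a] = qcnj (unitq [a])"
    by (simp add: unitq_def emb_icnj) (simp add: qcnj_def)
  then show ?thesis using norm_unitq1[OF assms] by simp
qed

lemma wop_cont: assumes "cont f" shows "cont (wop m f)"
  unfolding wop_def by (intro continuous_intros cont_comp[OF assms])

lemma hecke_cont: assumes "cont f" shows "cont (hecke f)"
  unfolding hecke_def by (intro continuous_intros cont_comp[OF assms])

lemma hecke_harm: "harm d f \<Longrightarrow> harm d (hecke f)"
  unfolding hecke_def by (intro harm_sum harm_rot norm_unitq1) auto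

lemma wop_harm: "harm d f \<Longrightarrow> harm d (wop m f)"
  unfolding wop_def by (intro harm_sum harm_rot norm_unitq finite_words) auto

lemma wop_1: "wop (Suc 0) f = hecke f"
  unfolding wop_def hecke_def words_1 by (subst sum.reindex) (auto simp: inj_on_def fun_eq_iff)

text \<open>Prepending a letter to a reduced word gives a reduced word unless the letter cancels the first one, and then
  only the tail is left.\<close>

lemma wop_Suc_Suc:
  "wop (Suc (Suc m)) f x = wop (Suc m) (hecke f) x - (\<Sum>w\<in>words (Suc m). f (rot (unitq (tl w)) x))"
proof -
  have inj: "inj_on (\<lambda>(w,x). x # w) (SIGMA w:words (Suc m). gens - {icnj (hd w)})" by (auto simp: inj_on_def)
  have "wop (Suc (Suc m)) f x = (\<Sum>(w,a)\<in>(SIGMA w:words (Suc m). gens - {icnj (hd w)}). f (rot (unitq (a # w)) x))"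
    unfolding wop_def words_Suc_Suc by (subst sum.reindex[OF inj]) (simp add: case_prod_beta)
  also have "\<dots> = (\<Sum>w\<in>words (Suc m). \<Sum>a\<in>gens - {icnj (hd w)}. f (rot (unitq [a]) (rot (unitq w) x)))"
    by (subst sum.Sigma[symmetric]) (simp_all add: unitq_Cons[symmetric])
  also have "\<dots> = (\<Sum>w\<in>words (Suc m). hecke f (rot (unitq w) x) - f (rot (unitq (tl w)) x))"
  proof (intro sum.cong refl)
    fix w assume w: "w \<in> words (Suc m)"
    then obtain h t where ht: "w = h # t" "h \<in> gens" by (cases w) (auto simp: words_def reduced_def)
    have "rot (unitq [icnj h]) (rot (unitq w) x) = rot (unitq t) x"
      unfolding ht(1) unitq_Cons[of h t] by (rule unitq_icnj[OF ht(2)])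
    then show "(\<Sum>a\<in>gens - {icnj (hd w)}. f (rot (unitq [a]) (rot (unitq w) x))) = hecke f (rot (unitq w) x) - f (rot (unitq (tl w)) x)"
      using icnj_gens[OF ht(2)] by (subst sum_diff1) (simp_all add: hecke_def ht(1))
  qed
  finally show ?thesis by (simp add: wop_def sum_subtractf)
qed

lemma sum_tl_words: "(\<Sum>w\<in>words (Suc (Suc m)). (h (tl w) :: real)) = 5 * (\<Sum>w\<in>words (Suc m). h w)"
proof -
  have inj: "inj_on (\<lambda>(w,x). x # w) (SIGMA w:words (Suc m). gens - {icnj (hd w)})" by (auto simp: inj_on_def)
  have "(\<Sum>w\<in>words (Suc (Suc m)). h (tl w)) = (\<Sum>(w,a)\<in>(SIGMA w:words (Suc m). gens - {icnj (hd w)}). h w)"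
    unfolding words_Suc_Suc by (subst sum.reindex[OF inj]) (simp add: case_prod_beta)
  also have "\<dots> = (\<Sum>w\<in>words (Suc m). \<Sum>a\<in>gens - {icnj (hd w)}. h w)"
    by (subst sum.Sigma[symmetric]) simp_all
  also have "\<dots> = (\<Sum>w\<in>words (Suc m). 5 * h w)"
  proof (intro sum.cong refl)
    fix w assume "w \<in> words (Suc m)"
    then have "hd w \<in> gens" by (cases w) (auto simp: words_def reduced_def)
    then show "(\<Sum>a\<in>gens - {icnj (hd w)}. h w) = 5 * h w" by (simp add: icnj_gens card_gens)
  qed
  finally show ?thesis by (simp add: sum_distrib_left)
qed

lemma wop_rec: "wop (Suc (Suc (Suc m))) f x = wop (Suc (Suc m)) (hecke f) x - 5 * wop (Suc m) f x"
  unfolding wop_Suc_Suc[of "Suc m"] sum_tl_words[of "\<lambda>w. f (rot (unitq w) x)"] by (simp add: wop_def)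

lemma wop_2: "wop (Suc (Suc 0)) f x = hecke (hecke f) x - 6 * f x"
proof -
  have "(\<Sum>w\<in>words (Suc 0). f (rot (unitq (tl w)) x)) = 6 * f x"
    unfolding words_1 by (subst sum.reindex) (auto simp: inj_on_def card_gens)
  then show ?thesis unfolding wop_Suc_Suc wop_1 by simp
qed

definition nrm :: "(real^3 \<Rightarrow> real) \<Rightarrow> real" where "nrm f = sqrt (ip f f)"

lemma nrm_ge0 [simp]: "0 \<le> nrm f" by (simp add: nrm_def)
lemma nrm_sq: "(nrm f)\<^sup>2 = ip f f" by (simp add: nrm_def)

lemma nrm_add: assumes "cont f" "cont g" shows "nrm (\<lambda>x. f x + g x) \<le> nrm f + nrm g"
proof -
  have c: "cont (\<lambda>x. f x + g x)" by (intro continuous_intros assms)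
  have "ip (\<lambda>x. f x + g x) (\<lambda>x. f x + g x) = ip f (\<lambda>x. f x + g x) + ip g (\<lambda>x. f x + g x)"
    by (rule ip_add[OF assms c])
  also have "\<dots> = ip (\<lambda>x. f x + g x) f + ip (\<lambda>x. f x + g x) g" by (simp only: ip_commute)
  also have "\<dots> = ip f f + ip g f + (ip f g + ip g g)"
    by (simp only: ip_add[OF assms assms(1)] ip_add[OF assms assms(2)])
  also have "\<dots> = ip f f + 2 * ip f g + ip g g" by (simp add: ip_commute)
  also have "\<dots> \<le> (nrm f)\<^sup>2 + 2 * (nrm f * nrm g) + (nrm g)\<^sup>2"
    using ip_CS'[OF assms] by (simp add: nrm_sq nrm_def)
  also have "\<dots> = (nrm f + nrm g)\<^sup>2" by (simp add: power2_sum)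
  finally show ?thesis unfolding nrm_def[of "\<lambda>x. f x + g x"] by (intro real_le_lsqrt) auto
qed

lemma nrm_scale: "nrm (\<lambda>x. c * f x) = \<bar>c\<bar> * nrm f"
proof -
  have "ip (\<lambda>x. c * f x) (\<lambda>x. c * f x) = c * ip f (\<lambda>x. c * f x)" by (rule ip_scale)
  also have "ip f (\<lambda>x. c * f x) = ip (\<lambda>x. c * f x) f" by (rule ip_commute)
  also have "\<dots> = c * ip f f" by (rule ip_scale)
  finally have "ip (\<lambda>x. c * f x) (\<lambda>x. c * f x) = c\<^sup>2 * ip f f" by (simp add: power2_eq_square)
  then show ?thesis by (simp add: nrm_def real_sqrt_mult)
qed

lemma nrm_rot: "norm q = 1 \<Longrightarrow> cont f \<Longrightarrow> nrm (\<lambda>x. f (rot q x)) = nrm f"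
  by (simp add: nrm_def ip_rot)

lemma nrm_sum: "finite I \<Longrightarrow> (\<And>i. i \<in> I \<Longrightarrow> cont (f i)) \<Longrightarrow> nrm (\<lambda>x. \<Sum>i\<in>I. f i x) \<le> (\<Sum>i\<in>I. nrm (f i))"
proof (induction rule: finite_induct)
  case empty then show ?case by (simp add: nrm_def ip_def)
next
  case (insert i I)
  have "nrm (\<lambda>x. f i x + (\<Sum>j\<in>I. f j x)) \<le> nrm (f i) + nrm (\<lambda>x. \<Sum>j\<in>I. f j x)"
    using insert by (intro nrm_add continuous_on_sum) auto
  then show ?case using insert by simp
qed

lemma nrm_wop_trivial: assumes "cont f" shows "nrm (wop m f) \<le> card (words m) * nrm f"
proof -
  have "nrm (wop m f) \<le> (\<Sum>w\<in>words m. nrm (\<lambda>x. f (rot (unitq w) x)))"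
    unfolding wop_def by (intro nrm_sum finite_words cont_comp[OF assms] continuous_intros)
  also have "\<dots> = (\<Sum>w\<in>words m. nrm f)" by (intro sum.cong refl nrm_rot norm_unitq assms)
  finally show ?thesis by simp
qed

lemma hecke_selfadjoint: assumes "cont f" "cont g" shows "ip f (hecke g) = ip (hecke f) g"
proof -
  have fr: "cont (\<lambda>x. f (rot q x))" "cont (\<lambda>x. g (rot q x))" for q by (intro cont_comp[OF assms(1)] cont_comp[OF assms(2)] continuous_intros)+
  have "ip f (hecke g) = (\<Sum>a\<in>gens. ip f (\<lambda>x. g (rot (unitq [a]) x)))"
    unfolding hecke_def by (intro ip_sum_right finite_gens fr assms)
  also have "\<dots> = (\<Sum>a\<in>gens. ip (\<lambda>x. f (rot (unitq [icnj a]) x)) g)"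
  proof (intro sum.cong refl)
    fix a assume a: "a \<in> gens"
    have "unitq [icnj a] = qcnj (unitq [a])" by (simp add: unitq_def emb_icnj) (simp add: qcnj_def)
    then show "ip f (\<lambda>x. g (rot (unitq [a]) x)) = ip (\<lambda>x. f (rot (unitq [icnj a]) x)) g"
      using ip_rot_adj[OF norm_unitq1[OF a] assms] by simp
  qed
  also have "\<dots> = (\<Sum>a\<in>gens. ip (\<lambda>x. f (rot (unitq [a]) x)) g)"
    by (rule sum.reindex_bij_witness[of _ icnj icnj]) (auto simp: icnj_gens)
  also have "\<dots> = ip (hecke f) g" unfolding hecke_def by (intro ip_sum[symmetric] finite_gens fr assms)
  finally show ?thesis .
qed

text \<open>Small values of this mean an approximate eigenfunction. Working with these avoids any use of the
  finite dimension of the space of harmonics.\<close>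

definition shift :: "real \<Rightarrow> (real^3 \<Rightarrow> real) \<Rightarrow> real^3 \<Rightarrow> real" where
  "shift \<mu> f x = hecke (hecke f) x - \<mu> * f x"

text \<open>The polynomial by which the word operator of length \<open>2 * k + 2\<close> acts on an eigenfunction of \<open>hecke \<circ> hecke\<close>
  with eigenvalue \<open>\<mu>\<close>.\<close>

fun walk_poly :: "real \<Rightarrow> nat \<Rightarrow> real" where
  "walk_poly \<mu> 0 = \<mu> - 6"
| "walk_poly \<mu> (Suc 0) = (\<mu> - 10) * (\<mu> - 6) - 30"
| "walk_poly \<mu> (Suc (Suc k)) = (\<mu> - 10) * walk_poly \<mu> (Suc k) - 25 * walk_poly \<mu> k"

lemma wop_linear: "wop m (\<lambda>x. f x - c * g x) x = wop m f x - c * wop m g x"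
  by (simp add: wop_def sum_subtractf sum_distrib_left)

lemma wop_rec2:
  "wop (2 * Suc (Suc (Suc k))) f x = wop (2 * Suc (Suc k)) (shift \<mu> f) x + (\<mu> - 10) * wop (2 * Suc (Suc k)) f x - 25 * wop (2 * Suc k) f x"
proof -
  define n where "n = Suc (2 * k)"
  have e: "2 * Suc (Suc (Suc k)) = Suc (Suc (Suc (Suc (Suc n))))" "2 * Suc (Suc k) = Suc (Suc (Suc n))" "2 * Suc k = Suc n"
    by (simp_all add: n_def)
  have "wop (Suc (Suc (Suc (Suc (Suc n))))) f x = wop (Suc (Suc (Suc (Suc n)))) (hecke f) x - 5 * wop (Suc (Suc (Suc n))) f x"
    by (rule wop_rec)
  also have "wop (Suc (Suc (Suc (Suc n)))) (hecke f) x = wop (Suc (Suc (Suc n))) (hecke (hecke f)) x - 5 * wop (Suc (Suc n)) (hecke f) x"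
    by (rule wop_rec)
  also have "wop (Suc (Suc n)) (hecke f) x = wop (Suc (Suc (Suc n))) f x + 5 * wop (Suc n) f x"
    using wop_rec[of n f x] by simp
  finally show ?thesis unfolding e shift_def wop_linear by (simp add: algebra_simps)
qed

lemma wop_4: "wop 4 f x = wop 2 (shift \<mu> f) x + (\<mu> - 10) * wop 2 f x - 30 * f x"
proof -
  have e: "4 = Suc (Suc (Suc (Suc 0)))" "2 = Suc (Suc 0)" by simp_all
  have "wop (Suc (Suc (Suc (Suc 0)))) f x = wop (Suc (Suc (Suc 0))) (hecke f) x - 5 * wop (Suc (Suc 0)) f x" by (rule wop_rec)
  also have "wop (Suc (Suc (Suc 0))) (hecke f) x = wop (Suc (Suc 0)) (hecke (hecke f)) x - 5 * wop (Suc 0) (hecke f) x" by (rule wop_rec)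
  also have "wop (Suc 0) (hecke f) x = wop (Suc (Suc 0)) f x + 6 * f x" by (simp add: wop_1 wop_2)
  finally show ?thesis unfolding e shift_def wop_linear by (simp add: algebra_simps)
qed

lemma shift_cont: "cont f \<Longrightarrow> cont (shift \<mu> f)"
  unfolding shift_def by (intro continuous_intros hecke_cont)

lemma walk_poly_approx:
  "\<exists>K\<ge>0. \<forall>f. cont f \<longrightarrow> nrm (\<lambda>x. wop (2 * Suc k) f x - walk_poly \<mu> k * f x) \<le> K * nrm (shift \<mu> f)"
proof (induction k rule: induct_nat_012)
  case 0
  have "(\<lambda>x. wop (2 * Suc 0) f x - walk_poly \<mu> 0 * f x) = shift \<mu> f" for f
    using wop_2[of f] by (auto simp: shift_def fun_eq_iff algebra_simps numeral_2_eq_2)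
  then show ?case by (intro exI[of _ 1]) auto
next
  case 1
  have "(\<lambda>x. wop (2 * Suc (Suc 0)) f x - walk_poly \<mu> (Suc 0) * f x) = (\<lambda>x. wop 2 (shift \<mu> f) x + (\<mu> - 10) * shift \<mu> f x)" for f
  proof (rule ext)
    fix x
    have e: "2 * Suc (Suc 0) = (4::nat)" "Suc (Suc 0) = (2::nat)" by simp_all
    have w2: "wop 2 f x = hecke (hecke f) x - 6 * f x" using wop_2[of f x] unfolding e .
    have w4: "wop (2 * Suc (Suc 0)) f x = wop 2 (shift \<mu> f) x + (\<mu> - 10) * wop 2 f x - 30 * f x"
      unfolding e(1) by (rule wop_4)
    show "wop (2 * Suc (Suc 0)) f x - walk_poly \<mu> (Suc 0) * f x = wop 2 (shift \<mu> f) x + (\<mu> - 10) * shift \<mu> f x"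
      unfolding w4 w2 by (simp add: shift_def[of \<mu> f] algebra_simps)
  qed
  moreover have "nrm (\<lambda>x. wop 2 (shift \<mu> f) x + (\<mu> - 10) * shift \<mu> f x) \<le> (card (words 2) + \<bar>\<mu> - 10\<bar>) * nrm (shift \<mu> f)" if "cont f" for f
  proof -
    have "nrm (\<lambda>x. wop 2 (shift \<mu> f) x + (\<mu> - 10) * shift \<mu> f x) \<le> nrm (wop 2 (shift \<mu> f)) + nrm (\<lambda>x. (\<mu> - 10) * shift \<mu> f x)"
      by (intro nrm_add wop_cont shift_cont that continuous_intros)
    then show ?thesis using nrm_wop_trivial[OF shift_cont[OF that], of 2 \<mu>]
      unfolding nrm_scale distrib_right by linarith
  qed
  ultimately show ?case by (intro exI[of _ "card (words 2) + \<bar>\<mu> - 10\<bar>"]) auto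
next
  case (ge2 k)
  obtain K1 where K1: "K1 \<ge> 0" "\<And>f. cont f \<Longrightarrow> nrm (\<lambda>x. wop (2 * Suc (Suc k)) f x - walk_poly \<mu> (Suc k) * f x) \<le> K1 * nrm (shift \<mu> f)" using ge2(2) by blast
  obtain K2 where K2: "K2 \<ge> 0" "\<And>f. cont f \<Longrightarrow> nrm (\<lambda>x. wop (2 * Suc k) f x - walk_poly \<mu> k * f x) \<le> K2 * nrm (shift \<mu> f)" using ge2(1) by blast
  define N where "N = card (words (2 * Suc (Suc k)))"
  show ?case
  proof (intro exI[of _ "N + \<bar>\<mu> - 10\<bar> * K1 + 25 * K2"] conjI allI impI)
    fix f :: "real^3 \<Rightarrow> real" assume f: "cont f"
    define u where "u = wop (2 * Suc (Suc k)) (shift \<mu> f)"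
    define v where "v x = wop (2 * Suc (Suc k)) f x - walk_poly \<mu> (Suc k) * f x" for x
    define w where "w x = wop (2 * Suc k) f x - walk_poly \<mu> k * f x" for x
    have c: "cont u" "cont v" "cont w" unfolding u_def v_def w_def by (intro continuous_intros wop_cont shift_cont f)+
    have eq: "(\<lambda>x. wop (2 * Suc (Suc (Suc k))) f x - walk_poly \<mu> (Suc (Suc k)) * f x) = (\<lambda>x. (u x + (\<mu> - 10) * v x) + (-25) * w x)"
      unfolding wop_rec2[of k f _ \<mu>] by (auto simp: u_def v_def w_def algebra_simps)
    have "nrm (\<lambda>x. wop (2 * Suc (Suc (Suc k))) f x - walk_poly \<mu> (Suc (Suc k)) * f x) \<le> nrm (\<lambda>x. u x + (\<mu> - 10) * v x) + nrm (\<lambda>x. (-25) * w x)"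
      unfolding eq by (intro nrm_add continuous_intros c)
    also have "\<dots> \<le> nrm u + nrm (\<lambda>x. (\<mu> - 10) * v x) + nrm (\<lambda>x. (-25) * w x)"
      by (intro add_mono nrm_add continuous_intros c order_refl)
    also have "\<dots> = nrm u + \<bar>\<mu> - 10\<bar> * nrm v + 25 * nrm w" by (simp add: nrm_scale[of "-25", simplified] nrm_scale)
    also have "\<dots> \<le> N * nrm (shift \<mu> f) + \<bar>\<mu> - 10\<bar> * (K1 * nrm (shift \<mu> f)) + 25 * (K2 * nrm (shift \<mu> f))"
      unfolding u_def v_def w_def N_def
      by (intro add_mono mult_left_mono K1 K2 f nrm_wop_trivial shift_cont) auto
    finally show "nrm (\<lambda>x. wop (2 * Suc (Suc (Suc k))) f x - walk_poly \<mu> (Suc (Suc k)) * f x) \<le> (N + \<bar>\<mu> - 10\<bar> * K1 + 25 * K2) * nrm (shift \<mu> f)"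
      by (simp add: algebra_simps)
  qed (use K1 K2 in auto)
qed

text \<open>The growth rates of the recurrence are the roots of \<open>z\<^sup>2 - (\<mu> - 10) z + 25\<close>, and the larger one is at least
  \<open>y\<close> when \<open>\<mu> - 10 \<ge> y + 25 / y\<close>.\<close>

lemma walk_poly_growth:
  assumes y: "5 \<le> y" "y \<le> 25" and mu: "\<mu> \<ge> y + 25 / y + 10"
  shows "walk_poly \<mu> k \<ge> y ^ Suc k \<and> walk_poly \<mu> (Suc k) \<ge> y * walk_poly \<mu> k"
proof (induction k)
  case 0
  define s where "s = \<mu> - 6"
  have s: "s \<ge> y + 25 / y + 4" using mu by (simp add: s_def)
  have 1: "s \<ge> y" using s y by (smt (verit) divide_nonneg_nonneg)
  have "0 \<le> (25 - y) * (y + 5)" using y by (intro mult_nonneg_nonneg) auto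
  then have "5 * y * y \<le> 625 + 100 * y" by (simp add: algebra_simps)
  then have "5 * y \<le> 625 / y + 100" using y by (simp add: field_simps)
  then have "30 * y \<le> 25 * (y + 25 / y + 4)" by (simp add: algebra_simps)
  also have "\<dots> \<le> 25 * s" using s by simp
  finally have "30 \<le> 25 / y * s" using y by (simp add: field_simps)
  moreover have "(\<mu> - 10) * s \<ge> (y + 25 / y) * s" using mu 1 y by (intro mult_right_mono) auto
  ultimately have "(\<mu> - 10) * s - 30 \<ge> y * s" by (simp add: distrib_right)
  then show ?case using 1 by (simp add: s_def)
next
  case (Suc k)
  define a where "a = walk_poly \<mu> k"
  define b where "b = walk_poly \<mu> (Suc k)"
  have h: "a \<ge> y ^ Suc k" "b \<ge> y * a" using Suc by (auto simp: a_def b_def)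
  have a0: "a \<ge> 0" using h(1) y by (meson order_trans zero_le_power zero_le_numeral)
  then have b0: "b \<ge> 0" using h(2) y by (meson mult_nonneg_nonneg order_trans zero_le_numeral)
  have 1: "b \<ge> y ^ Suc (Suc k)"
  proof -
    have "y * y ^ Suc k \<le> y * a" using h(1) y by (intro mult_left_mono) auto
    then show ?thesis using h(2) by simp
  qed
  have "25 * a \<le> 25 / y * b" using h(2) y by (simp add: field_simps)
  moreover have "(\<mu> - 10) * b \<ge> (y + 25 / y) * b" using mu b0 by (intro mult_right_mono) auto
  ultimately have "(\<mu> - 10) * b - 25 * a \<ge> y * b" by (simp add: distrib_right)
  then show ?case using 1 by (simp add: a_def b_def)
qed

text \<open>Let \<open>\<mu>\<close> be the supremum of the Rayleigh quotients of \<open>hecke \<circ> hecke\<close>. Almost maximizing functions are approximate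
  eigenfunctions, so the word operator acts on them nearly by \<open>walk_poly \<mu> k\<close>, which must not exceed its norm
  \<open>N\<close>; but it does if \<open>\<mu>\<close> is larger than claimed.\<close>

lemma hecke_bound_from_words:
  assumes y: "5 \<le> y" "y \<le> 25"
    and N: "\<And>f. harm d f \<Longrightarrow> nrm (wop (2 * Suc k) f) \<le> N * nrm f" and lt: "N < y ^ Suc k"
    and f: "harm d f"
  shows "ip (hecke f) (hecke f) \<le> (y + 25 / y + 10) * ip f f"
proof (rule ccontr)
  assume neg: "\<not> ip (hecke f) (hecke f) \<le> (y + 25 / y + 10) * ip f f"
  note fc = harm_cont[OF f]
  have hb: "nrm (hecke g) \<le> 6 * nrm g" if "cont g" for g
    using nrm_wop_trivial[OF that, of "Suc 0"] card_words[of "Suc 0"] by (simp add: wop_1)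
  have f0: "ip f f > 0"
  proof (rule ccontr)
    assume "\<not> ip f f > 0"
    then have "ip f f = 0" using ip_nonneg[of f] by linarith
    then have "nrm (hecke f) \<le> 0" using hb[OF fc] by (simp add: nrm_def)
    then have "ip (hecke f) (hecke f) \<le> 0" by (simp add: nrm_def)
    then have "ip (hecke f) (hecke f) = 0" using ip_nonneg[of "hecke f"] by linarith
    then show False using neg \<open>ip f f = 0\<close> by simp
  qed
  define M where "M = {ip (hecke g) (hecke g) / ip g g | g. harm d g \<and> ip g g > 0}"
  have bdd: "bdd_above M"
  proof (rule bdd_aboveI[of _ 36])
    fix z assume "z \<in> M"
    then obtain g where g: "z = ip (hecke g) (hecke g) / ip g g" "harm d g" "ip g g > 0" by (auto simp: M_def)
    have "(nrm (hecke g))\<^sup>2 \<le> (6 * nrm g)\<^sup>2" using hb[OF harm_cont[OF g(2)]] by (intro power_mono) auto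
    then show "z \<le> 36" using g(3) by (simp add: g(1) nrm_sq power_mult_distrib pos_divide_le_eq)
  qed
  define \<mu> where "\<mu> = Sup M"
  have mem: "ip (hecke f) (hecke f) / ip f f \<in> M" using f f0 by (auto simp: M_def)
  have mub: "ip (hecke g) (hecke g) \<le> \<mu> * ip g g" if g: "harm d g" for g
  proof (cases "ip g g > 0")
    case True
    then have "ip (hecke g) (hecke g) / ip g g \<le> \<mu>" unfolding \<mu>_def by (intro cSup_upper bdd) (auto simp: M_def g)
    then show ?thesis using True by (simp add: pos_divide_le_eq)
  next
    case False
    then have z: "ip g g = 0" using ip_nonneg[of g] by linarith
    then have "nrm (hecke g) \<le> 0" using hb[OF harm_cont[OF g]] by (simp add: nrm_def)
    then have "ip (hecke g) (hecke g) \<le> 0" by (simp add: nrm_def)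
    then show ?thesis using z by simp
  qed
  have "y + 25 / y + 10 < ip (hecke f) (hecke f) / ip f f" using neg f0 by (simp add: pos_less_divide_eq)
  also have "\<dots> \<le> \<mu>" unfolding \<mu>_def by (rule cSup_upper[OF mem bdd])
  finally have mu: "\<mu> \<ge> y + 25 / y + 10" by simp
  have mu0: "\<mu> > 0" using mu y by (smt (verit) divide_nonneg_nonneg)
  obtain K where K: "K \<ge> 0" "\<And>f. cont f \<Longrightarrow> nrm (\<lambda>x. wop (2 * Suc k) f x - walk_poly \<mu> k * f x) \<le> K * nrm (shift \<mu> f)"
    using walk_poly_approx[of k \<mu>] by blast
  have P: "walk_poly \<mu> k \<ge> y ^ Suc k" using walk_poly_growth[OF y mu] by blast
  have "walk_poly \<mu> k \<le> N + K * sqrt \<epsilon>" if e: "\<epsilon> > 0" for \<epsilon>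
  proof -
    have "\<mu> - \<epsilon> / \<mu> < \<mu>" using e mu0 by simp
    then obtain z where "z \<in> M" "\<mu> - \<epsilon> / \<mu> < z" unfolding \<mu>_def using less_cSupE mem by (metis empty_iff)
    then obtain g where g: "harm d g" "ip g g > 0" "\<mu> - \<epsilon> / \<mu> < ip (hecke g) (hecke g) / ip g g" by (auto simp: M_def)
    note gc = harm_cont[OF g(1)]
    define h where "h = hecke (hecke g)"
    have hc: "cont h" unfolding h_def by (intro hecke_cont gc)
    have sh: "shift \<mu> g = (\<lambda>x. h x - \<mu> * g x)" by (simp add: shift_def h_def fun_eq_iff)
    have mgc: "cont (\<lambda>x. \<mu> * g x)" by (intro continuous_intros gc)
    have sc: "cont (\<lambda>x. h x - \<mu> * g x)" by (intro continuous_intros hc gc)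
    have hg: "ip h g = ip (hecke g) (hecke g)" unfolding h_def by (simp add: hecke_selfadjoint[symmetric] hecke_cont gc)
    have "ip (shift \<mu> g) (shift \<mu> g) = ip h (\<lambda>x. h x - \<mu> * g x) - \<mu> * ip g (\<lambda>x. h x - \<mu> * g x)"
      unfolding sh ip_diff[OF hc mgc sc] ip_scale ..
    also have "\<dots> = (ip h h - \<mu> * ip g h) - \<mu> * (ip h g - \<mu> * ip g g)"
      unfolding ip_commute[of h "\<lambda>x. h x - \<mu> * g x"] ip_commute[of g "\<lambda>x. h x - \<mu> * g x"] ip_diff[OF hc mgc hc] ip_diff[OF hc mgc gc] ip_scale ..
    also have "\<dots> = ip h h - 2 * \<mu> * ip (hecke g) (hecke g) + \<mu> * \<mu> * ip g g"
      unfolding ip_commute[of g h] hg by (simp add: algebra_simps)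
    also have "\<dots> \<le> \<mu> * ip (hecke g) (hecke g) - 2 * \<mu> * ip (hecke g) (hecke g) + \<mu> * \<mu> * ip g g"
      using mub[OF hecke_harm[OF g(1)]] by (simp add: h_def)
    also have "\<dots> = \<mu> * (\<mu> * ip g g - ip (hecke g) (hecke g))" by (simp add: algebra_simps)
    also have "\<dots> \<le> \<mu> * (\<epsilon> / \<mu> * ip g g)"
    proof (rule mult_left_mono)
      have "(\<mu> - \<epsilon> / \<mu>) * ip g g < ip (hecke g) (hecke g)" using g(2,3) by (simp only: pos_less_divide_eq)
      then show "\<mu> * ip g g - ip (hecke g) (hecke g) \<le> \<epsilon> / \<mu> * ip g g" unfolding left_diff_distrib by linarith
    qed (use mu0 in simp)
    also have "\<dots> = \<epsilon> * ip g g" using mu0 by simp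
    finally have s: "nrm (shift \<mu> g) \<le> sqrt \<epsilon> * nrm g" unfolding nrm_def real_sqrt_mult[symmetric] by simp
    have gn: "nrm g > 0" using g(2) by (simp add: nrm_def)
    define u where "u x = wop (2 * Suc k) g x - walk_poly \<mu> k * g x" for x
    have uc: "cont u" unfolding u_def by (intro continuous_intros wop_cont gc)
    have "walk_poly \<mu> k * nrm g \<le> nrm (\<lambda>x. walk_poly \<mu> k * g x)" by (simp add: nrm_scale mult_right_mono)
    also have "(\<lambda>x. walk_poly \<mu> k * g x) = (\<lambda>x. wop (2 * Suc k) g x + (-1) * u x)" by (simp add: u_def fun_eq_iff)
    also have "nrm \<dots> \<le> nrm (wop (2 * Suc k) g) + nrm (\<lambda>x. (-1) * u x)"
      by (intro nrm_add continuous_intros wop_cont gc uc)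
    also have "nrm (\<lambda>x. (-1) * u x) = nrm u" by (simp add: nrm_scale[of "-1", simplified])
    also have "nrm (wop (2 * Suc k) g) + nrm u \<le> N * nrm g + K * (sqrt \<epsilon> * nrm g)"
    proof (intro add_mono N g)
      have "nrm u \<le> K * nrm (shift \<mu> g)" unfolding u_def by (rule K(2)[OF gc])
      also have "\<dots> \<le> K * (sqrt \<epsilon> * nrm g)" by (intro mult_left_mono s K)
      finally show "nrm u \<le> K * (sqrt \<epsilon> * nrm g)" .
    qed
    finally have "walk_poly \<mu> k * nrm g \<le> (N + K * sqrt \<epsilon>) * nrm g" by (simp add: algebra_simps)
    then show ?thesis using gn by simp
  qed
  note * = this
  have "walk_poly \<mu> k \<le> N"
  proof (rule field_le_epsilon)
    fix e :: real assume e: "e > 0"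
    have "walk_poly \<mu> k \<le> N + K * sqrt ((e / (K + 1))\<^sup>2)" using e K by (intro *) auto
    also have "K * sqrt ((e / (K + 1))\<^sup>2) = e * (K / (K + 1))" using e K by simp
    also have "\<dots> \<le> e * 1" using e K by (intro mult_left_mono) auto
    finally show "walk_poly \<mu> k \<le> N + e" by simp
  qed
  then show False using P lt by simp
qed

section \<open>Spectral gap in high degrees\<close>

lemma geometric_sum_le: "(q::real) \<ge> 2 \<Longrightarrow> (\<Sum>l\<in>{1..m}. q ^ l) \<le> 2 * q ^ m"
proof (induction m)
  case (Suc m)
  have "(\<Sum>l\<in>{1..Suc m}. q ^ l) = (\<Sum>l\<in>{1..m}. q ^ l) + q ^ Suc m" by simp
  also have "\<dots> \<le> 2 * q ^ m + q ^ Suc m" using Suc by simp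
  also have "\<dots> \<le> q * q ^ m + q ^ Suc m" using Suc by (intro add_mono mult_right_mono) auto
  finally show ?case by simp
qed simp

lemma card_words_le: "real (card (words m)) \<le> 6 * 5 ^ m"
proof (cases m)
  case 0 then show ?thesis by (simp add: words_0)
next
  case (Suc k) then show ?thesis using card_words[of m] by simp
qed

lemma card_words_le2: "m \<ge> 1 \<Longrightarrow> real (card (words m)) \<le> 2 * 5 ^ m"
  using card_words[of m] by (cases m) auto

text \<open>The sum over the branching position \<open>l\<close> is geometric and dominated by its largest term \<open>l = m\<close>; the
  first term counts the pairs of equal words.\<close>

lemma close_pairs_bound:
  assumes D: "0 < D" "D \<le> 1" and m: "m \<ge> 1"
  shows "real (card {(w,w') \<in> words m \<times> words m. close D w w'}) \<le> 2 * 5 ^ m + 1440 * D powr (11/3) * (5 ^ m) powr (8/3)"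
proof -
  define q where "q = (5::real) powr (5/3)"
  have q: "q \<ge> 2"
  proof -
    have "(5::real) powr 1 \<le> q" unfolding q_def by (intro powr_mono) auto
    then show ?thesis by simp
  qed
  have ql: "(5 ^ l) powr (5/3) = q ^ l" for l
    unfolding q_def by (simp add: powr_power powr_powr mult.commute flip: powr_realpow)
  have b: "real (card (words (m - l)) * card (branching D l)) \<le> 720 * D powr (11/3) * 5 ^ m * q ^ l" if l: "l \<in> {1..m}" for l
  proof -
    have l1: "l \<ge> 1" using l by simp
    have "real (card (branching D l)) \<le> 120 * D powr (11/3) * (5 ^ l) powr (8/3)"
      using near_int_bound[OF l1 D] card_branching[OF l1, of D] by linarith
    then have "real (card (words (m - l)) * card (branching D l)) \<le> (6 * 5 ^ (m - l)) * (120 * D powr (11/3) * (5 ^ l) powr (8/3))"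
      unfolding of_nat_mult by (intro mult_mono card_words_le) auto
    also have "(5 ^ l) powr (8/3) = (5 ^ l) powr 1 * ((5::real) ^ l) powr (5/3)" by (simp only: powr_add[symmetric]) simp
    also have "\<dots> = 5 ^ l * q ^ l" unfolding ql by simp
    also have "(6 * 5 ^ (m - l)) * (120 * D powr (11/3) * (5 ^ l * q ^ l)) = 720 * D powr (11/3) * (5 ^ (m - l) * 5 ^ l) * q ^ l" by simp
    also have "(5::real) ^ (m - l) * 5 ^ l = 5 ^ m" using l by (simp flip: power_add)
    finally show ?thesis .
  qed
  have "real (card {(w,w') \<in> words m \<times> words m. close D w w'}) \<le> real (card (words m)) + (\<Sum>l\<in>{1..m}. real (card (words (m - l)) * card (branching D l)))"
  proof -
    have "real (card {(w,w') \<in> words m \<times> words m. close D w w'}) \<le> real (card (words m) + (\<Sum>l\<in>{1..m}. card (words (m - l)) * card (branching D l)))"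
      using card_close_pairs[of m D] by (simp only: of_nat_le_iff)
    then show ?thesis by (simp only: of_nat_add of_nat_sum)
  qed
  also have "\<dots> \<le> 2 * 5 ^ m + (\<Sum>l\<in>{1..m}. 720 * D powr (11/3) * 5 ^ m * q ^ l)"
    by (intro add_mono card_words_le2 m sum_mono b)
  also have "\<dots> = 2 * 5 ^ m + 720 * D powr (11/3) * 5 ^ m * (\<Sum>l\<in>{1..m}. q ^ l)"
    by (simp only: sum_distrib_left)
  also have "\<dots> \<le> 2 * 5 ^ m + 720 * D powr (11/3) * 5 ^ m * (2 * q ^ m)"
    by (intro add_left_mono mult_left_mono geometric_sum_le q) auto
  also have "\<dots> = 2 * 5 ^ m + 1440 * D powr (11/3) * (5 ^ m * q ^ m)" by simp
  also have "5 ^ m * q ^ m = (5 ^ m) powr 1 * ((5::real) ^ m) powr (5/3)" unfolding ql by simp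
  also have "\<dots> = (5 ^ m) powr (8/3)" by (simp only: powr_add[symmetric]) simp
  finally show ?thesis .
qed

lemma unitq_close: "w \<in> words m \<Longrightarrow> w' \<in> words m \<Longrightarrow> norm (unitq w - unitq w') \<le> D \<longleftrightarrow> close D w w'"
proof -
  assume "w \<in> words m" "w' \<in> words m"
  then have l: "length w = m" "length w' = m" by (auto simp: words_def)
  have "unitq w - unitq w' = (1 / sqrt 5 ^ m) *\<^sub>R (emb (wval w) - emb (wval w'))"
    by (simp add: unitq_def l scaleR_diff_right)
  then have "norm (unitq w - unitq w') = norm (emb (wval w) - emb (wval w')) / sqrt 5 ^ m" by simp
  then show ?thesis by (simp add: close_def l pos_divide_le_eq)
qed

lemma wop_operator_bound:
  assumes c: "c > 0" "\<And>\<delta>. 0 < \<delta> \<Longrightarrow> \<delta> \<le> 1 \<Longrightarrow> c * \<delta> ^ 3 \<le> measure haar {q. norm (q - (1,0)) \<le> \<delta>}"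
    and d: "d \<ge> 1" and m: "m \<ge> 1" and f: "harm d f"
  shows "nrm (wop m f) \<le> sqrt (1024 / c * (real d)\<^sup>2 * (2 * 5 ^ m + 1440 * real d powr (-11/3) * (5 ^ m) powr (8/3))) * nrm f"
proof -
  define \<delta> where "\<delta> = 1 / (8 * real d)"
  interpret rotation_sum "words m" unitq d \<delta>
    by unfold_locales (use d in \<open>auto simp: \<delta>_def norm_unitq\<close>)
  have T: "T f = wop m f" by (simp add: T_def wop_def fun_eq_iff)
  have d1: "0 < \<delta>" "\<delta> \<le> 1" "0 < 2 * \<delta>" "2 * \<delta> \<le> 1" using d by (simp_all add: \<delta>_def)
  have "{(i,j) \<in> words m \<times> words m. norm (unitq i - unitq j) \<le> 2 * \<delta>} = {(w,w') \<in> words m \<times> words m. close (2 * \<delta>) w w'}"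
    using unitq_close by auto
  then have cp: "real close_pairs \<le> 2 * 5 ^ m + 1440 * (2 * \<delta>) powr (11/3) * (5 ^ m) powr (8/3)"
    unfolding close_pairs_def using close_pairs_bound[OF d1(3,4) m] by simp
  have "(2 * \<delta>) powr (11/3) \<le> (1 / real d) powr (11/3)"
    using d by (intro powr_mono2) (auto simp: \<delta>_def field_simps)
  also have "(1 / real d) powr (11/3) = real d powr (-11/3)" using d by (simp add: powr_minus_divide powr_divide)
  finally have cp2: "real close_pairs \<le> 2 * 5 ^ m + 1440 * real d powr (-11/3) * (5 ^ m) powr (8/3)" (is "_ \<le> ?R")
    using cp by (smt (verit) mult_left_mono mult_right_mono powr_ge_zero)
  have vl: "c * \<delta> ^ 3 \<le> v" unfolding v_def cap_def by (rule c(2)[OF d1(1,2)])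
  have R0: "?R \<ge> 0" by (intro add_nonneg_nonneg mult_nonneg_nonneg) auto
  have "close_pairs / (v * (2 * real d + 1)) \<le> ?R / ((c * \<delta> ^ 3) * (2 * real d))"
    using cp2 vl d1 c(1) d R0 less_imp_le[OF v_pos] by (intro frac_le mult_mono mult_pos_pos) auto
  also have "\<dots> = 256 / c * (real d)\<^sup>2 * ?R"
    using d c(1) by (simp add: \<delta>_def field_simps power2_eq_square power3_eq_cube)
  finally have S2: "S\<^sup>2 \<le> 256 / c * (real d)\<^sup>2 * ?R" unfolding S_def using v_pos by simp
  have S0: "S \<ge> 0" unfolding S_def using v_pos by simp
  have "2 * S \<le> sqrt (1024 / c * (real d)\<^sup>2 * ?R)"
    by (rule real_le_rsqrt) (use S2 in \<open>simp add: power_mult_distrib\<close>)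
  have wh: "harm d (wop m f)" by (rule wop_harm[OF f])
  have "(nrm (wop m f))\<^sup>2 \<le> 2 * S * nrm f * nrm (wop m f)"
    using operator_bound[OF f wh] unfolding T nrm_sq nrm_def by (simp add: nrm_def)
  then have "nrm (wop m f) \<le> 2 * S * nrm f"
    using S0 by (cases "nrm (wop m f) = 0") (auto simp: power2_eq_square mult_le_cancel_right less_le)
  also have "\<dots> \<le> sqrt (1024 / c * (real d)\<^sup>2 * ?R) * nrm f"
    by (intro mult_right_mono \<open>2 * S \<le> _\<close>) auto
  finally show ?thesis .
qed

text \<open>With words of length \<open>2 * k\<close> and \<open>x = 25 ^ k\<close>, the squared norm of the word operator is of order
  \<open>d\<^sup>2 * x + d powr (-5/3) * x powr (8/3)\<close>, to be compared with its trivial value \<open>x\<^sup>2\<close>. Both terms save a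
  power of \<open>d\<close> if \<open>x\<close> lies strictly between \<open>d\<^sup>2\<close> and \<open>d powr (5/2)\<close>.\<close>

lemma high_degree_gap:
  "\<exists>d0 \<mu>. \<mu> < 36 \<and> (\<forall>d\<ge>d0. \<forall>f. harm d f \<longrightarrow> ip (hecke f) (hecke f) \<le> \<mu> * ip f f)"
proof -
  obtain c where c: "c > 0" "\<And>\<delta>. 0 < \<delta> \<Longrightarrow> \<delta> \<le> 1 \<Longrightarrow> c * \<delta> ^ 3 \<le> measure haar {q. norm (q - (1,0)) \<le> \<delta>}"
    using haar_cap by blast
  \<comment> \<open>Then \<open>y ^ (2 * k) = x powr (2 - 1/27)\<close>, which gives away a factor of order \<open>d powr (1/12)\<close> of the
      factor \<open>d powr (1/6)\<close> that both terms save.\<close>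
  define y where "y = (25::real) powr (53/54)"
  have y5: "5 \<le> y"
  proof -
    have "(25::real) powr (1/2) \<le> y" unfolding y_def by (intro powr_mono) auto
    then show ?thesis by (simp add: powr_half_sqrt)
  qed
  have y25: "y < 25"
  proof -
    have "y < 25 powr 1" unfolding y_def by (intro powr_less_mono) auto
    then show ?thesis by simp
  qed
  define \<mu> where "\<mu> = y + 25 / y + 10"
  have mu: "\<mu> < 36"
  proof -
    have "(25 - y) * (y - 1) > 0" using y5 y25 by (intro mult_pos_pos) auto
    then have "y * y + 25 < 26 * y" by (simp add: algebra_simps)
    then show ?thesis using y5 unfolding \<mu>_def by (simp add: field_simps)
  qed
  define C where "C = 1024 / c * 25924"
  have C: "C > 0" using c(1) by (simp add: C_def)
  define d0 where "d0 = max 2 (nat \<lceil>C powr 27\<rceil> + 1)"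
  show ?thesis
  proof (intro exI[of _ d0] exI[of _ \<mu>] conjI mu allI impI)
    fix d f assume dd: "d0 \<le> d" and f: "harm d f"
    define r where "r = real d"
    have d2: "d \<ge> 2" "r > C powr 27"
      using dd unfolding d0_def r_def by (auto) linarith
    have r: "r \<ge> 2" using d2 by (simp add: r_def)
    \<comment> \<open>The exponent \<open>9/4\<close> is the middle of the admissible range from \<open>2\<close> to \<open>5/2\<close>.\<close>
    define k where "k = nat \<lceil>log 25 (r powr (9/4))\<rceil>"
    define x where "x = (25::real) ^ k"
    have lg: "log 25 (r powr (9/4)) > 0" using r by (simp add: log_powr)
    then have k1: "k \<ge> 1" unfolding k_def by linarith
    have xk: "x = 25 powr real k" by (simp add: x_def powr_realpow)
    have kl: "log 25 (r powr (9/4)) \<le> real k" "real k \<le> log 25 (r powr (9/4)) + 1"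
      using lg unfolding k_def by linarith+
    have x1: "r powr (9/4) \<le> x"
    proof -
      have "25 powr (log 25 (r powr (9/4))) \<le> x" unfolding xk using kl by (intro powr_mono) auto
      then show ?thesis using r by simp
    qed
    have x2: "x \<le> 25 * r powr (9/4)"
    proof -
      have "x \<le> 25 powr (log 25 (r powr (9/4)) + 1)" unfolding xk using kl by (intro powr_mono) auto
      then show ?thesis using r by (simp add: powr_add)
    qed
    have x0: "x > 0" by (simp add: x_def)
    obtain k' where k': "k = Suc k'" using k1 by (cases k) auto
    have x5: "(5::real) ^ (2 * Suc k') = x" by (simp add: x_def k' power_mult)
    have A: "r\<^sup>2 * x \<le> x\<^sup>2 * r powr (-1/6)"
    proof -
      have "r\<^sup>2 = r powr 2" using r by simp
      also have "\<dots> = r powr (9/4) * r powr (-1/4)" by (simp only: powr_add[symmetric]) simp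
      also have "\<dots> \<le> x * r powr (-1/6)" using r x0 by (intro mult_mono x1 powr_mono) auto
      finally have "r\<^sup>2 * x \<le> (x * r powr (-1/6)) * x" using x0 by (intro mult_right_mono) auto
      then show ?thesis by (simp add: power2_eq_square ac_simps)
    qed
    have B: "r\<^sup>2 * (r powr (-11/3) * x powr (8/3)) \<le> 9 * (x\<^sup>2 * r powr (-1/6))"
    proof -
      have "x powr (2/3) \<le> (25 * r powr (9/4)) powr (2/3)" using x0 x2 by (intro powr_mono2) auto
      also have "\<dots> = 25 powr (2/3) * r powr (3/2)" by (simp add: powr_mult powr_powr)
      also have "\<dots> \<le> 9 * r powr (3/2)"
      proof (intro mult_right_mono)
        have "(25 powr (2/3)) ^ 3 \<le> (9::real) ^ 3" by (simp add: powr_power)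
        then show "(25::real) powr (2/3) \<le> 9" by (subst (asm) power_mono_iff) auto
      qed auto
      finally have x23: "x powr (2/3) \<le> 9 * r powr (3/2)" .
      have "r\<^sup>2 * (r powr (-11/3) * x powr (8/3)) = (r powr 2 * r powr (-11/3)) * (x powr 2 * x powr (2/3))"
      proof -
        have 1: "r powr 2 = r\<^sup>2" using r by simp
        have 2: "x powr (8/3) = x powr 2 * x powr (2/3)" by (simp only: powr_add[symmetric]) simp
        show ?thesis unfolding 1 2 by (simp only: mult.assoc)
      qed
      also have "\<dots> \<le> (r powr 2 * r powr (-11/3)) * (x powr 2 * (9 * r powr (3/2)))"
        by (intro mult_left_mono x23) auto
      also have "\<dots> = 9 * (x powr 2 * (r powr 2 * r powr (-11/3) * r powr (3/2)))" by simp
      also have "r powr 2 * r powr (-11/3) * r powr (3/2) = r powr (-1/6)" by (simp only: powr_add[symmetric]) simp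
      also have "x powr 2 = x\<^sup>2" using x0 by simp
      finally show ?thesis .
    qed
    have E: "r powr (-1/6) \<le> 2 * x powr (-2/27)"
    proof -
      have "x powr (4/9) \<le> (25 * r powr (9/4)) powr (4/9)" using x0 x2 by (intro powr_mono2) auto
      also have "\<dots> = 25 powr (4/9) * r" using r by (simp add: powr_mult powr_powr)
      finally have "x powr (4/9) \<le> 25 powr (4/9) * r" .
      then have "(x powr (4/9)) powr (1/6) \<le> (25 powr (4/9) * r) powr (1/6)" by (intro powr_mono2) auto
      then have "x powr (2/27) \<le> 25 powr (2/27) * r powr (1/6)" using r by (simp add: powr_mult powr_powr)
      also have "\<dots> \<le> 2 * r powr (1/6)"
      proof (intro mult_right_mono)
        have "(25::real) powr (2/27) \<le> 25 powr (1/5)" by (intro powr_mono) auto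
        also have "(25::real) powr (1/5) \<le> 2"
        proof -
          have "(25 powr (1/5)) ^ 5 \<le> (2::real) ^ 5" by (simp add: powr_power)
          then show ?thesis by (subst (asm) power_mono_iff) auto
        qed
        finally show "(25::real) powr (2/27) \<le> 2" .
      qed auto
      finally have "x powr (2/27) \<le> 2 * r powr (1/6)" .
      then show ?thesis using r x0 by (simp add: powr_minus_divide field_simps)
    qed
    define N where "N = sqrt (1024 / c * r\<^sup>2 * (2 * x + 1440 * r powr (-11/3) * x powr (8/3)))"
    have NN: "nrm (wop (2 * Suc k') g) \<le> N * nrm g" if "harm d g" for g
      using wop_operator_bound[OF c _ _ that, of "2 * Suc k'"] d2 unfolding x5 N_def r_def by simp
    have "r\<^sup>2 * (2 * x + 1440 * r powr (-11/3) * x powr (8/3)) = 2 * (r\<^sup>2 * x) + 1440 * (r\<^sup>2 * (r powr (-11/3) * x powr (8/3)))"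
      by (simp add: algebra_simps)
    also have "\<dots> \<le> 2 * (x\<^sup>2 * r powr (-1/6)) + 1440 * (9 * (x\<^sup>2 * r powr (-1/6)))"
      by (intro add_mono mult_left_mono A B) auto
    also have "\<dots> = 12962 * (x\<^sup>2 * r powr (-1/6))" by simp
    also have "\<dots> \<le> 12962 * (x\<^sup>2 * (2 * x powr (-2/27)))" by (intro mult_left_mono E) auto
    also have "\<dots> = 25924 * (x powr 2 * x powr (-2/27))" using x0 by simp
    also have "x powr 2 * x powr (-2/27) = x powr (52/27)" by (simp only: powr_add[symmetric]) simp
    finally have "1024 / c * (r\<^sup>2 * (2 * x + 1440 * r powr (-11/3) * x powr (8/3))) \<le> 1024 / c * (25924 * x powr (52/27))"
      using c(1) by (intro mult_left_mono) auto
    also have "\<dots> = C * x powr (52/27)" by (simp add: C_def)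
    also have "\<dots> < x powr (1/27) * x powr (52/27)"
    proof (rule mult_strict_right_mono)
      have "C = (C powr 27) powr (1/27)" unfolding powr_powr using C by simp
      also have "\<dots> < r powr (1/27)" using d2(2) by (intro powr_less_mono2) auto
      also have "\<dots> \<le> x powr (1/27)"
      proof (intro powr_mono2)
        have "r powr 1 \<le> r powr (9/4)" using r by (intro powr_mono) auto
        then show "r \<le> x" using x1 r by simp
      qed (use r in auto)
      finally show "C < x powr (1/27)" .
    qed (use x0 in simp)
    also have "\<dots> = x powr (53/27)" by (simp only: powr_add[symmetric]) simp
    finally have "N < sqrt (x powr (53/27))" unfolding N_def by (intro real_sqrt_less_mono) (simp only: mult.assoc)
    also have "\<dots> = (x powr (53/27)) powr (1/2)" by (rule powr_half_sqrt[symmetric]) simp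
    also have "\<dots> = x powr (53/54)" by (simp add: powr_powr)
    also have "\<dots> = y ^ Suc k'"
      unfolding xk y_def k'[symmetric] by (simp add: powr_powr powr_power mult.commute)
    finally have "N < y ^ Suc k'" .
    then show "ip (hecke f) (hecke f) \<le> \<mu> * ip f f"
      unfolding \<mu>_def by (intro hecke_bound_from_words[of y d k' N] NN f) (use y5 y25 in auto)
  qed
qed

section \<open>Spectral gap in low degrees\<close>

lemma Euler_angles:
  assumes "norm q = 1"
  shows "\<exists>\<alpha> \<beta> \<gamma>. q = qmult (erot e1 \<alpha>) (qmult (erot (axis 3 1) \<beta>) (erot e1 \<gamma>))"
proof -
  obtain a v where q: "q = (a,v)" by (metis surj_pair)
  define b c d where "b = v$1" and "c = v$2" and "d = v$3"
  have n: "a\<^sup>2 + b\<^sup>2 + c\<^sup>2 + d\<^sup>2 = 1"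
    using assms norm_q[of q] by (simp add: q b_def c_def d_def inner_vec_def sum_3 power2_eq_square)
  define C where "C = sqrt (a\<^sup>2 + b\<^sup>2)"
  define S where "S = sqrt (c\<^sup>2 + d\<^sup>2)"
  have CS: "C\<^sup>2 + S\<^sup>2 = 1" using n by (simp add: C_def S_def)
  obtain \<beta> where be: "C = cos \<beta>" "S = sin \<beta>" using sincos_total_2pi[OF CS] by blast
  obtain s where s: "a = C * cos s" "b = C * sin s"
    unfolding C_def by (metis complex.sel cmod_def rcis_cmod_Arg Re_rcis Im_rcis)
  obtain t where t: "d = S * cos t" "- c = S * sin t"
  proof -
    have "d = sqrt (d\<^sup>2 + (-c)\<^sup>2) * cos (Arg (Complex d (-c)))" "- c = sqrt (d\<^sup>2 + (-c)\<^sup>2) * sin (Arg (Complex d (-c)))"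
      by (metis complex.sel cmod_def rcis_cmod_Arg Re_rcis Im_rcis)+
    then show ?thesis using that[of "Arg (Complex d (-c))"] by (simp add: S_def add.commute)
  qed
  define A where "A = (s + t) / 2"
  define G where "G = (s - t) / 2"
  have st: "s = A + G" "t = A - G" by (simp_all add: A_def G_def field_simps)
  have "q = qmult (erot e1 (2 * A)) (qmult (erot (axis 3 1) (2 * \<beta>)) (erot e1 (2 * G)))"
  proof -
    have "a = cos \<beta> * (cos A * cos G - sin A * sin G)" using s be st by (simp add: cos_add)
    moreover have "v$1 = cos \<beta> * (sin A * cos G + cos A * sin G)" using s be st by (simp add: sin_add b_def[symmetric])
    moreover have "v$3 = sin \<beta> * (cos A * cos G + sin A * sin G)" using t be st by (simp add: cos_diff d_def[symmetric])
    moreover have "v$2 = - (sin \<beta> * (sin A * cos G - cos A * sin G))" using t be st by (simp add: sin_diff c_def[symmetric] minus_equation_iff[of c] ) 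
    ultimately show ?thesis
      by (simp add: q qmult_def erot_def prod_eq_iff vec_eq_iff forall_3 inner_vec_def sum_3 cross3_def axis_def algebra_simps)
  qed
  then show ?thesis by blast
qed

text \<open>Modulo \<open>5\<close> the powers of \<open>1 + 2 i\<close> are nonzero multiples of it, since its square is congruent to \<open>2\<close> times
  itself.\<close>

lemma power_one_plus_2i:
  "n \<ge> 1 \<Longrightarrow> \<exists>x y :: int. (Complex 1 2) ^ n = Complex (of_int x) (of_int y) \<and> \<not> 5 dvd x \<and> 5 dvd y - 2 * x"
proof (induction n rule: nat_induct_at_least)
  case base
  show ?case by (intro exI[of _ 1] exI[of _ 2]) auto
next
  case (Suc n)
  then obtain x y :: int where xy: "(Complex 1 2) ^ n = Complex (of_int x) (of_int y)" "\<not> 5 dvd x" "5 dvd y - 2 * x" by blast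
  have "(Complex 1 2) ^ Suc n = Complex (of_int (x - 2 * y)) (of_int (y + 2 * x))"
    by (simp add: xy complex_eq_iff)
  moreover have "\<not> 5 dvd x - 2 * y" using xy(2,3) by presburger
  moreover have "5 dvd (y + 2 * x) - 2 * (x - 2 * y)" using xy(3) by presburger
  ultimately show ?case by blast
qed

definition base_angle :: real where "base_angle = Arg (Complex 1 2)"

lemma base_angle: "cos base_angle = 1 / sqrt 5" "sin base_angle = 2 / sqrt 5"
proof -
  have m: "cmod (Complex 1 2) = sqrt 5" by (simp add: cmod_def)
  have "Complex 1 2 = rcis (sqrt 5) base_angle" unfolding base_angle_def m[symmetric] by (simp add: rcis_cmod_Arg)
  then have "1 = sqrt 5 * cos base_angle" "2 = sqrt 5 * sin base_angle"
    by (metis Re_rcis complex.sel(1), metis Im_rcis complex.sel(2))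
  then show "cos base_angle = 1 / sqrt 5" "sin base_angle = 2 / sqrt 5" by (simp_all add: field_simps)
qed

text \<open>Otherwise a power of \<open>1 + 2 i\<close> would be real, against \<open>power_one_plus_2i\<close>.\<close>

lemma base_angle_irrational: "k \<ge> 1 \<Longrightarrow> cis (real k * (4 * base_angle)) \<noteq> 1"
proof
  assume k: "k \<ge> 1" and e: "cis (real k * (4 * base_angle)) = 1"
  obtain x y :: int where xy: "(Complex 1 2) ^ (4 * k) = Complex (of_int x) (of_int y)" "\<not> 5 dvd x" "5 dvd y - 2 * x"
    using power_one_plus_2i[of "4 * k"] k by auto
  have m: "cmod (Complex 1 2) = sqrt 5" by (simp add: cmod_def)
  have "Complex 1 2 = rcis (sqrt 5) base_angle" unfolding base_angle_def m[symmetric] by (simp add: rcis_cmod_Arg)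
  then have "(Complex 1 2) ^ (4 * k) = rcis (sqrt 5 ^ (4 * k)) (real (4 * k) * base_angle)"
    by (simp add: DeMoivre2)
  also have "\<dots> = of_real (sqrt 5 ^ (4 * k)) * cis (real k * (4 * base_angle))" by (simp add: rcis_def ac_simps)
  finally have "Im ((Complex 1 2) ^ (4 * k)) = 0" unfolding e by simp
  then have "y = 0" unfolding xy(1) by simp
  then show False using xy by presburger
qed

text \<open>As the angle is irrational, none of the finitely many numbers on the right with \<open>k \<noteq> 0\<close> vanishes.\<close>

lemma rotation_orbit_bound:
  "\<exists>B>0. \<forall>k::int. \<bar>k\<bar> \<le> int d \<longrightarrow> (\<forall>\<phi>. (cmod (cis (of_int k * \<phi>) - 1))\<^sup>2 \<le> B * (cmod (cis (of_int k * (4 * base_angle)) - 1))\<^sup>2)"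
proof -
  define z where "z k = (cmod (cis (real k * (4 * base_angle)) - 1))\<^sup>2" for k :: nat
  have z: "z k > 0" if "k \<ge> 1" for k using base_angle_irrational[OF that] by (simp add: z_def)
  define B where "B = 1 + (\<Sum>k\<in>{1..d}. 4 / z k)"
  have B0: "B > 0" unfolding B_def using z by (intro add_pos_nonneg sum_nonneg) (auto simp: z_def)
  have neg: "cmod (cis (- t) - 1) = cmod (cis t - 1)" for t
  proof -
    have "cis (- t) - 1 = cnj (cis t - 1)" by (simp add: cis_cnj)
    then show ?thesis by (metis complex_mod_cnj)
  qed
  show ?thesis
  proof (intro exI[of _ B] conjI B0 allI impI)
    fix k :: int and \<phi> assume k: "\<bar>k\<bar> \<le> int d"
    define n where "n = nat \<bar>k\<bar>"
    show "(cmod (cis (of_int k * \<phi>) - 1))\<^sup>2 \<le> B * (cmod (cis (of_int k * (4 * base_angle)) - 1))\<^sup>2"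
    proof (cases "k = 0")
      case False
      then have n: "n \<in> {1..d}" using k by (auto simp: n_def)
      have "of_int k * (4 * base_angle) = real n * (4 * base_angle) \<or> of_int k * (4 * base_angle) = - (real n * (4 * base_angle))"
        by (cases "k \<ge> 0") (auto simp: n_def)
      then have zz: "(cmod (cis (of_int k * (4 * base_angle)) - 1))\<^sup>2 = z n"
        unfolding z_def using neg by metis
      have "4 / z n \<le> (\<Sum>k\<in>{1..d}. 4 / z k)"
        using n by (intro member_le_sum) (auto simp: z_def)
      then have "4 / z n \<le> B" by (simp add: B_def)
      then have "4 \<le> B * z n" using z[of n] n by (simp add: pos_divide_le_eq)
      moreover have "cmod (cis (of_int k * \<phi>) - 1) \<le> 2" using norm_triangle_ineq4[of "cis (of_int k * \<phi>)" 1] by simp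
      then have "(cmod (cis (of_int k * \<phi>) - 1))\<^sup>2 \<le> 2\<^sup>2" by (intro power_mono) auto
      ultimately show ?thesis unfolding zz by simp
    qed simp
  qed
qed

lemma unitq_gen:
  "unitq [(1,2,0,0)] = erot e1 (2 * base_angle)" "unitq [(1,0,0,2)] = erot (axis 3 1) (2 * base_angle)"
  by (simp_all add: unitq_def erot_def base_angle prod_eq_iff vec_eq_iff forall_3 axis_def)

text \<open>Expanding the squares, the sum over all pairs of generators of the squared distances between translates of
  \<open>f\<close> is \<open>72 * ip f f - 2 * ip (hecke f) (hecke f)\<close>; the pair of \<open>a\<close> and its inverse is one of the
  summands.\<close>

lemma hecke_defect:
  assumes f: "cont f" and a: "a \<in> gens"
  shows "(\<integral>x. (f (rot (unitq [a]) (rot (unitq [a]) x)) - f x)\<^sup>2 \<partial>sph) \<le> 2 * (36 * ip f f - ip (hecke f) (hecke f))"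
proof -
  define g where "g b x = f (rot (unitq [b]) x)" for b x
  have gc: "cont (g b)" for b unfolding g_def by (intro cont_comp[OF f] continuous_intros)
  define P where "P b c = (\<integral>x. (g b x - g c x)\<^sup>2 \<partial>sph)" for b c
  have gg: "ip (g b) (g b) = ip f f" if "b \<in> gens" for b
    unfolding g_def using ip_rot[OF norm_unitq1[OF that] f f] .
  have Pe: "P b c = 2 * ip f f - 2 * ip (g b) (g c)" if "b \<in> gens" "c \<in> gens" for b c
  proof -
    have dc: "cont (\<lambda>x. g b x - g c x)" by (intro continuous_intros gc)
    have "P b c = ip (\<lambda>x. g b x - g c x) (\<lambda>x. g b x - g c x)" by (simp add: P_def ip_def power2_eq_square)
    also have "\<dots> = ip (g b) (\<lambda>x. g b x - g c x) - ip (g c) (\<lambda>x. g b x - g c x)" by (rule ip_diff[OF gc gc dc])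
    also have "\<dots> = (ip (g b) (g b) - ip (g c) (g b)) - (ip (g b) (g c) - ip (g c) (g c))"
      unfolding ip_commute[of "g b" "\<lambda>x. g b x - g c x"] ip_commute[of "g c" "\<lambda>x. g b x - g c x"] ip_diff[OF gc gc gc] ..
    finally show ?thesis using gg[OF that(1)] gg[OF that(2)] ip_commute[of "g c" "g b"] by simp
  qed
  have hg: "hecke f = (\<lambda>x. \<Sum>b\<in>gens. g b x)" by (simp add: hecke_def g_def fun_eq_iff)
  have "ip (hecke f) (hecke f) = (\<Sum>b\<in>gens. \<Sum>c\<in>gens. ip (g b) (g c))"
    unfolding hg by (subst ip_sum[OF finite_gens gc]) (auto intro!: continuous_intros gc sum.cong ip_sum_right)
  moreover have "(\<Sum>b\<in>gens. \<Sum>c\<in>gens. P b c) = (\<Sum>b\<in>gens. \<Sum>c\<in>gens. 2 * ip f f - 2 * ip (g b) (g c))"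
    by (intro sum.cong refl Pe)
  ultimately have tot: "(\<Sum>b\<in>gens. \<Sum>c\<in>gens. P b c) = 72 * ip f f - 2 * ip (hecke f) (hecke f)"
    by (simp add: sum_subtractf sum_distrib_left[symmetric] card_gens)
  have P0: "P b c \<ge> 0" for b c unfolding P_def by (intro integral_nonneg_AE) auto
  have ia: "icnj a \<in> gens" by (rule icnj_gens[OF a])
  have "P a (icnj a) \<le> (\<Sum>c\<in>gens. P a c)" using ia P0 by (intro member_le_sum) auto
  also have "\<dots> \<le> (\<Sum>b\<in>gens. \<Sum>c\<in>gens. P b c)" using a P0 by (intro member_le_sum[of a gens "\<lambda>b. \<Sum>c\<in>gens. P b c"] sum_nonneg) auto
  finally have "P a (icnj a) \<le> 2 * (36 * ip f f - ip (hecke f) (hecke f))" using tot by simp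
  moreover have "(\<integral>x. (g a (rot (unitq [a]) x) - g (icnj a) (rot (unitq [a]) x))\<^sup>2 \<partial>sph) = P a (icnj a)"
    unfolding P_def by (rule sph_rot[OF norm_unitq1[OF a], of "\<lambda>x. (g a x - g (icnj a) x)\<^sup>2"]) (intro continuous_intros gc)
  ultimately show ?thesis by (simp add: g_def unitq_icnj[OF a])
qed

lemma harm_mean: assumes "harm d f" "d \<ge> 1" shows "(\<integral>x. f x \<partial>sph) = 0"
proof -
  have "ip f (\<lambda>_. 1) = 0"
    using assms(1) polyd_const[of 0 1] less_le_trans[OF zero_less_one assms(2)] unfolding harm_def by blast
  then show ?thesis by (simp add: ip_def)
qed

text \<open>If \<open>f\<close> were almost invariant under the generators, then under rotations by twice their angles about two coordinate axes,
  then by \<open>rotation_orbit_bound\<close> under all rotations about these axes, and by Euler angles under all rotations.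
  Averaging over all rotations, \<open>f\<close> would be almost equal to its mean, which is zero.\<close>

lemma low_degree_gap:
  assumes d: "d \<ge> 1"
  shows "\<exists>\<mu><36. \<forall>f. harm d f \<longrightarrow> ip (hecke f) (hecke f) \<le> \<mu> * ip f f"
proof -
  obtain B where B: "B > 0" "\<And>k \<phi>. \<bar>k\<bar> \<le> int d \<Longrightarrow> (cmod (cis (of_int k * \<phi>) - 1))\<^sup>2 \<le> B * (cmod (cis (of_int k * (4 * base_angle)) - 1))\<^sup>2"
    using rotation_orbit_bound[of d] by blast
  show ?thesis
  proof (intro exI[of _ "36 - 1 / (9 * B)"] conjI allI impI)
    fix f assume f: "harm d f"
    note fc = harm_cont[OF f]
    have fp: "polyd d f" using f by (simp add: harm_def)
    \<comment> \<open>The defect of \<open>f\<close> from being invariant under the generators.\<close>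
    define \<Delta> where "\<Delta> = 36 * ip f f - ip (hecke f) (hecke f)"
    have axis: "nrm (\<lambda>x. f (rot (erot u \<phi>) x) - f x) \<le> sqrt (2 * B * \<Delta>)"
      if u: "norm u = 1" "unitq [a] = erot u (2 * base_angle)" "a \<in> gens" for u \<phi> a
    proof -
      have "(\<integral>x. (f (rot (erot u \<phi>) x) - f x)\<^sup>2 \<partial>sph) \<le> B * (\<integral>x. (f (rot (erot u (4 * base_angle)) x) - f x)\<^sup>2 \<partial>sph) + 0 * (\<integral>x. (f x)\<^sup>2 \<partial>sph)"
        by (rule rotation_difference_bound[OF fp u(1)]) (use B in auto)
      also have "(\<lambda>x. (f (rot (erot u (4 * base_angle)) x) - f x)\<^sup>2) = (\<lambda>x. (f (rot (unitq [a]) (rot (unitq [a]) x)) - f x)\<^sup>2)"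
        using erot_add[OF u(1), of "2 * base_angle" "2 * base_angle"] by (simp add: u(2) rot_qmult)
      also have "B * (\<integral>x. (f (rot (unitq [a]) (rot (unitq [a]) x)) - f x)\<^sup>2 \<partial>sph) + 0 * (\<integral>x. (f x)\<^sup>2 \<partial>sph) \<le> B * (2 * \<Delta>) + 0"
        unfolding \<Delta>_def using hecke_defect[OF fc u(3)] B(1) by (intro add_mono mult_left_mono) auto
      finally have "ip (\<lambda>x. f (rot (erot u \<phi>) x) - f x) (\<lambda>x. f (rot (erot u \<phi>) x) - f x) \<le> 2 * B * \<Delta>"
        by (simp add: ip_def power2_eq_square)
      then show ?thesis unfolding nrm_def by (rule real_sqrt_le_mono)
    qed
    have g1: "(1,2,0,0) \<in> gens" "(1,0,0,2) \<in> gens" by (simp_all add: gens_def)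
    have n3: "norm (axis 3 1 :: real^3) = 1" by (simp add: norm_axis_1)
    have comp: "nrm (\<lambda>x. f (rot (qmult p q) x) - f x) \<le> nrm (\<lambda>x. f (rot p x) - f x) + nrm (\<lambda>x. f (rot q x) - f x)"
      if "norm q = 1" for p q
    proof -
      have c: "cont (\<lambda>x. f (rot p x) - f x)" for p by (intro continuous_intros cont_comp[OF fc] fc)
      have "nrm (\<lambda>x. (f (rot p (rot q x)) - f (rot q x)) + (f (rot q x) - f x)) \<le> nrm (\<lambda>x. f (rot p (rot q x)) - f (rot q x)) + nrm (\<lambda>x. f (rot q x) - f x)"
        by (intro nrm_add continuous_intros cont_comp[OF fc] fc)
      also have "nrm (\<lambda>x. f (rot p (rot q x)) - f (rot q x)) = nrm (\<lambda>x. f (rot p x) - f x)"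
        by (rule nrm_rot[OF that c[of p]])
      finally show ?thesis by (simp add: rot_qmult)
    qed
    have all: "nrm (\<lambda>x. f (rot q x) - f x) \<le> 3 * sqrt (2 * B * \<Delta>)" if q: "norm q = 1" for q
    proof -
      obtain \<alpha> \<beta> \<gamma> where e: "q = qmult (erot e1 \<alpha>) (qmult (erot (axis 3 1) \<beta>) (erot e1 \<gamma>))" using Euler_angles[OF q] by blast
      have "nrm (\<lambda>x. f (rot q x) - f x) \<le> nrm (\<lambda>x. f (rot (erot e1 \<alpha>) x) - f x) + (nrm (\<lambda>x. f (rot (erot (axis 3 1) \<beta>) x) - f x) + nrm (\<lambda>x. f (rot (erot e1 \<gamma>) x) - f x))"
        unfolding e by (intro order_trans[OF comp] add_left_mono) (auto simp: norm_qmult n3 intro!: comp)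
      also have "\<dots> \<le> sqrt (2 * B * \<Delta>) + (sqrt (2 * B * \<Delta>) + sqrt (2 * B * \<Delta>))"
        by (intro add_mono axis[OF norm_e1 unitq_gen(1) g1(1)] axis[OF n3 unitq_gen(2) g1(2)])
      finally show ?thesis by simp
    qed
    have D0: "\<Delta> \<ge> 0"
    proof -
      have "norm ((1,0) :: quaternion) = 1" by (simp add: norm_prod_def)
      then have "0 \<le> 3 * sqrt (2 * B * \<Delta>)" using order_trans[OF nrm_ge0 all] by blast
      then have "0 \<le> 2 * B * \<Delta>" by simp
      then show ?thesis using B(1) by (simp add: zero_le_mult_iff)
    qed
    have dif: "ip f f - ip f (\<lambda>x. f (rot q x)) \<le> 9 * B * \<Delta>" if q: "norm q = 1" for q
    proof -
      define h where "h x = f (rot q x)" for x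
      have hc: "cont h" unfolding h_def by (intro cont_comp[OF fc] continuous_intros)
      have dc: "cont (\<lambda>x. h x - f x)" by (intro continuous_intros hc fc)
      have "ip (\<lambda>x. h x - f x) (\<lambda>x. h x - f x) = (nrm (\<lambda>x. f (rot q x) - f x))\<^sup>2" by (simp add: nrm_sq h_def)
      also have "\<dots> \<le> (3 * sqrt (2 * B * \<Delta>))\<^sup>2" by (intro power_mono all q) simp
      also have "\<dots> = 18 * B * \<Delta>" using B(1) D0 by (simp add: power_mult_distrib)
      finally have "ip h (\<lambda>x. h x - f x) - ip f (\<lambda>x. h x - f x) \<le> 18 * B * \<Delta>" unfolding ip_diff[OF hc fc dc] .
      then have "(ip h h - ip f h) - (ip h f - ip f f) \<le> 18 * B * \<Delta>"
        unfolding ip_commute[of h "\<lambda>x. h x - f x"] ip_commute[of f "\<lambda>x. h x - f x"] ip_diff[OF hc fc hc] ip_diff[OF hc fc fc] .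
      moreover have "ip h h = ip f f" unfolding h_def by (rule ip_rot[OF q fc fc])
      ultimately show ?thesis using ip_commute[of h f] by (simp add: h_def[abs_def])
    qed
    have z: "(\<integral>q. ip f (\<lambda>x. f (rot q x)) \<partial>haar) = 0"
    proof -
      have fz: "(\<integral>x. f x \<partial>sph) = 0" by (rule harm_mean[OF f d])
      have "(\<integral>q. ip f (\<lambda>x. f (rot q x)) \<partial>haar) = (\<integral>x. (\<integral>q. f x * f (rot q x) \<partial>haar) \<partial>sph)"
        unfolding ip_def by (intro fubini_haar_sph) (auto simp: case_prod_beta intro!: continuous_intros cont_comp[OF fc])
      also have "\<dots> = (\<integral>x. 0 \<partial>sph)"
      proof (intro integral_cong_AE)
        show "AE x in sph. (\<integral>q. f x * f (rot q x) \<partial>haar) = 0"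
          using AE_sph_norm by eventually_elim (simp add: haar_point[OF _ fc] fz)
        have "cont (\<lambda>x. \<integral>q. f x * f (rot q x) \<partial>haar)"
          by (intro cpt_prob_continuous_integral[OF cpt_prob_haar]) (auto simp: case_prod_beta intro!: continuous_intros cont_comp[OF fc])
        then show "(\<lambda>x. \<integral>q. f x * f (rot q x) \<partial>haar) \<in> borel_measurable sph"
          by (simp only: measurable_cong_sets[OF sets_sph refl]) (rule cont_borel)
      qed simp
      finally show ?thesis by simp
    qed
    have Fc: "cont (\<lambda>q. ip f (\<lambda>x. f (rot q x)))" unfolding ip_def
      by (intro cpt_prob_continuous_integral[OF cpt_prob_sph]) (auto simp: case_prod_beta intro!: continuous_intros cont_comp[OF fc])
    interpret H: prob_space haar by (rule prob_haar)
    have "ip f f = (\<integral>q. ip f f - ip f (\<lambda>x. f (rot q x)) \<partial>haar)"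
      using z by (subst Bochner_Integration.integral_diff) (auto simp: H.prob_space[unfolded space_haar] intro!: int_haar Fc continuous_intros)
    also have "\<dots> \<le> (\<integral>q. 9 * B * \<Delta> \<partial>haar)"
      by (intro integral_mono_AE eventually_mono[OF AE_haar_norm] dif) (auto intro!: int_haar Fc continuous_intros)
    also have "\<dots> = 9 * B * \<Delta>" by (simp add: H.prob_space[unfolded space_haar])
    finally have "ip f f / (9 * B) \<le> \<Delta>" using B(1) by (simp add: pos_divide_le_eq mult.commute)
    then show "ip (hecke f) (hecke f) \<le> (36 - 1 / (9 * B)) * ip f f" by (simp add: \<Delta>_def left_diff_distrib)
  qed (use B in auto)
qed

lemma harmonic_gap: "\<exists>\<mu><36. \<mu> \<ge> 0 \<and> (\<forall>d\<ge>1. \<forall>f. harm d f \<longrightarrow> ip (hecke f) (hecke f) \<le> \<mu> * ip f f)"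
proof -
  obtain d0 \<mu>0 where h: "\<mu>0 < 36" "\<And>d f. d \<ge> d0 \<Longrightarrow> harm d f \<Longrightarrow> ip (hecke f) (hecke f) \<le> \<mu>0 * ip f f"
    using high_degree_gap by blast
  obtain m where m: "\<And>d. d \<ge> 1 \<Longrightarrow> m d < 36 \<and> (\<forall>f. harm d f \<longrightarrow> ip (hecke f) (hecke f) \<le> m d * ip f f)"
    using low_degree_gap by metis
  define \<mu> where "\<mu> = Max ({0, \<mu>0} \<union> m ` {1..d0})"
  have fin: "finite ({0, \<mu>0} \<union> m ` {1..d0})" by simp
  show ?thesis
  proof (intro exI[of _ \<mu>] conjI allI impI)
    show "\<mu> < 36" unfolding \<mu>_def using h(1) m by (subst Max_less_iff) auto
    show "\<mu> \<ge> 0" unfolding \<mu>_def by (rule Max_ge) auto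
    fix d f assume d: "1 \<le> d" and f: "harm d f"
    have "\<exists>\<nu>. \<nu> \<le> \<mu> \<and> ip (hecke f) (hecke f) \<le> \<nu> * ip f f"
    proof (cases "d \<ge> d0")
      case True
      have "\<mu>0 \<le> \<mu>" unfolding \<mu>_def by (rule Max_ge[OF fin]) simp
      then show ?thesis using h(2)[OF True f] by blast
    next
      case False
      then have "m d \<in> {0, \<mu>0} \<union> m ` {1..d0}" using d by auto
      then have "m d \<le> \<mu>" unfolding \<mu>_def by (rule Max_ge[OF fin])
      then show ?thesis using m[OF d] f by blast
    qed
    then show "ip (hecke f) (hecke f) \<le> \<mu> * ip f f" by (meson ip_nonneg mult_right_mono order_trans)
  qed
qed

section \<open>Spectral gap for continuous functions\<close>

inductive lspan :: "(real^3 \<Rightarrow> real) set \<Rightarrow> (real^3 \<Rightarrow> real) \<Rightarrow> bool" for F where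
  lspan_0: "lspan F (\<lambda>_. 0)"
| lspan_add: "lspan F f \<Longrightarrow> b \<in> F \<Longrightarrow> lspan F (\<lambda>x. f x + c * b x)"

lemma lspan_plus: "lspan F g \<Longrightarrow> lspan F f \<Longrightarrow> lspan F (\<lambda>x. f x + g x)"
proof (induction rule: lspan.induct)
  case (lspan_add g b c)
  then show ?case using lspan.lspan_add[of F "\<lambda>x. f x + g x" b c] by (simp add: add.assoc)
qed simp

lemma lspan_scale: "lspan F f \<Longrightarrow> lspan F (\<lambda>x. c * f x)"
proof (induction rule: lspan.induct)
  case (lspan_add g b d)
  then show ?case using lspan.lspan_add[of F "\<lambda>x. c * g x" b "c * d"] by (simp add: algebra_simps)
qed (simp add: lspan_0)

lemma lspan_mono: "lspan F f \<Longrightarrow> F \<subseteq> G \<Longrightarrow> lspan G f"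
  by (induction rule: lspan.induct) (auto intro: lspan.intros)

lemma lspan_base: "b \<in> F \<Longrightarrow> lspan F b"
  using lspan_add[OF lspan_0, of b F 1] by simp

lemma lspan_cont: "lspan F f \<Longrightarrow> (\<And>b. b \<in> F \<Longrightarrow> cont b) \<Longrightarrow> cont f"
  by (induction rule: lspan.induct) (auto intro!: continuous_intros)

lemma lspan_polyd: "lspan F f \<Longrightarrow> (\<And>b. b \<in> F \<Longrightarrow> polyd d b) \<Longrightarrow> polyd d f"
  by (induction rule: lspan.induct) (auto intro!: polyd_const polyd_add polyd_scale)

lemma lspan_orth:
  "lspan F p \<Longrightarrow> (\<And>b. b \<in> F \<Longrightarrow> cont b) \<Longrightarrow> cont g \<Longrightarrow> (\<And>b. b \<in> F \<Longrightarrow> ip g b = 0) \<Longrightarrow> ip g p = 0"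
proof (induction rule: lspan.induct)
  case lspan_0 then show ?case by (simp add: ip_def)
next
  case (lspan_add f b c)
  have "cont f" "cont (\<lambda>x. c * b x)" using lspan_add lspan_cont by (auto intro!: continuous_intros)
  then have "ip g (\<lambda>x. f x + c * b x) = ip f g + c * ip b g"
    using lspan_add by (simp add: ip_commute[of g] ip_add ip_scale)
  then show ?case using lspan_add by (simp add: ip_commute)
qed

text \<open>Gram-Schmidt, one function at a time; a function whose remainder has norm zero is skipped.\<close>

lemma orthogonal_projection:
  "finite F \<Longrightarrow> (\<And>b. b \<in> F \<Longrightarrow> cont b) \<Longrightarrow> cont f \<Longrightarrow> \<exists>p. lspan F p \<and> (\<forall>b\<in>F. ip (\<lambda>x. f x - p x) b = 0)"
proof (induction arbitrary: f rule: finite_induct)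
  case empty then show ?case by (intro exI[of _ "\<lambda>_. 0"]) (simp add: lspan_0)
next
  case (insert b F)
  have cF: "\<And>b. b \<in> F \<Longrightarrow> cont b" and bc: "cont b" using insert.prems by auto
  obtain p where p: "lspan F p" "\<forall>b\<in>F. ip (\<lambda>x. f x - p x) b = 0" using insert.IH[OF cF insert.prems(2)] by blast
  obtain pb where pb: "lspan F pb" "\<forall>c\<in>F. ip (\<lambda>x. b x - pb x) c = 0" using insert.IH[OF cF bc] by blast
  define b' where "b' x = b x - pb x" for x
  define g where "g x = f x - p x" for x
  have c: "cont p" "cont pb" "cont b'" "cont g" "cont f"
    unfolding b'_def g_def using lspan_cont[OF p(1) cF] lspan_cont[OF pb(1) cF] insert.prems(2) bc by (auto intro!: continuous_intros)
  define t where "t = (if ip b' b' = 0 then 0 else ip g b' / ip b' b')"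
  define h where "h x = g x - t * b' x" for x
  have hc: "cont h" unfolding h_def by (intro continuous_intros c)
  have hip: "ip h u = ip g u - t * ip b' u" if "cont u" for u
  proof -
    have "cont (\<lambda>x. t * b' x)" by (intro continuous_intros c)
    then have "ip h u = ip g u - ip (\<lambda>x. t * b' x) u" unfolding h_def by (intro ip_diff c that)
    then show ?thesis by (simp add: ip_scale)
  qed
  have hF: "ip h u = 0" if "u \<in> F" for u
    using hip[OF cF[OF that]] p(2) pb(2) that by (simp add: g_def[abs_def] b'_def[abs_def])
  have hb': "ip h b' = 0"
  proof (cases "ip b' b' = 0")
    case True
    have "(ip g b')\<^sup>2 \<le> 0" using ip_CS[OF c(4) c(3)] True by simp
    then show ?thesis using hip[OF c(3)] True by (simp add: t_def)
  next
    case False then show ?thesis using hip[OF c(3)] by (simp add: t_def)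
  qed
  have hpb: "ip h pb = 0" by (rule lspan_orth[OF pb(1) cF hc hF])
  have "ip b h = 0"
  proof -
    have "ip (\<lambda>x. b' x + pb x) h = ip b' h + ip pb h" by (rule ip_add[OF c(3) c(2) hc])
    then show ?thesis using hb' hpb by (simp add: ip_commute b'_def)
  qed
  define q where "q x = p x + t * b' x" for x
  have "lspan (insert b F) (\<lambda>x. p x + t * (b x + (-1) * pb x))"
    by (rule lspan_plus[OF lspan_scale[OF lspan_plus[OF lspan_scale[OF lspan_mono[OF pb(1) subset_insertI]] lspan_base]]
          lspan_mono[OF p(1) subset_insertI]]) simp
  then have q: "lspan (insert b F) q" by (simp add: q_def[abs_def] b'_def)
  have "(\<lambda>x. f x - q x) = h" by (simp add: h_def g_def q_def fun_eq_iff)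
  then show ?case using q hF \<open>ip b h = 0\<close> by (intro exI[of _ q]) (auto simp: ip_commute)
qed

lemma polyd_0_const: "polyd d f \<Longrightarrow> d = 0 \<Longrightarrow> \<exists>c. f = (\<lambda>_. c)"
  by (induction rule: polyd.induct) auto

lemma polyd_spanning: "\<exists>F. finite F \<and> (\<forall>b\<in>F. polyd d b) \<and> (\<forall>f. polyd d f \<longrightarrow> lspan F f)"
proof (induction d)
  case 0
  have "lspan {\<lambda>_. 1} (\<lambda>_. c)" for c using lspan_scale[OF lspan_base[of "\<lambda>_. 1" "{\<lambda>_. 1}"], of c] by simp
  then show ?case using polyd_0_const by (intro exI[of _ "{\<lambda>_. 1}"]) (auto simp: polyd_const)
next
  case (Suc d)
  then obtain F where F: "finite F" "\<And>b. b \<in> F \<Longrightarrow> polyd d b" "\<And>f. polyd d f \<Longrightarrow> lspan F f" by blast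
  define G where "G = insert (\<lambda>_. 1) (\<Union>i\<in>UNIV. (\<lambda>b x. (axis i 1 \<bullet> x) * b x) ` F)"
  have m: "lspan G (\<lambda>x. (v \<bullet> x) * f x)" if "lspan F f" for v f
    using that
  proof (induction rule: lspan.induct)
    case lspan_0 then show ?case by (simp add: lspan.lspan_0)
  next
    case (lspan_add f b c)
    have "lspan G (\<lambda>x. c * v$i * ((axis i 1 \<bullet> x) * b x))" for i
      by (intro lspan_scale lspan_base) (use lspan_add in \<open>auto simp: G_def\<close>)
    then have "lspan G (\<lambda>x. (v \<bullet> x) * f x + (c * v$1 * ((axis 1 1 \<bullet> x) * b x) + (c * v$2 * ((axis 2 1 \<bullet> x) * b x) + c * v$3 * ((axis 3 1 \<bullet> x) * b x))))"
      by (intro lspan_plus lspan_add.IH)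
    also have "(\<lambda>x. (v \<bullet> x) * f x + (c * v$1 * ((axis 1 1 \<bullet> x) * b x) + (c * v$2 * ((axis 2 1 \<bullet> x) * b x) + c * v$3 * ((axis 3 1 \<bullet> x) * b x)))) = (\<lambda>x. (v \<bullet> x) * (f x + c * b x))"
      by (simp add: fun_eq_iff inner_axis' inner_vec_def[of v] sum_3 algebra_simps)
    finally show ?case .
  qed
  have one: "lspan G (\<lambda>_. c)" for c using lspan_scale[OF lspan_base[of "\<lambda>_. 1" G], of c] by (simp add: G_def)
  have "lspan G f" if "polyd n f" "n = Suc d" for n f
    using that
  proof (induction rule: polyd.induct)
    case (polyd_mult n f v)
    then show ?case using F(3) m by simp
  qed (auto intro: one lspan_plus)
  moreover have "finite G" using F(1) by (simp add: G_def)
  moreover have "polyd (Suc d) b" if "b \<in> G" for b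
    using that F(2) unfolding G_def by (auto intro!: polyd_const polyd_mult)
  ultimately show ?case by blast
qed

lemma harmonic_decomposition:
  assumes "polyd (Suc e) f" shows "\<exists>p h. polyd e p \<and> harm (Suc e) h \<and> f = (\<lambda>x. p x + h x)"
proof -
  obtain F where F: "finite F" "\<And>b. b \<in> F \<Longrightarrow> polyd e b" "\<And>f. polyd e f \<Longrightarrow> lspan F f" using polyd_spanning[of e] by blast
  have cF: "\<And>b. b \<in> F \<Longrightarrow> cont b" using F(2) polyd_cont by blast
  obtain p where p: "lspan F p" "\<forall>b\<in>F. ip (\<lambda>x. f x - p x) b = 0" using orthogonal_projection[OF F(1) cF polyd_cont[OF assms]] by blast
  have pp: "polyd e p" using lspan_polyd[OF p(1) F(2)] .
  have hc: "cont (\<lambda>x. f x - p x)" by (intro continuous_intros polyd_cont[OF assms] polyd_cont[OF pp])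
  have "harm (Suc e) (\<lambda>x. f x - p x)"
    unfolding harm_def
  proof (intro conjI allI impI)
    show "polyd (Suc e) (\<lambda>x. f x - p x)" by (intro polyd_diff assms polyd_Suc pp)
    fix e' q assume "e' < Suc e" "polyd e' q"
    then have "lspan F q" using F(3) polyd_mono[of e' q e] by simp
    then show "ip (\<lambda>x. f x - p x) q = 0" by (rule lspan_orth[OF _ cF hc]) (use p(2) in auto)
  qed
  then show ?thesis using pp by (intro exI[of _ p] exI[of _ "\<lambda>x. f x - p x"]) auto
qed

lemma ip_add_add:
  assumes "cont f" "cont g" "ip f g = 0" shows "ip (\<lambda>x. f x + g x) (\<lambda>x. f x + g x) = ip f f + ip g g"
proof -
  have c: "cont (\<lambda>x. f x + g x)" by (intro continuous_intros assms)
  have "ip (\<lambda>x. f x + g x) (\<lambda>x. f x + g x) = ip f (\<lambda>x. f x + g x) + ip g (\<lambda>x. f x + g x)"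
    by (rule ip_add[OF assms(1,2) c])
  also have "\<dots> = (ip f f + ip g f) + (ip f g + ip g g)"
    unfolding ip_commute[of f "\<lambda>x. f x + g x"] ip_commute[of g "\<lambda>x. f x + g x"] ip_add[OF assms(1,2,1)] ip_add[OF assms(1,2,2)] ..
  finally show ?thesis using assms(3) by (simp add: ip_commute[of g f])
qed

text \<open>By induction on the degree: \<open>hecke\<close> maps the harmonic part of top degree and the remaining polynomial to
  orthogonal functions, so the bounds add up.\<close>

lemma polynomial_gap:
  assumes gap: "\<And>d f. d \<ge> 1 \<Longrightarrow> harm d f \<Longrightarrow> ip (hecke f) (hecke f) \<le> \<mu> * ip f f"
  shows "polyd D f \<Longrightarrow> (\<integral>x. f x \<partial>sph) = 0 \<Longrightarrow> ip (hecke f) (hecke f) \<le> \<mu> * ip f f"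
proof (induction D arbitrary: f)
  case 0
  obtain c where c: "f = (\<lambda>_. c)" using polyd_0_const[OF 0(1)] by blast
  have "c = 0" using 0(2) prob_space.prob_space[OF prob_sph] by (simp add: c)
  then show ?case by (simp add: c ip_def hecke_def)
next
  case (Suc e)
  obtain p h where ph: "polyd e p" "harm (Suc e) h" "f = (\<lambda>x. p x + h x)" using harmonic_decomposition[OF Suc.prems(1)] by blast
  note pc = polyd_cont[OF ph(1)] and hc = harm_cont[OF ph(2)]
  have h0: "(\<integral>x. h x \<partial>sph) = 0" using harm_mean[OF ph(2)] by simp
  have "(\<integral>x. p x + h x \<partial>sph) = (\<integral>x. p x \<partial>sph) + (\<integral>x. h x \<partial>sph)"
    by (intro Bochner_Integration.integral_add int_sph pc hc)
  then have p0: "(\<integral>x. p x \<partial>sph) = 0" using Suc.prems(2) h0 by (simp add: ph(3))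
  have o1: "ip p h = 0" using ph(1,2) by (auto simp: harm_def ip_commute[of p])
  have hp: "polyd e (hecke p)" unfolding hecke_def by (intro polyd_sum polyd_rot ph) auto
  have o2: "ip (hecke p) (hecke h) = 0" using hp hecke_harm[OF ph(2)] by (auto simp: harm_def ip_commute[of "hecke p"])
  have hf: "hecke f = (\<lambda>x. hecke p x + hecke h x)" by (simp add: ph(3) hecke_def sum.distrib fun_eq_iff)
  have "ip (hecke f) (hecke f) = ip (hecke p) (hecke p) + ip (hecke h) (hecke h)"
    unfolding hf by (rule ip_add_add[OF hecke_cont[OF pc] hecke_cont[OF hc] o2])
  also have "\<dots> \<le> \<mu> * ip p p + \<mu> * ip h h"
    by (intro add_mono Suc.IH ph p0 gap[OF _ ph(2)]) simp
  also have "\<dots> = \<mu> * ip f f" unfolding ph(3) ip_add_add[OF pc hc o1] by (simp add: distrib_left)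
  finally show ?case .
qed

lemma rpf_polyd: "real_polynomial_function f \<Longrightarrow> \<exists>d. polyd d (f :: real^3 \<Rightarrow> real)"
proof (induction rule: real_polynomial_function.induct)
  case (linear f)
  then have lin: "linear f" by (simp add: bounded_linear.linear)
  define v where "v = adjoint f 1"
  have "f x = v \<bullet> x" for x using adjoint_works[OF lin, of x 1] by (simp add: v_def inner_commute)
  then have "f = (\<lambda>x. (v \<bullet> x) * 1)" by auto
  then show ?case using polyd_mult[OF polyd_const[of 0 1], of v] by auto
next
  case (const c) then show ?case using polyd_const by blast
next
  case (add f g)
  then obtain d e where "polyd d f" "polyd e g" by blast
  then have "polyd (max d e) f" "polyd (max d e) g" by (auto intro: polyd_mono)
  then show ?case using polyd_add by blast
next
  case (mult f g) then show ?case using polyd_times by blast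
qed

lemma nrm_le_sup:
  assumes "cont f" "\<And>x. norm x = 1 \<Longrightarrow> \<bar>f x\<bar> \<le> B" "0 \<le> B" shows "nrm f \<le> B"
proof -
  have "ip f f \<le> (\<integral>x. B\<^sup>2 \<partial>sph)" unfolding ip_def
  proof (intro integral_mono_AE)
    show "AE x in sph. f x * f x \<le> B\<^sup>2"
      using AE_sph_norm
    proof eventually_elim
      case (elim x)
      then have "\<bar>f x\<bar>\<^sup>2 \<le> B\<^sup>2" using assms(2) by (intro power_mono) auto
      then show ?case by (simp add: power2_eq_square)
    qed
  qed (auto intro!: int_sph continuous_intros assms)
  then have "ip f f \<le> B\<^sup>2" using prob_space.prob_space[OF prob_sph] by simp
  then show ?thesis unfolding nrm_def using assms(3) by (intro real_le_lsqrt) auto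
qed

lemma nrm_hecke_le: "cont f \<Longrightarrow> nrm (hecke f) \<le> 6 * nrm f"
  using nrm_wop_trivial[of f "Suc 0"] card_words[of "Suc 0"] by (simp add: wop_1)

text \<open>Polynomials are uniformly dense in the continuous functions on the sphere, and \<open>hecke\<close> is bounded.\<close>

theorem spectral_gap:
  "\<exists>\<kappa>. 0 \<le> \<kappa> \<and> \<kappa> < 1 \<and> (\<forall>f. cont f \<longrightarrow> (\<integral>x. f x \<partial>sph) = 0 \<longrightarrow> nrm (hecke f) \<le> 6 * \<kappa> * nrm f)"
proof -
  obtain \<mu> where mu: "\<mu> < 36" "\<mu> \<ge> 0" "\<And>d f. d \<ge> 1 \<Longrightarrow> harm d f \<Longrightarrow> ip (hecke f) (hecke f) \<le> \<mu> * ip f f"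
    using harmonic_gap by blast
  define \<kappa> where "\<kappa> = sqrt \<mu> / 6"
  have s6: "sqrt \<mu> < 6" using mu(1) real_sqrt_less_mono[of \<mu> "6\<^sup>2"] by (simp del: real_sqrt_less_iff)
  show ?thesis
  proof (intro exI[of _ \<kappa>] conjI allI impI)
    show "0 \<le> \<kappa>" using mu by (simp add: \<kappa>_def)
    show "\<kappa> < 1" using s6 by (simp add: \<kappa>_def)
    fix f :: "real^3 \<Rightarrow> real" assume f: "cont f" and f0: "(\<integral>x. f x \<partial>sph) = 0"
    have main: "nrm (hecke f) \<le> sqrt \<mu> * nrm f + 24 * e" if e: "e > 0" for e
    proof -
      obtain g where g: "real_polynomial_function g" "\<And>x. x \<in> sphere 0 1 \<Longrightarrow> \<bar>f x - g x\<bar> < e"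
        using Stone_Weierstrass_real_polynomial_function[of "sphere 0 1" f e] e continuous_on_subset[OF f subset_UNIV] by auto
      obtain d where gd: "polyd d g" using rpf_polyd[OF g(1)] by blast
      note gc = polyd_cont[OF gd]
      define m where "m = (\<integral>x. g x \<partial>sph)"
      interpret S: prob_space sph by (rule prob_sph)
      have me: "\<bar>m\<bar> \<le> e"
      proof -
        have "m = (\<integral>x. g x - f x \<partial>sph)" unfolding m_def using f0 by (subst Bochner_Integration.integral_diff) (auto intro!: int_sph f gc)
        then have "\<bar>m\<bar> \<le> (\<integral>x. \<bar>g x - f x\<bar> \<partial>sph)" by simp
        also have "\<dots> \<le> (\<integral>x. e \<partial>sph)"
        proof (intro integral_mono_AE)
          show "AE x in sph. \<bar>g x - f x\<bar> \<le> e" using AE_sph_norm by eventually_elim (use g(2) in \<open>auto simp: abs_minus_commute less_imp_le\<close>)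
        qed (auto intro!: int_sph continuous_intros f gc)
        finally show ?thesis by (simp add: S.prob_space[unfolded space_sph])
      qed
      define k where "k x = g x - m" for x
      have kd: "polyd d k" unfolding k_def by (intro polyd_diff gd polyd_const)
      note kc = polyd_cont[OF kd]
      have k0: "(\<integral>x. k x \<partial>sph) = 0" unfolding k_def by (subst Bochner_Integration.integral_diff) (auto simp: m_def S.prob_space[unfolded space_sph] intro!: int_sph gc)
      have "ip (hecke k) (hecke k) \<le> \<mu> * ip k k" by (rule polynomial_gap[OF mu(3) kd k0])
      then have hk: "nrm (hecke k) \<le> sqrt \<mu> * nrm k" unfolding nrm_def real_sqrt_mult[symmetric] by (rule real_sqrt_le_mono)
      define u where "u x = f x - k x" for x
      have uc: "cont u" unfolding u_def by (intro continuous_intros f kc)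
      have un: "nrm u \<le> 2 * e"
      proof (rule nrm_le_sup[OF uc])
        fix x :: "real^3" assume "norm x = 1"
        then have "\<bar>f x - g x\<bar> < e" using g(2)[of x] by simp
        then show "\<bar>u x\<bar> \<le> 2 * e" using me by (simp add: u_def k_def)
      qed (use e in simp)
      have "nrm (\<lambda>x. f x + (-1) * u x) \<le> nrm f + nrm (\<lambda>x. (-1) * u x)" by (intro nrm_add continuous_intros f uc)
      moreover have "nrm (\<lambda>x. (-1) * u x) = nrm u" unfolding nrm_scale by simp
      moreover have "(\<lambda>x. f x + (-1) * u x) = k" by (simp add: u_def fun_eq_iff)
      ultimately have "nrm k \<le> nrm f + nrm u" by simp
      then have nk: "nrm k \<le> nrm f + 2 * e" using un by simp
      have "hecke f = (\<lambda>x. hecke k x + hecke u x)" by (simp add: hecke_def u_def sum.distrib[symmetric] fun_eq_iff)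
      then have "nrm (hecke f) \<le> nrm (hecke k) + nrm (hecke u)" using nrm_add[OF hecke_cont[OF kc] hecke_cont[OF uc]] by simp
      also have "\<dots> \<le> sqrt \<mu> * (nrm f + 2 * e) + 6 * (2 * e)"
        using hk nrm_hecke_le[OF uc] un mult_left_mono[OF nk, of "sqrt \<mu>"] mu(2) by simp
      also have "\<dots> \<le> sqrt \<mu> * nrm f + 24 * e"
        using mult_right_mono[OF less_imp_le[OF s6], of "2 * e"] e by (simp add: algebra_simps)
      finally show ?thesis .
    qed
    have "nrm (hecke f) \<le> sqrt \<mu> * nrm f"
    proof (rule field_le_epsilon)
      fix e :: real assume "e > 0"
      then show "nrm (hecke f) \<le> sqrt \<mu> * nrm f + e" using main[of "e / 24"] by simp
    qed
    then show "nrm (hecke f) \<le> 6 * \<kappa> * nrm f" by (simp add: \<kappa>_def)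
  qed
qed

text \<open>By Archimedes the mean is \<open>sin R / R\<close>; as \<open>zmean_pderiv\<close> speaks of polynomials, the cosine is approximated by one.\<close>

lemma cos_mean:
  assumes R: "R > 0"
  shows "\<bar>\<integral>x. cos (R * x$1) \<partial>sph\<bar> \<le> 1 / R"
proof (rule field_le_epsilon)
  fix e :: real assume "e > 0"
  define \<epsilon> where "\<epsilon> = e / 2"
  have e: "\<epsilon> > 0" using \<open>e > 0\<close> by (simp add: \<epsilon>_def)
  have "continuous_on {-1..1} (\<lambda>z. cos (R * z))" by (intro continuous_intros)
  then obtain g where g: "real_polynomial_function g" "\<And>z. z \<in> {-1..1} \<Longrightarrow> \<bar>cos (R * z) - g z\<bar> < \<epsilon>"
    using Stone_Weierstrass_real_polynomial_function[of "{-1..1::real}" "\<lambda>z. cos (R * z)" \<epsilon>] e by auto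
  obtain a n where an: "g = (\<lambda>x. \<Sum>i\<le>n. a i * x ^ i)" using g(1) unfolding real_polynomial_function_iff_sum by blast
  define p where "p = (\<Sum>i\<le>n. monom (a i) i)"
  have gp: "g z = poly p z" for z by (simp add: an p_def poly_sum poly_monom)
  obtain Q where Q: "pderiv Q = p" using ex_antiderivative by blast
  define G where "G z = poly Q z - sin (R * z) / R" for z
  have "\<exists>z>-1. z < 1 \<and> G 1 - G (-1) = (1 - (-1)) * (poly p z - cos (R * z))"
  proof (rule MVT2)
    fix z :: real
    have "(G has_real_derivative (poly (pderiv Q) z - cos (R * z) * R / R)) (at z)"
      unfolding G_def by (auto intro!: derivative_eq_intros)
    then show "(G has_real_derivative (poly p z - cos (R * z))) (at z)" using R by (simp add: Q)
  qed simp
  then obtain z where z: "-1 < z" "z < 1" "G 1 - G (-1) = 2 * (poly p z - cos (R * z))" by auto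
  have "\<bar>G 1 - G (-1)\<bar> \<le> 2 * \<epsilon>" using g(2)[of z] z gp[of z] by (simp add: abs_mult abs_minus_commute)
  then have q: "\<bar>poly Q 1 - poly Q (-1)\<bar> \<le> 2 * \<epsilon> + 2 / R"
  proof -
    have "\<bar>sin R / R\<bar> \<le> 1 / R" using R by (simp add: divide_right_mono)
    moreover have "G 1 - G (-1) = poly Q 1 - poly Q (-1) - 2 * (sin R / R)" by (simp add: G_def)
    moreover have "2 / R = 2 * (1 / R)" by simp
    ultimately show ?thesis using \<open>\<bar>G 1 - G (-1)\<bar> \<le> 2 * \<epsilon>\<close> by linarith
  qed
  have zm: "\<bar>zmean p\<bar> \<le> \<epsilon> + 1 / R" unfolding Q[symmetric] zmean_pderiv using q by simp
  interpret S: prob_space sph by (rule prob_sph)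
  have ci: "cont (\<lambda>x::real^3. cos (R * x$1))" by (intro continuous_intros)
  have "\<bar>(\<integral>x. cos (R * x$1) \<partial>sph) - zmean p\<bar> = \<bar>\<integral>x. cos (R * x$1) - poly p (x$1) \<partial>sph\<bar>"
    unfolding zmean_def by (subst Bochner_Integration.integral_diff) (auto intro!: int_sph ci continuous_intros)
  also have "\<dots> \<le> (\<integral>x. \<bar>cos (R * x$1) - poly p (x$1)\<bar> \<partial>sph)" by simp
  also have "\<dots> \<le> (\<integral>x. \<epsilon> \<partial>sph)"
  proof (intro integral_mono_AE)
    show "AE x in sph. \<bar>cos (R * x$1) - poly p (x$1)\<bar> \<le> \<epsilon>" using AE_sph_norm
    proof eventually_elim
      case (elim x)
      then have "\<bar>x$1\<bar> \<le> 1" using component_le_norm_cart[of x 1] by simp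
      then have "x$1 \<in> {-1..1}" by (auto simp: abs_le_iff)
      then show ?case using g(2)[of "x$1"] gp[of "x$1"] by simp
    qed
  qed (auto intro!: int_sph continuous_intros)
  also have "\<dots> = \<epsilon>" by (simp add: S.prob_space[unfolded space_sph])
  finally show "\<bar>\<integral>x. cos (R * x$1) \<partial>sph\<bar> \<le> 1 / R + e" using zm unfolding \<epsilon>_def by linarith
qed

section \<open>The self-similar measure of a lazy walk\<close>

lemma Omega_5: "Omega 5 = (\<lambda>a. unitq [a]) ` gens"
proof -
  have u: "unitq [a] = (1 / sqrt 5) *\<^sub>R emb a" for a by (simp add: unitq_def)
  have sol: "(a,b,c,d) \<in> gens" if h: "a\<^sup>2 + b\<^sup>2 + c\<^sup>2 + d\<^sup>2 = 5" "a > 0" "odd a" "even b" "even c" "even d" for a b c d :: int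
  proof -
    have a2: "a\<^sup>2 \<le> 5" using h(1) zero_le_power2[of b] zero_le_power2[of c] zero_le_power2[of d] by linarith
    have "a < 3"
    proof (rule ccontr)
      assume "\<not> a < 3"
      then have "3\<^sup>2 \<le> a\<^sup>2" by (intro power_mono) auto
      then show False using a2 by simp
    qed
    then have "a = 1 \<or> a = 2" using h(2) by linarith
    then have a: "a = 1" using h(3) by auto
    obtain b' c' d' where e: "b = 2 * b'" "c = 2 * c'" "d = 2 * d'" using h(4-6) by (auto elim!: evenE)
    have s: "b'\<^sup>2 + c'\<^sup>2 + d'\<^sup>2 = 1" using h(1) by (simp add: a e power_mult_distrib)
    have rng: "x \<in> {-1,0,1}" if "x\<^sup>2 \<le> 1" for x :: int
    proof -
      have "\<bar>x\<bar> \<le> 1" using that by (simp add: abs_square_le_1)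
      then show ?thesis by auto
    qed
    have "b' \<in> {-1,0,1}" "c' \<in> {-1,0,1}" "d' \<in> {-1,0,1}"
      using s zero_le_power2[of b'] zero_le_power2[of c'] zero_le_power2[of d'] by (intro rng; linarith)+
    then show ?thesis using s unfolding a e gens_def by (elim insertE emptyE) simp_all
  qed
  show ?thesis
  proof
    show "Omega 5 \<subseteq> (\<lambda>a. unitq [a]) ` gens"
    proof
      fix q assume "q \<in> Omega 5"
      then obtain a b c d :: int where q: "q = (1 / sqrt 5) *\<^sub>R (of_int a, vector [of_int b, of_int c, of_int d])"
        and h: "a\<^sup>2 + b\<^sup>2 + c\<^sup>2 + d\<^sup>2 = 5" "a > 0" "odd a" "even b" "even c" "even d"
        by (auto simp: Omega_def)
      show "q \<in> (\<lambda>a. unitq [a]) ` gens"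
        by (rule image_eqI[OF _ sol[OF h]]) (simp add: q u)
    qed
    have mem: "unitq [(a,b,c,d)] \<in> Omega 5" if "(a,b,c,d) \<in> gens" for a b c d
      unfolding Omega_def u mem_Collect_eq
      by (rule exI[of _ a], rule exI[of _ b], rule exI[of _ c], rule exI[of _ d]) (use that in \<open>auto simp: gens_def\<close>)
    show "(\<lambda>a. unitq [a]) ` gens \<subseteq> Omega 5"
    proof (rule image_subsetI)
      fix x assume "x \<in> gens"
      then show "unitq [x] \<in> Omega 5" using mem by (cases x rule: prod_cases4) simp
    qed
  qed
qed

lemma ramanujan_set_5: "ramanujan_set 5 = (\<lambda>a. rot (unitq [a])) ` gens"
proof -
  have "Ad (unitq [a]) = rot (unitq [a])" if "a \<in> gens" for a
    using Ad_eq_rot[of "unitq [a]"] norm_unitq1[OF that] by (simp add: fun_eq_iff)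
  then show ?thesis unfolding ramanujan_set_def Omega_5 image_image by (intro image_cong) auto
qed

text \<open>\<open>\<epsilon>\<close> is the probability of a translation in each step and \<open>r\<close> the contraction ratio.\<close>

locale lazy_walk =
  fixes \<epsilon> r :: real
  assumes eps: "0 < \<epsilon>" "\<epsilon> < 1" and r: "0 < r" "r < 1"
begin

definition step_pmf :: "(iquat \<times> bool) pmf" where
  "step_pmf = pair_pmf (pmf_of_set gens) (bernoulli_pmf \<epsilon>)"

definition wt :: "bool \<Rightarrow> real" where "wt b = (if b then \<epsilon> else 1 - \<epsilon>) / 6"

lemma wt_pos: "wt b > 0" using eps by (simp add: wt_def)

definition fmap :: "iquat \<times> bool \<Rightarrow> real^3 \<Rightarrow> real^3" where
  "fmap p x = r *\<^sub>R rot (unitq [fst p]) x + of_bool (snd p) *\<^sub>R e1"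

primrec approx :: "nat \<Rightarrow> (iquat \<times> bool) stream \<Rightarrow> real^3" where
  "approx 0 s = 0"
| "approx (Suc n) s = fmap (shd s) (approx n (stl s))"

lemma gens_ne: "gens \<noteq> {}" by (simp add: gens_def)

lemma norm_unitq_any: "fst (shd s) \<in> gens \<Longrightarrow> norm (rot (unitq [fst (shd s)]) x) = norm x"
  using norm_unitq1 by simp

definition good :: "(iquat \<times> bool) stream set" where "good = {s. \<forall>p\<in>sset s. fst p \<in> gens}"

lemma good_Cons: "p ## s \<in> good \<longleftrightarrow> fst p \<in> gens \<and> s \<in> good" by (auto simp: good_def)
lemma good_shd: "s \<in> good \<Longrightarrow> fst (shd s) \<in> gens" and good_stl: "s \<in> good \<Longrightarrow> stl s \<in> good"
  by (cases s; auto simp: good_def)+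

lemma approx_step: "s \<in> good \<Longrightarrow> norm (approx (Suc n) s - approx n s) \<le> r ^ n"
proof (induction n arbitrary: s)
  case 0
  then show ?case by (simp add: fmap_def linear_0[OF linear_rot])
next
  case (Suc n)
  have "approx (Suc (Suc n)) s - approx (Suc n) s = r *\<^sub>R rot (unitq [fst (shd s)]) (approx (Suc n) (stl s) - approx n (stl s))"
    by (simp add: fmap_def linear_diff[OF linear_rot] scaleR_diff_right)
  then have "norm (approx (Suc (Suc n)) s - approx (Suc n) s) = r * norm (approx (Suc n) (stl s) - approx n (stl s))"
    using r norm_unitq_any[OF good_shd[OF Suc.prems]] by simp
  also have "\<dots> \<le> r * r ^ n" using Suc.IH[OF good_stl[OF Suc.prems]] r by (intro mult_left_mono) auto
  finally show ?case by simp
qed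

lemma approx_conv: assumes "s \<in> good" shows "convergent (\<lambda>n. approx n s)"
proof -
  have "summable (\<lambda>n. approx (Suc n) s - approx n s)"
    by (rule summable_comparison_test[OF _ summable_geometric[of r]]) (use approx_step[OF assms] r in auto)
  then have "convergent (\<lambda>n. \<Sum>i<n. approx (Suc i) s - approx i s)" by (rule summable_iff_convergent[THEN iffD1])
  then show ?thesis unfolding sum_lessThan_telescope[of "\<lambda>n. approx n s"] by simp
qed

text \<open>The default value outside of convergence only serves measurability: the good sequences, on which the approximations
  converge, have full measure.\<close>

definition limpt :: "(iquat \<times> bool) stream \<Rightarrow> real^3" where
  "limpt s = (if convergent (\<lambda>n. approx n s) then lim (\<lambda>n. approx n s) else 0)"

lemma limpt_lim: "s \<in> good \<Longrightarrow> (\<lambda>n. approx n s) \<longlonglongrightarrow> limpt s"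
  using approx_conv convergent_LIMSEQ_iff by (auto simp: limpt_def)

lemma limpt_Cons: assumes "p ## s \<in> good" shows "limpt (p ## s) = fmap p (limpt s)"
proof -
  have s: "s \<in> good" using assms by (simp add: good_Cons)
  have "(\<lambda>n. approx (Suc n) (p ## s)) \<longlonglongrightarrow> limpt (p ## s)" using limpt_lim[OF assms] by (rule LIMSEQ_Suc)
  moreover have "(\<lambda>n. fmap p (approx n s)) \<longlonglongrightarrow> fmap p (limpt s)"
  proof -
    have "cont (fmap p)" unfolding fmap_def by (intro continuous_intros)
    then have "isCont (fmap p) (limpt s)" by (simp add: continuous_on_eq_continuous_at)
    then show ?thesis using limpt_lim[OF s] by (rule isCont_tendsto_compose)
  qed
  ultimately show ?thesis by (simp add: LIMSEQ_unique)
qed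

lemma limpt_bound: assumes "s \<in> good" shows "norm (limpt s) \<le> 1 / (1 - r)"
proof (rule LIMSEQ_le_const2[OF tendsto_norm[OF limpt_lim[OF assms]]])
  have "norm (approx n s) \<le> 1 / (1 - r)" if "s \<in> good" for n s
    using that
  proof (induction n arbitrary: s)
    case (Suc n)
    have "norm (approx (Suc n) s) \<le> r * norm (approx n (stl s)) + 1"
      using norm_triangle_ineq[of "r *\<^sub>R rot (unitq [fst (shd s)]) (approx n (stl s))" "of_bool (snd (shd s)) *\<^sub>R e1"]
        norm_unitq_any[OF good_shd[OF Suc.prems]] r by (cases "snd (shd s)") (auto simp: fmap_def)
    also have "\<dots> \<le> r * (1 / (1 - r)) + 1" using Suc r good_stl by (intro add_mono mult_left_mono) auto
    also have "\<dots> = 1 / (1 - r)" using r by (simp add: field_simps)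
    finally show ?case .
  qed (use r in simp)
  then show "\<exists>N. \<forall>n\<ge>N. norm (approx n s) \<le> 1 / (1 - r)" using assms by blast
qed

abbreviation "PS \<equiv> stream_space (measure_pmf step_pmf)"

lemma prob_PS: "prob_space PS"
  by (rule prob_space.prob_space_stream_space) (rule prob_space_measure_pmf)

lemma space_PS [simp]: "space PS = UNIV" by (simp add: space_stream_space)

lemma shd_meas: "shd \<in> PS \<rightarrow>\<^sub>M count_space UNIV"
  using measurable_shd[of "measure_pmf step_pmf"] by (simp cong: measurable_cong_sets)

lemma approx_meas [measurable]: "approx n \<in> PS \<rightarrow>\<^sub>M borel"
proof (induction n)
  case 0 then show ?case by simp
next
  case (Suc n)
  have "(\<lambda>s. fmap (shd s) (approx n (stl s))) \<in> PS \<rightarrow>\<^sub>M borel"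
  proof (rule measurable_compose_countable'[where I = UNIV and g = shd and f = "\<lambda>p s. fmap p (approx n (stl s))"])
    fix p
    have "cont (fmap p)" unfolding fmap_def by (intro continuous_intros)
    then have [measurable]: "fmap p \<in> borel \<rightarrow>\<^sub>M borel" by (rule borel_measurable_continuous_onI)
    have [measurable]: "approx n \<in> PS \<rightarrow>\<^sub>M borel" by (rule Suc.IH)
    show "(\<lambda>s. fmap p (approx n (stl s))) \<in> PS \<rightarrow>\<^sub>M borel" by measurable
  qed (auto simp: shd_meas)
  then show ?case by (simp cong: measurable_cong)
qed

lemma limpt_meas [measurable]: "limpt \<in> PS \<rightarrow>\<^sub>M borel"
proof -
  have "(\<lambda>s. if convergent (\<lambda>n. approx n s) then approx n s else 0) \<in> PS \<rightarrow>\<^sub>M borel" for n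
    unfolding Cauchy_convergent_iff[symmetric] by measurable
  then show ?thesis
  proof (rule borel_measurable_LIMSEQ_metric)
    fix s
    show "(\<lambda>n. if convergent (\<lambda>n. approx n s) then approx n s else 0) \<longlonglongrightarrow> limpt s"
      by (auto simp: limpt_def convergent_LIMSEQ_iff)
  qed
qed

lemma AE_good: "AE s in PS. s \<in> good"
proof -
  have "AE s in PS. stream_all (\<lambda>p. fst p \<in> gens) s"
  proof (rule prob_space.AE_stream_all)
    show "prob_space (measure_pmf step_pmf)" by (rule prob_space_measure_pmf)
    show "AE p in measure_pmf step_pmf. fst p \<in> gens"
      by (auto simp: AE_measure_pmf_iff step_pmf_def gens_ne)
  qed simp
  then show ?thesis by (auto simp: good_def stream.pred_set elim!: eventually_mono)
qed

definition \<nu> :: "(real^3) measure" where "\<nu> = distr PS borel limpt"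

lemma sets_nu [simp, measurable_cong]: "sets \<nu> = sets borel" by (simp add: \<nu>_def)
lemma space_nu [simp]: "space \<nu> = UNIV" by (simp add: \<nu>_def)

lemma prob_nu: "prob_space \<nu>" unfolding \<nu>_def by (intro prob_space.prob_space_distr prob_PS) simp

lemma AE_nu: "AE x in \<nu>. norm x \<le> 1 / (1 - r)"
  unfolding \<nu>_def by (subst AE_distr_iff) (auto intro!: eventually_mono[OF AE_good] limpt_bound)

lemma cpt_prob_nu: "cpt_prob \<nu>"
  unfolding cpt_prob_def
  by (intro conjI prob_nu sets_nu exI[of _ "cball 0 (1 / (1 - r))"]) (use AE_nu in auto)

text \<open>Split off the first step of the random sequence.\<close>

lemma nn_integral_nu:
  assumes [measurable]: "g \<in> borel_measurable borel"
  shows "(\<integral>\<^sup>+x. g x \<partial>\<nu>) = (\<Sum>p\<in>gens \<times> UNIV. ennreal (wt (snd p)) * (\<integral>\<^sup>+x. g (fmap p x) \<partial>\<nu>))"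
proof -
  have fm: "fmap p \<in> borel \<rightarrow>\<^sub>M borel" for p
    unfolding fmap_def by (intro borel_measurable_continuous_onI continuous_intros)
  have "(\<integral>\<^sup>+x. g x \<partial>\<nu>) = (\<integral>\<^sup>+s. g (limpt s) \<partial>PS)" unfolding \<nu>_def by (intro nn_integral_distr) auto
  also have "\<dots> = (\<integral>\<^sup>+p. (\<integral>\<^sup>+s. g (limpt (p ## s)) \<partial>PS) \<partial>measure_pmf step_pmf)"
    by (rule prob_space.nn_integral_stream_space[OF prob_space_measure_pmf]) measurable
  also have "\<dots> = (\<Sum>p\<in>set_pmf step_pmf. (\<integral>\<^sup>+s. g (limpt (p ## s)) \<partial>PS) * pmf step_pmf p)"
    by (rule nn_integral_measure_pmf_finite) (auto simp: step_pmf_def gens_ne)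
  also have "\<dots> = (\<Sum>p\<in>gens \<times> UNIV. ennreal (wt (snd p)) * (\<integral>\<^sup>+x. g (fmap p x) \<partial>\<nu>))"
  proof (rule sum.cong)
    show sp: "set_pmf step_pmf = gens \<times> UNIV" using eps by (auto simp: step_pmf_def gens_ne)
    fix p assume p: "p \<in> gens \<times> (UNIV :: bool set)"
    then have pg: "fst p \<in> gens" by auto
    have "(\<integral>\<^sup>+s. g (limpt (p ## s)) \<partial>PS) = (\<integral>\<^sup>+s. g (fmap p (limpt s)) \<partial>PS)"
      by (intro nn_integral_cong_AE eventually_mono[OF AE_good]) (simp add: limpt_Cons good_Cons pg)
    also have "\<dots> = (\<integral>\<^sup>+x. g (fmap p x) \<partial>\<nu>)"
      unfolding \<nu>_def using measurable_compose[OF fm[of p] assms] by (subst nn_integral_distr) auto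
    finally have 1: "(\<integral>\<^sup>+s. g (limpt (p ## s)) \<partial>PS) = (\<integral>\<^sup>+x. g (fmap p x) \<partial>\<nu>)" .
    have "pmf step_pmf p = wt (snd p)"
      using pg eps by (cases p; cases "snd p") (auto simp: step_pmf_def pmf_pair wt_def card_gens gens_ne)
    then show "(\<integral>\<^sup>+s. g (limpt (p ## s)) \<partial>PS) * ennreal (pmf step_pmf p) = ennreal (wt (snd p)) * (\<integral>\<^sup>+x. g (fmap p x) \<partial>\<nu>)"
      by (simp add: 1 mult.commute)
  qed
  finally show ?thesis .
qed

lemma fmap_cont: "cont (fmap p)" unfolding fmap_def by (intro continuous_intros)

lemma int_nu: "cont g \<Longrightarrow> integrable \<nu> (g :: real^3 \<Rightarrow> 'b::{banach,second_countable_topology})"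
  by (rule cpt_prob_integrable[OF cpt_prob_nu])

lemma integral_nu_nonneg:
  fixes g :: "real^3 \<Rightarrow> real"
  assumes g: "cont g" "\<And>x. 0 \<le> g x"
  shows "(\<integral>x. g x \<partial>\<nu>) = (\<Sum>p\<in>gens \<times> UNIV. wt (snd p) * (\<integral>x. g (fmap p x) \<partial>\<nu>))"
proof -
  have gf: "cont (\<lambda>x. g (fmap p x))" for p by (intro cont_comp[OF g(1)] fmap_cont)
  have I: "(\<integral>\<^sup>+x. ennreal (h x) \<partial>\<nu>) = ennreal (\<integral>x. h x \<partial>\<nu>)" if "cont h" "\<And>x. 0 \<le> h x" for h
    by (intro nn_integral_eq_integral int_nu that AE_I2)
  have "ennreal (\<integral>x. g x \<partial>\<nu>) = (\<Sum>p\<in>gens \<times> UNIV. ennreal (wt (snd p)) * (\<integral>\<^sup>+x. ennreal (g (fmap p x)) \<partial>\<nu>))"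
    unfolding I[OF g, symmetric] by (rule nn_integral_nu) (use cont_borel[OF g(1)] in simp)
  also have "\<dots> = (\<Sum>p\<in>gens \<times> UNIV. ennreal (wt (snd p) * (\<integral>x. g (fmap p x) \<partial>\<nu>)))"
    by (intro sum.cong refl) (simp add: I[OF gf g(2)] ennreal_mult'' integral_nonneg_AE g(2))
  also have "\<dots> = ennreal (\<Sum>p\<in>gens \<times> UNIV. wt (snd p) * (\<integral>x. g (fmap p x) \<partial>\<nu>))"
    by (intro sum_ennreal mult_nonneg_nonneg integral_nonneg_AE AE_I2 g(2) less_imp_le[OF wt_pos])
  finally show ?thesis
    by (subst (asm) ennreal_inj) (auto intro!: sum_nonneg mult_nonneg_nonneg integral_nonneg_AE g(2) less_imp_le[OF wt_pos])
qed

lemma integral_nu_real: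
  fixes g :: "real^3 \<Rightarrow> real"
  assumes g: "cont g"
  shows "(\<integral>x. g x \<partial>\<nu>) = (\<Sum>p\<in>gens \<times> UNIV. wt (snd p) * (\<integral>x. g (fmap p x) \<partial>\<nu>))"
proof -
  define a where "a x = max (g x) 0" for x
  define b where "b x = max (- g x) 0" for x
  have ab: "cont a" "cont b" unfolding a_def b_def by (intro continuous_intros g)+
  have e: "g x = a x - b x" for x by (auto simp: a_def b_def)
  have af: "cont (\<lambda>x. a (fmap p x))" "cont (\<lambda>x. b (fmap p x))" for p by (intro cont_comp[OF ab(1)] cont_comp[OF ab(2)] fmap_cont)+
  have "(\<integral>x. g x \<partial>\<nu>) = (\<integral>x. a x \<partial>\<nu>) - (\<integral>x. b x \<partial>\<nu>)"
    unfolding e by (intro Bochner_Integration.integral_diff int_nu ab)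
  also have "\<dots> = (\<Sum>p\<in>gens \<times> UNIV. wt (snd p) * ((\<integral>x. a (fmap p x) \<partial>\<nu>) - (\<integral>x. b (fmap p x) \<partial>\<nu>)))"
    using integral_nu_nonneg[OF ab(1)] integral_nu_nonneg[OF ab(2)]
    by (simp add: a_def b_def sum_subtractf right_diff_distrib)
  also have "\<dots> = (\<Sum>p\<in>gens \<times> UNIV. wt (snd p) * (\<integral>x. g (fmap p x) \<partial>\<nu>))"
    unfolding e by (intro sum.cong refl arg_cong2[where f = "(*)"] Bochner_Integration.integral_diff[symmetric] int_nu af)
  finally show ?thesis .
qed

lemma integral_nu_complex:
  fixes g :: "real^3 \<Rightarrow> complex"
  assumes g: "cont g"
  shows "(\<integral>x. g x \<partial>\<nu>) = (\<Sum>p\<in>gens \<times> UNIV. of_real (wt (snd p)) * (\<integral>x. g (fmap p x) \<partial>\<nu>))"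
proof -
  have gf: "cont (\<lambda>x. g (fmap p x))" for p by (intro cont_comp[OF g] fmap_cont)
  have "Re (\<integral>x. g x \<partial>\<nu>) = (\<Sum>p\<in>gens \<times> UNIV. wt (snd p) * (\<integral>x. Re (g (fmap p x)) \<partial>\<nu>))"
    using integral_nu_real[of "\<lambda>x. Re (g x)"] int_nu[OF g] g by (simp add: continuous_intros)
  moreover have "Im (\<integral>x. g x \<partial>\<nu>) = (\<Sum>p\<in>gens \<times> UNIV. wt (snd p) * (\<integral>x. Im (g (fmap p x)) \<partial>\<nu>))"
    using integral_nu_real[of "\<lambda>x. Im (g x)"] int_nu[OF g] g by (simp add: continuous_intros)
  ultimately show ?thesis using int_nu[OF gf] by (simp add: complex_eq_iff)
qed

lemma sum_gens_bool: "(\<Sum>p\<in>gens \<times> (UNIV :: bool set). h p) = (\<Sum>a\<in>gens. h (a, False) + h (a, True))"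
proof -
  have "(\<Sum>p\<in>gens \<times> (UNIV :: bool set). h p) = (\<Sum>a\<in>gens. \<Sum>b\<in>UNIV. h (a, b))"
    by (simp add: sum.cartesian_product)
  then show ?thesis by (simp add: UNIV_bool add.commute)
qed

theorem self_similar: "self_similar_measure (ramanujan_ifs_index 5) (ramanujan_ifs r) \<nu>"
proof -
  define R where "R a = rot (unitq [a])" for a
  define c where "c i = (if i = 1 then \<epsilon> else 1 - \<epsilon>) / 6" for i :: nat
  define p where "p z = (\<Sum>a\<in>{a \<in> gens. R a = fst z}. c (snd z))" for z :: "(real^3 \<Rightarrow> real^3) \<times> nat"
  have idx: "ramanujan_ifs_index 5 = R ` gens \<times> {0,1}"
    by (simp add: ramanujan_ifs_index_def ramanujan_set_5 R_def)
  have grp: "(\<Sum>z\<in>ramanujan_ifs_index 5. (\<Sum>a\<in>{a \<in> gens. R a = fst z}. h a (fst z) (snd z))) = (\<Sum>a\<in>gens. h a (R a) 0 + h a (R a) (1::nat))"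
    for h :: "iquat \<Rightarrow> _ \<Rightarrow> nat \<Rightarrow> 'a::comm_monoid_add"
  proof -
    have "(\<Sum>z\<in>ramanujan_ifs_index 5. (\<Sum>a\<in>{a \<in> gens. R a = fst z}. h a (fst z) (snd z)))
      = (\<Sum>O'\<in>R ` gens. \<Sum>i\<in>{0,1}. \<Sum>a\<in>{a \<in> gens. R a = O'}. h a O' i)"
      unfolding idx by (subst sum.cartesian_product) (simp add: case_prod_beta)
    also have "\<dots> = (\<Sum>O'\<in>R ` gens. \<Sum>a\<in>{a \<in> gens. R a = O'}. \<Sum>i\<in>{0,1}. h a O' i)"
      by (intro sum.cong refl sum.swap)
    also have "\<dots> = (\<Sum>O'\<in>R ` gens. \<Sum>a\<in>{a \<in> gens. R a = O'}. \<Sum>i\<in>{0,1}. h a (R a) i)"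
      by (intro sum.cong refl) auto
    also have "\<dots> = (\<Sum>a\<in>gens. \<Sum>i\<in>{0,1}. h a (R a) i)" by (rule sum.group) auto
    finally show ?thesis by simp
  qed
  have c0: "c i > 0" for i using eps by (simp add: c_def)
  show ?thesis unfolding self_similar_measure_def
  proof (intro conjI prob_nu sets_nu exI[of _ p] ballI)
    fix z assume "z \<in> ramanujan_ifs_index 5"
    then obtain a where "a \<in> gens" "R a = fst z" by (auto simp: idx)
    then have "{a \<in> gens. R a = fst z} \<noteq> {}" by blast
    then show "0 < p z" unfolding p_def by (intro sum_pos c0) simp_all
  next
    have "(\<Sum>z\<in>ramanujan_ifs_index 5. p z) = (\<Sum>a\<in>gens. c 0 + c 1)"
      unfolding p_def using grp[of "\<lambda>a O' i. c i"] by simp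
    moreover have "c 0 + c 1 = 1 / 6" by (simp add: c_def field_simps)
    ultimately show "(\<Sum>z\<in>ramanujan_ifs_index 5. p z) = 1" by (simp only: sum_constant card_gens)
  next
    fix A :: "(real^3) set" assume A: "A \<in> sets borel"
    have fm: "(\<lambda>x. r *\<^sub>R R a x + real i *\<^sub>R e1) \<in> \<nu> \<rightarrow>\<^sub>M borel" for a i
      unfolding R_def by (subst measurable_cong_sets[OF sets_nu refl]) (intro borel_measurable_continuous_onI continuous_intros)
    have em: "emeasure (distr \<nu> borel (ramanujan_ifs r (R a, i))) A = (\<integral>\<^sup>+x. indicator A (r *\<^sub>R R a x + real i *\<^sub>R e1) \<partial>\<nu>)" for a i
    proof -
      have "emeasure (distr \<nu> borel (ramanujan_ifs r (R a, i))) A = (\<integral>\<^sup>+y. indicator A y \<partial>distr \<nu> borel (\<lambda>x. r *\<^sub>R R a x + real i *\<^sub>R e1))"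
        using A by (simp add: ramanujan_ifs_def)
      also have "\<dots> = (\<integral>\<^sup>+x. indicator A (r *\<^sub>R R a x + real i *\<^sub>R e1) \<partial>\<nu>)"
        by (rule nn_integral_distr[OF fm]) (use A in simp)
      finally show ?thesis .
    qed
    have "(\<Sum>z\<in>ramanujan_ifs_index 5. ennreal (p z) * emeasure (distr \<nu> borel (ramanujan_ifs r z)) A)
      = (\<Sum>z\<in>ramanujan_ifs_index 5. (\<Sum>a\<in>{a \<in> gens. R a = fst z}. ennreal (c (snd z)) * emeasure (distr \<nu> borel (ramanujan_ifs r (fst z, snd z))) A))"
    proof (intro sum.cong refl)
      fix z
      have "ennreal (p z) = (\<Sum>a\<in>{a \<in> gens. R a = fst z}. ennreal (c (snd z)))"
        unfolding p_def by (rule sum_ennreal[symmetric]) (rule less_imp_le[OF c0])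
      then show "ennreal (p z) * emeasure (distr \<nu> borel (ramanujan_ifs r z)) A
        = (\<Sum>a\<in>{a \<in> gens. R a = fst z}. ennreal (c (snd z)) * emeasure (distr \<nu> borel (ramanujan_ifs r (fst z, snd z))) A)"
        by (simp only: sum_distrib_right prod.collapse)
    qed
    also have "\<dots> = (\<Sum>a\<in>gens. ennreal (c 0) * emeasure (distr \<nu> borel (ramanujan_ifs r (R a, 0))) A + ennreal (c 1) * emeasure (distr \<nu> borel (ramanujan_ifs r (R a, 1))) A)"
      by (rule grp)
    also have "\<dots> = (\<Sum>q\<in>gens \<times> UNIV. ennreal (wt (snd q)) * (\<integral>\<^sup>+x. indicator A (fmap q x) \<partial>\<nu>))"
      unfolding sum_gens_bool em by (simp add: fmap_def c_def wt_def R_def)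
    also have "\<dots> = (\<integral>\<^sup>+x. indicator A x \<partial>\<nu>)" by (rule nn_integral_nu[symmetric]) (use A in simp)
    also have "\<dots> = emeasure \<nu> A" using A by simp
    finally show "emeasure \<nu> A = (\<Sum>z\<in>ramanujan_ifs_index 5. ennreal (p z) * emeasure (distr \<nu> borel (ramanujan_ifs r z)) A)" by simp
  qed
qed

text \<open>A step without translation maps the ball for \<open>n\<close> into the ball for \<open>n + 1\<close>.\<close>

lemma ball_mass: "(1 - \<epsilon>) ^ n \<le> measure \<nu> (cball 0 (r ^ n / (1 - r)))"
proof (induction n)
  case 0
  interpret prob_space \<nu> by (rule prob_nu)
  have "prob (cball 0 (1 / (1 - r))) = 1"
    by (subst prob_eq_1) (use AE_nu in \<open>auto elim!: eventually_mono\<close>)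
  then show ?case by simp
next
  case (Suc n)
  interpret prob_space \<nu> by (rule prob_nu)
  define A where "A n = cball (0::real^3) (r ^ n / (1 - r))" for n
  have ind: "indicator (A n) x \<le> (indicator (A (Suc n)) (fmap (a, False) x) :: ennreal)" if "a \<in> gens" for a x
  proof -
    have "fmap (a, False) x \<in> A (Suc n)" if "x \<in> A n"
      using mult_left_mono[of "norm x" "r ^ n / (1 - r)" r] that norm_unitq1[OF \<open>a \<in> gens\<close>] r
      by (simp add: A_def fmap_def)
    then show ?thesis by (auto simp: indicator_def)
  qed
  have "ennreal (1 - \<epsilon>) * emeasure \<nu> (A n) = (\<Sum>a\<in>gens. ennreal (wt False) * (\<integral>\<^sup>+x. indicator (A n) x \<partial>\<nu>))"
  proof -
    have "(\<Sum>a\<in>gens. ennreal (wt False) * (\<integral>\<^sup>+x. indicator (A n) x \<partial>\<nu>)) = of_nat 6 * (ennreal (wt False) * emeasure \<nu> (A n))"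
      by (simp only: sum_constant card_gens) (simp add: A_def)
    also have "\<dots> = (ennreal 6 * ennreal (wt False)) * emeasure \<nu> (A n)" by (simp add: mult.assoc)
    also have "ennreal 6 * ennreal (wt False) = ennreal (6 * wt False)"
      by (rule ennreal_mult''[symmetric]) (rule less_imp_le[OF wt_pos])
    also have "6 * wt False = 1 - \<epsilon>" by (simp add: wt_def)
    finally show ?thesis by (rule sym)
  qed
  also have "\<dots> \<le> (\<Sum>a\<in>gens. ennreal (wt False) * (\<integral>\<^sup>+x. indicator (A (Suc n)) (fmap (a, False) x) \<partial>\<nu>))"
    by (intro sum_mono mult_left_mono nn_integral_mono ind) auto
  also have "\<dots> \<le> (\<Sum>p\<in>gens \<times> UNIV. ennreal (wt (snd p)) * (\<integral>\<^sup>+x. indicator (A (Suc n)) (fmap p x) \<partial>\<nu>))"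
    unfolding sum_gens_bool by (intro sum_mono) simp
  also have "\<dots> = (\<integral>\<^sup>+x. indicator (A (Suc n)) x \<partial>\<nu>)" by (rule nn_integral_nu[symmetric]) (auto simp: A_def intro!: borel_measurable_indicator borel_closed)
  also have "\<dots> = emeasure \<nu> (A (Suc n))" by (simp add: A_def)
  finally have "(1 - \<epsilon>) * measure \<nu> (A n) \<le> measure \<nu> (A (Suc n))"
    using eps by (simp add: emeasure_eq_measure ennreal_mult''[symmetric])
  moreover have "(1 - \<epsilon>) * (1 - \<epsilon>) ^ n \<le> (1 - \<epsilon>) * measure \<nu> (A n)"
    using Suc eps unfolding A_def by (intro mult_left_mono) auto
  ultimately show ?case by (simp add: A_def)
qed

end

section \<open>Averages of functions on the sphere\<close>

lemma sum_square_le: fixes f :: "'a \<Rightarrow> real" shows "(\<Sum>i\<in>I. f i)\<^sup>2 \<le> real (card I) * (\<Sum>i\<in>I. (f i)\<^sup>2)"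
  using Cauchy_Schwarz_ineq_sum[of "\<lambda>_. 1" f I] by simp

lemma rot_lipschitz:
  assumes "norm q = 1" "norm h = 1" shows "norm (rot q x - rot h x) \<le> 2 * norm (q - h) * norm x"
proof -
  have e: "(0, rot q x - rot h x) = qmult (qmult (q - h) (0,x)) (qcnj q) + qmult (qmult h (0,x)) (qcnj (q - h))"
  proof -
    have "(0, rot q x - rot h x) = qmult (qmult q (0,x)) (qcnj q) - qmult (qmult h (0,x)) (qcnj h)"
      by (simp add: qmult_rot)
    also have "\<dots> = qmult (qmult (q - h) (0,x)) (qcnj q) + qmult (qmult h (0,x)) (qcnj (q - h))"
      by (simp add: qmult_def qcnj_def comp3 algebra_simps)
    finally show ?thesis .
  qed
  have "norm (rot q x - rot h x) = norm ((0::real), rot q x - rot h x)" by (simp add: norm_prod_def)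
  also have "\<dots> \<le> norm (q - h) * norm x * norm q + norm h * norm x * norm (q - h)"
    unfolding e by (intro order_trans[OF norm_triangle_ineq]) (simp add: norm_qmult norm_prod_def[of "0"])
  finally show ?thesis using assms by (simp add: ac_simps)
qed

lemma sph_cap:
  "\<exists>c>0::real. \<forall>(\<rho>::real) x0. 0 < \<rho> \<longrightarrow> \<rho> \<le> 1 \<longrightarrow> norm x0 = 1 \<longrightarrow> c * \<rho> ^ 3 \<le> measure sph (cball x0 \<rho>)"
proof -
  obtain c where c: "c > 0" "\<And>\<delta>. 0 < \<delta> \<Longrightarrow> \<delta> \<le> 1 \<Longrightarrow> c * \<delta> ^ 3 \<le> measure haar {q. norm (q - (1,0)) \<le> \<delta>}"
    using haar_cap by blast
  interpret H: prob_space haar by (rule prob_haar)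
  show ?thesis
  proof (intro exI[of _ "c / 8"] conjI allI impI)
    fix \<rho> :: real and x0 :: "real^3" assume h: "0 < \<rho>" "\<rho> \<le> 1" "norm x0 = 1"
    obtain q0 where q0: "norm q0 = 1" "rot q0 e1 = x0" using rot_transitive[OF h(3)] by blast
    have "c / 8 * \<rho> ^ 3 = c * (\<rho>/2) ^ 3" by (simp add: power_divide)
    also have "\<dots> \<le> measure haar (cap (1,0) (\<rho>/2))" unfolding cap_def using h by (intro c(2)) auto
    also have "\<dots> = measure haar (cap q0 (\<rho>/2))" by (rule measure_cap[OF q0(1), symmetric])
    also have "\<dots> \<le> measure haar ((\<lambda>q. rot q e1) -` cball x0 \<rho> \<inter> space haar)"
    proof (rule H.finite_measure_mono_AE)
      show "AE q in haar. q \<in> cap q0 (\<rho>/2) \<longrightarrow> q \<in> (\<lambda>q. rot q e1) -` cball x0 \<rho> \<inter> space haar"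
        using AE_haar_norm
      proof eventually_elim
        case (elim q)
        then show ?case using rot_lipschitz[OF elim q0(1), of e1] q0(2)
          by (auto simp: cap_def dist_norm norm_minus_commute)
      qed
      show "(\<lambda>q. rot q e1) -` cball x0 \<rho> \<inter> space haar \<in> sets haar"
        by (rule measurable_sets[of _ _ borel]) auto
    qed
    also have "\<dots> = measure sph (cball x0 \<rho>)"
      unfolding sph_def by (rule measure_distr[symmetric]) auto
    finally show "c / 8 * \<rho> ^ 3 \<le> measure sph (cball x0 \<rho>)" .
  qed (use c in simp)
qed

text \<open>A Lipschitz function that is \<open>a\<close> at \<open>x0\<close> is at least \<open>a / 2\<close> on a cap of radius \<open>a / (2 * \<Lambda>)\<close>, whose
  measure is of order \<open>(a / \<Lambda>) ^ 3\<close>. The true order is the square, but the cube is what projecting a cap of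
  rotations gives, and the exponent is immaterial.\<close>

lemma sup_from_nrm:
  "\<exists>c>0. \<forall>u \<Lambda> x0. cont u \<longrightarrow> 1 \<le> \<Lambda> \<longrightarrow> norm x0 = 1 \<longrightarrow> \<bar>u x0\<bar> \<le> 1 \<longrightarrow>
    (\<forall>x y. norm x = 1 \<longrightarrow> norm y = 1 \<longrightarrow> \<bar>u x - u y\<bar> \<le> \<Lambda> * norm (x - y)) \<longrightarrow>
    c * \<bar>u x0\<bar> ^ 5 \<le> \<Lambda> ^ 3 * (nrm u)\<^sup>2"
proof -
  obtain c where c: "c > 0" "\<And>\<rho> x0. 0 < \<rho> \<Longrightarrow> \<rho> \<le> 1 \<Longrightarrow> norm x0 = 1 \<Longrightarrow> c * \<rho> ^ 3 \<le> measure sph (cball x0 \<rho>)"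
    using sph_cap by blast
  show ?thesis
  proof (intro exI[of _ "c / 32"] conjI allI impI)
    fix u :: "real^3 \<Rightarrow> real" and \<Lambda> x0
    assume uc: "cont u" and L: "1 \<le> \<Lambda>" and x0: "norm x0 = 1" and u1: "\<bar>u x0\<bar> \<le> 1"
      and lip: "\<forall>x y. norm x = 1 \<longrightarrow> norm y = 1 \<longrightarrow> \<bar>u x - u y\<bar> \<le> \<Lambda> * norm (x - y)"
    define a where "a = \<bar>u x0\<bar>"
    show "c / 32 * \<bar>u x0\<bar> ^ 5 \<le> \<Lambda> ^ 3 * (nrm u)\<^sup>2"
    proof (cases "a = 0")
      case True then show ?thesis using L by (simp add: a_def)
    next
      case False
      then have a: "0 < a" "a \<le> 1" using u1 by (auto simp: a_def)
      define \<rho> where "\<rho> = a / (2 * \<Lambda>)"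
      have rho: "0 < \<rho>" "\<rho> \<le> 1" using a L by (auto simp: \<rho>_def pos_divide_le_eq)
      have "c * \<rho> ^ 3 * (a/2)\<^sup>2 \<le> measure sph (cball x0 \<rho>) * (a/2)\<^sup>2" using c(2)[OF rho x0] by (intro mult_right_mono) auto
      also have "\<dots> = (\<integral>x. (a/2)\<^sup>2 * indicator (cball x0 \<rho>) x \<partial>sph)" by simp
      also have "\<dots> \<le> (\<integral>x. u x * u x \<partial>sph)"
      proof (intro integral_mono_AE)
        interpret prob_space sph by (rule prob_sph)
        show "integrable sph (\<lambda>x. (a/2)\<^sup>2 * indicator (cball x0 \<rho>) x)"
          by (intro integrable_mult_right integrable_real_indicator) (auto simp: emeasure_eq_measure)
        show "integrable sph (\<lambda>x. u x * u x)" by (intro int_sph continuous_intros uc)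
        show "AE x in sph. (a/2)\<^sup>2 * indicator (cball x0 \<rho>) x \<le> u x * u x"
          using AE_sph_norm
        proof eventually_elim
          case (elim x)
          show ?case
          proof (cases "x \<in> cball x0 \<rho>")
            case True
            then have "\<bar>u x - u x0\<bar> \<le> \<Lambda> * \<rho>"
              using lip elim x0 L by (smt (verit) dist_norm mem_cball mult_left_mono norm_minus_commute)
            also have "\<Lambda> * \<rho> = a / 2" using L by (simp add: \<rho>_def)
            finally have "a / 2 \<le> \<bar>u x\<bar>" unfolding a_def by linarith
            then have "(a/2)\<^sup>2 \<le> \<bar>u x\<bar>\<^sup>2" using a by (intro power_mono) auto
            then show ?thesis using True by (simp add: power2_eq_square)
          qed simp
        qed
      qed
      finally have "c * \<rho> ^ 3 * (a/2)\<^sup>2 \<le> (nrm u)\<^sup>2" by (simp add: nrm_sq ip_def)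
      then have "\<Lambda> ^ 3 * (c * \<rho> ^ 3 * (a/2)\<^sup>2) \<le> \<Lambda> ^ 3 * (nrm u)\<^sup>2" using L by (intro mult_left_mono) auto
      moreover have "\<Lambda> ^ 3 * (c * \<rho> ^ 3 * (a/2)\<^sup>2) = c / 32 * a ^ 5"
        using L by (simp add: \<rho>_def power_divide power_mult_distrib eval_nat_numeral)
      ultimately show ?thesis unfolding a_def by linarith
    qed
  qed (use c in simp)
qed

definition avg :: "(real^3 \<Rightarrow> real) \<Rightarrow> real^3 \<Rightarrow> real" where "avg f x = hecke f x / 6"

lemma avg_cont: "cont f \<Longrightarrow> cont (avg f)" unfolding avg_def by (intro continuous_intros hecke_cont) auto

lemma avg_pow_cont: "cont f \<Longrightarrow> cont ((avg ^^ m) f)" by (induction m) (auto intro: avg_cont)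

lemma avg_mean: assumes "cont f" shows "(\<integral>x. avg f x \<partial>sph) = (\<integral>x. f x \<partial>sph)"
proof -
  have "(\<integral>x. hecke f x \<partial>sph) = (\<Sum>a\<in>gens. (\<integral>x. f (rot (unitq [a]) x) \<partial>sph))"
    unfolding hecke_def by (intro Bochner_Integration.integral_sum int_sph cont_comp[OF assms] continuous_intros)
  also have "\<dots> = (\<Sum>a\<in>gens. (\<integral>x. f x \<partial>sph))" by (intro sum.cong refl sph_rot norm_unitq1 assms)
  finally show ?thesis by (simp add: avg_def[abs_def] card_gens)
qed

lemma avg_const: "avg (\<lambda>_. c) = (\<lambda>_. c)" by (simp add: avg_def fun_eq_iff hecke_def card_gens)

lemma avg_add: "avg (\<lambda>x. f x + g x) = (\<lambda>x. avg f x + avg g x)"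
  by (simp add: avg_def fun_eq_iff hecke_def sum.distrib add_divide_distrib)

lemma avg_pow_split: "(avg ^^ m) (\<lambda>x. c + g x) = (\<lambda>x. c + (avg ^^ m) g x)"
  by (induction m) (simp_all add: avg_add avg_const)

lemma avg_mono: assumes "\<And>x. norm x = 1 \<Longrightarrow> f x \<le> g x" "norm x = 1" shows "avg f x \<le> avg g x"
  unfolding avg_def hecke_def by (intro divide_right_mono sum_mono assms) (auto simp: norm_unitq1 assms)

lemma avg_lipschitz:
  assumes "\<And>x y. norm x = 1 \<Longrightarrow> norm y = 1 \<Longrightarrow> \<bar>f x - f y\<bar> \<le> \<Lambda> * norm (x - y)" "norm x = 1" "norm y = 1"
  shows "\<bar>avg f x - avg f y\<bar> \<le> \<Lambda> * norm (x - y)"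
proof -
  have "\<bar>hecke f x - hecke f y\<bar> \<le> (\<Sum>a\<in>gens. \<bar>f (rot (unitq [a]) x) - f (rot (unitq [a]) y)\<bar>)"
    unfolding hecke_def sum_subtractf[symmetric] by (rule sum_abs)
  also have "\<dots> \<le> (\<Sum>a\<in>gens. \<Lambda> * norm (x - y))"
  proof (intro sum_mono)
    fix a assume a: "a \<in> gens"
    have "\<bar>f (rot (unitq [a]) x) - f (rot (unitq [a]) y)\<bar> \<le> \<Lambda> * norm (rot (unitq [a]) x - rot (unitq [a]) y)"
      using a assms by (intro assms(1)) (auto simp: norm_unitq1)
    also have "rot (unitq [a]) x - rot (unitq [a]) y = rot (unitq [a]) (x - y)" by (simp add: linear_diff[OF linear_rot])
    finally show "\<bar>f (rot (unitq [a]) x) - f (rot (unitq [a]) y)\<bar> \<le> \<Lambda> * norm (x - y)" using norm_unitq1[OF a] by simp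
  qed
  finally have "\<bar>hecke f x - hecke f y\<bar> \<le> 6 * (\<Lambda> * norm (x - y))" by (simp add: card_gens)
  moreover have "\<bar>avg f x - avg f y\<bar> = \<bar>hecke f x - hecke f y\<bar> / 6" by (simp add: avg_def diff_divide_distrib[symmetric])
  ultimately show ?thesis by simp
qed

section \<open>Fourier decay in mean square\<close>

context lazy_walk begin

definition FT :: "real^3 \<Rightarrow> complex" where "FT \<xi> = fourier_measure \<nu> \<xi>"
definition F :: "real^3 \<Rightarrow> real" where "F \<xi> = (cmod (FT \<xi>))\<^sup>2"
definition c0 :: real where "c0 = (1 - \<epsilon>)\<^sup>2 + \<epsilon>\<^sup>2"
definition b0 :: real where "b0 = 2 * \<epsilon> * (1 - \<epsilon>)"
definition \<phi> :: "real \<Rightarrow> real" where "\<phi> s = c0 + b0 * cos s"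

lemma cont_cis: "cont (\<lambda>x::real^3. cis (- (\<xi> \<bullet> x)))"
  unfolding cis_conv_exp by (intro continuous_intros)

lemma FT_alt: "FT \<xi> = Complex (\<integral>x. cos (\<xi> \<bullet> x) \<partial>\<nu>) (- (\<integral>x. sin (\<xi> \<bullet> x) \<partial>\<nu>))"
proof -
  have "Re (FT \<xi>) = (\<integral>x. Re (cis (- (\<xi> \<bullet> x))) \<partial>\<nu>)" "Im (FT \<xi>) = (\<integral>x. Im (cis (- (\<xi> \<bullet> x))) \<partial>\<nu>)"
    unfolding FT_def fourier_measure_def by (simp_all only: integral_Re[OF int_nu[OF cont_cis], symmetric] integral_Im[OF int_nu[OF cont_cis], symmetric])
  then show ?thesis by (simp add: complex_eq_iff)
qed

lemma F_alt: "F \<xi> = (\<integral>x. cos (\<xi> \<bullet> x) \<partial>\<nu>)\<^sup>2 + (\<integral>x. sin (\<xi> \<bullet> x) \<partial>\<nu>)\<^sup>2"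
  by (simp add: F_def FT_alt cmod_power2)

lemma F_cont: "cont F"
  unfolding F_alt
  by (intro continuous_intros cpt_prob_continuous_integral[OF cpt_prob_nu])
    (auto simp: case_prod_beta intro!: continuous_intros)

lemma FT_le1: "cmod (FT \<xi>) \<le> 1"
proof -
  interpret prob_space \<nu> by (rule prob_nu)
  have "cmod (FT \<xi>) \<le> (\<integral>x. cmod (cis (- (\<xi> \<bullet> x))) \<partial>\<nu>)" unfolding FT_def fourier_measure_def by (rule integral_norm_bound)
  then show ?thesis using prob_space[unfolded space_nu] by simp
qed

lemma F_nonneg: "0 \<le> F \<xi>" by (simp add: F_def)
lemma F_le1: "F \<xi> \<le> 1" unfolding F_def using FT_le1 by (simp add: power_le_one)

lemma F_lipschitz: "\<bar>F \<xi> - F \<zeta>\<bar> \<le> 2 / (1 - r) * norm (\<xi> - \<zeta>)"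
proof -
  interpret prob_space \<nu> by (rule prob_nu)
  have "FT \<xi> - FT \<zeta> = (\<integral>x. cis (- (\<xi> \<bullet> x)) - cis (- (\<zeta> \<bullet> x)) \<partial>\<nu>)"
    unfolding FT_def fourier_measure_def by (intro Bochner_Integration.integral_diff[symmetric] int_nu cont_cis)
  then have "cmod (FT \<xi> - FT \<zeta>) \<le> (\<integral>x. cmod (cis (- (\<xi> \<bullet> x)) - cis (- (\<zeta> \<bullet> x))) \<partial>\<nu>)"
    by (metis integral_norm_bound)
  also have "\<dots> \<le> (\<integral>x. norm (\<xi> - \<zeta>) * (1 / (1 - r)) \<partial>\<nu>)"
  proof (intro integral_mono_AE)
    show "AE x in \<nu>. cmod (cis (- (\<xi> \<bullet> x)) - cis (- (\<zeta> \<bullet> x))) \<le> norm (\<xi> - \<zeta>) * (1 / (1 - r))"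
      using AE_nu
    proof eventually_elim
      case (elim x)
      have "cis (- (\<xi> \<bullet> x)) - cis (- (\<zeta> \<bullet> x)) = cis (- (\<zeta> \<bullet> x)) * (cis (- ((\<xi> - \<zeta>) \<bullet> x)) - 1)"
        by (simp add: right_diff_distrib cis_mult inner_diff_left)
      then have "cmod (cis (- (\<xi> \<bullet> x)) - cis (- (\<zeta> \<bullet> x))) = cmod (cis (- ((\<xi> - \<zeta>) \<bullet> x)) - 1)" by (simp add: norm_mult)
      also have "\<dots> \<le> \<bar>(\<xi> - \<zeta>) \<bullet> x\<bar>" using cmod_cis_diff[of "- ((\<xi> - \<zeta>) \<bullet> x)"] by simp
      also have "\<dots> \<le> norm (\<xi> - \<zeta>) * norm x" by (rule Cauchy_Schwarz_ineq2)
      also have "\<dots> \<le> norm (\<xi> - \<zeta>) * (1 / (1 - r))" using elim by (intro mult_left_mono) auto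
      finally show ?case .
    qed
    show "integrable \<nu> (\<lambda>x. cmod (cis (- (\<xi> \<bullet> x)) - cis (- (\<zeta> \<bullet> x))))" by (intro int_nu continuous_intros cont_cis)
  qed simp
  also have "\<dots> = norm (\<xi> - \<zeta>) / (1 - r)" using prob_space[unfolded space_nu] by simp
  finally have d: "cmod (FT \<xi> - FT \<zeta>) \<le> norm (\<xi> - \<zeta>) / (1 - r)" .
  have "\<bar>F \<xi> - F \<zeta>\<bar> = \<bar>cmod (FT \<xi>) - cmod (FT \<zeta>)\<bar> * (cmod (FT \<xi>) + cmod (FT \<zeta>))"
    by (simp add: F_def power2_eq_square square_diff_square_factored abs_mult)
  also have "\<dots> \<le> cmod (FT \<xi> - FT \<zeta>) * 2"
    using FT_le1[of \<xi>] FT_le1[of \<zeta>] norm_triangle_ineq3[of "FT \<xi>" "FT \<zeta>"] by (intro mult_mono) auto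
  also have "\<dots> \<le> norm (\<xi> - \<zeta>) / (1 - r) * 2" using d by (rule mult_right_mono) simp
  finally show ?thesis by (simp add: mult.commute)
qed

lemma phi_alt: "\<phi> s = (cmod (of_real (1 - \<epsilon>) + of_real \<epsilon> * cis (- s)))\<^sup>2"
proof -
  have "(cmod (of_real (1 - \<epsilon>) + of_real \<epsilon> * cis (- s)))\<^sup>2 = (1 - \<epsilon> + \<epsilon> * cos s)\<^sup>2 + (\<epsilon> * sin s)\<^sup>2"
    by (simp add: cmod_power2)
  also have "\<dots> = (1 - \<epsilon>)\<^sup>2 + 2 * \<epsilon> * (1 - \<epsilon>) * cos s + \<epsilon>\<^sup>2 * ((sin s)\<^sup>2 + (cos s)\<^sup>2)"
    unfolding power2_sum power_mult_distrib by (simp only: distrib_left mult_ac add_ac)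
  also have "(sin s)\<^sup>2 + (cos s)\<^sup>2 = 1" by simp
  finally show ?thesis by (simp add: \<phi>_def c0_def b0_def)
qed

lemma cb_bounds: "0 \<le> b0" "0 \<le> c0" "c0 + b0 = 1" "c0 \<le> 1" "b0 \<le> 1"
proof -
  show b: "0 \<le> b0" using eps by (simp add: b0_def)
  show c: "0 \<le> c0" by (simp add: c0_def)
  show s: "c0 + b0 = 1" by (simp add: c0_def b0_def power2_eq_square algebra_simps)
  show "c0 \<le> 1" "b0 \<le> 1" using b c s by linarith+
qed

lemma phi_bounds: "0 \<le> \<phi> s" "\<phi> s \<le> 1"
proof -
  show "0 \<le> \<phi> s" by (simp add: phi_alt)
  have "b0 * cos s \<le> b0 * 1" using cb_bounds by (intro mult_left_mono) auto
  then show "\<phi> s \<le> 1" using cb_bounds by (simp add: \<phi>_def)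
qed

lemma FT_rec: "FT \<xi> = (of_real (1 - \<epsilon>) + of_real \<epsilon> * cis (- (\<xi>$1))) * (\<Sum>a\<in>gens. FT (r *\<^sub>R rot (qcnj (unitq [a])) \<xi>)) / 6"
proof -
  have t: "cis (- (\<xi> \<bullet> fmap (a,b) x)) = cis (- (of_bool b * \<xi>$1)) * cis (- ((r *\<^sub>R rot (qcnj (unitq [a])) \<xi>) \<bullet> x))" for a b x
  proof -
    have "\<xi> \<bullet> rot (unitq [a]) x = rot (qcnj (unitq [a])) \<xi> \<bullet> x" by (metis inner_commute rot_inner)
    then have "\<xi> \<bullet> fmap (a,b) x = (r *\<^sub>R rot (qcnj (unitq [a])) \<xi>) \<bullet> x + of_bool b * \<xi>$1"
      by (simp add: fmap_def inner_add_right inner_axis)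
    then show ?thesis by (simp add: cis_mult add.commute)
  qed
  have "FT \<xi> = (\<Sum>p\<in>gens \<times> UNIV. of_real (wt (snd p)) * (\<integral>x. cis (- (\<xi> \<bullet> fmap p x)) \<partial>\<nu>))"
    unfolding FT_def fourier_measure_def by (rule integral_nu_complex[OF cont_cis])
  also have "\<dots> = (\<Sum>a\<in>gens. of_real (wt False) * FT (r *\<^sub>R rot (qcnj (unitq [a])) \<xi>) + of_real (wt True) * (cis (- (\<xi>$1)) * FT (r *\<^sub>R rot (qcnj (unitq [a])) \<xi>)))"
    unfolding sum_gens_bool t by (simp add: FT_def fourier_measure_def)
  also have "\<dots> = (\<Sum>a\<in>gens. (of_real (1 - \<epsilon>) + of_real \<epsilon> * cis (- (\<xi>$1))) / 6 * FT (r *\<^sub>R rot (qcnj (unitq [a])) \<xi>))"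
    by (intro sum.cong refl) (simp add: wt_def field_simps)
  finally show ?thesis unfolding sum_distrib_left[symmetric] by simp
qed

text \<open>The Cauchy-Schwarz inequality for the six summands of \<open>FT_rec\<close>; the generators are closed under
  conjugation.\<close>

lemma F_rec: "F \<xi> \<le> \<phi> (\<xi>$1) * ((\<Sum>a\<in>gens. F (r *\<^sub>R rot (unitq [a]) \<xi>)) / 6)"
proof -
  define z where "z a = FT (r *\<^sub>R rot (qcnj (unitq [a])) \<xi>)" for a
  have "F \<xi> = \<phi> (\<xi>$1) * ((cmod (\<Sum>a\<in>gens. z a))\<^sup>2 / 36)"
    unfolding F_def phi_alt FT_rec[of \<xi>] z_def[symmetric] by (simp add: norm_mult norm_divide power_mult_distrib power_divide)
  also have "(cmod (\<Sum>a\<in>gens. z a))\<^sup>2 \<le> (\<Sum>a\<in>gens. cmod (z a))\<^sup>2" by (intro power_mono norm_sum) auto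
  also have "\<dots> \<le> 6 * (\<Sum>a\<in>gens. (cmod (z a))\<^sup>2)" using sum_square_le[of "\<lambda>a. cmod (z a)" gens] by (simp add: card_gens)
  also have "(\<Sum>a\<in>gens. (cmod (z a))\<^sup>2) = (\<Sum>a\<in>gens. F (r *\<^sub>R rot (unitq [a]) \<xi>))"
  proof (rule sum.reindex_bij_witness[of _ icnj icnj])
    fix a assume "a \<in> gens"
    have "unitq [icnj a] = qcnj (unitq [a])" by (simp add: unitq_def emb_icnj) (simp add: qcnj_def)
    then show "F (r *\<^sub>R rot (unitq [icnj a]) \<xi>) = (cmod (z a))\<^sup>2" by (simp add: F_def z_def)
  qed (auto simp: icnj_gens)
  finally show ?thesis using phi_bounds(1)[of "\<xi>$1"] by (simp add: mult_left_mono)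
qed

definition FR :: "real \<Rightarrow> real^3 \<Rightarrow> real" where "FR R x = F (R *\<^sub>R x)"

lemma FR_cont: "cont (FR R)" unfolding FR_def by (intro cont_comp[OF F_cont] continuous_intros)

lemma FR_rec: "FR R x \<le> \<phi> (R * x$1) * avg (FR (r * R)) x"
  using F_rec[of "R *\<^sub>R x"] by (simp add: FR_def avg_def hecke_def linear_scale[OF linear_rot] mult.commute)

definition HR :: "real \<Rightarrow> real" where "HR R = ip (FR R) (FR R)"

text \<open>Write the average as its mean \<open>m\<close> plus a function \<open>G0\<close> of mean zero. The part \<open>m\<close> is multiplied by the mean of
  \<open>\<phi>\<^sup>2\<close>, in which the cosine contributes at most \<open>1 / R \<le> \<eta>\<close>; on \<open>G0\<close> the gap gains the factor \<open>\<kappa>\<close>,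
  which outweighs the loss \<open>4 * b0 / \<eta>\<close> from the mixed term because \<open>b0\<close> is small.\<close>

lemma L2_step:
  assumes gap: "0 \<le> \<kappa>" "\<And>f. cont f \<Longrightarrow> (\<integral>x. f x \<partial>sph) = 0 \<Longrightarrow> nrm (hecke f) \<le> 6 * \<kappa> * nrm f"
    and \<eta>: "0 < \<eta>" "R * \<eta> \<ge> 1" "R > 0"
    and \<theta>: "\<theta> = c0\<^sup>2 + b0\<^sup>2 + 3 * b0 * \<eta>" "\<kappa>\<^sup>2 * (c0\<^sup>2 + b0\<^sup>2 + 2 * b0 + 4 * b0 / \<eta>) \<le> \<theta>"
  shows "HR R \<le> \<theta> * HR (r * R)"
proof -
  interpret S: prob_space sph by (rule prob_sph)
  note P1 = S.prob_space[unfolded space_sph]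
  define f where "f = FR (r * R)"
  define m where "m = (\<integral>x. f x \<partial>sph)"
  define f0 where "f0 x = f x - m" for x
  define G0 where "G0 = avg f0"
  have fc: "cont f" "cont f0" unfolding f_def f0_def by (intro continuous_intros FR_cont)+
  have Gc: "cont G0" unfolding G0_def by (rule avg_cont[OF fc(2)])
  have f00: "(\<integral>x. f0 x \<partial>sph) = 0" unfolding f0_def
    by (subst Bochner_Integration.integral_diff) (auto intro!: int_sph fc simp: m_def P1)
  have G00: "(\<integral>x. G0 x \<partial>sph) = 0" unfolding G0_def using avg_mean[OF fc(2)] f00 by simp
  have avf: "avg f x = m + G0 x" for x
    using avg_add[of "\<lambda>_. m" f0] by (simp add: f0_def G0_def avg_const)
  have nG: "nrm G0 \<le> \<kappa> * nrm f0"
  proof -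
    have "nrm G0 = nrm (\<lambda>x. (1/6) * hecke f0 x)" by (simp add: G0_def avg_def[abs_def])
    also have "\<dots> = (1/6) * nrm (hecke f0)" unfolding nrm_scale by simp
    finally show ?thesis using gap(2)[OF fc(2) f00] by simp
  qed
  define g2 where "g2 = ip G0 G0"
  have g2: "0 \<le> g2" "g2 \<le> \<kappa>\<^sup>2 * ip f0 f0"
  proof -
    show "0 \<le> g2" by (simp add: g2_def)
    have "(nrm G0)\<^sup>2 \<le> (\<kappa> * nrm f0)\<^sup>2" using nG by (intro power_mono) auto
    then show "g2 \<le> \<kappa>\<^sup>2 * ip f0 f0" by (simp add: power_mult_distrib nrm_sq g2_def)
  qed
  have Hf: "HR (r * R) = m\<^sup>2 + ip f0 f0"
  proof -
    have "HR (r * R) = (\<integral>x. (m\<^sup>2 + 2 * m * f0 x) + f0 x * f0 x \<partial>sph)"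
      unfolding HR_def ip_def f_def[symmetric] by (intro Bochner_Integration.integral_cong refl) (simp add: f0_def power2_eq_square algebra_simps)
    also have "\<dots> = (\<integral>x. m\<^sup>2 + 2 * m * f0 x \<partial>sph) + ip f0 f0"
      unfolding ip_def by (intro Bochner_Integration.integral_add int_sph continuous_intros fc)
    also have "(\<integral>x. m\<^sup>2 + 2 * m * f0 x \<partial>sph) = m\<^sup>2 + 2 * m * (\<integral>x. f0 x \<partial>sph)"
      by (subst Bochner_Integration.integral_add) (auto intro!: int_sph continuous_intros fc simp: P1)
    finally show ?thesis using f00 by simp
  qed
  define C where "C x = cos (R * x$1)" for x :: "real^3"
  have Cc: "cont C" unfolding C_def by (intro continuous_intros)
  have Cb: "\<bar>C x\<bar> \<le> 1" for x by (simp add: C_def)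
  have iC: "(\<integral>x. C x \<partial>sph) \<le> 1 / R" using cos_mean[OF \<eta>(3)] unfolding C_def by linarith
  have iCG: "(\<integral>x. C x * G0 x \<partial>sph) * m \<le> \<bar>m\<bar> * sqrt g2"
  proof -
    have "nrm C \<le> 1" by (rule nrm_le_sup[OF Cc Cb]) simp
    then have "\<bar>ip C G0\<bar> \<le> 1 * sqrt g2" using ip_CS'[OF Cc Gc] mult_right_mono[of "nrm C" 1 "sqrt g2"] g2(1)
      by (simp add: nrm_def g2_def)
    then have "\<bar>ip C G0 * m\<bar> \<le> sqrt g2 * \<bar>m\<bar>" by (simp add: abs_mult mult_right_mono)
    then have "ip C G0 * m \<le> \<bar>m\<bar> * sqrt g2" by (simp add: mult.commute)
    then show ?thesis by (simp add: ip_def)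
  qed
  have iCGG: "(\<integral>x. C x * (G0 x * G0 x) \<partial>sph) \<le> g2"
    unfolding g2_def ip_def
  proof (intro integral_mono int_sph continuous_intros Cc Gc)
    fix x
    show "C x * (G0 x * G0 x) \<le> G0 x * G0 x" using mult_right_mono[of "C x" 1 "G0 x * G0 x"] Cb[of x] by simp
  qed
  have "HR R \<le> (\<integral>x. (c0\<^sup>2 + b0\<^sup>2 + 2 * c0 * b0 * C x) * (m + G0 x)\<^sup>2 \<partial>sph)"
    unfolding HR_def ip_def
  proof (intro integral_mono int_sph continuous_intros FR_cont Cc Gc)
    fix x
    have "FR R x \<le> \<phi> (R * x$1) * (m + G0 x)" using FR_rec[of R x] avf[of x] by (simp add: f_def)
    moreover have "0 \<le> FR R x" by (simp add: FR_def F_nonneg)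
    ultimately have "FR R x * FR R x \<le> (\<phi> (R * x$1) * (m + G0 x)) * (\<phi> (R * x$1) * (m + G0 x))" by (intro mult_mono) auto
    also have "\<dots> = (\<phi> (R * x$1))\<^sup>2 * (m + G0 x)\<^sup>2" by (simp add: power2_eq_square)
    also have "\<dots> \<le> (c0\<^sup>2 + b0\<^sup>2 + 2 * c0 * b0 * C x) * (m + G0 x)\<^sup>2"
    proof (rule mult_right_mono)
      have "(C x)\<^sup>2 \<le> 1" using Cb[of x] by (simp add: abs_square_le_1)
      then have "b0\<^sup>2 * (C x)\<^sup>2 \<le> b0\<^sup>2 * 1" by (intro mult_left_mono) auto
      moreover have "(\<phi> (R * x$1))\<^sup>2 = c0\<^sup>2 + 2 * c0 * b0 * C x + b0\<^sup>2 * (C x)\<^sup>2"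
        by (simp add: \<phi>_def C_def power2_sum power_mult_distrib algebra_simps)
      ultimately show "(\<phi> (R * x$1))\<^sup>2 \<le> c0\<^sup>2 + b0\<^sup>2 + 2 * c0 * b0 * C x" by simp
    qed simp
    finally show "FR R x * FR R x \<le> (c0\<^sup>2 + b0\<^sup>2 + 2 * c0 * b0 * C x) * (m + G0 x)\<^sup>2" .
  qed
  also have "\<dots> = (c0\<^sup>2 + b0\<^sup>2) * (m\<^sup>2 + g2) + 2 * c0 * b0 * (m\<^sup>2 * (\<integral>x. C x \<partial>sph) + 2 * ((\<integral>x. C x * G0 x \<partial>sph) * m) + (\<integral>x. C x * (G0 x * G0 x) \<partial>sph))"
  proof -
    define A B where "A = c0\<^sup>2 + b0\<^sup>2" and "B = 2 * c0 * b0"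
    have "(\<integral>x. (A + B * C x) * (m + G0 x)\<^sup>2 \<partial>sph) =
      (\<integral>x. (A * m\<^sup>2 + (2 * A * m) * G0 x + A * (G0 x * G0 x)) + ((B * m\<^sup>2) * C x + (2 * B * m) * (C x * G0 x) + B * (C x * (G0 x * G0 x))) \<partial>sph)"
      by (intro Bochner_Integration.integral_cong refl) (simp add: power2_eq_square algebra_simps)
    also have "\<dots> = (\<integral>x. (A * m\<^sup>2 + (2 * A * m) * G0 x + A * (G0 x * G0 x)) \<partial>sph) + (\<integral>x. ((B * m\<^sup>2) * C x + (2 * B * m) * (C x * G0 x) + B * (C x * (G0 x * G0 x))) \<partial>sph)"
      by (intro Bochner_Integration.integral_add int_sph continuous_intros Cc Gc)
    also have "(\<integral>x. (A * m\<^sup>2 + (2 * A * m) * G0 x + A * (G0 x * G0 x)) \<partial>sph) = A * m\<^sup>2 + (2 * A * m) * (\<integral>x. G0 x \<partial>sph) + A * g2"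
      by (subst Bochner_Integration.integral_add Bochner_Integration.integral_add, (intro int_sph continuous_intros Gc)+)+ (simp add: P1 g2_def ip_def)
    also have "(\<integral>x. ((B * m\<^sup>2) * C x + (2 * B * m) * (C x * G0 x) + B * (C x * (G0 x * G0 x))) \<partial>sph)
       = (B * m\<^sup>2) * (\<integral>x. C x \<partial>sph) + (2 * B * m) * (\<integral>x. C x * G0 x \<partial>sph) + B * (\<integral>x. C x * (G0 x * G0 x) \<partial>sph)"
      by (subst Bochner_Integration.integral_add Bochner_Integration.integral_add, (intro int_sph continuous_intros Cc Gc)+)+ simp
    finally show ?thesis using G00 unfolding A_def B_def by (simp add: algebra_simps)
  qed
  also have "\<dots> \<le> (c0\<^sup>2 + b0\<^sup>2) * (m\<^sup>2 + g2) + 2 * c0 * b0 * (m\<^sup>2 * \<eta> + 2 * (\<bar>m\<bar> * sqrt g2) + g2)"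
  proof -
    have "1 / R \<le> \<eta>" using \<eta> by (simp add: pos_divide_le_eq mult.commute)
    then have "m\<^sup>2 * (\<integral>x. C x \<partial>sph) \<le> m\<^sup>2 * \<eta>" using iC by (intro mult_left_mono) auto
    then have "m\<^sup>2 * (\<integral>x. C x \<partial>sph) + 2 * ((\<integral>x. C x * G0 x \<partial>sph) * m) + (\<integral>x. C x * (G0 x * G0 x) \<partial>sph)
        \<le> m\<^sup>2 * \<eta> + 2 * (\<bar>m\<bar> * sqrt g2) + g2" using iCG iCGG by linarith
    then show ?thesis using cb_bounds by (intro add_left_mono mult_left_mono) auto
  qed
  also have "\<dots> \<le> (c0\<^sup>2 + b0\<^sup>2) * (m\<^sup>2 + g2) + 2 * b0 * (m\<^sup>2 * \<eta> + 2 * (\<bar>m\<bar> * sqrt g2) + g2)"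
    using cb_bounds \<eta>(1) g2(1) by (intro add_left_mono mult_right_mono) (auto intro!: mult_left_le_one_le)
  also have "\<dots> \<le> (c0\<^sup>2 + b0\<^sup>2) * (m\<^sup>2 + g2) + 2 * b0 * (m\<^sup>2 * \<eta> + (\<eta> / 2 * m\<^sup>2 + 2 / \<eta> * g2) + g2)"
  proof -
    have "0 \<le> (\<eta> * \<bar>m\<bar> - 2 * sqrt g2)\<^sup>2" by simp
    then have "4 * \<eta> * (\<bar>m\<bar> * sqrt g2) \<le> \<eta>\<^sup>2 * m\<^sup>2 + 4 * g2"
      using g2(1) by (simp add: power2_diff power_mult_distrib algebra_simps)
    then have "2 * (\<bar>m\<bar> * sqrt g2) \<le> \<eta> / 2 * m\<^sup>2 + 2 / \<eta> * g2"
      using \<eta>(1) by (simp add: field_simps power2_eq_square)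
    then show ?thesis using cb_bounds by (intro add_left_mono mult_left_mono add_mono order_refl) auto
  qed
  also have "\<dots> = \<theta> * m\<^sup>2 + (c0\<^sup>2 + b0\<^sup>2 + 2 * b0 + 4 * b0 / \<eta>) * g2" unfolding \<theta>(1) by (simp add: algebra_simps)
  also have "\<dots> \<le> \<theta> * m\<^sup>2 + \<theta> * ip f0 f0"
  proof -
    have "(c0\<^sup>2 + b0\<^sup>2 + 2 * b0 + 4 * b0 / \<eta>) * g2 \<le> (c0\<^sup>2 + b0\<^sup>2 + 2 * b0 + 4 * b0 / \<eta>) * (\<kappa>\<^sup>2 * ip f0 f0)"
      using cb_bounds \<eta>(1) by (intro mult_left_mono g2) auto
    also have "\<dots> = (\<kappa>\<^sup>2 * (c0\<^sup>2 + b0\<^sup>2 + 2 * b0 + 4 * b0 / \<eta>)) * ip f0 f0" by simp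
    also have "\<dots> \<le> \<theta> * ip f0 f0" by (intro mult_right_mono \<theta>) simp
    finally show ?thesis by simp
  qed
  finally show ?thesis unfolding Hf by (simp add: distrib_left)
qed

lemma HR_le1: "HR R \<le> 1"
proof -
  have "nrm (FR R) \<le> 1" by (rule nrm_le_sup[OF FR_cont]) (auto simp: FR_def F_nonneg F_le1 abs_le_iff intro: order_trans[OF _ F_nonneg])
  then show ?thesis unfolding HR_def nrm_sq[symmetric] by (simp add: power_le_one)
qed

text \<open>Iterate \<open>L2_step\<close> down to radii at most \<open>1 / \<eta>\<close>, where the bound is trivial.\<close>

lemma HR_decay:
  assumes gap: "0 \<le> \<kappa>" "\<And>f. cont f \<Longrightarrow> (\<integral>x. f x \<partial>sph) = 0 \<Longrightarrow> nrm (hecke f) \<le> 6 * \<kappa> * nrm f"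
    and \<eta>: "0 < \<eta>"
    and \<theta>: "\<theta> = c0\<^sup>2 + b0\<^sup>2 + 3 * b0 * \<eta>" "\<kappa>\<^sup>2 * (c0\<^sup>2 + b0\<^sup>2 + 2 * b0 + 4 * b0 / \<eta>) \<le> \<theta>"
    and \<beta>: "\<beta> \<ge> 0" "r powr (2 * \<beta>) = \<theta>" and R: "R > 0"
  shows "HR R \<le> (1 / (\<eta> * R)) powr (2 * \<beta>)"
proof -
  have small: "HR R \<le> (1 / (\<eta> * R)) powr (2 * \<beta>)" if "R > 0" "R * \<eta> \<le> 1" for R
  proof -
    have "1 \<le> 1 / (\<eta> * R)" using that \<eta> by (simp add: field_simps)
    then have "1 \<le> (1 / (\<eta> * R)) powr (2 * \<beta>)" using \<beta> by (intro ge_one_powr_ge_zero) auto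
    then show ?thesis using HR_le1[of R] by linarith
  qed
  have ind: "HR R \<le> (1 / (\<eta> * R)) powr (2 * \<beta>)" if "R > 0" "R * \<eta> * r ^ n \<le> 1" for n R
    using that
  proof (induction n arbitrary: R)
    case 0 then show ?case using small by simp
  next
    case (Suc n)
    show ?case
    proof (cases "R * \<eta> \<le> 1")
      case False
      then have "HR R \<le> \<theta> * HR (r * R)" by (intro L2_step[OF gap \<eta> _ _ \<theta>] Suc) auto
      also have "\<dots> \<le> \<theta> * (1 / (\<eta> * (r * R))) powr (2 * \<beta>)"
        using Suc r \<beta>(2) by (intro mult_left_mono Suc.IH) (auto simp: algebra_simps \<beta>(2)[symmetric])
      also have "\<dots> = (r * (1 / (\<eta> * (r * R)))) powr (2 * \<beta>)" unfolding \<beta>(2)[symmetric] by (rule powr_mult[symmetric])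
      also have "r * (1 / (\<eta> * (r * R))) = 1 / (\<eta> * R)" using r by simp
      finally show ?thesis .
    qed (use small Suc in auto)
  qed
  have "(\<lambda>n. R * \<eta> * r ^ n) \<longlonglongrightarrow> R * \<eta> * 0" by (intro tendsto_intros LIMSEQ_realpow_zero) (use r in auto)
  then have "eventually (\<lambda>n. R * \<eta> * r ^ n < 1) sequentially" by (rule order_tendstoD) simp
  then obtain n where "R * \<eta> * r ^ n < 1" using eventually_happens by force
  then show ?thesis using ind[OF R, of n] by simp
qed

lemma FR_iterate: "norm x = 1 \<Longrightarrow> FR R x \<le> (avg ^^ m) (FR (r ^ m * R)) x"
proof (induction m arbitrary: R x)
  case (Suc m)
  have "FR R x \<le> avg (FR (r * R)) x"
  proof -
    have "0 \<le> avg (FR (r * R)) x" unfolding avg_def hecke_def FR_def by (intro divide_nonneg_nonneg sum_nonneg F_nonneg) auto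
    then have "\<phi> (R * x$1) * avg (FR (r * R)) x \<le> 1 * avg (FR (r * R)) x" by (intro mult_right_mono phi_bounds)
    then show ?thesis using FR_rec[of R x] by simp
  qed
  also have "\<dots> \<le> avg ((avg ^^ m) (FR (r ^ m * (r * R)))) x" by (rule avg_mono[OF Suc.IH Suc.prems])
  finally show ?case by (simp add: ac_simps)
qed simp

end

section \<open>Pointwise Fourier decay\<close>

lemma avg_pow_abs_le:
  assumes "\<And>x. norm x = 1 \<Longrightarrow> \<bar>g x\<bar> \<le> b" "norm x = 1"
  shows "\<bar>(avg ^^ m) g x\<bar> \<le> b"
  using assms(2)
proof (induction m arbitrary: x)
  case (Suc m)
  have "avg ((avg ^^ m) g) x \<le> avg (\<lambda>_. b) x" by (rule avg_mono) (use Suc in \<open>auto simp: abs_le_iff\<close>)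
  moreover have "avg (\<lambda>_. - b) x \<le> avg ((avg ^^ m) g) x"
    by (rule avg_mono) (use Suc in \<open>auto simp: abs_le_iff intro: minus_le_iff[THEN iffD1]\<close>)
  ultimately show ?case by (simp add: avg_const)
qed (simp add: assms)

lemma avg_pow_lipschitz:
  assumes "\<And>x y. norm x = 1 \<Longrightarrow> norm y = 1 \<Longrightarrow> \<bar>f x - f y\<bar> \<le> \<Lambda> * norm (x - y)" "norm x = 1" "norm y = 1"
  shows "\<bar>(avg ^^ m) f x - (avg ^^ m) f y\<bar> \<le> \<Lambda> * norm (x - y)"
  using assms(2,3)
proof (induction m arbitrary: x y)
  case (Suc m) then show ?case by (simp add: avg_lipschitz)
qed (simp add: assms)

lemma avg_pow_gap:
  assumes gap: "0 \<le> \<kappa>" "\<And>f. cont f \<Longrightarrow> (\<integral>x. f x \<partial>sph) = 0 \<Longrightarrow> nrm (hecke f) \<le> 6 * \<kappa> * nrm f"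
    and g: "cont g" "(\<integral>x. g x \<partial>sph) = 0"
  shows "nrm ((avg ^^ m) g) \<le> \<kappa> ^ m * nrm g"
proof (induction m)
  case (Suc m)
  have c: "cont ((avg ^^ m) g)" by (rule avg_pow_cont[OF g(1)])
  have z: "(\<integral>x. (avg ^^ m) g x \<partial>sph) = 0"
    by (induction m) (use g in \<open>simp_all add: avg_mean avg_pow_cont\<close>)
  have "nrm (avg ((avg ^^ m) g)) = (1/6) * nrm (hecke ((avg ^^ m) g))"
    using nrm_scale[of "1/6" "hecke ((avg ^^ m) g)"] by (simp add: avg_def[abs_def])
  also have "\<dots> \<le> \<kappa> * nrm ((avg ^^ m) g)" using gap(2)[OF c z] by simp
  also have "\<dots> \<le> \<kappa> * (\<kappa> ^ m * nrm g)" by (intro mult_left_mono Suc gap)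
  finally show ?case by simp
qed simp

context lazy_walk begin

lemma FR_lipschitz: "0 \<le> R \<Longrightarrow> \<bar>FR R x - FR R y\<bar> \<le> 2 / (1 - r) * R * norm (x - y)"
  using F_lipschitz[of "R *\<^sub>R x" "R *\<^sub>R y"] by (simp add: FR_def scaleR_diff_right[symmetric])

text \<open>Iterate the recursion \<open>m\<close> times with \<open>\<phi> \<le> 1\<close>. The mean of \<open>F\<close> over the sphere of radius \<open>r ^ m * R\<close> is controlled
  by the mean square decay. The deviation \<open>u\<close> from the mean has norm at most \<open>\<kappa> ^ m\<close> and a Lipschitz
  constant of order \<open>R\<close>, so by \<open>sup_from_nrm\<close> it is \<open>O(R powr (-2))\<close> once \<open>\<kappa> ^ m \<le> R powr (-13/2)\<close>. This
  fixes \<open>m\<close> as a multiple of \<open>ln R\<close> and hence the loss in the radius.\<close>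

lemma F_decay:
  assumes gap: "0 < \<kappa>" "\<kappa> < 1" "\<And>f. cont f \<Longrightarrow> (\<integral>x. f x \<partial>sph) = 0 \<Longrightarrow> nrm (hecke f) \<le> 6 * \<kappa> * nrm f"
    and H: "0 < \<eta>" "0 \<le> \<beta>" "\<And>R. R > 0 \<Longrightarrow> HR R \<le> (1 / (\<eta> * R)) powr (2 * \<beta>)"
    and \<gamma>: "\<gamma> \<le> 2" "\<gamma> \<le> \<beta> * (1 - 13 / (2 * ln (1 / \<kappa>)) * ln (1 / r))"
  shows "\<exists>C>0. \<forall>\<xi>. norm \<xi> \<ge> 1 \<longrightarrow> F \<xi> \<le> C * norm \<xi> powr (- \<gamma>)"
proof -
  interpret S: prob_space sph by (rule prob_sph)
  note P1 = S.prob_space[unfolded space_sph]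
  obtain c where c: "c > 0" "\<And>u \<Lambda> x0. cont u \<Longrightarrow> 1 \<le> \<Lambda> \<Longrightarrow> norm x0 = 1 \<Longrightarrow> \<bar>u x0\<bar> \<le> 1 \<Longrightarrow>
    (\<And>x y. norm x = 1 \<Longrightarrow> norm y = 1 \<Longrightarrow> \<bar>u x - u y\<bar> \<le> \<Lambda> * norm (x - y)) \<Longrightarrow>
    c * \<bar>u x0\<bar> ^ 5 \<le> \<Lambda> ^ 3 * (nrm u)\<^sup>2"
    using sup_from_nrm by blast
  define l where "l = ln (1 / \<kappa>)"
  have l: "l > 0" unfolding l_def using gap by (intro ln_gt_zero) simp
  define L where "L = ln (1 / r)"
  have L: "L > 0" unfolding L_def using r by (intro ln_gt_zero) simp
  define K where "K = 13 / (2 * l)"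
  have K: "K > 0" "K * l = 13 / 2" using l by (simp_all add: K_def)
  define D where "D = root 5 ((2 / (1 - r)) ^ 3 / c)"
  have D: "D > 0" "D ^ 5 = (2 / (1 - r)) ^ 3 / c"
    unfolding D_def using c(1) r by (auto intro!: real_root_gt_zero)
  define E where "E = (1 / (\<eta> * r)) powr \<beta>"
  have E: "E \<ge> 0" by (simp add: E_def)
  show ?thesis
  proof (intro exI[of _ "E + D"] conjI allI impI)
    show "0 < E + D" using E D by simp
    fix \<xi> :: "real^3" assume x1: "norm \<xi> \<ge> 1"
    define R where "R = norm \<xi>"
    define x0 where "x0 = (1 / R) *\<^sub>R \<xi>"
    have R: "R \<ge> 1" using x1 by (simp add: R_def)
    have x0: "norm x0 = 1" "F \<xi> = FR R x0" using R by (simp_all add: x0_def FR_def R_def[symmetric])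
    define m where "m = nat \<lceil>K * ln R\<rceil>"
    have m: "K * ln R \<le> real m" "real m \<le> K * ln R + 1"
      using K R by (auto simp: m_def intro: of_nat_ceiling) 
    have km: "\<kappa> ^ m \<le> R powr (- (13 / 2))"
    proof -
      have "\<kappa> ^ m = exp (- (l * real m))" using gap
        by (simp add: l_def ln_div mult.commute[of _ "real m"] exp_of_nat_mult)
      also have "\<dots> \<le> exp (- (l * (K * ln R)))" using l m by simp
      also have "l * (K * ln R) = 13 / 2 * ln R" unfolding K(2)[symmetric] by (simp only: mult_ac)
      finally show ?thesis using R by (simp add: powr_def)
    qed
    have rm: "r * R powr (- (K * L)) \<le> r ^ m"
    proof -
      have "r * R powr (- (K * L)) = exp (- (L * (K * ln R + 1)))"
        using r R by (simp add: powr_def L_def ln_div exp_diff exp_add exp_minus algebra_simps)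
      also have "\<dots> \<le> exp (- (L * real m))" using L m by simp
      also have "\<dots> = r ^ m" using r by (simp add: L_def ln_div mult.commute[of _ "real m"] exp_of_nat_mult)
      finally show ?thesis .
    qed
    define \<rho> where "\<rho> = r ^ m * R"
    have rho: "0 < \<rho>" "\<rho> \<le> R" using r R by (auto simp: \<rho>_def power_le_one intro!: mult_left_le_one_le)
    define M where "M = (\<integral>x. FR \<rho> x \<partial>sph)"
    define g where "g x = FR \<rho> x - M" for x
    have gc: "cont g" unfolding g_def by (intro continuous_intros FR_cont)
    have FRb: "0 \<le> FR \<rho> x" "FR \<rho> x \<le> 1" for x by (simp_all add: FR_def F_nonneg F_le1)
    have iF: "integrable sph (FR \<rho>)" by (intro int_sph FR_cont)
    have Mb: "0 \<le> M" "M \<le> 1"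
    proof -
      show "0 \<le> M" unfolding M_def using FRb by simp
      have "M \<le> (\<integral>x. 1 \<partial>sph)" unfolding M_def by (intro integral_mono iF FRb) simp
      then show "M \<le> 1" using P1 by simp
    qed
    have g0: "(\<integral>x. g x \<partial>sph) = 0" unfolding g_def using iF by (simp add: M_def P1)
    have gb: "\<bar>g x\<bar> \<le> 1" for x using FRb[of x] Mb by (simp add: g_def abs_le_iff)
    define u where "u = (avg ^^ m) g"
    have uc: "cont u" unfolding u_def by (rule avg_pow_cont[OF gc])
    have nu: "nrm u \<le> \<kappa> ^ m"
    proof -
      have "nrm g \<le> 1" by (rule nrm_le_sup[OF gc gb]) simp
      have "nrm u \<le> \<kappa> ^ m * nrm g" unfolding u_def by (rule avg_pow_gap[OF _ gap(3) gc g0]) (use gap in auto)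
      also have "\<dots> \<le> \<kappa> ^ m * 1" using gap \<open>nrm g \<le> 1\<close> by (intro mult_left_mono) auto
      finally show ?thesis by simp
    qed
    define \<Lambda> where "\<Lambda> = 2 / (1 - r) * R"
    have r2: "1 \<le> 2 / (1 - r)" using r by simp
    have Lam: "1 \<le> \<Lambda>" unfolding \<Lambda>_def using mult_mono[OF r2 R] r2 by (simp only: mult_1_left)
    have glip: "\<bar>g x - g y\<bar> \<le> \<Lambda> * norm (x - y)" for x y
    proof -
      have "\<bar>g x - g y\<bar> \<le> 2 / (1 - r) * \<rho> * norm (x - y)" using FR_lipschitz[of \<rho> x y] rho by (simp add: g_def)
      also have "\<dots> \<le> 2 / (1 - r) * R * norm (x - y)" using rho r2 r by (intro mult_right_mono mult_left_mono) auto
      finally show ?thesis by (simp add: \<Lambda>_def)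
    qed
    have "c * \<bar>u x0\<bar> ^ 5 \<le> \<Lambda> ^ 3 * (nrm u)\<^sup>2"
    proof (rule c(2)[OF uc Lam x0(1)])
      show "\<bar>u x0\<bar> \<le> 1" unfolding u_def by (rule avg_pow_abs_le[OF gb x0(1)])
      show "\<bar>u x - u y\<bar> \<le> \<Lambda> * norm (x - y)" if "norm x = 1" "norm y = 1" for x y
        unfolding u_def by (rule avg_pow_lipschitz[OF glip that])
    qed
    also have "\<dots> \<le> \<Lambda> ^ 3 * (R powr (- (13 / 2)))\<^sup>2"
      using nu km Lam nrm_ge0[of u] by (intro mult_left_mono power_mono) auto
    also have "\<dots> = (2 / (1 - r)) ^ 3 * (R powr (-2)) ^ 5"
    proof -
      have "\<Lambda> ^ 3 = (2 / (1 - r)) ^ 3 * R powr 3" unfolding \<Lambda>_def power_mult_distrib using R by simp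
      moreover have "(R powr (- (13 / 2)))\<^sup>2 = R powr (-13)" by (simp add: power2_eq_square powr_add[symmetric])
      moreover have "(R powr (-2)) ^ 5 = R powr (-10)" using R by (simp add: powr_power)
      moreover have "R powr 3 * R powr (-13) = R powr (-10)" unfolding powr_add[symmetric] by simp
      ultimately show ?thesis by (simp only: mult.assoc)
    qed
    finally have "\<bar>u x0\<bar> ^ 5 \<le> (2 / (1 - r)) ^ 3 * (R powr (-2)) ^ 5 / c" using c(1) by (simp add: pos_le_divide_eq mult.commute)
    also have "\<dots> = (D * R powr (-2)) ^ 5" by (simp only: power_mult_distrib D(2)) simp
    finally have u1: "\<bar>u x0\<bar> \<le> D * R powr (-2)" by (rule power_le_imp_le_base[of _ 4, simplified]) (use D in auto)
    have M1: "M \<le> E * R powr (- \<gamma>)"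
    proof -
      have "M = ip (FR \<rho>) (\<lambda>_. 1)" by (simp add: M_def ip_def)
      also have "\<dots> \<le> nrm (FR \<rho>) * nrm (\<lambda>_. 1)" using ip_CS'[OF FR_cont, of "\<lambda>_. 1" \<rho>] by (simp add: nrm_def)
      also have "nrm (\<lambda>_. 1) = 1" by (simp add: nrm_def ip_def P1)
      finally have "M \<le> nrm (FR \<rho>)" by simp
      also have "\<dots> \<le> (1 / (\<eta> * \<rho>)) powr \<beta>"
      proof (rule power2_le_imp_le)
        have "(nrm (FR \<rho>))\<^sup>2 \<le> (1 / (\<eta> * \<rho>)) powr (2 * \<beta>)" using H(3)[OF rho(1)] by (simp add: HR_def nrm_sq)
        also have "\<dots> = ((1 / (\<eta> * \<rho>)) powr \<beta>)\<^sup>2" by (simp only: power2_eq_square powr_add[symmetric] mult_2)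
        finally show "(nrm (FR \<rho>))\<^sup>2 \<le> ((1 / (\<eta> * \<rho>)) powr \<beta>)\<^sup>2" .
      qed simp
      also have "\<dots> \<le> (1 / (\<eta> * r) * R powr (- (1 - K * L))) powr \<beta>"
      proof (rule powr_mono2)
        have "1 / (\<eta> * \<rho>) \<le> 1 / (\<eta> * (r * R powr (- (K * L)) * R))"
          unfolding \<rho>_def using rm H R r by (intro divide_left_mono mult_left_mono mult_right_mono) auto
        also have "\<dots> = 1 / (\<eta> * r) * R powr (- (1 - K * L))"
          using R by (simp add: powr_diff powr_minus field_simps)
        finally show "1 / (\<eta> * \<rho>) \<le> 1 / (\<eta> * r) * R powr (- (1 - K * L))" .
      qed (use H rho in auto)
      also have "\<dots> = E * R powr (- (\<beta> * (1 - K * L)))"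
        unfolding E_def powr_mult powr_powr by (simp only: mult_minus_left mult_minus_right mult.commute)
      also have "\<dots> \<le> E * R powr (- \<gamma>)" using \<gamma>(2) R E unfolding K_def l_def L_def by (intro mult_left_mono powr_mono) auto
      finally show ?thesis .
    qed
    have "F \<xi> \<le> (avg ^^ m) (FR \<rho>) x0" unfolding x0(2) \<rho>_def by (rule FR_iterate[OF x0(1)])
    also have "FR \<rho> = (\<lambda>x. M + g x)" by (simp add: g_def fun_eq_iff)
    also have "(avg ^^ m) (\<lambda>x. M + g x) x0 = M + u x0" unfolding avg_pow_split u_def ..
    also have "\<dots> \<le> E * R powr (- \<gamma>) + D * R powr (-2)" using M1 u1 by linarith
    also have "\<dots> \<le> E * R powr (- \<gamma>) + D * R powr (- \<gamma>)" using \<gamma>(1) R D by (intro add_left_mono mult_left_mono powr_mono) auto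
    finally show "F \<xi> \<le> (E + D) * norm \<xi> powr (- \<gamma>)" by (simp add: R_def distrib_right)
  qed
qed

end

section \<open>Concentration of the measure\<close>

context lazy_walk begin

text \<open>The ball of \<open>ball_mass\<close> alone contributes to the energy of order \<open>\<alpha>\<close> a multiple of
  \<open>r powr (n * (a - \<alpha>))\<close>, which is unbounded in \<open>n\<close> for \<open>\<alpha> > a\<close>.\<close>

lemma dim2_le:
  assumes a: "0 \<le> a" "(1 - \<epsilon>)\<^sup>2 = r powr a"
  shows "dim2 \<nu> \<le> ereal a"
  unfolding dim2_def
proof (rule Sup_least, clarsimp)
  fix \<alpha> assume fin: "riesz_energy \<alpha> \<nu> < \<top>"
  show "\<alpha> \<le> a"
  proof (rule ccontr)
    assume "\<not> \<alpha> \<le> a"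
    then have al: "a < \<alpha>" "0 < \<alpha>" using a by auto
    interpret prob_space \<nu> by (rule prob_nu)
    obtain e where e: "riesz_energy \<alpha> \<nu> = ennreal e" "0 \<le> e" using fin by (metis ennreal_cases less_irrefl infinity_ennreal_def)
    have bound: "(2 / (1 - r)) powr (- \<alpha>) * (r powr (a - \<alpha>)) ^ n \<le> e" for n
    proof -
      define \<rho> where "\<rho> = r ^ n / (1 - r)"
      define B where "B = cball (0::real^3) \<rho>"
      define k where "k = (2 * \<rho>) powr (- \<alpha>)"
      have rho: "0 < \<rho>" using r by (simp add: \<rho>_def)
      have B: "B \<in> sets \<nu>" unfolding B_def by simp
      have ker: "ennreal k * indicator B x * indicator B y \<le> riesz_kernel \<alpha> (x - y)" for x y
      proof (cases "x \<in> B \<and> y \<in> B \<and> x \<noteq> y")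
        case True
        then have "norm (x - y) \<le> 2 * \<rho>" unfolding B_def using norm_triangle_ineq4[of x y] by simp
        then have "k \<le> norm (x - y) powr (- \<alpha>)" unfolding k_def using True al by (intro powr_mono2') auto
        then show ?thesis using True al by (simp add: riesz_kernel_def ennreal_leI)
      qed (use al in \<open>auto simp: riesz_kernel_def indicator_def\<close>)
      have "ennreal (k * (measure \<nu> B * measure \<nu> B)) = (\<integral>\<^sup>+x. (\<integral>\<^sup>+y. ennreal k * indicator B x * indicator B y \<partial>\<nu>) \<partial>\<nu>)"
        using B by (simp add: nn_integral_cmult nn_integral_multc emeasure_eq_measure ennreal_mult' k_def ac_simps)
      also have "\<dots> \<le> riesz_energy \<alpha> \<nu>" unfolding riesz_energy_def by (intro nn_integral_mono ker)
      finally have le: "k * (measure \<nu> B * measure \<nu> B) \<le> e" using e by simp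
      have keq: "k = (2 / (1 - r)) powr (- \<alpha>) * (r powr (- \<alpha>)) ^ n"
      proof -
        have "2 * \<rho> = 2 / (1 - r) * r ^ n" by (simp add: \<rho>_def)
        then have "k = (2 / (1 - r)) powr (- \<alpha>) * (r ^ n) powr (- \<alpha>)" unfolding k_def by (simp only: powr_mult)
        also have "(r ^ n) powr (- \<alpha>) = (r powr (- \<alpha>)) ^ n" using r by (simp add: powr_powr powr_power mult.commute flip: powr_realpow)
        finally show ?thesis .
      qed
      have "k * ((1 - \<epsilon>) ^ n * (1 - \<epsilon>) ^ n) \<le> k * (measure \<nu> B * measure \<nu> B)"
        using ball_mass[of n] eps unfolding B_def \<rho>_def k_def by (intro mult_left_mono mult_mono) auto
      also have "(1 - \<epsilon>) ^ n * (1 - \<epsilon>) ^ n = (r powr a) ^ n" unfolding a(2)[symmetric] by (simp add: power2_eq_square power_mult_distrib)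
      also have "k * ((r powr a) ^ n) = (2 / (1 - r)) powr (- \<alpha>) * (r powr (a - \<alpha>)) ^ n"
        unfolding keq by (simp add: power_mult_distrib[symmetric] powr_add[symmetric] mult.assoc)
      finally show ?thesis using le by linarith
    qed
    have "1 < r powr (a - \<alpha>)" using al r by (simp add: powr_def mult_neg_neg)
    then obtain n where "e / (2 / (1 - r)) powr (- \<alpha>) < (r powr (a - \<alpha>)) ^ n" using real_arch_pow by blast
    then show False using bound[of n] r by (simp add: pos_divide_less_eq mult.commute)
  qed
qed

text \<open>A square integrable density gives a ball of radius \<open>\<rho>\<close> the mass \<open>O(\<rho> powr (3/2))\<close>, while the mass in
  \<open>ball_mass\<close> is of order \<open>\<rho> powr (a / 2)\<close>.\<close>

lemma no_L2_density:
  assumes a: "a < 3" "(1 - \<epsilon>)\<^sup>2 = r powr a"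
  shows "\<not> has_L2_density \<nu>"
proof
  assume "has_L2_density \<nu>"
  then obtain g :: "real^3 \<Rightarrow> real" where g: "g \<in> borel_measurable borel" "\<And>x. 0 \<le> g x"
    "integrable lborel (\<lambda>x. (g x)\<^sup>2)" "\<nu> = density lborel (\<lambda>x. ennreal (g x))" unfolding has_L2_density_def by blast
  interpret prob_space \<nu> by (rule prob_nu)
  define G where "G = (\<integral>x. (g x)\<^sup>2 \<partial>lborel)"
  define V where "V = unit_ball_vol 3"
  have GV: "0 \<le> G" "0 \<le> V" by (auto simp: G_def V_def)
  have ball: "measure \<nu> (cball 0 \<rho>) \<le> (G + V) / 2 * \<rho> powr (3/2)" if rho: "0 < \<rho>" for \<rho>
  proof -
    define k where "k = \<rho> powr (3/2)"
    have k: "0 < k" "k * k = \<rho> ^ 3" using rho by (simp_all add: k_def powr_add[symmetric])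
    have cb: "cball (0::real^3) \<rho> \<in> sets borel" by (intro borel_closed closed_cball)
    have pt: "ennreal (g x) * indicator (cball 0 \<rho>) x \<le> ennreal (k / 2) * ennreal ((g x)\<^sup>2) + ennreal (1 / (2 * k)) * indicator (cball 0 \<rho>) x" for x
    proof (cases "x \<in> cball 0 \<rho>")
      case True
      have "0 \<le> (k * g x - 1)\<^sup>2 / (2 * k)" using k by simp
      also have "\<dots> = k / 2 * (g x)\<^sup>2 + 1 / (2 * k) - g x" using k by (simp add: field_simps power2_eq_square)
      finally have "ennreal (g x) \<le> ennreal (k / 2 * (g x)\<^sup>2 + 1 / (2 * k))" by (intro ennreal_leI) simp
      then show ?thesis using True k by (simp add: ennreal_mult'[symmetric] flip: ennreal_plus)
    qed simp
    have "emeasure \<nu> (cball 0 \<rho>) = (\<integral>\<^sup>+x. ennreal (g x) * indicator (cball 0 \<rho>) x \<partial>lborel)"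
      unfolding g(4) using g(1) by (intro emeasure_density) auto
    also have "\<dots> \<le> (\<integral>\<^sup>+x. ennreal (k / 2) * ennreal ((g x)\<^sup>2) + ennreal (1 / (2 * k)) * indicator (cball 0 \<rho>) x \<partial>lborel)"
      by (intro nn_integral_mono pt)
    also have "\<dots> = ennreal (k / 2) * (\<integral>\<^sup>+x. ennreal ((g x)\<^sup>2) \<partial>lborel) + ennreal (1 / (2 * k)) * emeasure lborel (cball (0::real^3) \<rho>)"
      using g(1) cb by (subst nn_integral_add) (auto simp: nn_integral_cmult nn_integral_cmult_indicator intro!: borel_measurable_times_ennreal borel_measurable_const borel_measurable_indicator)
    also have "(\<integral>\<^sup>+x. ennreal ((g x)\<^sup>2) \<partial>lborel) = ennreal G"
      unfolding G_def by (rule nn_integral_eq_integral[OF g(3)]) simp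
    also have "emeasure lborel (cball (0::real^3) \<rho>) = ennreal (V * \<rho> ^ 3)" using rho by (simp add: emeasure_cball V_def)
    also have "ennreal (k / 2) * ennreal G + ennreal (1 / (2 * k)) * ennreal (V * \<rho> ^ 3) = ennreal (k / 2 * G + 1 / (2 * k) * (V * \<rho> ^ 3))"
      using rho k GV by (simp add: ennreal_mult'[symmetric] flip: ennreal_plus)
    also have "k / 2 * G + 1 / (2 * k) * (V * \<rho> ^ 3) = (G + V) / 2 * k"
      using k unfolding k(2)[symmetric] by (simp add: field_simps)
    finally show ?thesis using GV k by (simp add: emeasure_eq_measure k_def)
  qed
  define b where "b = r powr ((a - 3) / 2)"
  define D where "D = (G + V) / 2 * (1 / (1 - r)) powr (3/2)"
  have b1: "1 < b" using a r by (simp add: b_def powr_def mult_neg_neg)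
  have "b ^ n \<le> D" for n
  proof -
    have q: "1 - \<epsilon> = r powr (a / 2)"
    proof -
      have "(1 - \<epsilon>)\<^sup>2 = (r powr (a / 2))\<^sup>2" unfolding a(2) using r by (simp add: power2_eq_square powr_add[symmetric])
      then show ?thesis using eps by (subst (asm) power2_eq_iff_nonneg) auto
    qed
    have "(r powr (a / 2)) ^ n \<le> (G + V) / 2 * (r ^ n / (1 - r)) powr (3/2)"
      using ball_mass[of n] ball[of "r ^ n / (1 - r)"] r unfolding q by force
    also have "(r ^ n / (1 - r)) powr (3/2) = (1 / (1 - r)) powr (3/2) * (r powr (3/2)) ^ n"
    proof -
      have "r ^ n / (1 - r) = 1 / (1 - r) * r ^ n" by simp
      moreover have "(r ^ n) powr (3/2) = (r powr (3/2)) ^ n" using r by (simp add: powr_powr powr_power mult.commute flip: powr_realpow)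
      ultimately show ?thesis by (simp only: powr_mult)
    qed
    finally have "(r powr (a / 2)) ^ n \<le> D * (r powr (3/2)) ^ n" by (simp add: D_def)
    moreover have "(r powr (a / 2)) ^ n = b ^ n * (r powr (3/2)) ^ n"
      using r by (simp add: b_def power_mult_distrib[symmetric] powr_add[symmetric] diff_divide_distrib)
    ultimately show ?thesis using r by simp
  qed
  moreover obtain n where "D < b ^ n" using real_arch_pow[OF b1] by blast
  ultimately show False by (meson not_le)
qed

end

section \<open>Absolute continuity from a square integrable Fourier transform\<close>

lemma double_cos_integral:
  fixes s :: real
  assumes M: "cpt_prob M"
  shows "(\<integral>u. (\<integral>v. cos (s * (u - v)) \<partial>M) \<partial>M) = (\<integral>u. cos (s * u) \<partial>M)\<^sup>2 + (\<integral>u. sin (s * u) \<partial>M)\<^sup>2"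
proof -
  define A where "A = (\<integral>u. cos (s * u) \<partial>M)"
  define B where "B = (\<integral>u. sin (s * u) \<partial>M)"
  note int = cpt_prob_integrable[OF M]
  have s1: "(\<integral>v. cos (s * (u - v)) \<partial>M) = cos (s * u) * A + sin (s * u) * B" for u
  proof -
    have "(\<integral>v. cos (s * (u - v)) \<partial>M) = (\<integral>v. cos (s * u) * cos (s * v) + sin (s * u) * sin (s * v) \<partial>M)"
      by (simp add: right_diff_distrib cos_diff)
    also have "\<dots> = cos (s * u) * A + sin (s * u) * B"
      unfolding A_def B_def by (subst Bochner_Integration.integral_add) (auto intro!: int continuous_intros)
    finally show ?thesis .
  qed
  have "(\<integral>u. (\<integral>v. cos (s * (u - v)) \<partial>M) \<partial>M) = A * A + B * B"
    unfolding s1 by (subst Bochner_Integration.integral_add) (auto intro!: int continuous_intros simp: A_def B_def)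
  then show ?thesis by (simp add: A_def B_def power2_eq_square)
qed

text \<open>The double integral is the squared modulus of the mean of \<open>cis (z * u)\<close> over \<open>u\<close> in \<open>[0, 1]\<close>: a nonnegative kernel,
  bounded below near zero, whose Fourier transform has compact support.\<close>

lemma Fejer_kernel_bound:
  fixes z :: real
  assumes "\<bar>z\<bar> \<le> 1"
  shows "1 \<le> 4 * (\<integral>u. (\<integral>v. cos (z * (u - v)) \<partial>unif01) \<partial>unif01)"
proof -
  interpret U: prob_space unif01 using cpt_prob_unif01 by (simp add: cpt_prob_def)
  define A where "A = (\<integral>u. cos (z * u) \<partial>unif01)"
  define B where "B = (\<integral>u. sin (z * u) \<partial>unif01)"
  note int = cpt_prob_integrable[OF cpt_prob_unif01]
  have "(\<integral>u. (\<integral>v. cos (z * (u - v)) \<partial>unif01) \<partial>unif01) = A * A + B * B"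
    by (simp add: double_cos_integral[OF cpt_prob_unif01] A_def B_def power2_eq_square)
  moreover have "1 / 2 \<le> A"
  proof -
    have "(\<integral>u. 1 / 2 \<partial>unif01) \<le> A" unfolding A_def
    proof (intro integral_mono_AE)
      have "AE u in unif01. u \<in> {0..1}" unfolding unif01_def by (intro AE_uniform_measureI) auto
      then show "AE u in unif01. 1 / 2 \<le> cos (z * u)"
      proof eventually_elim
        case (elim u)
        then have "\<bar>z * u\<bar> \<le> 1" using assms by (auto simp: abs_mult intro: mult_le_one)
        then have "\<bar>z * u\<bar> \<le> pi / 3" using pi_gt3 by linarith
        then have "cos (pi / 3) \<le> cos \<bar>z * u\<bar>" by (intro cos_monotone_0_pi_le) (use pi_gt3 in auto)
        then show ?case by (simp add: cos_60)
      qed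
    qed (auto intro!: int continuous_intros)
    then show ?thesis using U.prob_space by simp
  qed
  then have "1 / 2 * (1 / 2) \<le> A * A" by (intro mult_mono) auto
  moreover have "0 \<le> B * B" by simp
  ultimately show ?thesis by linarith
qed

text \<open>The energy is the integral of the squared modulus of the Fourier transform of \<open>\<mu>\<close>, written without
  complex numbers.\<close>

locale line_measure =
  fixes \<mu> :: "real measure" and E :: real
  assumes cpt: "cpt_prob \<mu>"
    and energy: "(\<integral>\<^sup>+ s. ennreal (\<integral>x. (\<integral>y. cos (s * (x - y)) \<partial>\<mu>) \<partial>\<mu>) \<partial>lborel) \<le> ennreal E" "0 \<le> E"
begin

sublocale prob_space \<mu> using cpt by (simp add: cpt_prob_def)

lemma sets_mu [measurable_cong, simp]: "sets \<mu> = sets borel" using cpt by (simp add: cpt_prob_def)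
lemma space_mu [simp]: "space \<mu> = UNIV" using sets_eq_imp_space_eq[OF sets_mu] by simp

definition G :: "real \<Rightarrow> real" where "G s = (\<integral>x. (\<integral>y. cos (s * (x - y)) \<partial>\<mu>) \<partial>\<mu>)"

lemma G_cont: "cont G"
  unfolding G_def
  by (intro cpt_prob_continuous_integral[OF cpt] continuous_intros | simp add: case_prod_beta)+

lemma G_nonneg: "0 \<le> G s" unfolding G_def double_cos_integral[OF cpt] by simp

text \<open>Bound the indicator of \<open>\<bar>x - y\<bar> \<le> \<rho>\<close> by the kernel of \<open>Fejer_kernel_bound\<close> and exchange integrals: what remains is a mean of
  the squared modulus of the Fourier transform over frequencies of order \<open>1 / \<rho>\<close>.\<close>

lemma near_diagonal:
  assumes rho: "0 < \<rho>"
  shows "(\<integral>\<^sup>+x. (\<integral>\<^sup>+y. indicator (cball x \<rho>) y \<partial>\<mu>) \<partial>\<mu>) \<le> ennreal (4 * E * \<rho>)"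
proof -
  interpret U: prob_space unif01 using cpt_prob_unif01 by (simp add: cpt_prob_def)
  have setsU: "sets unif01 = sets borel" by (simp add: unif01_def)
  note U = cpt_prob_unif01
  define k where "k x y = (\<integral>u. (\<integral>v. cos ((x - y) / \<rho> * (u - v)) \<partial>unif01) \<partial>unif01)" for x y
  have kb: "indicator (cball x \<rho>) y \<le> ennreal (4 * k x y)" for x y
  proof (cases "y \<in> cball x \<rho>")
    case True
    then have "\<bar>(x - y) / \<rho>\<bar> \<le> 1" using rho by (simp add: dist_real_def)
    from Fejer_kernel_bound[OF this] show ?thesis using True unfolding k_def by simp
  qed simp
  have kn: "0 \<le> k x y" for x y unfolding k_def double_cos_integral[OF U] by simp
  have "(\<integral>\<^sup>+x. (\<integral>\<^sup>+y. indicator (cball x \<rho>) y \<partial>\<mu>) \<partial>\<mu>) \<le> (\<integral>\<^sup>+x. (\<integral>\<^sup>+y. ennreal (4 * k x y) \<partial>\<mu>) \<partial>\<mu>)"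
    by (intro nn_integral_mono kb)
  also have "\<dots> = ennreal (4 * (\<integral>x. (\<integral>y. k x y \<partial>\<mu>) \<partial>\<mu>))"
  proof -
    have kc2: "continuous_on UNIV (\<lambda>(x,y). k x y)"
    proof -
      have "continuous_on UNIV (\<lambda>p. (\<integral>u. (\<integral>v. cos ((fst p - snd p) / \<rho> * (u - v)) \<partial>unif01) \<partial>unif01))"
        using rho by (intro cpt_prob_continuous_integral[OF U] | (auto simp: case_prod_beta intro!: continuous_intros)[1])+
      then show ?thesis by (simp add: k_def case_prod_beta)
    qed
    have kc1: "cont (k x)" for x
    proof -
      have "cont (\<lambda>y. (\<lambda>(x,y). k x y) (x, y))" by (rule continuous_on_compose2[OF kc2]) (auto intro!: continuous_intros)
      then show ?thesis by simp
    qed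
    have "(\<integral>\<^sup>+y. ennreal (4 * k x y) \<partial>\<mu>) = ennreal (4 * (\<integral>y. k x y \<partial>\<mu>))" for x
      by (subst nn_integral_eq_integral) (auto intro!: cpt_prob_integrable[OF cpt] continuous_intros kc1 simp: kn)
    moreover have "(\<integral>\<^sup>+x. ennreal (4 * (\<integral>y. k x y \<partial>\<mu>)) \<partial>\<mu>) = ennreal (4 * (\<integral>x. (\<integral>y. k x y \<partial>\<mu>) \<partial>\<mu>))"
      by (subst nn_integral_eq_integral)
        (auto intro!: cpt_prob_integrable[OF cpt] continuous_intros cpt_prob_continuous_integral[OF cpt kc2] Bochner_Integration.integral_nonneg simp: kn)
    ultimately show ?thesis by simp
  qed
  also have "(\<integral>x. (\<integral>y. k x y \<partial>\<mu>) \<partial>\<mu>) = (\<integral>u. (\<integral>v. G ((u - v) / \<rho>) \<partial>unif01) \<partial>unif01)"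
  proof -
    have "(\<integral>x. (\<integral>y. k x y \<partial>\<mu>) \<partial>\<mu>) = (\<integral>x. (\<integral>u. (\<integral>y. (\<integral>v. cos ((x - y) / \<rho> * (u - v)) \<partial>unif01) \<partial>\<mu>) \<partial>unif01) \<partial>\<mu>)"
      unfolding k_def
      by (intro Bochner_Integration.integral_cong refl cpt_prob_fubini[OF cpt U] | (unfold case_prod_beta, rule cpt_prob_continuous_integral[OF U], use rho in \<open>force simp: case_prod_beta intro!: continuous_intros\<close>))+
    also have "\<dots> = (\<integral>x. (\<integral>u. (\<integral>v. (\<integral>y. cos ((x - y) / \<rho> * (u - v)) \<partial>\<mu>) \<partial>unif01) \<partial>unif01) \<partial>\<mu>)"
      by (intro Bochner_Integration.integral_cong refl cpt_prob_fubini[OF cpt U]) (use rho in \<open>force simp: case_prod_beta intro!: continuous_intros\<close>)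
    also have "\<dots> = (\<integral>u. (\<integral>x. (\<integral>v. (\<integral>y. cos ((x - y) / \<rho> * (u - v)) \<partial>\<mu>) \<partial>unif01) \<partial>\<mu>) \<partial>unif01)"
      by (intro cpt_prob_fubini[OF cpt U], unfold case_prod_beta)
        (intro cpt_prob_continuous_integral[OF U] cpt_prob_continuous_integral[OF cpt] | (use rho in \<open>force simp: case_prod_beta intro!: continuous_intros cpt_prob_continuous_integral[OF cpt]\<close>)[1])+
    also have "\<dots> = (\<integral>u. (\<integral>v. (\<integral>x. (\<integral>y. cos ((x - y) / \<rho> * (u - v)) \<partial>\<mu>) \<partial>\<mu>) \<partial>unif01) \<partial>unif01)"
      by (intro Bochner_Integration.integral_cong refl cpt_prob_fubini[OF cpt U], unfold case_prod_beta)
        (intro cpt_prob_continuous_integral[OF cpt] | (use rho in \<open>force simp: case_prod_beta intro!: continuous_intros\<close>)[1])+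
    also have "\<dots> = (\<integral>u. (\<integral>v. G ((u - v) / \<rho>) \<partial>unif01) \<partial>unif01)"
      unfolding G_def by (simp add: mult.commute)
    finally show ?thesis .
  qed
  also have "ennreal (4 * (\<integral>u. (\<integral>v. G ((u - v) / \<rho>) \<partial>unif01) \<partial>unif01)) \<le> ennreal (4 * E * \<rho>)"
  proof -
    have inner: "(\<integral>v. G ((u - v) / \<rho>) \<partial>unif01) \<le> E * \<rho>" for u
    proof -
      have Gc: "cont (\<lambda>v. G ((u - v) / \<rho>))" using rho by (intro cont_comp[OF G_cont] continuous_intros) auto
      have "ennreal (\<integral>v. G ((u - v) / \<rho>) \<partial>unif01) = (\<integral>\<^sup>+v. ennreal (G ((u - v) / \<rho>)) \<partial>unif01)"
        by (intro nn_integral_eq_integral[symmetric] cpt_prob_integrable[OF U] Gc) (simp add: G_nonneg)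
      also have "\<dots> = (\<integral>\<^sup>+v. ennreal (G ((u - v) / \<rho>)) * indicator {0..1} v \<partial>lborel)"
        unfolding unif01_def using cont_borel[OF Gc] by (subst nn_integral_uniform_measure) (auto simp: divide_ennreal_def)
      also have "\<dots> \<le> (\<integral>\<^sup>+v. ennreal (G ((u - v) / \<rho>)) \<partial>lborel)"
        by (intro nn_integral_mono) (auto simp: indicator_def)
      also have "\<dots> = ennreal \<rho> * (\<integral>\<^sup>+s. ennreal (G s) \<partial>lborel)"
      proof -
        have "(\<integral>\<^sup>+s. ennreal (G s) \<partial>lborel) = ennreal (1 / \<rho>) * (\<integral>\<^sup>+v. ennreal (G ((u - v) / \<rho>)) \<partial>lborel)"
          using nn_integral_real_affine[of "\<lambda>s. ennreal (G s)" "- 1 / \<rho>" "u / \<rho>"] rho cont_borel[OF G_cont]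
          by (simp add: diff_divide_distrib)
        then have "ennreal \<rho> * (\<integral>\<^sup>+s. ennreal (G s) \<partial>lborel) = ennreal (\<rho> * (1 / \<rho>)) * (\<integral>\<^sup>+v. ennreal (G ((u - v) / \<rho>)) \<partial>lborel)"
          using rho by (simp add: ennreal_mult'[symmetric] mult.assoc[symmetric])
        then show ?thesis using rho by simp
      qed
      also have "\<dots> \<le> ennreal \<rho> * ennreal E" using energy by (intro mult_left_mono) (auto simp: G_def)
      also have "\<dots> = ennreal (E * \<rho>)" using rho by (simp add: ennreal_mult' mult.commute energy)
      finally show ?thesis using energy rho by (simp add: ennreal_le_iff)
    qed
    have "(\<integral>u. (\<integral>v. G ((u - v) / \<rho>) \<partial>unif01) \<partial>unif01) \<le> (\<integral>u. E * \<rho> \<partial>unif01)"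
    proof (intro integral_mono inner cpt_prob_integrable[OF U] cpt_prob_continuous_integral[OF U])
      show "continuous_on UNIV (\<lambda>(u, v). G ((u - v) / \<rho>))"
        unfolding case_prod_beta using rho by (intro continuous_on_compose2[OF G_cont] continuous_intros) auto
    qed auto
    then have "(\<integral>u. (\<integral>v. G ((u - v) / \<rho>) \<partial>unif01) \<partial>unif01) \<le> E * \<rho>" using U.prob_space by simp
    then show ?thesis by (intro ennreal_leI) simp
  qed
  finally show ?thesis .
qed

end

definition near :: "real \<Rightarrow> real \<Rightarrow> real \<Rightarrow> ennreal" where "near \<rho> x y = (if \<bar>x - y\<bar> \<le> \<rho> then 1 else 0)"

lemma near_measurable [measurable]:
  "f \<in> borel_measurable M \<Longrightarrow> g \<in> borel_measurable M \<Longrightarrow> (\<lambda>x. near \<rho> (f x) (g x)) \<in> borel_measurable M"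
  unfolding near_def by measurable

lemma near_commute: "near \<rho> x y = near \<rho> y x" by (simp add: near_def abs_minus_commute)

lemma near_cball: "near \<rho> x y = indicator (cball x \<rho>) y" by (simp add: near_def indicator_def dist_real_def)

lemma near_lborel: "0 < \<rho> \<Longrightarrow> (\<integral>\<^sup>+y. near \<rho> x y \<partial>lborel) = ennreal (2 * \<rho>)"
proof -
  assume "0 < \<rho>"
  moreover have "near \<rho> x y = indicator {x - \<rho> .. x + \<rho>} y" for y by (auto simp: near_def indicator_def)
  ultimately show ?thesis by simp
qed

context line_measure begin

lemma borel_mu [simp]: "borel_measurable \<mu> = borel_measurable borel" by (rule measurable_cong_sets) auto

text \<open>The density of \<open>\<mu>\<close> smeared out at scale \<open>\<rho>\<close>.\<close>

definition dens :: "real \<Rightarrow> real \<Rightarrow> real" where "dens \<rho> y = measure \<mu> (cball y \<rho>) / (2 * \<rho>)"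

lemma near_mu: "(\<integral>\<^sup>+x. near \<rho> y x \<partial>\<mu>) = ennreal (measure \<mu> (cball y \<rho>))"
  unfolding near_cball by (subst nn_integral_indicator) (auto simp: emeasure_eq_measure)

lemma dens_nn: "0 < \<rho> \<Longrightarrow> ennreal (dens \<rho> y) = ennreal (1 / (2 * \<rho>)) * (\<integral>\<^sup>+x. near \<rho> y x \<partial>\<mu>)"
  unfolding near_mu dens_def by (simp add: ennreal_mult'[symmetric])

lemma dens_measurable [measurable]: "dens \<rho> \<in> borel_measurable borel"
proof -
  have "(\<lambda>y. enn2real (\<integral>\<^sup>+x. near \<rho> y x \<partial>\<mu>)) \<in> borel_measurable borel"
    by (intro borel_measurable_enn2real borel_measurable_nn_integral) measurable
  then show ?thesis unfolding near_mu dens_def[abs_def] by simp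
qed

lemma nn_integral_swap_lborel:
  assumes "(\<lambda>p. h (fst p) (snd p)) \<in> borel_measurable (borel \<Otimes>\<^sub>M borel)"
  shows "(\<integral>\<^sup>+x. (\<integral>\<^sup>+y. h x y \<partial>lborel) \<partial>\<mu>) = (\<integral>\<^sup>+y. (\<integral>\<^sup>+x. h x y \<partial>\<mu>) \<partial>lborel)"
proof -
  interpret P: pair_sigma_finite \<mu> lborel ..
  have "sets (\<mu> \<Otimes>\<^sub>M lborel) = sets (borel \<Otimes>\<^sub>M borel)" by (intro sets_pair_measure_cong) auto
  then have "(\<lambda>p. h (fst p) (snd p)) \<in> borel_measurable (\<mu> \<Otimes>\<^sub>M lborel)" using assms by (simp cong: measurable_cong_sets)
  then have "(\<lambda>(x,y). h x y) \<in> borel_measurable (\<mu> \<Otimes>\<^sub>M lborel)" by (simp add: case_prod_beta)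
  from P.Fubini'[OF this] show ?thesis ..
qed

text \<open>If \<open>x\<close> and \<open>x'\<close> are both within \<open>\<rho>\<close> of \<open>y\<close>, they are within \<open>2 * \<rho>\<close> of each other.\<close>

lemma dens_L2:
  assumes rho: "0 < \<rho>"
  shows "(\<integral>\<^sup>+y. ennreal ((dens \<rho> y)\<^sup>2) \<partial>lborel) \<le> ennreal (4 * E)"
proof -
  define c where "c = ennreal (1 / (2 * \<rho>))"
  have step: "(\<integral>\<^sup>+x. near \<rho> y x \<partial>\<mu>) * (\<integral>\<^sup>+x. near \<rho> y x \<partial>\<mu>) \<le> (\<integral>\<^sup>+x. near \<rho> x y * (\<integral>\<^sup>+x'. near (2 * \<rho>) x x' \<partial>\<mu>) \<partial>\<mu>)" for y
  proof -
    have "(\<integral>\<^sup>+x. near \<rho> y x \<partial>\<mu>) * (\<integral>\<^sup>+x. near \<rho> y x \<partial>\<mu>) = (\<integral>\<^sup>+x. near \<rho> y x * (\<integral>\<^sup>+x'. near \<rho> y x' \<partial>\<mu>) \<partial>\<mu>)"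
      by (subst nn_integral_multc) auto
    also have "\<dots> = (\<integral>\<^sup>+x. (\<integral>\<^sup>+x'. near \<rho> y x * near \<rho> y x' \<partial>\<mu>) \<partial>\<mu>)"
      by (subst nn_integral_cmult) auto
    also have "\<dots> \<le> (\<integral>\<^sup>+x. (\<integral>\<^sup>+x'. near \<rho> x y * near (2 * \<rho>) x x' \<partial>\<mu>) \<partial>\<mu>)"
      by (intro nn_integral_mono) (auto simp: near_def abs_minus_commute)
    also have "\<dots> = (\<integral>\<^sup>+x. near \<rho> x y * (\<integral>\<^sup>+x'. near (2 * \<rho>) x x' \<partial>\<mu>) \<partial>\<mu>)"
      by (subst nn_integral_cmult) auto
    finally show ?thesis .
  qed
  have "(\<integral>\<^sup>+y. ennreal ((dens \<rho> y)\<^sup>2) \<partial>lborel) = (\<integral>\<^sup>+y. c * c * ((\<integral>\<^sup>+x. near \<rho> y x \<partial>\<mu>) * (\<integral>\<^sup>+x. near \<rho> y x \<partial>\<mu>)) \<partial>lborel)"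
  proof (intro nn_integral_cong)
    fix y
    have "0 \<le> dens \<rho> y" using rho by (simp add: dens_def)
    then have "ennreal ((dens \<rho> y)\<^sup>2) = ennreal (dens \<rho> y) * ennreal (dens \<rho> y)" by (simp add: power2_eq_square ennreal_mult')
    then show "ennreal ((dens \<rho> y)\<^sup>2) = c * c * ((\<integral>\<^sup>+x. near \<rho> y x \<partial>\<mu>) * (\<integral>\<^sup>+x. near \<rho> y x \<partial>\<mu>))"
      unfolding dens_nn[OF rho] c_def by (simp add: ac_simps)
  qed
  also have "\<dots> \<le> (\<integral>\<^sup>+y. c * c * (\<integral>\<^sup>+x. near \<rho> x y * (\<integral>\<^sup>+x'. near (2 * \<rho>) x x' \<partial>\<mu>) \<partial>\<mu>) \<partial>lborel)"
    by (intro nn_integral_mono mult_left_mono step) auto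
  also have "\<dots> = c * c * (\<integral>\<^sup>+y. (\<integral>\<^sup>+x. near \<rho> x y * (\<integral>\<^sup>+x'. near (2 * \<rho>) x x' \<partial>\<mu>) \<partial>\<mu>) \<partial>lborel)"
    by (intro nn_integral_cmult) measurable
  also have "(\<integral>\<^sup>+y. (\<integral>\<^sup>+x. near \<rho> x y * (\<integral>\<^sup>+x'. near (2 * \<rho>) x x' \<partial>\<mu>) \<partial>\<mu>) \<partial>lborel)
      = (\<integral>\<^sup>+x. (\<integral>\<^sup>+y. near \<rho> x y * (\<integral>\<^sup>+x'. near (2 * \<rho>) x x' \<partial>\<mu>) \<partial>lborel) \<partial>\<mu>)"
    by (rule nn_integral_swap_lborel[symmetric]) measurable
  also have "\<dots> = (\<integral>\<^sup>+x. ennreal (2 * \<rho>) * (\<integral>\<^sup>+x'. near (2 * \<rho>) x x' \<partial>\<mu>) \<partial>\<mu>)"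
    by (subst nn_integral_multc) (auto simp: near_lborel[OF rho])
  also have "\<dots> = ennreal (2 * \<rho>) * (\<integral>\<^sup>+x. (\<integral>\<^sup>+x'. near (2 * \<rho>) x x' \<partial>\<mu>) \<partial>\<mu>)"
    by (intro nn_integral_cmult) measurable
  also have "c * c * \<dots> \<le> c * c * (ennreal (2 * \<rho>) * ennreal (4 * E * (2 * \<rho>)))"
    using near_diagonal[of "2 * \<rho>"] rho unfolding near_cball by (intro mult_left_mono) auto
  also have "\<dots> = ennreal (1 / (2 * \<rho>) * (1 / (2 * \<rho>)) * (2 * \<rho> * (4 * E * (2 * \<rho>))))"
    using rho energy unfolding c_def by (simp add: ennreal_mult'[symmetric])
  also have "1 / (2 * \<rho>) * (1 / (2 * \<rho>)) * (2 * \<rho> * (4 * E * (2 * \<rho>))) = 4 * E" using rho by simp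
  finally show ?thesis .
qed

text \<open>By the arithmetic-geometric mean inequality with weight \<open>k\<close>, \<open>U\<close> has mass \<open>O(k)\<close> for the smeared
  density, uniformly in \<open>\<rho>\<close>.\<close>

lemma averaged_mass:
  assumes rho: "0 < \<rho>" and k: "0 < k" and U: "open U" "emeasure lborel U \<le> ennreal (k * k)"
  shows "(\<integral>\<^sup>+x. ennreal (1 / (2 * \<rho>)) * (\<integral>\<^sup>+y. indicator U y * near \<rho> x y \<partial>lborel) \<partial>\<mu>) \<le> ennreal (k * (2 * E + 1))"
proof -
  have [measurable]: "U \<in> sets borel" using U by simp
  have "(\<integral>\<^sup>+x. ennreal (1 / (2 * \<rho>)) * (\<integral>\<^sup>+y. indicator U y * near \<rho> x y \<partial>lborel) \<partial>\<mu>)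
      = (\<integral>\<^sup>+x. (\<integral>\<^sup>+y. ennreal (1 / (2 * \<rho>)) * (indicator U y * near \<rho> x y) \<partial>lborel) \<partial>\<mu>)"
    by (subst nn_integral_cmult) auto
  also have "\<dots> = (\<integral>\<^sup>+y. (\<integral>\<^sup>+x. ennreal (1 / (2 * \<rho>)) * (indicator U y * near \<rho> x y) \<partial>\<mu>) \<partial>lborel)"
    by (rule nn_integral_swap_lborel) measurable
  also have "\<dots> = (\<integral>\<^sup>+y. indicator U y * ennreal (dens \<rho> y) \<partial>lborel)"
  proof (intro nn_integral_cong)
    fix y
    have "(\<integral>\<^sup>+x. ennreal (1 / (2 * \<rho>)) * (indicator U y * near \<rho> x y) \<partial>\<mu>) = (\<integral>\<^sup>+x. (ennreal (1 / (2 * \<rho>)) * indicator U y) * near \<rho> y x \<partial>\<mu>)"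
      by (simp add: near_commute mult.assoc)
    also have "\<dots> = (ennreal (1 / (2 * \<rho>)) * indicator U y) * (\<integral>\<^sup>+x. near \<rho> y x \<partial>\<mu>)" by (intro nn_integral_cmult) auto
    finally show "(\<integral>\<^sup>+x. ennreal (1 / (2 * \<rho>)) * (indicator U y * near \<rho> x y) \<partial>\<mu>) = indicator U y * ennreal (dens \<rho> y)"
      unfolding dens_nn[OF rho] by (simp add: ac_simps)
  qed
  also have "\<dots> \<le> (\<integral>\<^sup>+y. ennreal (k / 2) * ennreal ((dens \<rho> y)\<^sup>2) + ennreal (1 / (2 * k)) * indicator U y \<partial>lborel)"
  proof (intro nn_integral_mono)
    fix y
    show "indicator U y * ennreal (dens \<rho> y) \<le> ennreal (k / 2) * ennreal ((dens \<rho> y)\<^sup>2) + ennreal (1 / (2 * k)) * indicator U y"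
    proof (cases "y \<in> U")
      case True
      have "0 \<le> (k * dens \<rho> y - 1)\<^sup>2 / (2 * k)" using k by simp
      also have "\<dots> = k / 2 * (dens \<rho> y)\<^sup>2 + 1 / (2 * k) - dens \<rho> y" using k by (simp add: field_simps power2_eq_square)
      finally have "ennreal (dens \<rho> y) \<le> ennreal (k / 2 * (dens \<rho> y)\<^sup>2 + 1 / (2 * k))" by (intro ennreal_leI) simp
      then show ?thesis using True k by (simp add: ennreal_mult'[symmetric] flip: ennreal_plus)
    qed simp
  qed
  also have "\<dots> = ennreal (k / 2) * (\<integral>\<^sup>+y. ennreal ((dens \<rho> y)\<^sup>2) \<partial>lborel) + ennreal (1 / (2 * k)) * emeasure lborel U"
    by (subst nn_integral_add) (auto simp: nn_integral_cmult nn_integral_cmult_indicator)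
  also have "\<dots> \<le> ennreal (k / 2) * ennreal (4 * E) + ennreal (1 / (2 * k)) * ennreal (k * k)"
    by (intro add_mono mult_left_mono dens_L2 rho U) auto
  also have "\<dots> = ennreal (k / 2 * (4 * E) + 1 / (2 * k) * (k * k))"
    using k energy by (simp add: ennreal_mult'[symmetric] flip: ennreal_plus)
  also have "\<dots> \<le> ennreal (k * (2 * E + 1))" using k by (intro ennreal_leI) (simp add: distrib_left)
  finally show ?thesis .
qed

text \<open>For points of the open set the smeared indicator is eventually one, so Fatou's lemma removes the
  smearing.\<close>

lemma open_mass:
  assumes k: "0 < k" and U: "open U" "emeasure lborel U \<le> ennreal (k * k)"
  shows "emeasure \<mu> U \<le> ennreal (k * (2 * E + 1))"
proof -
  have [measurable]: "U \<in> sets borel" using U by simp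
  define \<rho> where "\<rho> n = 1 / real (Suc n)" for n
  have rho: "0 < \<rho> n" for n by (simp add: \<rho>_def)
  define q where "q n x = ennreal (1 / (2 * \<rho> n)) * (\<integral>\<^sup>+y. indicator U y * near (\<rho> n) x y \<partial>lborel)" for n x
  have qm: "q n \<in> borel_measurable \<mu>" for n unfolding q_def by measurable
  have lim: "indicator U x \<le> liminf (\<lambda>n. q n x)" for x
  proof (rule Liminf_bounded)
    show "\<forall>\<^sub>F n in sequentially. indicator U x \<le> q n x"
    proof (cases "x \<in> U")
      case True
      then obtain e where e: "e > 0" "ball x e \<subseteq> U" using U openE by blast
      have "\<rho> \<longlonglongrightarrow> 0" unfolding \<rho>_def by (rule LIMSEQ_Suc[OF lim_1_over_n])
      then have "\<forall>\<^sub>F n in sequentially. \<rho> n < e" using e by (auto dest: order_tendstoD(2))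
      then show ?thesis
      proof eventually_elim
        case (elim n)
        have "indicator U y * near (\<rho> n) x y = near (\<rho> n) x y" for y
          using e elim by (auto simp: near_def indicator_def dist_real_def subset_iff)
        then have "q n x = ennreal (1 / (2 * \<rho> n)) * ennreal (2 * \<rho> n)" unfolding q_def using near_lborel[OF rho] by simp
        also have "\<dots> = 1" using rho[of n] by (simp add: ennreal_mult'[symmetric])
        finally show ?case by (simp add: indicator_def)
      qed
    qed simp
  qed
  have "emeasure \<mu> U = (\<integral>\<^sup>+x. indicator U x \<partial>\<mu>)" by simp
  also have "\<dots> \<le> (\<integral>\<^sup>+x. liminf (\<lambda>n. q n x) \<partial>\<mu>)" by (intro nn_integral_mono lim)
  also have "\<dots> \<le> liminf (\<lambda>n. \<integral>\<^sup>+x. q n x \<partial>\<mu>)" by (rule nn_integral_liminf[OF qm])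
  also have "\<dots> \<le> limsup (\<lambda>n. \<integral>\<^sup>+x. q n x \<partial>\<mu>)" by (rule Liminf_le_Limsup) simp
  also have "\<dots> \<le> ennreal (k * (2 * E + 1))" unfolding q_def
    by (intro Limsup_bounded always_eventually allI averaged_mass rho k U)
  finally show ?thesis .
qed

theorem abs_cont: "absolutely_continuous lborel \<mu>"
  unfolding absolutely_continuous_def
proof
  fix N :: "real set" assume "N \<in> null_sets lborel"
  then have N: "N \<in> sets borel" "emeasure lborel N = 0" by auto
  have "emeasure \<mu> N \<le> 0 + ennreal e" if e: "0 < e" for e
  proof -
    define k where "k = e / (2 * E + 1)"
    have k: "0 < k" "k * (2 * E + 1) = e" using e energy by (auto simp: k_def)
    obtain U where U: "open U" "N \<subseteq> U" "emeasure lborel (U - N) < ennreal (k * k)"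
      using outer_regular_lborel[OF N(1), of "k * k"] k by auto
    have "emeasure lborel U = emeasure lborel (N \<union> (U - N))" using U(2) by (simp add: Un_absorb1)
    also have "\<dots> \<le> emeasure lborel N + emeasure lborel (U - N)" using N U by (intro emeasure_subadditive) auto
    finally have "emeasure lborel U \<le> ennreal (k * k)" using N U(3) by simp
    from open_mass[OF k(1) U(1) this] have "emeasure \<mu> U \<le> ennreal e" by (simp add: k)
    moreover have "emeasure \<mu> N \<le> emeasure \<mu> U" using U by (intro emeasure_mono) auto
    ultimately show ?thesis by simp
  qed
  then have "emeasure \<mu> N \<le> 0" by (rule ennreal_le_epsilon) 
  then show "N \<in> null_sets \<mu>" using N by (intro null_setsI) auto
qed

end

section \<open>Projections to lines\<close>

lemma powr_tail_integral:
  fixes p :: real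
  assumes p: "1 < p"
  shows "(\<integral>\<^sup>+s. ennreal (\<bar>s\<bar> powr (- p)) * indicator {1..} s \<partial>lborel) = ennreal (1 / (p - 1))"
proof -
  have "(\<integral>\<^sup>+s. ennreal (\<bar>s\<bar> powr (- p)) * indicator {1..} s \<partial>lborel) = (\<integral>\<^sup>+s. ennreal (s powr (- p)) * indicator {1..} s \<partial>lborel)"
    by (intro nn_integral_cong) (auto simp: indicator_def)
  also have "\<dots> = ennreal (0 - (- ((1::real) powr (1 - p) / (p - 1))))"
  proof (rule nn_integral_FTC_atLeast[where F = "\<lambda>s. - (s powr (1 - p) / (p - 1))"])
    show "((\<lambda>s. - (s powr (1 - p) / (p - 1))) has_real_derivative x powr (- p)) (at x)" if "1 \<le> x" for x
    proof -
      have "((\<lambda>s. - (s powr (1 - p) / (p - 1))) has_real_derivative - ((1 - p) * x powr (1 - p - 1) / (p - 1))) (at x)"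
        by (intro DERIV_minus DERIV_cdivide has_real_derivative_powr) (use that in simp)
      moreover have "(1 - p) * y / (p - 1) = - y" for y using p by (simp add: divide_eq_eq algebra_simps)
      ultimately show ?thesis by simp
    qed
    have "((\<lambda>s::real. - (s powr (1 - p) / (p - 1))) \<longlongrightarrow> - (0 / (p - 1))) at_top"
      using p by (intro tendsto_intros tendsto_neg_powr filterlim_ident) auto
    then show "((\<lambda>s::real. - (s powr (1 - p) / (p - 1))) \<longlongrightarrow> 0) at_top" by simp
  qed auto
  finally show ?thesis by simp
qed

lemma decay_integral:
  fixes h :: "real \<Rightarrow> real"
  assumes p: "1 < p" and A: "0 \<le> A" "\<And>s. \<bar>s\<bar> \<le> 1 \<Longrightarrow> h s \<le> A" and B: "0 \<le> B" "\<And>s. 1 \<le> \<bar>s\<bar> \<Longrightarrow> h s \<le> B * \<bar>s\<bar> powr (- p)"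
  shows "(\<integral>\<^sup>+s. ennreal (h s) \<partial>lborel) \<le> ennreal (2 * A + 2 * B / (p - 1))"
proof -
  define T where "T s = ennreal (\<bar>s\<bar> powr (- p)) * indicator {1..} s" for s :: real
  have Tm [measurable]: "T \<in> borel_measurable borel" unfolding T_def by measurable
  have "ennreal (h s) \<le> ennreal A * indicator {-1..1} s + (ennreal B * T s + ennreal B * T (- s))" for s
  proof (cases "\<bar>s\<bar> \<le> 1")
    case True
    then have "ennreal (h s) \<le> ennreal A * indicator {-1..1} s" using A(2)[OF True] by (auto simp: indicator_def ennreal_leI)
    then show ?thesis by (rule order_trans) simp
  next
    case False
    then have "ennreal (h s) \<le> ennreal B * ennreal (\<bar>s\<bar> powr (- p))" using B by (simp add: ennreal_mult'[symmetric] ennreal_leI)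
    moreover have "T s = ennreal (\<bar>s\<bar> powr (- p)) \<or> T (- s) = ennreal (\<bar>s\<bar> powr (- p))" using False by (auto simp: T_def indicator_def abs_if split: if_splits)
    ultimately show ?thesis by (auto intro: order_trans add_increasing add_increasing2)
  qed
  then have "(\<integral>\<^sup>+s. ennreal (h s) \<partial>lborel) \<le> (\<integral>\<^sup>+s. ennreal A * indicator {-1..1} s + (ennreal B * T s + ennreal B * T (- s)) \<partial>lborel)"
    by (rule nn_integral_mono)
  also have "\<dots> = ennreal A * emeasure lborel {-1..1::real} + (ennreal B * (\<integral>\<^sup>+s. T s \<partial>lborel) + ennreal B * (\<integral>\<^sup>+s. T (- s) \<partial>lborel))"
    by (simp add: nn_integral_add nn_integral_cmult nn_integral_cmult_indicator)
  also have "(\<integral>\<^sup>+s. T (- s) \<partial>lborel) = (\<integral>\<^sup>+s. T s \<partial>lborel)"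
    using nn_integral_real_affine[of T "-1" 0] by simp
  also have "(\<integral>\<^sup>+s. T s \<partial>lborel) = ennreal (1 / (p - 1))" unfolding T_def by (rule powr_tail_integral[OF p])
  also have "ennreal A * emeasure lborel {-1..1::real} + (ennreal B * ennreal (1 / (p - 1)) + ennreal B * ennreal (1 / (p - 1)))
      = ennreal (A * 2 + (B * (1 / (p - 1)) + B * (1 / (p - 1))))"
  proof -
    have "emeasure lborel {-1..1::real} = ennreal 2" by simp
    then show ?thesis using A(1) B(1) p by (simp add: ennreal_mult'[symmetric] del: ennreal_numeral flip: ennreal_plus)
  qed
  also have "A * 2 + (B * (1 / (p - 1)) + B * (1 / (p - 1))) = 2 * A + 2 * B / (p - 1)" by (simp add: add_divide_distrib[symmetric])
  finally show ?thesis .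
qed

context lazy_walk begin

definition marginal :: "real^3 \<Rightarrow> real measure" where "marginal u = distr \<nu> borel (\<lambda>x. x \<bullet> u)"

lemma inner_meas [measurable]: "(\<lambda>x. x \<bullet> u) \<in> \<nu> \<rightarrow>\<^sub>M borel"
  by (simp add: measurable_cong_sets[OF sets_nu refl])

lemma cpt_prob_marginal: "norm u = 1 \<Longrightarrow> cpt_prob (marginal u)"
  unfolding cpt_prob_def marginal_def
proof (intro conjI exI)
  assume u: "norm u = 1"
  show "prob_space (distr \<nu> borel (\<lambda>x. x \<bullet> u))" by (intro prob_space.prob_space_distr prob_nu) simp
  show "AE y in distr \<nu> borel (\<lambda>x. x \<bullet> u). y \<in> cball 0 (1 / (1 - r))"
  proof (subst AE_distr_iff)
    show "AE x in \<nu>. x \<bullet> u \<in> cball 0 (1 / (1 - r))"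
      using AE_nu
    proof eventually_elim
      case (elim x)
      then show ?case using Cauchy_Schwarz_ineq2[of x u] u by simp
    qed
  qed auto
qed auto

lemma marginal_energy:
  assumes u: "norm u = 1"
  shows "(\<integral>x. (\<integral>y. cos (s * (x - y)) \<partial>marginal u) \<partial>marginal u) = F (s *\<^sub>R u)"
  unfolding double_cos_integral[OF cpt_prob_marginal[OF u]] F_alt
  unfolding marginal_def by (subst (1 2) integral_distr) (auto simp: inner_commute)

text \<open>Integrals over \<open>V\<close> are pulled back along \<open>s \<mapsto> s *\<^sub>R u\<close> with \<open>u\<close> a unit vector of \<open>V\<close>, and the Fourier
  transform of the projection at \<open>s *\<^sub>R u\<close> is that of \<open>\<nu>\<close> at the same point.\<close>

lemma projections_regular:
  assumes C: "0 < C" "\<And>\<xi>. norm \<xi> \<ge> 1 \<Longrightarrow> F \<xi> \<le> C * norm \<xi> powr (- \<gamma>)"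
    and t: "0 \<le> t" "1 + 2 * t < \<gamma>" and V: "V \<in> grassmannian 1"
  shows "absolutely_continuous (line_lebesgue V) (proj_measure V \<nu>) \<and> in_sobolev t V (proj_measure V \<nu>)"
proof -
  have sub: "subspace V" and dim: "dim V = 1" using V by (auto simp: grassmannian_def)
  obtain v where v: "v \<in> V" "v \<noteq> 0" using dim by (metis dim_eq_0 subsetI singletonI zero_neq_one)
  define u where "u = (1 / norm v) *\<^sub>R v"
  have u: "u \<in> V" "norm u = 1" using v sub by (auto simp: u_def subspace_scale)
  have uu: "u \<bullet> u = 1" using u by (simp add: dot_square_norm)
  have "u \<noteq> 0" using u by auto
  then have "independent {u}" by simp
  then have "V \<subseteq> span {u}" using u dim by (intro card_ge_dim_independent) auto
  then have Vu: "\<exists>c. w = c *\<^sub>R u" if "w \<in> V" for w using that by (auto simp: span_singleton)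
  have proj: "orth_proj V x = (x \<bullet> u) *\<^sub>R u" for x
    unfolding orth_proj_def
  proof (rule the1_equality[OF orth_proj_ex1[OF sub]], intro conjI ballI)
    show "(x \<bullet> u) *\<^sub>R u \<in> V" using sub u by (simp add: subspace_scale)
    fix w assume "w \<in> V"
    then obtain c where "w = c *\<^sub>R u" using Vu by blast
    then show "(x - (x \<bullet> u) *\<^sub>R u) \<bullet> w = 0" using uu by (simp add: inner_diff_left)
  qed
  have lin: "(\<lambda>s. s *\<^sub>R u) \<in> borel \<rightarrow>\<^sub>M restrict_space borel V"
    using sub u by (intro measurable_restrict_space2) (auto intro: subspace_scale)
  have pm: "orth_proj V \<in> \<nu> \<rightarrow>\<^sub>M restrict_space borel V"
    unfolding proj using sub u by (intro measurable_restrict_space2) (auto intro: subspace_scale)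
  have LL: "line_lebesgue V = distr lborel (restrict_space borel V) (\<lambda>s. s *\<^sub>R u)" by (rule line_lebesgue_eq[OF V u])
  have Fu: "F (s *\<^sub>R u) \<le> C * \<bar>s\<bar> powr (- \<gamma>)" if "1 \<le> \<bar>s\<bar>" for s using C(2)[of "s *\<^sub>R u"] that u by simp
  have "line_measure (marginal u) (2 * 1 + 2 * C / (\<gamma> - 1))"
  proof (rule line_measure.intro)
    show "cpt_prob (marginal u)" by (rule cpt_prob_marginal[OF u(2)])
    show "(\<integral>\<^sup>+s. ennreal (\<integral>x. (\<integral>y. cos (s * (x - y)) \<partial>marginal u) \<partial>marginal u) \<partial>lborel) \<le> ennreal (2 * 1 + 2 * C / (\<gamma> - 1))"
      unfolding marginal_energy[OF u(2)] by (rule decay_integral) (use Fu C F_le1 t in auto)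
    show "0 \<le> 2 * 1 + 2 * C / (\<gamma> - 1)" using C t by simp
  qed
  then have ac: "absolutely_continuous lborel (marginal u)" by (rule line_measure.abs_cont)
  show ?thesis
  proof
    show "absolutely_continuous (line_lebesgue V) (proj_measure V \<nu>)"
      unfolding absolutely_continuous_def
    proof
      fix A assume A: "A \<in> null_sets (line_lebesgue V)"
      then have As: "A \<in> sets (restrict_space borel V)" by (auto simp: LL)
      define N where "N = (\<lambda>s. s *\<^sub>R u) -` A"
      have Ns: "N \<in> sets borel" using measurable_sets[OF lin As] by (simp add: N_def)
      have "emeasure lborel N = 0" using A As lin unfolding LL by (auto simp: null_sets_def emeasure_distr N_def)
      then have "N \<in> null_sets (marginal u)" using ac Ns by (auto simp: absolutely_continuous_def null_sets_def)
      then have "emeasure (marginal u) N = 0" by auto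
      moreover have "emeasure (marginal u) N = emeasure \<nu> ((\<lambda>x. x \<bullet> u) -` N \<inter> space \<nu>)"
        unfolding marginal_def using Ns by (intro emeasure_distr) auto
      moreover have "(\<lambda>x. x \<bullet> u) -` N = orth_proj V -` A" by (auto simp: N_def proj)
      ultimately have "emeasure (proj_measure V \<nu>) A = 0" unfolding proj_measure_def using pm As by (simp add: emeasure_distr)
      then show "A \<in> null_sets (proj_measure V \<nu>)" using As by (intro null_setsI) (auto simp: proj_measure_def)
    qed
    have FM: "(cmod (fourier_measure (proj_measure V \<nu>) \<xi>))\<^sup>2 = F \<xi>" if xi: "\<xi> \<in> V" for \<xi>
    proof -
      obtain c where c: "\<xi> = c *\<^sub>R u" using Vu[OF xi] by blast
      have "fourier_measure (proj_measure V \<nu>) \<xi> = (\<integral>x. cis (- (\<xi> \<bullet> orth_proj V x)) \<partial>\<nu>)"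
        unfolding fourier_measure_def proj_measure_def
        by (intro integral_distr pm measurable_restrict_space1 borel_measurable_continuous_onI cont_cis)
      also have "\<dots> = FT \<xi>" unfolding FT_def fourier_measure_def proj c by (simp add: uu inner_commute mult.commute)
      finally show ?thesis by (simp add: F_def)
    qed
    have "(\<integral>\<^sup>+ \<xi>. ennreal ((1 + (norm \<xi>)\<^sup>2) powr t * (cmod (fourier_measure (proj_measure V \<nu>) \<xi>))\<^sup>2) \<partial>line_lebesgue V)
        = (\<integral>\<^sup>+ \<xi>. ennreal ((1 + (norm \<xi>)\<^sup>2) powr t * F \<xi>) \<partial>line_lebesgue V)"
      by (intro nn_integral_cong) (simp add: FM LL space_restrict_space)
    also have "\<dots> = (\<integral>\<^sup>+ s. ennreal ((1 + (norm (s *\<^sub>R u))\<^sup>2) powr t * F (s *\<^sub>R u)) \<partial>lborel)"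
      unfolding LL
    proof (rule nn_integral_distr)
      have "(\<lambda>\<xi>. (1 + (norm \<xi>)\<^sup>2) powr t * F \<xi>) \<in> borel_measurable borel"
        using cont_borel[OF F_cont] by measurable
      then show "(\<lambda>\<xi>. ennreal ((1 + (norm \<xi>)\<^sup>2) powr t * F \<xi>)) \<in> borel_measurable (distr lborel (restrict_space borel V) (\<lambda>s. s *\<^sub>R u))"
        by (subst measurable_distr_eq1) (intro measurable_restrict_space1, simp)
    qed (use lin in simp)
    also have "\<dots> \<le> ennreal (2 * 2 powr t + 2 * (2 powr t * C) / (\<gamma> - 2 * t - 1))"
    proof (rule decay_integral)
      show "(1 + (norm (s *\<^sub>R u))\<^sup>2) powr t * F (s *\<^sub>R u) \<le> 2 powr t" if "\<bar>s\<bar> \<le> 1" for s :: real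
      proof -
        have "s\<^sup>2 \<le> 1" using that by (simp add: abs_square_le_1)
        then have "(1 + s\<^sup>2) powr t \<le> 2 powr t" using t by (intro powr_mono2) auto
        then have "(1 + s\<^sup>2) powr t * F (s *\<^sub>R u) \<le> 2 powr t * 1" by (intro mult_mono F_le1 F_nonneg) auto
        then show ?thesis using u by simp
      qed
      show "(1 + (norm (s *\<^sub>R u))\<^sup>2) powr t * F (s *\<^sub>R u) \<le> 2 powr t * C * \<bar>s\<bar> powr (- (\<gamma> - 2 * t))" if s: "1 \<le> \<bar>s\<bar>" for s :: real
      proof -
        have s2: "1 \<le> s\<^sup>2" using power_mono[OF s, of 2] by simp
        then have "(1 + s\<^sup>2) powr t \<le> (2 * s\<^sup>2) powr t" using t by (intro powr_mono2) auto
        also have "\<dots> = 2 powr t * \<bar>s\<bar> powr (2 * t)"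
        proof -
          have "s\<^sup>2 = \<bar>s\<bar> powr 2" using s by simp
          then show ?thesis by (simp only: powr_mult powr_powr)
        qed
        finally have "(1 + s\<^sup>2) powr t * F (s *\<^sub>R u) \<le> 2 powr t * \<bar>s\<bar> powr (2 * t) * (C * \<bar>s\<bar> powr (- \<gamma>))"
          by (intro mult_mono Fu s F_nonneg) auto
        also have "\<dots> = 2 powr t * C * (\<bar>s\<bar> powr (2 * t) * \<bar>s\<bar> powr (- \<gamma>))" by simp
        also have "\<bar>s\<bar> powr (2 * t) * \<bar>s\<bar> powr (- \<gamma>) = \<bar>s\<bar> powr (- (\<gamma> - 2 * t))" by (simp add: powr_add[symmetric])
        finally show ?thesis using u by simp
      qed
    qed (use t C in auto)
    also have "\<dots> < \<infinity>" by simp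
    finally show "in_sobolev t V (proj_measure V \<nu>)" unfolding in_sobolev_def .
  qed
qed

end

section \<open>Choice of the parameters\<close>

text \<open>As \<open>\<epsilon>\<close> tends to \<open>0\<close> with \<open>r powr a = (1 - \<epsilon>)\<^sup>2\<close>, one has \<open>ln \<theta> \<approx> - (4 - 6 * \<eta>) * \<epsilon>\<close> and
  \<open>ln r \<approx> - (2 / a) * \<epsilon>\<close>, so that the decay exponent \<open>\<beta>\<close> tends to \<open>a * (1 - 3 / 2 * \<eta>)\<close>. The other two
  conditions hold in the limit with room to spare.\<close>

lemma choice_of_parameters:
  fixes a \<eta> \<kappa> K g :: real
  assumes a: "0 < a" and eta: "0 < \<eta>" and kap: "0 < \<kappa>" "\<kappa> < 1" and g: "0 \<le> g" "g < a * (1 - 3 / 2 * \<eta>)"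
  shows "\<exists>\<epsilon> r \<beta> \<theta>. 0 < \<epsilon> \<and> \<epsilon> < 1 \<and> 0 < r \<and> r < 1 \<and> (1 - \<epsilon>)\<^sup>2 = r powr a \<and> 0 \<le> \<beta> \<and> r powr (2 * \<beta>) = \<theta> \<and>
    \<theta> = ((1 - \<epsilon>)\<^sup>2 + \<epsilon>\<^sup>2)\<^sup>2 + (2 * \<epsilon> * (1 - \<epsilon>))\<^sup>2 + 3 * (2 * \<epsilon> * (1 - \<epsilon>)) * \<eta> \<and>
    \<kappa>\<^sup>2 * (((1 - \<epsilon>)\<^sup>2 + \<epsilon>\<^sup>2)\<^sup>2 + (2 * \<epsilon> * (1 - \<epsilon>))\<^sup>2 + 2 * (2 * \<epsilon> * (1 - \<epsilon>)) + 4 * (2 * \<epsilon> * (1 - \<epsilon>)) / \<eta>) \<le> \<theta> \<and>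
    g < \<beta> * (1 - K * ln (1 / r))"
proof -
  define c where "c e = (1 - e)\<^sup>2 + e\<^sup>2" for e :: real
  define b where "b e = 2 * e * (1 - e)" for e :: real
  define \<theta> where "\<theta> e = (c e)\<^sup>2 + (b e)\<^sup>2 + 3 * b e * \<eta>" for e
  define lr where "lr e = 2 / a * ln (1 - e)" for e
  define \<beta> where "\<beta> e = ln (\<theta> e) / (2 * lr e)" for e
  have d1: "((\<lambda>e. ln (\<theta> e)) has_real_derivative 6 * \<eta> - 4) (at 0)"
    unfolding \<theta>_def c_def b_def by (auto intro!: derivative_eq_intros simp: algebra_simps)
  have d2: "((\<lambda>e. 2 * lr e) has_real_derivative - (4 / a)) (at 0)"
    unfolding lr_def using a by (auto intro!: derivative_eq_intros)
  have z: "ln (\<theta> 0) = 0" "lr 0 = 0" by (simp_all add: \<theta>_def c_def b_def lr_def)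
  have "((\<lambda>e. (ln (\<theta> e) / e) / (2 * lr e / e)) \<longlongrightarrow> (6 * \<eta> - 4) / (- (4 / a))) (at 0)"
    using d1 d2 a by (intro tendsto_divide) (simp_all add: DERIV_def z)
  moreover have "\<forall>\<^sub>F e in at 0. (ln (\<theta> e) / e) / (2 * lr e / e) = \<beta> e"
    unfolding eventually_at by (intro exI[of _ 1]) (simp add: \<beta>_def)
  moreover have "(6 * \<eta> - 4) / (- (4 / a)) = a * (1 - 3 / 2 * \<eta>)" using a by (simp add: field_simps)
  ultimately have lb: "(\<beta> \<longlongrightarrow> a * (1 - 3 / 2 * \<eta>)) (at 0)" by (simp add: tendsto_cong)
  have lim: "(f \<longlongrightarrow> f 0) (at 0)" if "isCont f 0" for f :: "real \<Rightarrow> real" using that by (simp add: isCont_def)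
  have ll: "((\<lambda>e. \<beta> e * (1 - K * (- lr e))) \<longlongrightarrow> a * (1 - 3 / 2 * \<eta>) * (1 - K * (- lr 0))) (at 0)"
    by (intro tendsto_intros lb lim) (use a in \<open>auto simp: lr_def intro!: continuous_intros\<close>)
  have lk: "((\<lambda>e. \<theta> e - \<kappa>\<^sup>2 * ((c e)\<^sup>2 + (b e)\<^sup>2 + 2 * b e + 4 * b e / \<eta>)) \<longlongrightarrow>
      \<theta> 0 - \<kappa>\<^sup>2 * ((c 0)\<^sup>2 + (b 0)\<^sup>2 + 2 * b 0 + 4 * b 0 / \<eta>)) (at 0)"
    by (rule lim) (auto simp: \<theta>_def c_def b_def intro!: continuous_intros simp: eta less_imp_neq[OF eta, symmetric])
  have k1: "\<kappa>\<^sup>2 < 1" using kap by (simp add: power_less_one_iff)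
  have e1: "\<forall>\<^sub>F e in at 0. 0 < \<beta> e" using g by (intro order_tendstoD(1)[OF lb]) simp
  have e2: "\<forall>\<^sub>F e in at 0. g < \<beta> e * (1 - K * (- lr e))" using g by (intro order_tendstoD(1)[OF ll]) (simp add: z)
  have e3: "\<forall>\<^sub>F e in at 0. 0 < \<theta> e - \<kappa>\<^sup>2 * ((c e)\<^sup>2 + (b e)\<^sup>2 + 2 * b e + 4 * b e / \<eta>)"
    using k1 by (intro order_tendstoD(1)[OF lk]) (simp add: \<theta>_def c_def b_def)
  have "\<forall>\<^sub>F e in at_right 0. (0 < \<beta> e \<and> g < \<beta> e * (1 - K * (- lr e))) \<and> 0 < \<theta> e - \<kappa>\<^sup>2 * ((c e)\<^sup>2 + (b e)\<^sup>2 + 2 * b e + 4 * b e / \<eta>)"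
    using eventually_conj[OF eventually_conj[OF e1 e2] e3] by (rule filter_leD[OF at_le[OF subset_UNIV]])
  moreover have "\<forall>\<^sub>F e in at_right 0. e \<in> {0<..<1::real}" by (rule eventually_at_right_real) simp
  ultimately have "\<forall>\<^sub>F e in at_right 0. ((0 < \<beta> e \<and> g < \<beta> e * (1 - K * (- lr e))) \<and> 0 < \<theta> e - \<kappa>\<^sup>2 * ((c e)\<^sup>2 + (b e)\<^sup>2 + 2 * b e + 4 * b e / \<eta>)) \<and> e \<in> {0<..<1::real}"
    by (rule eventually_conj)
  then obtain e where e: "0 < \<beta> e" "g < \<beta> e * (1 - K * (- lr e))" "0 < \<theta> e - \<kappa>\<^sup>2 * ((c e)\<^sup>2 + (b e)\<^sup>2 + 2 * b e + 4 * b e / \<eta>)" "0 < e" "e < 1"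
    using eventually_happens[of _ "at_right (0::real)"] by (auto simp: trivial_limit_at_right_real)
  define r where "r = exp (lr e)"
  have neg: "lr e < 0" using e a by (simp add: lr_def divide_neg_pos)
  have th: "0 < \<theta> e"
  proof -
    have "0 < c e" "0 \<le> b e" using e by (auto simp: c_def b_def add_pos_nonneg)
    then show ?thesis using eta unfolding \<theta>_def by (intro add_pos_nonneg) auto
  qed
  show ?thesis
  proof (rule exI[of _ e], rule exI[of _ r], rule exI[of _ "\<beta> e"], rule exI[of _ "\<theta> e"], intro conjI)
    show "0 < e" "e < 1" "0 < r" "r < 1" "0 \<le> \<beta> e" using e neg by (auto simp: r_def)
    have "r powr a = exp (2 * ln (1 - e))" using a by (simp add: powr_def r_def lr_def)
    also have "\<dots> = exp (ln (1 - e)) * exp (ln (1 - e))" unfolding mult_2 exp_add ..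
    also have "\<dots> = (1 - e)\<^sup>2" using e by (simp add: power2_eq_square)
    finally show "(1 - e)\<^sup>2 = r powr a" ..
    show "r powr (2 * \<beta> e) = \<theta> e" using neg th by (simp add: powr_def r_def \<beta>_def exp_ln)
    show "\<theta> e = ((1 - e)\<^sup>2 + e\<^sup>2)\<^sup>2 + (2 * e * (1 - e))\<^sup>2 + 3 * (2 * e * (1 - e)) * \<eta>" by (simp add: \<theta>_def c_def b_def)
    show "\<kappa>\<^sup>2 * (((1 - e)\<^sup>2 + e\<^sup>2)\<^sup>2 + (2 * e * (1 - e))\<^sup>2 + 2 * (2 * e * (1 - e)) + 4 * (2 * e * (1 - e)) / \<eta>) \<le> \<theta> e"
      using e(3) by (simp add: c_def b_def)
    show "g < \<beta> e * (1 - K * ln (1 / r))" using e(2) by (simp add: r_def ln_div)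
  qed
qed

theorem corollary1p6:
  fixes \<delta> t :: real
  assumes "0 < \<delta>" and "\<delta> < 1" and "0 \<le> t" and "t < \<delta> / 2"
  shows "\<exists>r \<nu>. 0 < r \<and> r < 1 \<and>
    self_similar_measure (ramanujan_ifs_index 5) (ramanujan_ifs r) \<nu> \<and>
    (dim2 \<nu> < ereal (1 + \<delta>) \<and> \<not> has_L2_density \<nu>) \<and>
    (\<forall>V \<in> grassmannian 1.
      absolutely_continuous (line_lebesgue V) (proj_measure V \<nu>) \<and>
      in_sobolev t V (proj_measure V \<nu>))"
proof -
  obtain \<kappa>0 where k0: "0 \<le> \<kappa>0" "\<kappa>0 < 1" "\<And>f. cont f \<Longrightarrow> (\<integral>x. f x \<partial>sph) = 0 \<Longrightarrow> nrm (hecke f) \<le> 6 * \<kappa>0 * nrm f"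
    using spectral_gap by blast
  \<comment> \<open>Enlarged to be positive, since its logarithm is needed.\<close>
  define \<kappa> where "\<kappa> = max \<kappa>0 (1/2)"
  have kap: "0 < \<kappa>" "\<kappa> < 1" using k0 by (auto simp: \<kappa>_def)
  have gap: "nrm (hecke f) \<le> 6 * \<kappa> * nrm f" if "cont f" "(\<integral>x. f x \<partial>sph) = 0" for f
  proof -
    have "6 * \<kappa>0 * nrm f \<le> 6 * \<kappa> * nrm f" by (intro mult_right_mono) (auto simp: \<kappa>_def)
    then show ?thesis using k0(3)[OF that] by linarith
  qed
  \<comment> \<open>Any \<open>a\<close> strictly between \<open>1 + 2 * t\<close> and \<open>1 + \<delta>\<close> would do.\<close>
  define a where "a = 1 + (2 * t + \<delta>) / 2"
  have a: "1 + 2 * t < a" "a < 1 + \<delta>" "0 < a" using assms by (auto simp: a_def field_simps)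
  define \<eta> where "\<eta> = (a - 1 - 2 * t) / (3 * a)"
  have eta: "0 < \<eta>" using a by (simp add: \<eta>_def)
  have "a * (1 - 3 / 2 * \<eta>) = (a + (1 + 2 * t)) / 2" using a by (simp add: \<eta>_def field_simps)
  then have g: "1 + 2 * t < a * (1 - 3 / 2 * \<eta>)" using a by simp
  obtain \<epsilon> r \<beta> \<theta> where p: "0 < \<epsilon>" "\<epsilon> < 1" "0 < r" "r < 1" "(1 - \<epsilon>)\<^sup>2 = r powr a" "0 \<le> \<beta>" "r powr (2 * \<beta>) = \<theta>"
    "\<theta> = ((1 - \<epsilon>)\<^sup>2 + \<epsilon>\<^sup>2)\<^sup>2 + (2 * \<epsilon> * (1 - \<epsilon>))\<^sup>2 + 3 * (2 * \<epsilon> * (1 - \<epsilon>)) * \<eta>"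
    "\<kappa>\<^sup>2 * (((1 - \<epsilon>)\<^sup>2 + \<epsilon>\<^sup>2)\<^sup>2 + (2 * \<epsilon> * (1 - \<epsilon>))\<^sup>2 + 2 * (2 * \<epsilon> * (1 - \<epsilon>)) + 4 * (2 * \<epsilon> * (1 - \<epsilon>)) / \<eta>) \<le> \<theta>"
    "1 + 2 * t < \<beta> * (1 - 13 / (2 * ln (1 / \<kappa>)) * ln (1 / r))"
    using choice_of_parameters[OF a(3) eta kap _ g, of "13 / (2 * ln (1 / \<kappa>))"] assms by auto
  interpret lazy_walk \<epsilon> r by unfold_locales (use p in auto)
  \<comment> \<open>The exponent of the deviation from the mean in \<open>F_decay\<close> is \<open>2\<close>, above \<open>1 + 2 * t\<close> as \<open>2 * t < \<delta> < 1\<close>.\<close>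
  define \<gamma> where "\<gamma> = min 2 (\<beta> * (1 - 13 / (2 * ln (1 / \<kappa>)) * ln (1 / r)))"
  have gam: "1 + 2 * t < \<gamma>" using p assms by (auto simp: \<gamma>_def)
  have H: "HR R \<le> (1 / (\<eta> * R)) powr (2 * \<beta>)" if "0 < R" for R
    by (rule HR_decay[OF less_imp_le[OF kap(1)] gap eta _ _ p(6,7) that]) (use p in \<open>simp_all add: c0_def b0_def\<close>)
  obtain C where C: "0 < C" "\<And>\<xi>. norm \<xi> \<ge> 1 \<Longrightarrow> F \<xi> \<le> C * norm \<xi> powr (- \<gamma>)"
    using F_decay[OF kap gap eta p(6) H, of \<gamma>] by (auto simp: \<gamma>_def)
  have "dim2 \<nu> \<le> ereal a" by (rule dim2_le) (use a p in auto)
  also have "\<dots> < ereal (1 + \<delta>)" using a by simp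
  finally have dim: "dim2 \<nu> < ereal (1 + \<delta>)" .
  have "\<not> has_L2_density \<nu>" by (rule no_L2_density[OF _ p(5)]) (use a assms in simp)
  then show ?thesis using p(3,4) self_similar dim projections_regular[OF C assms(3) gam] by blast
qed

end
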